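(* Let $\tau$ be a linear anti-symplectic involution on $(\mathbb{R}^{2n},\omega_0)$ and let $D\subset\mathbb{R}^{2n}$ be a $\tau$-invariant convex bounded domain with $C^{1,1}$ boundary $\mathcal S=\partial D$. Then there exists a $\tau$-brake closed characteristic $x^\ast$ on $\partial D$ such that $$A(x^\ast)=\min\{A(x)>0\,|\,x\text{ is a $\tau$-brake closed characteristic on }\mathcal S\}=c_{\rm EH,\tau}(D)=c_{\rm EH,\tau}(\partial D).$$
   Context: $\mathbb{R}^{2n}$ has coordinates $(x,y)$, $\omega_0=\sum dx_i\wedge dy_i$, inner product $\langle\cdot,\cdot\rangle$, $J_0(x,y)=(-y,x)$; $\tau_0(x,y)=(x,-y)$, $L_0={\rm Fix}(\tau_0)=\{y=0\}$. A linear anti-symplectic involution is a linear $\tau$ with $\tau^*\omega_0=-\omega_0$, $\tau^2=\mathrm{id}$. Action: $A(x)=\frac12\int_0^T\langle -J_0\dot x,x\rangle dt$. A $\tau$-brake closed characteristic on a $\tau$-invariant smooth hypersurface $\mathcal S$ is a $C^1$ embedding $x:\mathbb{R}/T\mathbb{Z}\to\mathcal S$ with $\dot x(t)\in\ker(\omega_0|_{T_{x(t)}\mathcal S})$ and $x(T-t)=\tau(x(t))$. Symmetric Ekeland–Hofer capacity. Let $\mathbb E$ be the Hilbert space of $x\in L^2(\mathbb{R}/\mathbb{Z};\mathbb{R}^{2n})$, $x(t)=\sum_{j\in\mathbb Z}e^{2\pi jtJ_0}x_j$ with all $x_j\in L_0$ and $\sum|j||x_j|^2<\infty$, inner product $\langle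 x,y\rangle=\langle x_0,y_0\rangle+\sum_j2\pi|j|\langle x_j,y_j\rangle$, norm $\|\cdot\|$; $\mathbb E=\mathbb E^-\oplus\mathbb E^0\oplus\mathbb E^+$ with $\mathbb E^0=L_0$, $\mathbb E^\pm$ the sums over $\pm j>0$; write $x=x^-+x^0+x^+$; $S^+$ is the unit sphere of $\mathbb E^+$. An admissible deformation is a continuous $\gamma:\mathbb E\to\mathbb E$ with a homotopy $(\gamma_u)_{u\in[0,1]}$, $\gamma_0=\mathrm{id}$, $\gamma_1=\gamma$, such that for all $u$, $x^+\ne0\Rightarrow\gamma_u(x)^+\neq0$, and $\gamma_u(x)=a(x,u)x^++b(x,u)x^0+c(x,u)x^-+K(x,u)$ with $(a,b,c,K):\mathbb E\times[0,1]\to(0,\infty)^3\times\mathbb E$ continuous and mapping bounded sets to relatively compact sets; $\Gamma$ is the set of these. For continuous $H:\mathbb{R}^{2n}\to[0,\infty)$, $\Phi_H(x)=\frac12(\|x^+\|^2-\|x^-\|^2)-\int_0^1H(x(t))dt$ and $c_{\rm EH,\tau_0}(H)=\sup_{h\in\Gamma}\inf_{x\in h(S^+)}\Phi_H(x)$. For $B\subset\mathbb{R}^{2n}$ with $\tau_0B=B$, $B\cap L_0\neq\emptyset$, let $\mathscr F(B)$ be the set of continuous $H\ge0$ with $H\circ\tau_0=H$, ${\rm Int}(H^{-1}(0))\cap L_0\ne\emptyset$, $H(z)=a|z|^2+\langle z,z_0\rangle+b$ outside a compact set for some $z_0\in L_0$, $a>2\pi$, $b\in\mathbb{R}$, and $H$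 vanishing near $\overline B$. If $B$ is bounded, $c_{\rm EH,\tau_0}(B)=\inf\{c_{\rm EH,\tau_0}(H)\,|\,H\in\mathscr F(B)\}$; if unbounded, $c_{\rm EH,\tau_0}(B)=\sup c_{\rm EH,\tau_0}(B_0)$ over bounded $\tau_0$-invariant $B_0\subset B$ meeting $L_0$. For a linear anti-symplectic involution $\tau$ and $\tau$-invariant $B$ meeting ${\rm Fix}(\tau)$, $c_{\rm EH,\tau}(B)=c_{\rm EH,\tau_0}(\Psi B)$ for any symplectic matrix $\Psi$ with $\Psi\tau=\tau_0\Psi$ (such $\Psi$ exists and the value is independent of the choice). *)

theory Defs
  imports "HOL-Analysis.Analysis"
begin

type_synonym 'n st = "(real^'n) \<times> (real^'n)"

definition omega0 :: "'n::finite st \<Rightarrow> 'n st \<Rightarrow> real" where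
  "omega0 u v = fst u \<bullet> snd v - snd u \<bullet> fst v"

definition J0 :: "'n::finite st \<Rightarrow> 'n st" where
  "J0 z = (- snd z, fst z)"

definition tau0 :: "'n::finite st \<Rightarrow> 'n st" where
  "tau0 z = (fst z, - snd z)"

definition L0 :: "'n::finite st set" where
  "L0 = {z. snd z = 0}"

definition lin_anti_symplectic_involution :: "('n::finite st \<Rightarrow> 'n st) \<Rightarrow> bool" where
  "lin_anti_symplectic_involution \<tau> \<longleftrightarrow> linear \<tau> \<and>
     (\<forall>u v. omega0 (\<tau> u) (\<tau> v) = - omega0 u v) \<and> (\<forall>z. \<tau> (\<tau> z) = z)"

definition lin_symplectic :: "('n::finite st \<Rightarrow> 'n st) \<Rightarrow> bool" where
  "lin_symplectic \<Psi> \<longleftrightarrow> linear \<Psi> \<and> (\<forall>u v. omega0 (\<Psi> u) (\<Psi> v) = omega0 u v)"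

text \<open>rot t = exp(t J0)\<close>
definition rot :: "real \<Rightarrow> 'n::finite st \<Rightarrow> 'n st" where
  "rot t z = (cos t *\<^sub>R fst z - sin t *\<^sub>R snd z, sin t *\<^sub>R fst z + cos t *\<^sub>R snd z)"

definition action :: "(real \<Rightarrow> 'n::finite st) \<Rightarrow> real \<Rightarrow> real" where
  "action x T = (1/2) * integral {0..T} (\<lambda>t. (- J0 (vector_derivative x (at t))) \<bullet> x t)"

definition tangent_space :: "'n::finite st set \<Rightarrow> 'n st \<Rightarrow> 'n st set" where
  "tangent_space S p = {v. \<exists>c. (\<forall>t. c t \<in> S) \<and> c 0 = p \<and> (c has_vector_derivative v) (at 0)}"

definition char_kernel :: "'n::finite st set \<Rightarrow> 'n st \<Rightarrow> 'n st set" where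
  "char_kernel S p = {v \<in> tangent_space S p. \<forall>w \<in> tangent_space S p. omega0 v w = 0}"

text \<open>A C^1 embedding x : R/TZ -> S, represented as a T-periodic C^1 map R -> S that is
  an immersion and injective on [0,T), with characteristic velocity and the brake symmetry.\<close>
definition brake_char ::
  "('n::finite st \<Rightarrow> 'n st) \<Rightarrow> 'n st set \<Rightarrow> (real \<Rightarrow> 'n st) \<Rightarrow> real \<Rightarrow> bool" where
  "brake_char \<tau> S x T \<longleftrightarrow> T > 0 \<and>
     (\<forall>t. x (t + T) = x t) \<and>
     x C1_differentiable_on UNIV \<and>
     (\<forall>t. vector_derivative x (at t) \<noteq> 0) \<and>
     inj_on x {0..<T} \<and>
     (\<forall>t. x t \<in> S) \<and>
     (\<forall>t. vector_derivative x (at t) \<in> char_kernel S (x t)) \<and>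
     (\<forall>t. x (T - t) = \<tau> (x t))"

text \<open>An element x of E is x(t) = sum_j exp(2 pi j t J0) x_j with x_j in L0; since
  x_j = (c j, 0) we store the sequence c :: int => R^n.\<close>

type_synonym 'n coeff = "int \<Rightarrow> real^'n"

definition Eset :: "'n::finite coeff set" where
  "Eset = {c. (\<lambda>j. real_of_int \<bar>j\<bar> * (norm (c j))\<^sup>2) summable_on UNIV}"

definition Einner :: "'n::finite coeff \<Rightarrow> 'n coeff \<Rightarrow> real" where
  "Einner c d = c 0 \<bullet> d 0 + (\<Sum>\<^sub>\<infinity>j. 2 * pi * real_of_int \<bar>j\<bar> * (c j \<bullet> d j))"

definition Enorm :: "'n::finite coeff \<Rightarrow> real" where
  "Enorm c = sqrt (Einner c c)"

definition Eplus :: "'n::finite coeff \<Rightarrow> 'n coeff" where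
  "Eplus c = (\<lambda>j. if j > 0 then c j else 0)"

definition Ezero :: "'n::finite coeff \<Rightarrow> 'n coeff" where
  "Ezero c = (\<lambda>j. if j = 0 then c j else 0)"

definition Eminus :: "'n::finite coeff \<Rightarrow> 'n coeff" where
  "Eminus c = (\<lambda>j. if j < 0 then c j else 0)"

definition Splus :: "'n::finite coeff set" where
  "Splus = {c \<in> Eset. Ezero c = (\<lambda>_. 0) \<and> Eminus c = (\<lambda>_. 0) \<and> Enorm c = 1}"

text \<open>f is an L^2 representative on [0,1] of the element with coefficients c:
  its Fourier coefficients int_0^1 exp(-2 pi j t J0) f(t) dt equal (c j, 0).\<close>
definition Ecurve :: "'n::finite coeff \<Rightarrow> (real \<Rightarrow> 'n st) \<Rightarrow> bool" where
  "Ecurve c f \<longleftrightarrow> f \<in> borel_measurable (lebesgue_on {0..1}) \<and>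
     integrable (lebesgue_on {0..1}) (\<lambda>t. (norm (f t))\<^sup>2) \<and>
     (\<forall>j::int. integral\<^sup>L (lebesgue_on {0..1}) (\<lambda>t. rot (- 2 * pi * real_of_int j * t) (f t))
               = (c j, 0))"

definition Ecurve_of :: "'n::finite coeff \<Rightarrow> real \<Rightarrow> 'n st" where
  "Ecurve_of c = (SOME f. Ecurve c f)"

definition PhiH :: "('n::finite st \<Rightarrow> real) \<Rightarrow> 'n coeff \<Rightarrow> ereal" where
  "PhiH H c = ereal ((1/2) * ((Enorm (Eplus c))\<^sup>2 - (Enorm (Eminus c))\<^sup>2))
      - enn2ereal (\<integral>\<^sup>+ t. ennreal (H (Ecurve_of c t)) \<partial>(lebesgue_on {0..1}))"

definition Ebounded :: "'n::finite coeff set \<Rightarrow> bool" where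
  "Ebounded B \<longleftrightarrow> (\<exists>R. \<forall>x\<in>B. Enorm x \<le> R)"

definition Erelcompact :: "'n::finite coeff set \<Rightarrow> bool" where
  "Erelcompact S \<longleftrightarrow> (\<forall>s::nat \<Rightarrow> 'n coeff. (\<forall>k. s k \<in> S) \<longrightarrow>
      (\<exists>r l. strict_mono r \<and> l \<in> Eset \<and> (\<lambda>k. Enorm (\<lambda>j. s (r k) j - l j)) \<longlonglongrightarrow> 0))"

definition Econt_real :: "('n::finite coeff \<Rightarrow> real \<Rightarrow> real) \<Rightarrow> bool" where
  "Econt_real f \<longleftrightarrow> (\<forall>x\<in>Eset. \<forall>u\<in>{0..1}. \<forall>e>0. \<exists>d>0. \<forall>y\<in>Eset. \<forall>v\<in>{0..1}.
      Enorm (\<lambda>j. y j - x j) < d \<and> \<bar>v - u\<bar> < d \<longrightarrow> \<bar>f y v - f x u\<bar> < e)"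

definition Econt_E :: "('n::finite coeff \<Rightarrow> real \<Rightarrow> 'n coeff) \<Rightarrow> bool" where
  "Econt_E f \<longleftrightarrow> (\<forall>x\<in>Eset. \<forall>u\<in>{0..1}. \<forall>e>0. \<exists>d>0. \<forall>y\<in>Eset. \<forall>v\<in>{0..1}.
      Enorm (\<lambda>j. y j - x j) < d \<and> \<bar>v - u\<bar> < d \<longrightarrow> Enorm (\<lambda>j. f y v j - f x u j) < e)"

definition defo ::
  "('n::finite coeff \<Rightarrow> real \<Rightarrow> real) \<Rightarrow> ('n coeff \<Rightarrow> real \<Rightarrow> real) \<Rightarrow>
   ('n coeff \<Rightarrow> real \<Rightarrow> real) \<Rightarrow> ('n coeff \<Rightarrow> real \<Rightarrow> 'n coeff) \<Rightarrow> real \<Rightarrow> 'n coeff \<Rightarrow> 'n coeff" where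
  "defo a b c K u x = (\<lambda>j. a x u *\<^sub>R Eplus x j + b x u *\<^sub>R Ezero x j + c x u *\<^sub>R Eminus x j + K x u j)"

definition pos_relcompact_real :: "('n::finite coeff \<Rightarrow> real \<Rightarrow> real) \<Rightarrow> bool" where
  "pos_relcompact_real f \<longleftrightarrow> (\<forall>B. B \<subseteq> Eset \<and> Ebounded B \<longrightarrow>
      (\<exists>\<alpha> \<beta>. 0 < \<alpha> \<and> (\<forall>x\<in>B. \<forall>u\<in>{0..1}. \<alpha> \<le> f x u \<and> f x u \<le> \<beta>)))"

definition Gamma :: "('n::finite coeff \<Rightarrow> 'n coeff) set" where
  "Gamma = {\<gamma>. \<exists>a b c K.
     (\<forall>x\<in>Eset. \<forall>u\<in>{0..1}. a x u > 0 \<and> b x u > 0 \<and> c x u > 0 \<and> K x u \<in> Eset) \<and>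
     Econt_real a \<and> Econt_real b \<and> Econt_real c \<and> Econt_E K \<and>
     pos_relcompact_real a \<and> pos_relcompact_real b \<and> pos_relcompact_real c \<and>
     (\<forall>B. B \<subseteq> Eset \<and> Ebounded B \<longrightarrow> Erelcompact {K x u |x u. x \<in> B \<and> u \<in> {0..1}}) \<and>
     (\<forall>x\<in>Eset. \<forall>u\<in>{0..1}. Eplus x \<noteq> (\<lambda>_. 0) \<longrightarrow> Eplus (defo a b c K u x) \<noteq> (\<lambda>_. 0)) \<and>
     (\<forall>x\<in>Eset. defo a b c K 0 x = x) \<and>
     (\<forall>x\<in>Eset. \<gamma> x = defo a b c K 1 x)}"

definition cEH_fun :: "('n::finite st \<Rightarrow> real) \<Rightarrow> ereal" where
  "cEH_fun H = (SUP h\<in>Gamma. INF x\<in>h ` Splus. PhiH H x)"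

definition FB :: "'n::finite st set \<Rightarrow> ('n st \<Rightarrow> real) set" where
  "FB B = {H. continuous_on UNIV H \<and> (\<forall>z. H z \<ge> 0) \<and> (\<forall>z. H (tau0 z) = H z) \<and>
     interior {z. H z = 0} \<inter> L0 \<noteq> {} \<and>
     (\<exists>C z0 a b. compact C \<and> z0 \<in> L0 \<and> a > 2 * pi \<and>
        (\<forall>z. z \<notin> C \<longrightarrow> H z = a * (norm z)\<^sup>2 + z \<bullet> z0 + b)) \<and>
     (\<exists>U. open U \<and> closure B \<subseteq> U \<and> (\<forall>z\<in>U. H z = 0))}"

definition cEH_tau0_bdd :: "'n::finite st set \<Rightarrow> ereal" where
  "cEH_tau0_bdd B = (INF H\<in>FB B. cEH_fun H)"

definition cEH_tau0 :: "'n::finite st set \<Rightarrow> ereal" where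
  "cEH_tau0 B = (if bounded B then cEH_tau0_bdd B
     else (SUP B0\<in>{B0. B0 \<subseteq> B \<and> bounded B0 \<and> tau0 ` B0 = B0 \<and> B0 \<inter> L0 \<noteq> {}}.
              cEH_tau0_bdd B0))"

definition cEH_tau :: "('n::finite st \<Rightarrow> 'n st) \<Rightarrow> 'n st set \<Rightarrow> ereal" where
  "cEH_tau \<tau> B = cEH_tau0 ((SOME \<Psi>. lin_symplectic \<Psi> \<and> \<Psi> \<circ> \<tau> = tau0 \<circ> \<Psi>) ` B)"

definition C11_boundary :: "'n::finite st set \<Rightarrow> bool" where
  "C11_boundary D \<longleftrightarrow> (\<forall>p\<in>frontier D. \<exists>e r g.
     norm e = 1 \<and> r > 0 \<and> (\<forall>z. g differentiable (at z)) \<and>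
     (\<exists>L. \<forall>z w. onorm (\<lambda>h. frechet_derivative g (at z) h - frechet_derivative g (at w) h)
                 \<le> L * norm (z - w)) \<and>
     D \<inter> ball p r = {z \<in> ball p r. z \<bullet> e < g (z - (z \<bullet> e) *\<^sub>R e)})"

end

theory Submission
  imports Defs "HOL-Homology.Brouwer_Degree" "HOL-Complex_Analysis.Great_Picard" "HOL-Real_Asymp.Real_Asymp"
begin

text \<open>Let \<open>p\<close> be a point of \<open>D\<close> fixed by \<open>\<tau>\<close>, and let \<open>G\<close> be the square of the gauge of \<open>D - p\<close>; since the
 boundary is $C^{1,1}$, the gradient of \<open>G\<close> is Lipschitz. After a linear symplectic change of coordinates, brake closed
 characteristics of action \<open>A > 0\<close> are the reparametrisations of the 1-periodic solutions of \<open>z' = A J\<^sub>0 \<nabla>G(z)\<close> on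
 \<open>G = 1\<close> with \<open>z(-t) = \<tau>\<^sub>0 z(t)\<close>. These are critical points on the loop space, and compactness gives a smallest \<open>A\<close>.

 Upper bound: if \<open>x\<close> is a solution for this \<open>A\<close>, then by convexity of \<open>G\<close> the functional of \<open>A (G - 1)\<close> is at most \<open>A\<close> on
 the half space spanned by \<open>x\<^sup>+\<close>, \<open>E\<^sup>0\<close> and \<open>E\<^sup>-\<close>, and non-contractibility of spheres shows that every
 admissible image of the unit sphere of \<open>E\<^sup>+\<close> meets that half space.

 Lower bound: a Hamiltonian vanishing near the boundary lies below \<open>f \<circ> G\<close> for a steep profile \<open>f\<close>. A critical point of
 the latter at a level in \<open>(0, B]\<close> rescales to a solution with multiplier at most \<open>B\<close>, so for \<open>B < A\<close> there is none;
 a Cerami type estimate then allows a finite number of gradient steps to push a small sphere of \<open>E\<^sup>+\<close>, translated to a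
 point of the boundary fixed by the involution, above the level \<open>B\<close>.\<close>

section \<open>Square-integrable functions on the unit interval\<close>

text \<open>The profile \<open>f\<close> must grow at most linearly, since a Lipschitz gradient is
  what makes the functional manageable on E, whose elements need not be bounded functions. With
  asymptotically linear growth the slope at infinity may itself be a multiplier, and then
  Palais-Smale sequences can be unbounded. The square root inside \<open>prof\<close> cures this:
  \<open>s * f' s - f s\<close> still tends to infinity like \<open>sqrt s\<close>, which controls
  critical sequences in the Cerami sense. The Lipschitz gradient also allows explicit steps in place
  of a gradient flow, each of them visibly admissible.

  The same two bounds give existence. For a suitable profile the intersection property bounds the
  capacity from above, whereas an empty set of multipliers would allow arbitrarily high lower
  bounds.

  For the capacities, the lower bound is proved for the boundary and the upper bound for the domain;
  monotonicity closes the chain. Minimality of the action is also what makes the loop embedded: a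
  loop that meets itself has a shorter period and hence a smaller multiplier.\<close>

abbreviation I01 :: "real measure" where "I01 \<equiv> lebesgue_on {0..1}"

interpretation I01: finite_measure I01
 by standard (simp add: emeasure_restrict_space)

lemma emeasure_I01: "emeasure I01 {0..1} = 1"
 by (simp add: emeasure_restrict_space)

lemma measure_I01 [simp]: "measure I01 {0..1} = 1"
 by (simp add: measure_def emeasure_I01)

text \<open>Functions are not identified modulo null sets, because \<open>Ecurve_of\<close> picks a
  single representative. Identities between classes therefore appear below as statements that hold
  almost everywhere.\<close>

definition L2 :: "(real => 'a::euclidean_space) => bool" where
 "L2 f \<longleftrightarrow> f \<in> borel_measurable I01 \<and> integrable I01 (\<lambda>t. (norm (f t))\<^sup>2)"

definition l2 :: "(real => 'a::euclidean_space) => real" where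
 "l2 f = sqrt (LINT t|I01. (norm (f t))\<^sup>2)"

lemma L2_measurable: "L2 f ==> f \<in> borel_measurable I01"
 by (simp add: L2_def)

lemma l2_nonneg: "0 \<le> l2 f"
 by (simp add: l2_def)

lemma l2_power2: "(l2 f)\<^sup>2 = (LINT t|I01. (norm (f t))\<^sup>2)"
 by (simp add: l2_def)

lemma L2_bound:
 assumes "L2 f" "g \<in> borel_measurable I01" "AE t in I01. norm (g t) \<le> C * norm (f t)"
 shows "L2 g"
proof -
 have "integrable I01 (\<lambda>t. C\<^sup>2 * (norm (f t))\<^sup>2)"
  using assms(1) by (simp add: L2_def)
 moreover have "AE t in I01. norm ((norm (g t))\<^sup>2) \<le> norm (C\<^sup>2 * (norm (f t))\<^sup>2)"
  using assms(3)
 proof eventually_elim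
  case (elim t)
  then have "(norm (g t))\<^sup>2 \<le> (C * norm (f t))\<^sup>2"
   by (intro power_mono) auto
  then show ?case by (simp add: power_mult_distrib)
 qed
 moreover have "(\<lambda>t. (norm (g t))\<^sup>2) \<in> borel_measurable I01"
  using assms(2) by measurable
 ultimately have "integrable I01 (\<lambda>t. (norm (g t))\<^sup>2)"
  using Bochner_Integration.integrable_bound by blast
 then show ?thesis using assms(2) by (simp add: L2_def)
qed

lemma l2_cong_AE:
 assumes "f \<in> borel_measurable I01" "g \<in> borel_measurable I01" "AE t in I01. f t = g t"
 shows "l2 f = l2 g"
 unfolding l2_def
 by (rule arg_cong[where f=sqrt], rule integral_cong_AE) (use assms in auto)

lemma L2_scaleR: "L2 f ==> L2 (\<lambda>t. c *\<^sub>R f t)"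
 by (rule L2_bound[of f _ "\<bar>c\<bar>"]) (auto simp: L2_def)

lemma L2_uminus: "L2 f ==> L2 (\<lambda>t. - f t)"
 using L2_scaleR[of f "-1"] by simp

lemma L2_add:
 assumes "L2 f" "L2 g" shows "L2 (\<lambda>t. f t + g t)"
proof -
 have [measurable]: "f \<in> borel_measurable I01" "g \<in> borel_measurable I01"
  using assms by (auto simp: L2_def)
 have "integrable I01 (\<lambda>t. (norm (f t + g t))\<^sup>2)"
 proof (rule Bochner_Integration.integrable_bound)
  show "integrable I01 (\<lambda>t. 2 * (norm (f t))\<^sup>2 + 2 * (norm (g t))\<^sup>2)"
   using assms by (auto simp: L2_def)
  show "AE t in I01. norm ((norm (f t + g t))\<^sup>2) \<le> norm (2 * (norm (f t))\<^sup>2 + 2 * (norm (g t))\<^sup>2)"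
  proof (rule AE_I2)
   fix t
   have "(norm (f t + g t))\<^sup>2 \<le> (norm (f t) + norm (g t))\<^sup>2"
    by (intro power_mono norm_triangle_ineq) auto
   also have "\<dots> \<le> 2 * (norm (f t))\<^sup>2 + 2 * (norm (g t))\<^sup>2"
    using zero_le_power2[of "norm (f t) - norm (g t)"] by (simp add: power2_eq_square algebra_simps)
   finally show "norm ((norm (f t + g t))\<^sup>2) \<le> norm (2 * (norm (f t))\<^sup>2 + 2 * (norm (g t))\<^sup>2)"
    by simp
  qed
 qed measurable
 then show ?thesis by (simp add: L2_def)
qed

lemma L2_diff: "L2 f ==> L2 g ==> L2 (\<lambda>t. f t - g t)"
 using L2_add[OF _ L2_uminus, of f g] by simp

lemma L2_zero: "L2 (\<lambda>t. 0)"
 by (simp add: L2_def)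

lemma L2_sum: "(\<And>i. i \<in> A ==> L2 (f i)) ==> L2 (\<lambda>t. \<Sum>i\<in>A. f i t)"
 by (induction A rule: infinite_finite_induct) (auto intro: L2_add L2_zero)

lemma L2_bounded:
 assumes "f \<in> borel_measurable I01" "\<And>t. t \<in> {0..1} ==> norm (f t) \<le> C"
 shows "L2 f"
proof -
 have "integrable I01 (\<lambda>t. (norm (f t))\<^sup>2)"
 proof (rule I01.integrable_const_bound[where B="C\<^sup>2"])
  show "AE t in I01. norm ((norm (f t))\<^sup>2) \<le> C\<^sup>2"
   using assms(2) by (intro AE_I2) (auto intro!: power_mono)
 qed (use assms(1) in measurable)
 then show ?thesis using assms(1) by (simp add: L2_def)
qed

lemma continuous_I01_measurable:
 fixes f :: "real => 'a::euclidean_space"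
 shows "continuous_on {0..1} f ==> f \<in> borel_measurable I01"
 by (rule continuous_imp_measurable_on_sets_lebesgue) auto

lemma L2_continuous:
 fixes f :: "real => 'a::euclidean_space"
 assumes "continuous_on {0..1} f" shows "L2 f"
proof -
 have "bounded (f ` {0..1})"
  using assms compact_continuous_image compact_imp_bounded by blast
 then obtain C where "\<forall>t\<in>{0..1}. norm (f t) \<le> C"
  by (auto simp: bounded_iff)
 then show ?thesis using L2_bounded continuous_I01_measurable assms by blast
qed

lemma L2_const: "L2 (\<lambda>t. c)"
 by (rule L2_continuous) auto

lemma L2_inner_integrable:
 fixes f g :: "real => 'a::euclidean_space"
 assumes "L2 f" "L2 g" shows "integrable I01 (\<lambda>t. f t \<bullet> g t)"
proof (rule Bochner_Integration.integrable_bound)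
 show "integrable I01 (\<lambda>t. (norm (f t))\<^sup>2 + (norm (g t))\<^sup>2)"
  using assms by (auto simp: L2_def)
 show "(\<lambda>t. f t \<bullet> g t) \<in> borel_measurable I01"
  using assms by (auto simp: L2_def)
 show "AE t in I01. norm (f t \<bullet> g t) \<le> norm ((norm (f t))\<^sup>2 + (norm (g t))\<^sup>2)"
 proof (rule AE_I2)
  fix t
  have "\<bar>f t \<bullet> g t\<bar> \<le> norm (f t) * norm (g t)" by (rule Cauchy_Schwarz_ineq2)
  also have "\<dots> \<le> (norm (f t))\<^sup>2 + (norm (g t))\<^sup>2"
   using zero_le_power2[of "norm (f t) - norm (g t)"]
    mult_nonneg_nonneg[OF norm_ge_zero[of "f t"] norm_ge_zero[of "g t"]]
   by (simp only: power2_diff)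
  finally show "norm (f t \<bullet> g t) \<le> norm ((norm (f t))\<^sup>2 + (norm (g t))\<^sup>2)" by simp
 qed
qed

lemma L2_norm: "L2 f ==> L2 (\<lambda>t. norm (f t))"
 by (auto simp: L2_def)

lemma L2_integrable:
 fixes f :: "real => 'a::euclidean_space"
 assumes "L2 f" shows "integrable I01 f"
proof -
 have "integrable I01 (\<lambda>t. norm (f t) \<bullet> (1::real))"
  by (rule L2_inner_integrable[OF L2_norm[OF assms] L2_const])
 then show ?thesis
  using assms by (simp add: L2_def integrable_norm_iff)
qed

lemma L2_Cauchy_Schwarz:
 fixes f g :: "real => 'a::euclidean_space"
 assumes "L2 f" "L2 g"
 shows "\<bar>\<integral>t. f t \<bullet> g t \<partial>I01\<bar> \<le> l2 f * l2 g"
proof -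
 define A B C where "A = (LINT t|I01. (norm (f t))\<^sup>2)" and "B = (LINT t|I01. (norm (g t))\<^sup>2)"
  and "C = (LINT t|I01. f t \<bullet> g t)"
 have int: "integrable I01 (\<lambda>t. (norm (f t))\<^sup>2)" "integrable I01 (\<lambda>t. (norm (g t))\<^sup>2)"
  "integrable I01 (\<lambda>t. f t \<bullet> g t)"
  using assms L2_inner_integrable by (auto simp: L2_def)
 have AB: "A \<ge> 0" "B \<ge> 0" by (auto simp: A_def B_def)
 have quad: "0 \<le> a\<^sup>2 * A - 2 * a * b * C + b\<^sup>2 * B" for a b
 proof -
  have sq: "(norm (a *\<^sub>R u - b *\<^sub>R v))\<^sup>2 = a\<^sup>2 * (norm u)\<^sup>2 - 2 * a * b * (u \<bullet> v) + b\<^sup>2 * (norm v)\<^sup>2"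
   for u v :: 'a
   by (simp add: power2_norm_eq_inner inner_diff_left inner_diff_right power2_eq_square[of a]
     power2_eq_square[of b] inner_commute algebra_simps)
  have "0 \<le> (LINT t|I01. (norm (a *\<^sub>R f t - b *\<^sub>R g t))\<^sup>2)" by simp
  also have "\<dots> = (LINT t|I01. a\<^sup>2 * (norm (f t))\<^sup>2 - 2 * a * b * (f t \<bullet> g t) + b\<^sup>2 * (norm (g t))\<^sup>2)"
   by (simp only: sq)
  also have "\<dots> = a\<^sup>2 * A - 2 * a * b * C + b\<^sup>2 * B"
   using int by (simp add: A_def B_def C_def)
  finally show ?thesis .
 qed
 have "C\<^sup>2 \<le> A * B"
 proof (cases "B = 0")
  case True
  have "C = 0"
  proof (rule ccontr)
   assume "C \<noteq> 0"
   \<comment> \<open>For \<open>B = 0\<close> the form is affine in \<open>b\<close>; this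
     \<open>b\<close> makes it equal to \<open>-1\<close>.\<close>
   have "0 \<le> 1\<^sup>2 * A - 2 * 1 * ((A + 1) / (2 * C)) * C + ((A + 1) / (2 * C))\<^sup>2 * B"
    by (rule quad)
   with True \<open>C \<noteq> 0\<close> show False by simp
  qed
  then show ?thesis using AB by simp
 next
  case False
  then have "B > 0" using AB by simp
  have "0 \<le> B\<^sup>2 * A - 2 * B * C * C + C\<^sup>2 * B" by (rule quad)
  then have "0 \<le> B * (A * B - C\<^sup>2)" by (simp add: power2_eq_square algebra_simps)
  then show ?thesis using \<open>B > 0\<close> by (simp add: zero_le_mult_iff)
 qed
 then have "sqrt (C\<^sup>2) \<le> sqrt (A * B)" by (rule real_sqrt_le_mono)
 then show ?thesis by (simp add: l2_def A_def B_def C_def real_sqrt_mult)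
qed

lemma l2_scaleR: "l2 (\<lambda>t. c *\<^sub>R f t) = \<bar>c\<bar> * l2 f"
 by (simp add: l2_def power_mult_distrib real_sqrt_mult)

lemma l2_triangle:
 assumes "L2 f" "L2 g"
 shows "l2 (\<lambda>t. f t + g t) \<le> l2 f + l2 g"
proof -
 have int: "integrable I01 (\<lambda>t. (norm (f t))\<^sup>2)" "integrable I01 (\<lambda>t. (norm (g t))\<^sup>2)"
  "integrable I01 (\<lambda>t. f t \<bullet> g t)"
  using assms L2_inner_integrable by (auto simp: L2_def)
 have "(l2 (\<lambda>t. f t + g t))\<^sup>2 = (LINT t|I01. (norm (f t))\<^sup>2 + 2 * (f t \<bullet> g t) + (norm (g t))\<^sup>2)"
  unfolding l2_power2
  by (rule Bochner_Integration.integral_cong)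
   (auto simp: power2_norm_eq_inner inner_add_left inner_add_right inner_commute)
 also have "\<dots> = (l2 f)\<^sup>2 + 2 * (LINT t|I01. f t \<bullet> g t) + (l2 g)\<^sup>2"
  using int by (simp add: l2_power2)
 also have "\<dots> \<le> (l2 f + l2 g)\<^sup>2"
  using L2_Cauchy_Schwarz[OF assms] by (simp add: power2_sum)
 finally show ?thesis
  by (rule power2_le_imp_le) (intro add_nonneg_nonneg l2_nonneg)
qed

lemma l2_mono:
 assumes "L2 f" "L2 g" "0 \<le> C" "AE t in I01. norm (f t) \<le> C * norm (g t)"
 shows "l2 f \<le> C * l2 g"
proof -
 have "(LINT t|I01. (norm (f t))\<^sup>2) \<le> (LINT t|I01. C\<^sup>2 * (norm (g t))\<^sup>2)"
 proof (rule integral_mono_AE)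
  show "AE t in I01. (norm (f t))\<^sup>2 \<le> C\<^sup>2 * (norm (g t))\<^sup>2"
   using assms(4)
  proof eventually_elim
   case (elim t)
   then have "(norm (f t))\<^sup>2 \<le> (C * norm (g t))\<^sup>2" by (intro power_mono) auto
   then show ?case by (simp add: power_mult_distrib)
  qed
 qed (use assms in \<open>auto simp: L2_def\<close>)
 then have "l2 f \<le> sqrt (C\<^sup>2 * (LINT t|I01. (norm (g t))\<^sup>2))"
  unfolding l2_def by (intro real_sqrt_le_mono) simp
 then show ?thesis using assms(3) by (simp add: l2_def real_sqrt_mult)
qed

lemma integral_norm_le_l2:
 assumes "L2 f" shows "(LINT t|I01. norm (f t)) \<le> l2 f"
proof -
 have "\<bar>\<integral>t. norm (f t) \<bullet> (1::real) \<partial>I01\<bar> \<le> l2 (\<lambda>t. norm (f t)) * l2 (\<lambda>t. 1::real)"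
  by (rule L2_Cauchy_Schwarz[OF L2_norm[OF assms] L2_const])
 moreover have "l2 (\<lambda>t. 1::real) = 1" by (simp add: l2_def)
 moreover have "l2 (\<lambda>t. norm (f t)) = l2 f" by (simp add: l2_def)
 ultimately show ?thesis by simp
qed

section \<open>Rotations and Fourier coefficients\<close>

abbreviation frq :: "int => real" where "frq j \<equiv> (2 * pi) * real_of_int j"

lemma rot_eq: "rot t z = cos t *\<^sub>R z + sin t *\<^sub>R J0 z"
 by (simp add: rot_def J0_def prod_eq_iff)

lemma J0_J0 [simp]: "J0 (J0 z) = - z"
 by (simp add: J0_def prod_eq_iff)

lemma inner_J0_J0 [simp]: "J0 z \<bullet> J0 w = z \<bullet> w"
 by (simp add: J0_def inner_prod_def)

lemma inner_J0_left: "J0 z \<bullet> w = - (z \<bullet> J0 w)"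
 by (simp add: J0_def inner_prod_def)

lemma inner_J0_self [simp]: "J0 z \<bullet> z = 0" "z \<bullet> J0 z = 0"
 by (simp_all add: J0_def inner_prod_def inner_commute)

lemma norm_J0 [simp]: "norm (J0 z) = norm z"
 by (simp add: norm_eq_sqrt_inner)

lemma linear_J0: "linear J0"
 by (rule linearI) (auto simp: J0_def prod_eq_iff)

lemma bounded_linear_J0: "bounded_linear J0"
 using linear_J0 by (rule linear_conv_bounded_linear[THEN iffD1])

lemmas J0_add = linear_add[OF linear_J0]
 and J0_scaleR = linear_cmul[OF linear_J0]
 and J0_uminus = linear_neg[OF linear_J0]

lemma J0_zero [simp]: "J0 0 = 0"
 by (simp add: J0_def zero_prod_def)

lemma rot_0 [simp]: "rot 0 z = z"
 by (simp add: rot_eq)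

lemma rot_rot: "rot a (rot b z) = rot (a + b) z"
 by (simp add: rot_eq J0_add J0_scaleR cos_add sin_add algebra_simps)

lemma inner_rot_left: "rot a z \<bullet> w = z \<bullet> rot (- a) w"
 by (simp add: rot_eq inner_add_left inner_add_right inner_diff_right inner_J0_left)

lemma inner_rot_rot [simp]: "rot a z \<bullet> rot a w = z \<bullet> w"
 by (simp add: inner_rot_left rot_rot)

lemma norm_rot [simp]: "norm (rot a z) = norm z"
 by (simp add: norm_eq_sqrt_inner)

lemma linear_rot: "linear (rot a)"
 by (rule linearI) (auto simp: rot_eq J0_add J0_scaleR algebra_simps)

lemmas rot_add = linear_add[OF linear_rot]
 and rot_scaleR = linear_cmul[OF linear_rot]

lemma rot_zero [simp]: "rot a 0 = 0"
 by (simp add: rot_eq)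

lemma rot_J0: "rot a (J0 z) = J0 (rot a z)"
 by (simp add: rot_eq J0_add J0_scaleR)

lemma continuous_rot [continuous_intros]:
 fixes f :: "real => 'n::finite st"
 shows "continuous_on S a ==> continuous_on S f ==> continuous_on S (\<lambda>t. rot (a t) (f t))"
 unfolding rot_def by (intro continuous_intros)

lemma borel_measurable_rot:
 fixes f :: "real => 'n::finite st"
 assumes "f \<in> borel_measurable I01"
 shows "(\<lambda>t. rot (c * t) (f t)) \<in> borel_measurable I01"
proof -
 have [measurable]: "(\<lambda>t. cos (c * t)) \<in> borel_measurable I01"
  "(\<lambda>t. sin (c * t)) \<in> borel_measurable I01"
  by (rule continuous_I01_measurable, intro continuous_intros)+
 have J: "J0 \<in> borel_measurable borel"
  using bounded_linear_J0 borel_measurable_continuous_onI linear_continuous_on by blast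
 have "(\<lambda>t. J0 (f t)) \<in> borel_measurable I01"
  using measurable_compose[OF assms J] .
 then show ?thesis unfolding rot_eq using assms by measurable
qed

definition fcoeff :: "int => (real => 'n::finite st) => 'n st" where
 "fcoeff j f = (LINT t|I01. rot (- 2 * pi * real_of_int j * t) (f t))"

definition fmode :: "int => 'n::finite st => real => 'n st" where
 "fmode j v t = rot (frq j * t) v"

lemma L2_rot:
 fixes f :: "real => 'n::finite st"
 shows "L2 f ==> L2 (\<lambda>t. rot (c * t) (f t))"
 by (rule L2_bound[of f _ 1]) (auto intro: borel_measurable_rot L2_measurable)

lemma L2_fmode: "L2 (fmode j v)"
 unfolding fmode_def[abs_def] by (rule L2_continuous) (intro continuous_intros)

lemma norm_fmode [simp]: "norm (fmode j v t) = norm v"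
 by (simp add: fmode_def)

lemma inner_fcoeff:
 assumes "L2 f" shows "v \<bullet> fcoeff j f = (LINT t|I01. fmode j v t \<bullet> f t)"
proof -
 have "integrable I01 (\<lambda>t. rot (- 2 * pi * real_of_int j * t) (f t))"
  using L2_integrable[OF L2_rot[OF assms, of "- 2 * pi * real_of_int j"]] by simp
 then have "v \<bullet> fcoeff j f = (LINT t|I01. v \<bullet> rot (- 2 * pi * real_of_int j * t) (f t))"
  unfolding fcoeff_def by (simp add: integral_inner_right)
 also have "\<dots> = (LINT t|I01. fmode j v t \<bullet> f t)"
  by (simp add: fmode_def inner_rot_left)
 finally show ?thesis .
qed

lemma fcoeff_add: "L2 f ==> L2 g ==> fcoeff j (\<lambda>t. f t + g t) = fcoeff j f + fcoeff j g"
 using L2_integrable[OF L2_rot, of f "- 2 * pi * real_of_int j"]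
  L2_integrable[OF L2_rot, of g "- 2 * pi * real_of_int j"]
 by (simp add: fcoeff_def rot_add)

lemma fcoeff_scaleR: "fcoeff j (\<lambda>t. c *\<^sub>R f t) = c *\<^sub>R fcoeff j f"
 by (simp add: fcoeff_def rot_scaleR)

lemma fcoeff_uminus: "fcoeff j (\<lambda>t. - f t) = - fcoeff j f"
 using fcoeff_scaleR[of j "-1" f] by simp

lemma fcoeff_diff: "L2 f ==> L2 g ==> fcoeff j (\<lambda>t. f t - g t) = fcoeff j f - fcoeff j g"
 using fcoeff_add[OF _ L2_uminus, of f g j] by (simp add: fcoeff_uminus)

lemma fcoeff_J0:
 assumes "L2 f" shows "fcoeff j (\<lambda>t. J0 (f t)) = J0 (fcoeff j f)"
 unfolding fcoeff_def rot_J0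
 by (rule integral_bounded_linear[OF bounded_linear_J0])
  (use L2_integrable[OF L2_rot[OF assms, of "- 2 * pi * real_of_int j"]] in simp)

lemma fcoeff_cong_AE:
 assumes "f \<in> borel_measurable I01" "g \<in> borel_measurable I01" "AE t in I01. f t = g t"
 shows "fcoeff j f = fcoeff j g"
 unfolding fcoeff_def
 by (rule integral_cong_AE)
  (use assms borel_measurable_rot[of f "- 2 * pi * real_of_int j"]
   borel_measurable_rot[of g "- 2 * pi * real_of_int j"] in auto)

lemma norm_fcoeff_le: assumes "L2 f" shows "norm (fcoeff j f) \<le> l2 f"
proof -
 have "norm (fcoeff j f) \<le> (LINT t|I01. norm (rot (- 2 * pi * real_of_int j * t) (f t)))"
  unfolding fcoeff_def by (rule integral_norm_bound)
 also have "\<dots> \<le> l2 f" using integral_norm_le_l2[OF assms] by simp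
 finally show ?thesis .
qed

lemma integral_I01_eq:
 fixes f :: "real => 'a::euclidean_space"
 shows "integrable I01 f ==> (LINT t|I01. f t) = integral {0..1} f"
 by (rule lebesgue_integral_eq_integral) auto

lemma integral_FTC_I01:
 fixes f :: "real => 'a::euclidean_space"
 assumes "\<And>t. t \<in> {0..1} ==> (F has_vector_derivative f t) (at t within {0..1})"
  and "continuous_on {0..1} f"
 shows "(LINT t|I01. f t) = F 1 - F 0"
proof -
 have "(f has_integral (F 1 - F 0)) {0..1}"
  by (rule fundamental_theorem_of_calculus) (use assms in auto)
 then show ?thesis
  using integral_I01_eq[OF L2_integrable[OF L2_continuous[OF assms(2)]]] by (simp add: integral_unique)
qed

lemma integral_cos_I01: "(LINT t|I01. cos (frq j * t)) = (if j = 0 then 1 else 0)"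
proof (cases "j = 0")
 case False
 have "(LINT t|I01. cos (frq j * t)) =
  sin (frq j * 1) / (frq j) - sin (frq j * 0) / (frq j)"
  by (rule integral_FTC_I01)
   (use False in \<open>auto intro!: derivative_eq_intros continuous_intros simp: has_real_derivative_iff_has_vector_derivative[symmetric]\<close>)
 then show ?thesis using False sin_int_2pin[of j] by (simp add: mult_ac)
qed simp

lemma integral_sin_I01: "(LINT t|I01. sin (frq j * t)) = 0"
proof (cases "j = 0")
 case False
 have "(LINT t|I01. sin (frq j * t)) =
  - cos (frq j * 1) / (frq j) - - cos (frq j * 0) / (frq j)"
  by (rule integral_FTC_I01)
   (use False in \<open>auto intro!: derivative_eq_intros continuous_intros simp: has_real_derivative_iff_has_vector_derivative[symmetric]\<close>)
 then show ?thesis using False cos_int_2pin[of j] by (simp add: mult_ac)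
qed simp

lemma integral_rot_I01: "(LINT t|I01. rot (frq j * t) v) = (if j = 0 then v else 0)"
proof -
 have i: "integrable I01 (\<lambda>t. cos (frq j * t))"
  "integrable I01 (\<lambda>t. sin (frq j * t))"
  by (rule L2_integrable, rule L2_continuous, intro continuous_intros)+
 show ?thesis
  unfolding rot_eq using i by (simp add: integral_cos_I01 integral_sin_I01)
qed

lemma fcoeff_fmode: "fcoeff j (fmode k v) = (if j = k then v else 0)"
proof -
 have "fcoeff j (fmode k v) = (LINT t|I01. rot (frq (k - j) * t) v)"
  unfolding fcoeff_def fmode_def rot_rot by (simp add: algebra_simps)
 then show ?thesis unfolding integral_rot_I01 by simp
qed

section \<open>Completeness of the trigonometric system\<close>

text \<open>The annihilator of the trigonometric system in the integrable functions; completeness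
  means that its members vanish almost everywhere. The product formulas for sine and cosine make it
  closed under multiplication by trigonometric polynomials, so testing against the constant 1 tests
  against all of them.\<close>

definition trig_null :: "(real => real) set" where
 "trig_null = {p. integrable I01 p \<and> (\<forall>j::int. (LINT t|I01. cos (frq j * t) * p t) = 0 \<and>
   (LINT t|I01. sin (frq j * t) * p t) = 0)}"

lemma integrable_I01_mult_bounded:
 fixes p :: "real => real"
 assumes "integrable I01 p" "\<phi> \<in> borel_measurable I01" "\<And>t. t \<in> {0..1} ==> \<bar>\<phi> t\<bar> \<le> C"
 shows "integrable I01 (\<lambda>t. \<phi> t * p t)"
proof (rule Bochner_Integration.integrable_bound)
 show "integrable I01 (\<lambda>t. C * p t)" using assms(1) by simp
 show "(\<lambda>t. \<phi> t * p t) \<in> borel_measurable I01" using assms by measurable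
 show "AE t in I01. norm (\<phi> t * p t) \<le> norm (C * p t)"
  using assms(3) by (intro AE_I2) (force simp: abs_mult intro!: mult_right_mono)
qed

lemma integrable_I01_mult_continuous:
 fixes p :: "real => real"
 assumes "integrable I01 p" "continuous_on {0..1} \<phi>"
 shows "integrable I01 (\<lambda>t. \<phi> t * p t)"
proof -
 have "bounded (\<phi> ` {0..1})"
  using assms compact_continuous_image compact_imp_bounded by blast
 then obtain C where "\<forall>t\<in>{0..1}. \<bar>\<phi> t\<bar> \<le> C"
  by (auto simp: bounded_iff)
 then show ?thesis using integrable_I01_mult_bounded continuous_I01_measurable assms by blast
qed

lemma trig_null_integrable:
 assumes "p \<in> trig_null"
 shows "integrable I01 (\<lambda>t. cos (frq j * t) * p t)" "integrable I01 (\<lambda>t. sin (frq j * t) * p t)"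
 using assms by (auto simp: trig_null_def intro!: integrable_I01_mult_continuous continuous_intros)

lemma trig_null_integral:
 assumes "p \<in> trig_null"
 shows "(LINT t|I01. cos (frq j * t) * p t) = 0" "(LINT t|I01. sin (frq j * t) * p t) = 0"
 using assms by (auto simp: trig_null_def)

lemma trig_null_lincomb:
 assumes "p \<in> trig_null" "q \<in> trig_null"
 shows "(\<lambda>t. a * p t + b * q t) \<in> trig_null"
proof -
 note i = trig_null_integrable
 have eq: "x * (a * p t + b * q t) = a * (x * p t) + b * (x * q t)" for x t
  by (simp add: algebra_simps)
 show ?thesis
  using assms i[OF assms(1)] i[OF assms(2)] by (simp add: trig_null_def eq)
qed

lemma trig_null_cos:
 assumes "p \<in> trig_null" shows "(\<lambda>t. cos (2 * pi * t) * p t) \<in> trig_null"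
proof -
 note i = trig_null_integrable[OF assms] and 0 = trig_null_integral[OF assms]
 have c: "cos (frq j * t) * (cos (2 * pi * t) * p t) =
   (1/2) * (cos (frq (j - 1) * t) * p t) + (1/2) * (cos (frq (j + 1) * t) * p t)" for j t
  by (simp only: mult.assoc[symmetric] cos_times_cos) (simp add: algebra_simps)
 have s: "sin (frq j * t) * (cos (2 * pi * t) * p t) =
   (1/2) * (sin (frq (j + 1) * t) * p t) + (1/2) * (sin (frq (j - 1) * t) * p t)" for j t
  by (simp only: mult.assoc[symmetric] sin_times_cos) (simp add: algebra_simps)
 have "integrable I01 (\<lambda>t. cos (2 * pi * t) * p t)" using i(1)[of 1] by simp
 moreover have "(LINT t|I01. cos (frq j * t) * (cos (2 * pi * t) * p t)) = 0" for j
  unfolding c using i(1)[of "j-1"] i(1)[of "j+1"] 0(1)[of "j-1"] 0(1)[of "j+1"]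
  by (subst Bochner_Integration.integral_add) auto
 moreover have "(LINT t|I01. sin (frq j * t) * (cos (2 * pi * t) * p t)) = 0" for j
  unfolding s using i(2)[of "j-1"] i(2)[of "j+1"] 0(2)[of "j-1"] 0(2)[of "j+1"]
  by (subst Bochner_Integration.integral_add) auto
 ultimately show ?thesis by (simp add: trig_null_def)
qed

lemma trig_null_sin:
 assumes "p \<in> trig_null" shows "(\<lambda>t. sin (2 * pi * t) * p t) \<in> trig_null"
proof -
 note i = trig_null_integrable[OF assms] and 0 = trig_null_integral[OF assms]
 have c: "cos (frq j * t) * (sin (2 * pi * t) * p t) =
   (1/2) * (sin (frq (j + 1) * t) * p t) + (-1/2) * (sin (frq (j - 1) * t) * p t)" for j t
  by (simp only: mult.assoc[symmetric] cos_times_sin) (simp add: field_simps)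
 have s: "sin (frq j * t) * (sin (2 * pi * t) * p t) =
   (1/2) * (cos (frq (j - 1) * t) * p t) + (-1/2) * (cos (frq (j + 1) * t) * p t)" for j t
  by (simp only: mult.assoc[symmetric] sin_times_sin) (simp add: field_simps)
 have "integrable I01 (\<lambda>t. sin (2 * pi * t) * p t)" using i(2)[of 1] by simp
 moreover have "(LINT t|I01. cos (frq j * t) * (sin (2 * pi * t) * p t)) = 0" for j
  unfolding c using i(2)[of "j-1"] i(2)[of "j+1"] 0(2)[of "j-1"] 0(2)[of "j+1"]
  by (subst Bochner_Integration.integral_add) auto
 moreover have "(LINT t|I01. sin (frq j * t) * (sin (2 * pi * t) * p t)) = 0" for j
  unfolding s using i(1)[of "j-1"] i(1)[of "j+1"] 0(1)[of "j-1"] 0(1)[of "j+1"]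
  by (subst Bochner_Integration.integral_add) auto
 ultimately show ?thesis by (simp add: trig_null_def)
qed

text \<open>On the unit circle a real polynomial in \<open>z\<close> is a trigonometric polynomial
  in \<open>t\<close>. The induction runs over all \<open>p\<close> at once, so that the product
  case is two applications of the hypothesis.\<close>

lemma trig_null_polynomial:
 fixes g :: "complex => real"
 assumes "real_polynomial_function g" "p \<in> trig_null"
 shows "(\<lambda>t. g (cis (2 * pi * t)) * p t) \<in> trig_null"
 using assms
proof (induction arbitrary: p)
 case (linear f)
 have "f (cis (2 * pi * t)) = f 1 * cos (2 * pi * t) + f \<i> * sin (2 * pi * t)" for t
 proof -
  have "cis (2 * pi * t) = cos (2 * pi * t) *\<^sub>R 1 + sin (2 * pi * t) *\<^sub>R \<i>"
   by (simp add: complex_eq_iff)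
  then have "f (cis (2 * pi * t)) = f (cos (2 * pi * t) *\<^sub>R 1 + sin (2 * pi * t) *\<^sub>R \<i>)" by simp
  also have "\<dots> = f 1 * cos (2 * pi * t) + f \<i> * sin (2 * pi * t)"
   using linear.hyps
   by (simp only: linear_add[OF bounded_linear.linear] linear_cmul[OF bounded_linear.linear]) simp
  finally show ?thesis .
 qed
 then show ?case
  using trig_null_lincomb[OF trig_null_cos[OF linear.prems] trig_null_sin[OF linear.prems], of "f 1" "f \<i>"]
  by (simp add: algebra_simps)
next
 case (const c)
 then show ?case using trig_null_lincomb[OF const.prems const.prems, of c 0] by simp
next
 case (add f g)
 then show ?case
  using trig_null_lincomb[OF add.IH(1)[OF add.prems] add.IH(2)[OF add.prems], of 1 1] by (simp add: algebra_simps)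
next
 case (mult f g)
 then show ?case using mult.IH(1)[OF mult.IH(2)[OF mult.prems]] by (simp add: mult_ac)
qed

text \<open>Stone-Weierstrass is applied on the circle, where the approximating polynomials are the
  trigonometric ones just treated; the error is at most \<open>e * K\<close>.\<close>

lemma trig_null_integral_continuous:
 fixes \<phi> :: "complex => real"
 assumes "p \<in> trig_null" "continuous_on (sphere 0 1) \<phi>"
 shows "(LINT t|I01. \<phi> (cis (2 * pi * t)) * p t) = 0"
proof -
 have p: "integrable I01 p" using assms by (simp add: trig_null_def)
 have cis: "continuous_on {0..1} (\<lambda>t. cis (2 * pi * t))"
  by (intro continuous_intros)
 have int: "integrable I01 (\<lambda>t. \<psi> (cis (2 * pi * t)) * p t)" if "continuous_on (sphere 0 1) \<psi>" for \<psi> :: "complex => real"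
  by (rule integrable_I01_mult_continuous[OF p])
   (rule continuous_on_compose2[OF that cis], auto)
 define K where "K = (LINT t|I01. \<bar>p t\<bar>)"
 have K: "K \<ge> 0" unfolding K_def by simp
 have "\<bar>\<integral>t. \<phi> (cis (2 * pi * t)) * p t \<partial>I01\<bar> \<le> e * K" if "e > 0" for e
 proof -
  obtain g where g: "real_polynomial_function g" "\<And>z. z \<in> sphere 0 1 ==> \<bar>\<phi> z - g z\<bar> < e"
   using Stone_Weierstrass_real_polynomial_function[of "sphere (0::complex) 1" \<phi> e] assms(2) \<open>e > 0\<close> by auto
  have gc: "continuous_on (sphere 0 1) g"
   using g(1) continuous_on_polymonial_function by (metis real_polynomial_function_eq)
  have "(LINT t|I01. g (cis (2 * pi * t)) * p t) = 0"
  proof -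
   have "(\<lambda>t. g (cis (2 * pi * t)) * p t) \<in> trig_null"
    by (rule trig_null_polynomial[OF g(1) assms(1)])
   then have "\<forall>j::int. (LINT t|I01. cos (frq j * t) * (g (cis (2 * pi * t)) * p t)) = 0"
    by (simp add: trig_null_def)
   from this[rule_format, of 0] show ?thesis by simp
  qed
  then have "(LINT t|I01. \<phi> (cis (2 * pi * t)) * p t) =
    (LINT t|I01. \<phi> (cis (2 * pi * t)) * p t - g (cis (2 * pi * t)) * p t)"
   using int[OF assms(2)] int[OF gc] by simp
  also have "\<bar>\<dots>\<bar> \<le> (LINT t|I01. e * \<bar>p t\<bar>)"
  proof (rule order.trans[OF integral_abs_bound], rule integral_mono)
   show "integrable I01 (\<lambda>t. \<bar>\<phi> (cis (2 * pi * t)) * p t - g (cis (2 * pi * t)) * p t\<bar>)"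
    using int[OF assms(2)] int[OF gc] by simp
   show "integrable I01 (\<lambda>t. e * \<bar>p t\<bar>)" using p by simp
   fix t
   have "\<bar>\<phi> (cis (2 * pi * t)) * p t - g (cis (2 * pi * t)) * p t\<bar> =
    \<bar>\<phi> (cis (2 * pi * t)) - g (cis (2 * pi * t))\<bar> * \<bar>p t\<bar>"
    by (simp add: left_diff_distrib flip: abs_mult)
   also have "\<dots> \<le> e * \<bar>p t\<bar>"
    using g(2)[of "cis (2 * pi * t)"] by (intro mult_right_mono) auto
   finally show "\<bar>\<phi> (cis (2 * pi * t)) * p t - g (cis (2 * pi * t)) * p t\<bar> \<le> e * \<bar>p t\<bar>" .
  qed
  also have "\<dots> = e * K" by (simp add: K_def)
  finally show ?thesis .
 qed
 then have le: "\<bar>\<integral>t. \<phi> (cis (2 * pi * t)) * p t \<partial>I01\<bar> \<le> e * K" if "e > 0" for e using that by blast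
 show ?thesis
 proof (rule ccontr)
  assume n: "(LINT t|I01. \<phi> (cis (2 * pi * t)) * p t) \<noteq> 0" (is "?x \<noteq> 0")
  \<comment> \<open>This \<open>e\<close> produces the factor \<open>K / (2 * (K + 1))\<close>,
    which is below 1; adding 1 covers \<open>K = 0\<close>.\<close>
  have "\<bar>?x\<bar> \<le> \<bar>?x\<bar> / (2 * (K + 1)) * K" using n K by (intro le) auto
  also have "\<dots> = \<bar>?x\<bar> * (K / (2 * (K + 1)))" by simp
  also have "\<dots> < \<bar>?x\<bar> * 1"
   using n K by (intro mult_strict_left_mono) (auto simp: field_simps)
  finally show False by simp
 qed
qed

text \<open>Cut-offs of the distance to \<open>C\<close> decrease pointwise to the indicator, and
  dominated convergence passes to the limit.\<close>

lemma trig_null_integral_closed: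
 assumes "p \<in> trig_null" "compact C" "C \<noteq> {}"
 shows "(LINT t|I01. indicator C (cis (2 * pi * t)) * p t) = 0"
proof -
 have p: "integrable I01 p" using assms by (simp add: trig_null_def)
 then have [measurable]: "p \<in> borel_measurable I01" by auto
 define \<phi> :: "nat => complex => real" where "\<phi> k z = max 0 (1 - real k * infdist z C)" for k z
 have \<phi>c: "continuous_on A (\<phi> k)" for k A
  unfolding \<phi>_def by (intro continuous_intros)
 have m: "(\<lambda>t. \<phi> k (cis (2 * pi * t))) \<in> borel_measurable I01" for k
  by (rule continuous_I01_measurable, rule continuous_on_compose2[OF \<phi>c[of UNIV]]) (auto intro!: continuous_intros)
 have b: "0 \<le> \<phi> k z" "\<phi> k z \<le> 1" for k z
  unfolding \<phi>_def using infdist_nonneg[of z C] by auto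
 have lim: "(\<lambda>k. \<phi> k z) \<longlonglongrightarrow> indicator C z" for z
 proof (cases "z \<in> C")
  case True then show ?thesis by (simp add: \<phi>_def)
 next
  case False
  then have pos: "infdist z C > 0"
   using assms by (metis in_closed_iff_infdist_zero compact_imp_closed infdist_nonneg order_le_less)
  have "\<forall>\<^sub>F k in sequentially. 1 / infdist z C \<le> real k"
   using eventually_ge_at_top[of "nat \<lceil>1 / infdist z C\<rceil>"] by eventually_elim linarith
  then have "\<forall>\<^sub>F k in sequentially. \<phi> k z = 0"
   by eventually_elim (use pos in \<open>simp add: \<phi>_def field_simps\<close>)
  then show ?thesis using False by (simp add: tendsto_eventually)
 qed
 have "(\<lambda>k. \<integral>t. \<phi> k (cis (2 * pi * t)) * p t \<partial>I01) \<longlonglongrightarrow> (LINT t|I01. indicator C (cis (2 * pi * t)) * p t)"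
 proof (rule integral_dominated_convergence[where w="\<lambda>t. \<bar>p t\<bar>"])
  show "(\<lambda>t. indicator C (cis (2 * pi * t)) * p t) \<in> borel_measurable I01"
   by (rule borel_measurable_LIMSEQ_real[where u="\<lambda>k t. \<phi> k (cis (2 * pi * t)) * p t"])
    (use m in \<open>auto intro!: tendsto_mult_right lim\<close>)
  show "(\<lambda>t. \<phi> k (cis (2 * pi * t)) * p t) \<in> borel_measurable I01" for k using m by measurable
  show "integrable I01 (\<lambda>t. \<bar>p t\<bar>)" using p by simp
  show "AE t in I01. (\<lambda>k. \<phi> k (cis (2 * pi * t)) * p t) \<longlonglongrightarrow> indicator C (cis (2 * pi * t)) * p t"
   by (intro AE_I2 tendsto_mult_right lim)
  show "AE t in I01. norm (\<phi> k (cis (2 * pi * t)) * p t) \<le> \<bar>p t\<bar>" for k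
   using b[of k] by (intro AE_I2) (auto simp: abs_mult intro!: mult_left_le_one_le)
 qed
 moreover have "(LINT t|I01. \<phi> k (cis (2 * pi * t)) * p t) = 0" for k
  by (rule trig_null_integral_continuous[OF assms(1) \<phi>c])
 ultimately show ?thesis by (simp add: LIMSEQ_const_iff)
qed

lemma AE_I01_neq: "AE t in I01. t \<noteq> a"
proof -
 have "{a} \<in> null_sets lebesgue" using negligible_iff_null_sets negligible_sing by blast
 then have "AE t in lebesgue. t \<notin> {a}" by (rule AE_not_in)
 then show ?thesis by (subst AE_restrict_space_iff) auto
qed

text \<open>The interval from 0 to \<open>b\<close> is seen through the circle as a compact arc. The
  parameter 1 falls on the same point as 0, hence the two indicators are compared only almost
  everywhere.\<close>

lemma trig_null_integral_atMost:
 assumes "p \<in> trig_null"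
 shows "(LINT t|I01. indicator {..b} t * p t) = 0"
proof -
 have p: "integrable I01 p" using assms by (simp add: trig_null_def)
 then have [measurable]: "p \<in> borel_measurable I01" by auto
 consider "b < 0" | "0 \<le> b" "b < 1" | "b \<ge> 1" by linarith
 then show ?thesis
 proof cases
  case 1
  then have "(LINT t|I01. indicator {..b} t * p t) = (LINT t|I01. 0)"
   by (intro Bochner_Integration.integral_cong) (auto simp: indicator_def)
  then show ?thesis by simp
 next
  case 3
  then have "(LINT t|I01. indicator {..b} t * p t) = (LINT t|I01. p t)"
   by (intro Bochner_Integration.integral_cong) (auto simp: indicator_def)
  moreover have "(LINT t|I01. cos (2 * pi * real_of_int 0 * t) * p t) = 0"
   using assms unfolding trig_null_def by blast
  ultimately show ?thesis by simp
 next
  case 2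
  define C where "C = (\<lambda>t. cis (2 * pi * t)) ` {0..b}"
  have C: "compact C" "C \<noteq> {}"
   unfolding C_def using 2 by (auto intro!: compact_continuous_image continuous_intros)
  have inC: "cis (2 * pi * t) \<in> C \<longleftrightarrow> t \<le> b" if "0 \<le> t" "t < 1" for t
  proof
   assume "cis (2 * pi * t) \<in> C"
   then obtain s where s: "0 \<le> s" "s \<le> b" "cis (2 * pi * t) = cis (2 * pi * s)" by (auto simp: C_def)
   then have "cos (2 * pi * t) = cos (2 * pi * s)" "sin (2 * pi * t) = sin (2 * pi * s)"
    by (auto simp: complex_eq_iff)
   then obtain n :: int where "2 * pi * t = 2 * pi * s + 2 * pi * n"
    using sin_cos_eq_iff by (metis (no_types, lifting) mult.commute mult.left_commute)
   then have "2 * pi * t = 2 * pi * (s + n)" by (simp add: algebra_simps)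
   then have "t = s + n" by simp
   then have "n = 0" using s that 2 by linarith
   then show "t \<le> b" using s \<open>t = s + n\<close> by simp
  qed (use that in \<open>auto simp: C_def\<close>)
  have "(LINT t|I01. indicator {..b} t * p t) = (LINT t|I01. indicator C (cis (2 * pi * t)) * p t)"
  proof (rule integral_cong_AE)
   have "(\<lambda>t. cis (2 * pi * t)) \<in> borel_measurable I01"
    by (intro continuous_I01_measurable continuous_intros)
   moreover have "C \<in> sets borel" using C by (simp add: borel_compact)
   ultimately show "(\<lambda>t. indicator C (cis (2 * pi * t)) * p t) \<in> borel_measurable I01" by measurable
   show "AE t in I01. indicator {..b} t * p t = indicator C (cis (2 * pi * t)) * p t"
    using AE_I01_neq[of 1] AE_space[of I01]
    by eventually_elim (use inC in \<open>auto simp: indicator_def\<close>)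
   have "(indicator {..b} :: real => real) \<in> borel_measurable I01"
    by (intro measurable_restrict_space1 measurable_completion) simp
   then show "(\<lambda>t. indicator {..b} t * p t) \<in> borel_measurable I01"
    by simp
  qed
  then show ?thesis using trig_null_integral_closed[OF assms C] by simp
 qed
qed

text \<open>The half lines form an intersection-stable generator, so the vanishing of the integrals
  over them spreads to all Borel sets. The function \<open>p\<close> is only Lebesgue measurable and
  is first replaced by a Borel version \<open>q\<close>.\<close>

lemma trig_null_AE_0:
 assumes "p \<in> trig_null" shows "AE t in I01. p t = 0"
proof -
 have p: "integrable I01 p" using assms by (simp add: trig_null_def)
 define q0 where "q0 t = indicator {0..1} t * p t" for t :: real
 have q0: "integrable lebesgue q0"
  using p unfolding q0_def by (subst (asm) integrable_restrict_space) auto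
 obtain q where q: "q \<in> borel_measurable lborel" "AE t in lborel. q0 t = q t"
  using completion_ex_borel_measurable_real[of q0 lborel] q0 by auto
 have [measurable]: "q \<in> borel_measurable borel" using q(1) by simp
 have qAE: "AE t in lebesgue. q0 t = q t" using q(2) by (rule AE_completion)
 have "integrable lebesgue q"
  using q0 q qAE by (subst integrable_cong_AE[where g=q0]) (auto intro: measurable_completion)
 then have qi: "integrable lborel q" using q by (simp add: integrable_completion)
 have b0: "(\<integral>t. indicator {..b} t *\<^sub>R q t \<partial>lborel) = 0" for b
 proof -
  have "(\<integral>t. indicator {..b} t *\<^sub>R q t \<partial>lborel) = (\<integral>t. indicator {..b} t *\<^sub>R q t \<partial>lebesgue)"
   using q by (intro integral_completion[symmetric]) measurable
  also have "\<dots> = (\<integral>t. indicator {0..1} t *\<^sub>R (indicator {..b} t * p t) \<partial>lebesgue)"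
  proof (rule integral_cong_AE)
   have m0: "q0 \<in> borel_measurable lebesgue" using q0 by auto
   have "(\<lambda>t. indicator {..b} t * q0 t) \<in> borel_measurable lebesgue"
    by (intro borel_measurable_times borel_measurable_indicator m0) auto
   then show "(\<lambda>t. indicator {0..1} t *\<^sub>R (indicator {..b} t * p t)) \<in> borel_measurable lebesgue"
    by (simp add: q0_def mult_ac)
   show "(\<lambda>t. indicator {..b} t *\<^sub>R q t) \<in> borel_measurable lebesgue"
    using q by (intro measurable_completion) measurable
   show "AE t in lebesgue. indicator {..b} t *\<^sub>R q t = indicator {0..1} t *\<^sub>R (indicator {..b} t * p t)"
    using qAE
   proof eventually_elim
    case (elim t)
    then show ?case unfolding q0_def by (metis mult.left_commute real_scaleR_def)
   qed
  qed
  also have "\<dots> = (LINT t|I01. indicator {..b} t * p t)"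
   by (subst integral_restrict_space) auto
  finally show ?thesis using trig_null_integral_atMost[OF assms] by simp
 qed
 have A0: "(LINT t:A|lborel. q t) = 0" if "A \<in> sets borel" for A
 proof -
  have si: "set_integrable lborel B q" if "B \<in> sets borel" for B
   using qi that unfolding set_integrable_def by (intro integrable_mult_indicator) auto
  have G: "Int_stable (range (atMost :: real => real set))" "range (atMost :: real => real set) \<subseteq> Pow UNIV"
   by (auto simp: Int_stable_def)
  have "A \<in> sigma_sets UNIV (range atMost)"
   using that unfolding borel_eq_atMost by simp
  from G this show ?thesis
  proof (induction rule: sigma_sets_induct_disjoint)
   case (basic A)
   then show ?case using b0 by (auto simp: set_lebesgue_integral_def)
  next
   case empty show ?case by (simp add: set_lebesgue_integral_def)
  next
   case (compl A)
   have A: "A \<in> sets borel" using compl unfolding borel_eq_atMost by simp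
   have "(LINT t:UNIV - A|lborel. q t) + (LINT t:A|lborel. q t) = (LINT t:UNIV|lborel. q t)"
    by (subst set_integral_Un[symmetric]) (use A si in auto)
   moreover have "(LINT t:UNIV|lborel. q t) = 0"
   proof -
    have "(LINT t:UNIV|lborel. q t) = (LINT t|lborel. q t)" by (simp add: set_lebesgue_integral_def)
    also have "\<dots> = (\<integral>t. q t \<partial>lebesgue)" using q by (intro integral_completion[symmetric]) simp
    also have "\<dots> = (\<integral>t. q0 t \<partial>lebesgue)"
     using qAE q q0 by (intro integral_cong_AE) (auto intro: measurable_completion)
    also have "\<dots> = (LINT t|I01. p t)" unfolding q0_def by (subst integral_restrict_space) auto
    also have "\<dots> = (LINT t|I01. indicator {..1} t * p t)"
     by (intro Bochner_Integration.integral_cong) (auto simp: indicator_def)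
    finally show ?thesis using trig_null_integral_atMost[OF assms] by simp
   qed
   ultimately show ?case using compl by simp
  next
   case (union A)
   have A: "A i \<in> sets borel" for i using union unfolding borel_eq_atMost by auto
   have "(LINT t:(\<Union>i. A i)|lborel. q t) = suminf (\<lambda>i. LINT t:A i|lborel. q t)"
    by (rule lebesgue_integral_countable_add) (use A si union in \<open>auto simp: disjoint_family_on_def\<close>)
   then show ?case using union by simp
  qed
 qed
 have "AE t in lborel. q t = 0"
  by (rule density_unique_real[OF qi]) (use A0 in \<open>auto simp: set_lebesgue_integral_def\<close>)
 then have "AE t in lebesgue. q t = 0" by (rule AE_completion)
 with qAE have "AE t in lebesgue. q0 t = 0" by eventually_elim simp
 then have "AE t in lebesgue. t \<in> {0..1} \<longrightarrow> p t = 0"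
  by eventually_elim (auto simp: q0_def indicator_def split: if_splits)
 then show ?thesis by (subst AE_restrict_space_iff) auto
qed

lemma fcoeff_0_AE_0:
 fixes f :: "real => 'n::finite st"
 assumes "L2 f" "\<And>j. fcoeff j f = 0"
 shows "AE t in I01. f t = 0"
proof -
 have "AE t in I01. u \<bullet> f t = 0" for u
 proof (rule trig_null_AE_0)
  have int: "integrable I01 (\<lambda>t. w \<bullet> f t)" for w
   by (rule L2_inner_integrable[OF L2_const assms(1)])
  have ci: "integrable I01 (\<lambda>t. cos (frq j * t) * (w \<bullet> f t))"
   "integrable I01 (\<lambda>t. sin (frq j * t) * (w \<bullet> f t))" for j w
   by (rule integrable_I01_mult_continuous[OF int], intro continuous_intros)+
  have eq: "(LINT t|I01. cos (frq j * t) * (w \<bullet> f t)) +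
   (LINT t|I01. sin (frq j * t) * (J0 w \<bullet> f t)) = 0" for j w
  proof -
   have "0 = (LINT t|I01. fmode j w t \<bullet> f t)"
    using inner_fcoeff[OF assms(1), of w j] assms(2) by simp
   also have "\<dots> = (LINT t|I01. cos (frq j * t) * (w \<bullet> f t) +
     sin (frq j * t) * (J0 w \<bullet> f t))"
    by (simp add: fmode_def rot_eq inner_add_left)
   finally show ?thesis using ci by simp
  qed
  \<comment> \<open>Cosine is even and sine is odd in \<open>j\<close>, so adding the identities for
    \<open>j\<close> and \<open>-j\<close> leaves the cosine term. The sine term then follows by
    inserting \<open>- J0 w\<close>.\<close>
  have c: "(LINT t|I01. cos (frq j * t) * (w \<bullet> f t)) = 0" for j w
   using eq[of j w] eq[of "-j" w] by simp
  have s: "(LINT t|I01. sin (frq j * t) * (w \<bullet> f t)) = 0" for j w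
   using eq[of j "- J0 w"] c[of j "- J0 w"] by (simp add: J0_uminus)
  show "(\<lambda>t. u \<bullet> f t) \<in> trig_null"
   using int c s by (simp add: trig_null_def)
 qed
 then have "AE t in I01. \<forall>u\<in>Basis. u \<bullet> f t = 0"
  by (intro AE_finite_allI) auto
 then show ?thesis
  by eventually_elim (rule euclidean_eqI, simp add: inner_commute)
qed

section \<open>Riesz--Fischer and Parseval\<close>

definition fsum :: "int set => (int => 'n::finite st) => real => 'n st" where
 "fsum A c t = (\<Sum>j\<in>A. fmode j (c j) t)"

lemma symmetric_intervals_exhaust:
 "filterlim (\<lambda>N. {-int N..int N}) (finite_subsets_at_top UNIV) sequentially"
 unfolding filterlim_finite_subsets_at_top
proof (intro allI impI)
 fix B :: "int set" assume B: "finite B \<and> B \<subseteq> UNIV"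
 define M where "M = Max (insert 0 ((\<lambda>j. nat \<bar>j\<bar>) ` B))"
 have "nat \<bar>j\<bar> \<le> M" if "j \<in> B" for j
  unfolding M_def using B that by (intro Max_ge) auto
 then have "B \<subseteq> {-int N..int N}" if "N \<ge> M" for N using that by fastforce
 then show "\<forall>\<^sub>F N in sequentially. finite {-int N..int N} \<and> B \<subseteq> {-int N..int N} \<and> {-int N..int N} \<subseteq> UNIV"
  by (auto simp: eventually_sequentially)
qed

lemma L2_fsum: "L2 (fsum A c)"
 unfolding fsum_def[abs_def] by (intro L2_sum L2_fmode)

lemma integral_fsum_inner:
 assumes "L2 f" "finite A"
 shows "(LINT t|I01. fsum A c t \<bullet> f t) = (\<Sum>j\<in>A. c j \<bullet> fcoeff j f)"
proof -
 have "(LINT t|I01. fsum A c t \<bullet> f t) = (LINT t|I01. (\<Sum>j\<in>A. fmode j (c j) t \<bullet> f t))"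
  by (simp add: fsum_def inner_sum_left)
 also have "\<dots> = (\<Sum>j\<in>A. (LINT t|I01. fmode j (c j) t \<bullet> f t))"
  by (intro Bochner_Integration.integral_sum L2_inner_integrable L2_fmode assms)
 finally show ?thesis by (simp add: inner_fcoeff[OF assms(1)])
qed

lemma fcoeff_sum:
 assumes "\<And>i. i \<in> A ==> L2 (f i)"
 shows "fcoeff j (\<lambda>t. \<Sum>i\<in>A. f i t) = (\<Sum>i\<in>A. fcoeff j (f i))"
 using assms
proof (induction A rule: infinite_finite_induct)
 case (insert x F)
 then show ?case by (simp add: fcoeff_add[OF _ L2_sum])
qed (simp_all add: fcoeff_def)

lemma fcoeff_fsum:
 assumes "finite A" shows "fcoeff j (fsum A c) = (if j \<in> A then c j else 0)"
proof -
 have "fcoeff j (fsum A c) = (\<Sum>i\<in>A. fcoeff j (fmode i (c i)))"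
  unfolding fsum_def[abs_def] by (intro fcoeff_sum L2_fmode)
 also have "\<dots> = (\<Sum>i\<in>A. if i = j then c i else 0)"
  by (rule sum.cong) (auto simp: fcoeff_fmode)
 finally show ?thesis using assms by (simp add: sum.delta)
qed

lemma l2_fsum:
 assumes "finite A" shows "(l2 (fsum A c))\<^sup>2 = (\<Sum>j\<in>A. (norm (c j))\<^sup>2)"
proof -
 have "(l2 (fsum A c))\<^sup>2 = (LINT t|I01. fsum A c t \<bullet> fsum A c t)"
  by (simp add: l2_power2 power2_norm_eq_inner)
 also have "\<dots> = (\<Sum>j\<in>A. c j \<bullet> fcoeff j (fsum A c))"
  by (rule integral_fsum_inner[OF L2_fsum assms])
 finally show ?thesis by (simp add: fcoeff_fsum assms power2_norm_eq_inner)
qed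

lemma Bessel_identity:
 assumes "L2 f" "finite A"
 shows "(l2 (\<lambda>t. f t - fsum A (\<lambda>j. fcoeff j f) t))\<^sup>2 = (l2 f)\<^sup>2 - (\<Sum>j\<in>A. (norm (fcoeff j f))\<^sup>2)"
proof -
 let ?S = "fsum A (\<lambda>j. fcoeff j f)"
 have int: "integrable I01 (\<lambda>t. (norm (f t))\<^sup>2)" "integrable I01 (\<lambda>t. (norm (?S t))\<^sup>2)"
  "integrable I01 (\<lambda>t. ?S t \<bullet> f t)"
  using assms L2_inner_integrable[OF L2_fsum assms(1)] L2_fsum unfolding L2_def by blast+
 have sq: "(norm (u - v))\<^sup>2 = (norm u)\<^sup>2 - 2 * (v \<bullet> u) + (norm v)\<^sup>2" for u v :: "'n::finite st"
  by (simp add: power2_norm_eq_inner inner_diff_left inner_diff_right inner_commute)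
 have "(l2 (\<lambda>t. f t - ?S t))\<^sup>2 = (l2 f)\<^sup>2 - 2 * (LINT t|I01. ?S t \<bullet> f t) + (l2 ?S)\<^sup>2"
  unfolding l2_power2 sq using int by simp
 then show ?thesis
  by (simp add: l2_fsum integral_fsum_inner assms power2_norm_eq_inner)
qed

lemma Bessel_inequality:
 assumes "L2 f" "finite A"
 shows "(\<Sum>j\<in>A. (norm (fcoeff j f))\<^sup>2) \<le> (l2 f)\<^sup>2"
 using Bessel_identity[OF assms] zero_le_power2[of "l2 (\<lambda>t. f t - fsum A (\<lambda>j. fcoeff j f) t)"] by linarith

lemma fcoeff_summable:
 assumes "L2 f" shows "(\<lambda>j. (norm (fcoeff j f))\<^sup>2) summable_on UNIV"
 by (rule nonneg_bdd_above_summable_on)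
  (auto intro!: bdd_aboveI[of _ "(l2 f)\<^sup>2"] Bessel_inequality assms)

text \<open>The tails are made as small as \<open>(1/4)^k\<close>, so that successive partial sums
  differ by at most \<open>(1/2)^k\<close> in \<open>l2\<close>. Their pointwise differences are
  then summable almost everywhere, and Fatou's lemma carries the tail bound to the limit. The index
  sets are exported because the rate is used again for the coefficients and for Parseval's
  identity.\<close>

lemma Riesz_Fischer_aux:
 fixes c :: "int => 'n::finite st"
 assumes "(\<lambda>j. (norm (c j))\<^sup>2) summable_on UNIV"
 obtains f A where "L2 f" "\<And>k. finite (A k)" "\<And>j. \<exists>k. \<forall>m\<ge>k. j \<in> A m"
  "\<And>k. (l2 (\<lambda>t. f t - fsum (A k) c t))\<^sup>2 \<le> (1/4)^k"
proof -
 let ?g = "\<lambda>j. (norm (c j))\<^sup>2"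
 define s where "s = infsum ?g UNIV"
 have hs: "(?g has_sum s) UNIV" using assms by (simp add: s_def)
 have "\<exists>N::nat. \<forall>A. finite A \<and> {-int N..int N} \<subseteq> A \<longrightarrow> sum ?g A > s - (1/4)^k" for k
 proof -
  have "((\<lambda>N. sum ?g {-int N..int N}) \<longlongrightarrow> s) sequentially"
   using hs unfolding has_sum_def by (rule filterlim_compose[OF _ symmetric_intervals_exhaust])
  then have "\<forall>\<^sub>F N in sequentially. s - (1/4)^k < sum ?g {-int N..int N}" by (rule order_tendstoD) simp
  then obtain N where N: "s - (1/4)^k < sum ?g {-int N..int N}" by (auto simp: eventually_sequentially)
  have "s - (1/4)^k < sum ?g A" if "finite A \<and> {-int N..int N} \<subseteq> A" for A
   using N sum_mono2[of A "{-int N..int N}" ?g] that by fastforce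
  then show ?thesis by blast
 qed
 then obtain N0 :: "nat => nat" where N0: "\<And>k A. finite A ==> {-int (N0 k)..int (N0 k)} \<subseteq> A ==> sum ?g A > s - (1/4)^k"
  by metis
 \<comment> \<open>Summing the \<open>N0 i\<close> makes \<open>N\<close> monotone, and the summand
   \<open>k\<close> makes every index belong to all later sets.\<close>
 define N where "N k = k + (\<Sum>i\<le>k. N0 i)" for k
 have NN0: "N0 k \<le> N k" for k unfolding N_def by (simp add: lessThan_Suc_atMost[symmetric])
 have Nmono: "N k \<le> N m" if "k \<le> m" for k m
  unfolding N_def using that by (intro add_mono sum_mono2) auto
 define A where "A k = {-int (N k)..int (N k)}" for k
 have finA: "finite (A k)" for k by (simp add: A_def)
 have Amono: "A k \<subseteq> A m" if "k \<le> m" for k m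
  using Nmono[OF that] by (auto simp: A_def)
 have gA: "sum ?g (A k) > s - (1/4)^k" for k
  using NN0[of k] by (intro N0) (auto simp: A_def)
 have gle: "sum ?g B \<le> s" if "finite B" for B
  unfolding s_def using assms that by (intro finite_sum_le_infsum) auto
 have tail: "(l2 (\<lambda>t. fsum (A m) c t - fsum (A k) c t))\<^sup>2 \<le> (1/4)^k" if "k \<le> m" for k m
 proof -
  have "fsum (A m) c t - fsum (A k) c t = fsum (A m - A k) c t" for t
   unfolding fsum_def using sum_diff[OF finA Amono[OF that], of "\<lambda>j. fmode j (c j) t"] by simp
  then have "(l2 (\<lambda>t. fsum (A m) c t - fsum (A k) c t))\<^sup>2 = sum ?g (A m - A k)"
   using l2_fsum[of "A m - A k" c] finA by simp
  also have "\<dots> = sum ?g (A m) - sum ?g (A k)"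
   by (rule sum_diff[OF finA Amono[OF that]])
  finally show ?thesis using gle[OF finA, of m] gA[of k] by linarith
 qed
 define S where "S k = fsum (A k) c" for k
 have LS: "L2 (S k)" for k by (simp add: S_def L2_fsum)
 have [measurable]: "S k \<in> borel_measurable I01" for k using LS by (rule L2_measurable)
 define d where "d k t = norm (S (Suc k) t - S k t)" for k t
 have dL: "L2 (\<lambda>t. S (Suc k) t - S k t)" for k by (intro L2_diff LS)
 have dint: "(\<integral>\<^sup>+t. ennreal (d k t) \<partial>I01) \<le> ennreal ((1/2)^k)" for k
 proof -
  have "(\<integral>\<^sup>+t. ennreal (d k t) \<partial>I01) = ennreal (LINT t|I01. d k t)"
   unfolding d_def using L2_integrable[OF dL] by (intro nn_integral_eq_integral) auto
  also have "(LINT t|I01. d k t) \<le> l2 (\<lambda>t. S (Suc k) t - S k t)"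
   unfolding d_def by (rule integral_norm_le_l2[OF dL])
  also have "\<dots> \<le> (1/2)^k"
  proof (rule power2_le_imp_le)
   have "((1/2::real)^k)\<^sup>2 = (1/4)^k" by (simp add: power2_eq_square power_mult_distrib[symmetric])
   then show "(l2 (\<lambda>t. S (Suc k) t - S k t))\<^sup>2 \<le> ((1/2)^k)\<^sup>2"
    using tail[of k "Suc k"] by (simp add: S_def)
  qed simp
  finally show ?thesis by (simp add: ennreal_leI)
 qed
 have "(\<integral>\<^sup>+t. suminf (\<lambda>k. ennreal (d k t)) \<partial>I01) = suminf (\<lambda>k. \<integral>\<^sup>+t. ennreal (d k t) \<partial>I01)"
  unfolding d_def by (intro nn_integral_suminf) measurable
 also have "\<dots> \<le> suminf (\<lambda>k. ennreal ((1/2)^k))"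
  by (intro suminf_le dint) auto
 also have "\<dots> = ennreal (suminf (\<lambda>k. (1/2)^k))"
  by (intro suminf_ennreal2) (auto intro: summable_geometric)
 finally have fin: "(\<integral>\<^sup>+t. suminf (\<lambda>k. ennreal (d k t)) \<partial>I01) \<noteq> \<infinity>"
  using ennreal_less_top le_less_trans by (metis infinity_ennreal_def less_irrefl)
 have "AE t in I01. suminf (\<lambda>k. ennreal (d k t)) \<noteq> \<infinity>"
  by (rule nn_integral_PInf_AE) (use fin in \<open>auto simp: d_def\<close>)
 then have conv: "AE t in I01. convergent (\<lambda>k. S k t)"
 proof eventually_elim
  case (elim t)
  have "summable (\<lambda>k. d k t)"
   using elim by (intro summable_suminf_not_top) (auto simp: d_def)
  then have "summable (\<lambda>k. S (Suc k) t - S k t)"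
   unfolding d_def by (rule summable_norm_cancel)
  then have "convergent (\<lambda>n. \<Sum>k<n. S (Suc k) t - S k t)"
   by (simp add: summable_iff_convergent)
  from convergent_add[OF this convergent_const[of "S 0 t"]]
  show ?case by (simp add: sum_lessThan_telescope[of "\<lambda>k. S k t"])
 qed
 define f where "f t = (if convergent (\<lambda>k. S k t) then lim (\<lambda>k. S k t) else 0)" for t
 have fm: "f \<in> borel_measurable I01"
 proof -
  have "(\<lambda>t. if Cauchy (\<lambda>k. S k t) then lim (\<lambda>k. S k t) else 0) \<in> borel_measurable I01"
   by measurable
  then show ?thesis unfolding f_def[abs_def] Cauchy_convergent_iff .
 qed
 have fl: "AE t in I01. (\<lambda>k. S k t) \<longlonglongrightarrow> f t"
  using conv by eventually_elim (auto simp: f_def convergent_LIMSEQ_iff)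
 have fatou: "(\<integral>\<^sup>+t. ennreal ((norm (f t - S k t))\<^sup>2) \<partial>I01) \<le> ennreal ((1/4)^k)" for k
 proof -
  have "(\<integral>\<^sup>+t. ennreal ((norm (f t - S k t))\<^sup>2) \<partial>I01) =
    (\<integral>\<^sup>+t. liminf (\<lambda>m. ennreal ((norm (S m t - S k t))\<^sup>2)) \<partial>I01)"
   using fl by (intro nn_integral_cong_AE, eventually_elim)
    (rule sym, intro lim_imp_Liminf tendsto_intros tendsto_ennrealI, auto)
  also have "\<dots> \<le> liminf (\<lambda>m. \<integral>\<^sup>+t. ennreal ((norm (S m t - S k t))\<^sup>2) \<partial>I01)"
   by (intro nn_integral_liminf) measurable
  also have "\<dots> \<le> ennreal ((1/4)^k)"
  proof (rule Liminf_le)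
   show "\<forall>\<^sub>F m in sequentially. (\<integral>\<^sup>+t. ennreal ((norm (S m t - S k t))\<^sup>2) \<partial>I01) \<le> ennreal ((1/4)^k)"
    using eventually_ge_at_top[of k]
   proof eventually_elim
    case (elim m)
    have "(\<integral>\<^sup>+t. ennreal ((norm (S m t - S k t))\<^sup>2) \<partial>I01) = ennreal ((l2 (\<lambda>t. S m t - S k t))\<^sup>2)"
     unfolding l2_power2 using L2_diff[OF LS LS, of m k]
     by (intro nn_integral_eq_integral) (auto simp: L2_def)
    then show ?case using tail[OF elim] by (simp add: S_def ennreal_leI)
   qed
  qed simp
  finally show ?thesis .
 qed
 have Lf: "L2 (\<lambda>t. f t - S k t)" for k
 proof -
  have "(\<integral>\<^sup>+t. ennreal ((norm (f t - S k t))\<^sup>2) \<partial>I01) < \<infinity>"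
   using le_less_trans[OF fatou[of k] ennreal_less_top] by (simp add: infinity_ennreal_def)
  then show ?thesis using fm unfolding L2_def by (auto intro!: integrableI_bounded)
 qed
 have "L2 (\<lambda>t. (f t - S 0 t) + S 0 t)" by (intro L2_add Lf LS)
 then have "L2 f" by simp
 moreover have "(l2 (\<lambda>t. f t - fsum (A k) c t))\<^sup>2 \<le> (1/4)^k" for k
 proof -
  have "ennreal ((l2 (\<lambda>t. f t - S k t))\<^sup>2) \<le> ennreal ((1/4)^k)"
   using fatou[of k] unfolding l2_power2 using Lf[of k]
   by (subst (asm) nn_integral_eq_integral) (auto simp: L2_def)
  then show ?thesis by (simp add: S_def)
 qed
 moreover have "\<exists>k. \<forall>m\<ge>k. j \<in> A m" for j
 proof (intro exI[of _ "nat \<bar>j\<bar>"] allI impI)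
  fix m assume "nat \<bar>j\<bar> \<le> m"
  then have "nat \<bar>j\<bar> \<le> N m" by (simp add: N_def)
  then show "j \<in> A m" by (auto simp: A_def)
 qed
 ultimately show ?thesis using that finA by blast
qed

lemma Riesz_Fischer_coeff:
 fixes c :: "int => 'n::finite st"
 assumes "L2 f" "\<And>k. finite (A k)" "\<And>j. \<exists>k. \<forall>m\<ge>k. j \<in> A m"
  "\<And>k. (l2 (\<lambda>t. f t - fsum (A k) c t))\<^sup>2 \<le> (1/4)^k"
 shows "fcoeff j f = c j"
proof -
 obtain k0 where k0: "\<And>m. m \<ge> k0 ==> j \<in> A m" using assms(3) by blast
 have le: "(norm (fcoeff j f - c j))\<^sup>2 \<le> (1/4)^k" if "k \<ge> k0" for k
 proof -
  have "fcoeff j f - c j = fcoeff j (\<lambda>t. f t - fsum (A k) c t)"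
   using k0[OF that] by (simp add: fcoeff_diff[OF assms(1) L2_fsum] fcoeff_fsum assms(2))
  then have "norm (fcoeff j f - c j) \<le> l2 (\<lambda>t. f t - fsum (A k) c t)"
   using norm_fcoeff_le[OF L2_diff[OF assms(1) L2_fsum[of "A k" c]], of j] by simp
  then have "(norm (fcoeff j f - c j))\<^sup>2 \<le> (l2 (\<lambda>t. f t - fsum (A k) c t))\<^sup>2"
   by (intro power_mono) auto
  then show ?thesis using assms(4)[of k] by linarith
 qed
 have "(\<lambda>k. (1/4::real)^k) \<longlonglongrightarrow> 0" by (intro LIMSEQ_power_zero) simp
 then have "(norm (fcoeff j f - c j))\<^sup>2 \<le> 0"
  by (rule LIMSEQ_le_const) (use le in blast)
 then show ?thesis by simp
qed

theorem Riesz_Fischer: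
 fixes c :: "int => 'n::finite st"
 assumes "(\<lambda>j. (norm (c j))\<^sup>2) summable_on UNIV"
 obtains f where "L2 f" "\<And>j. fcoeff j f = c j"
proof -
 obtain f A where f: "L2 f" "\<And>k. finite (A k)" "\<And>j. \<exists>k. \<forall>m\<ge>k. j \<in> A m"
  "\<And>k. (l2 (\<lambda>t. f t - fsum (A k) c t))\<^sup>2 \<le> (1/4)^k"
  using Riesz_Fischer_aux[OF assms] by blast
 show ?thesis using that[OF f(1)] Riesz_Fischer_coeff[OF f] by blast
qed

lemma L2_eqI_fcoeff:
 fixes f g :: "real => 'n::finite st"
 assumes "L2 f" "L2 g" "\<And>j. fcoeff j f = fcoeff j g"
 shows "AE t in I01. f t = g t"
proof -
 have "AE t in I01. f t - g t = 0"
  by (rule fcoeff_0_AE_0) (use assms in \<open>auto intro: L2_diff simp: fcoeff_diff\<close>)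
 then show ?thesis by simp
qed

text \<open>The Riesz-Fischer function of the coefficients of \<open>f\<close> has those same
  coefficients, hence agrees with \<open>f\<close> almost everywhere by completeness. Its
  approximation rate turns Bessel's inequality into an equality.\<close>

theorem Parseval:
 fixes f :: "real => 'n::finite st"
 assumes "L2 f" shows "((\<lambda>j. (norm (fcoeff j f))\<^sup>2) has_sum (l2 f)\<^sup>2) UNIV"
proof -
 obtain g A where g: "L2 g" "\<And>k. finite (A k)" "\<And>j. \<exists>k. \<forall>m\<ge>k. j \<in> A m"
  "\<And>k. (l2 (\<lambda>t. g t - fsum (A k) (\<lambda>j. fcoeff j f) t))\<^sup>2 \<le> (1/4)^k"
  using Riesz_Fischer_aux[OF fcoeff_summable[OF assms]] by blast
 have "AE t in I01. f t = g t"
  using L2_eqI_fcoeff[OF assms g(1)] Riesz_Fischer_coeff[OF g] by simp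
 then have "AE t in I01. g t - fsum (A k) (\<lambda>j. fcoeff j f) t = f t - fsum (A k) (\<lambda>j. fcoeff j f) t" for k
  by eventually_elim simp
 then have "l2 (\<lambda>t. g t - fsum (A k) (\<lambda>j. fcoeff j f) t) = l2 (\<lambda>t. f t - fsum (A k) (\<lambda>j. fcoeff j f) t)" for k
  by (intro l2_cong_AE L2_measurable L2_diff assms g L2_fsum)
 then have le: "(l2 f)\<^sup>2 - (1/4)^k \<le> (\<Sum>j\<in>A k. (norm (fcoeff j f))\<^sup>2)" for k
  using g(4)[of k] Bessel_identity[OF assms g(2)[of k]] by simp
 have "infsum (\<lambda>j. (norm (fcoeff j f))\<^sup>2) UNIV = (l2 f)\<^sup>2"
 proof (rule antisym)
  show "infsum (\<lambda>j. (norm (fcoeff j f))\<^sup>2) UNIV \<le> (l2 f)\<^sup>2"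
   by (rule infsum_le_finite_sums[OF fcoeff_summable[OF assms]]) (rule Bessel_inequality[OF assms])
  have "(l2 f)\<^sup>2 - (1/4)^k \<le> infsum (\<lambda>j. (norm (fcoeff j f))\<^sup>2) UNIV" for k
   by (rule order.trans[OF le[of k] finite_sum_le_infsum])
    (use fcoeff_summable[OF assms] g(2) in auto)
  moreover have "(\<lambda>k. (l2 f)\<^sup>2 - (1/4::real)^k) \<longlonglongrightarrow> (l2 f)\<^sup>2 - 0"
   by (intro tendsto_diff tendsto_const LIMSEQ_power_zero) simp
  ultimately show "(l2 f)\<^sup>2 \<le> infsum (\<lambda>j. (norm (fcoeff j f))\<^sup>2) UNIV"
   by (intro LIMSEQ_le_const2[where X="\<lambda>k. (l2 f)\<^sup>2 - (1/4::real)^k"]) auto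
 qed
 then show ?thesis using fcoeff_summable[OF assms] by (metis has_sum_infsum)
qed

theorem Parseval_inner:
 fixes f g :: "real => 'n::finite st"
 assumes "L2 f" "L2 g"
 shows "((\<lambda>j. fcoeff j f \<bullet> fcoeff j g) has_sum (LINT t|I01. f t \<bullet> g t)) UNIV"
proof -
 have P: "((\<lambda>j. (norm (fcoeff j f + fcoeff j g))\<^sup>2) has_sum (l2 (\<lambda>t. f t + g t))\<^sup>2) UNIV"
  using Parseval[OF L2_add[OF assms]] by (simp add: fcoeff_add assms)
 have M: "((\<lambda>j. (norm (fcoeff j f - fcoeff j g))\<^sup>2) has_sum (l2 (\<lambda>t. f t - g t))\<^sup>2) UNIV"
  using Parseval[OF L2_diff[OF assms]] by (simp add: fcoeff_diff assms)
 have pol: "x \<bullet> y = (1/4) * ((norm (x + y))\<^sup>2 - (norm (x - y))\<^sup>2)" for x y :: "'n st"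
  by (simp add: power2_norm_eq_inner inner_add_left inner_add_right inner_diff_left inner_diff_right inner_commute)
 have int: "integrable I01 (\<lambda>t. (norm (f t + g t))\<^sup>2)" "integrable I01 (\<lambda>t. (norm (f t - g t))\<^sup>2)"
  using L2_add[OF assms] L2_diff[OF assms] by (auto simp: L2_def)
 have "((\<lambda>j. (1/4) * ((norm (fcoeff j f + fcoeff j g))\<^sup>2 + (-1) * (norm (fcoeff j f - fcoeff j g))\<^sup>2)) has_sum
   (1/4) * ((l2 (\<lambda>t. f t + g t))\<^sup>2 + (-1) * (l2 (\<lambda>t. f t - g t))\<^sup>2)) UNIV"
  by (intro has_sum_cmult_right has_sum_add P M)
 then have "((\<lambda>j. (1/4) * ((norm (fcoeff j f + fcoeff j g))\<^sup>2 - (norm (fcoeff j f - fcoeff j g))\<^sup>2)) has_sum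
   (1/4) * ((l2 (\<lambda>t. f t + g t))\<^sup>2 - (l2 (\<lambda>t. f t - g t))\<^sup>2)) UNIV"
  by simp
 also have "(1/4) * ((l2 (\<lambda>t. f t + g t))\<^sup>2 - (l2 (\<lambda>t. f t - g t))\<^sup>2) = (LINT t|I01. f t \<bullet> g t)"
  unfolding l2_power2 pol using int by simp
 finally show ?thesis by (simp add: pol)
qed

section \<open>The Hilbert space of symmetric loops\<close>

text \<open>The weight of the \<open>j\<close>-th mode in \<open>Einner\<close>, with the separate
  term of the zero mode absorbed as weight 1.\<close>

definition wt :: "int => real" where
 "wt j = (if j = 0 then 1 else frq \<bar>j\<bar>)"

lemma wt_0 [simp]: "wt 0 = 1" by (simp add: wt_def)

lemma wt_ge_abs: "frq \<bar>j\<bar> \<le> wt j"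
 by (simp add: wt_def)

lemma wt_ge_1: "1 \<le> wt j"
proof (cases "j = 0")
 case False
 then have "1 \<le> real_of_int \<bar>j\<bar>" by linarith
 moreover have "1 \<le> 2 * pi" using pi_gt3 by simp
 ultimately have "1 * 1 \<le> frq \<bar>j\<bar>" by (intro mult_mono) auto
 then show ?thesis using False by (simp add: wt_def)
qed simp

lemma wt_pos: "0 < wt j" using wt_ge_1[of j] by linarith

lemma wt_nonneg: "0 \<le> wt j" using wt_pos[of j] by linarith

lemma Eset_iff: "c \<in> Eset \<longleftrightarrow> (\<lambda>j. wt j * (norm (c j))\<^sup>2) summable_on UNIV"
proof
 have f0: "(\<lambda>j::int. if j = 0 then (norm (c 0))\<^sup>2 else 0) summable_on UNIV"
  by (subst summable_on_cong_neutral[where T="{0}"]) auto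
 {
  assume "c \<in> Eset"
  then have "(\<lambda>j. 2 * pi * (real_of_int \<bar>j\<bar> * (norm (c j))\<^sup>2) + (if j = 0 then (norm (c 0))\<^sup>2 else 0)) summable_on UNIV"
   using f0 by (intro summable_on_add summable_on_cmult_right) (auto simp: Eset_def)
  then show "(\<lambda>j. wt j * (norm (c j))\<^sup>2) summable_on UNIV"
   by (rule summable_on_cong[THEN iffD1, rotated]) (auto simp: wt_def)
 next
  assume "(\<lambda>j. wt j * (norm (c j))\<^sup>2) summable_on UNIV"
  then have "(\<lambda>j. (1 / (2 * pi)) * (wt j * (norm (c j))\<^sup>2 + (-1) * (if j = 0 then (norm (c 0))\<^sup>2 else 0))) summable_on UNIV"
   using f0 by (intro summable_on_add summable_on_cmult_right) auto
  then have "(\<lambda>j. real_of_int \<bar>j\<bar> * (norm (c j))\<^sup>2) summable_on UNIV"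
   by (rule summable_on_cong[THEN iffD1, rotated]) (auto simp: wt_def)
  then show "c \<in> Eset" by (simp add: Eset_def)
 }
qed

lemma Eset_le:
 assumes "\<And>j. norm (d j) \<le> C * norm (c j)" "c \<in> Eset" shows "d \<in> Eset"
 unfolding Eset_iff
proof (rule summable_on_comparison_test)
 show "(\<lambda>j. C\<^sup>2 * (wt j * (norm (c j))\<^sup>2)) summable_on UNIV"
  using assms(2) by (intro summable_on_cmult_right) (simp add: Eset_iff)
 fix j
 have "(norm (d j))\<^sup>2 \<le> (C * norm (c j))\<^sup>2" using assms(1) by (intro power_mono) auto
 then have "wt j * (norm (d j))\<^sup>2 \<le> wt j * (C * norm (c j))\<^sup>2"
  by (intro mult_left_mono wt_nonneg)
 then show "wt j * (norm (d j))\<^sup>2 \<le> C\<^sup>2 * (wt j * (norm (c j))\<^sup>2)"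
  by (simp add: power_mult_distrib mult_ac)
qed (simp add: wt_nonneg)

lemma Eset_add:
 assumes "c \<in> Eset" "d \<in> Eset" shows "(\<lambda>j. c j + d j) \<in> Eset"
 unfolding Eset_iff
proof (rule summable_on_comparison_test)
 show "(\<lambda>j. 2 * (wt j * (norm (c j))\<^sup>2) + 2 * (wt j * (norm (d j))\<^sup>2)) summable_on UNIV"
  using assms by (intro summable_on_add summable_on_cmult_right) (auto simp: Eset_iff)
 fix j
 have "(norm (c j + d j))\<^sup>2 \<le> (norm (c j) + norm (d j))\<^sup>2"
  by (intro power_mono norm_triangle_ineq) auto
 also have "\<dots> \<le> 2 * (norm (c j))\<^sup>2 + 2 * (norm (d j))\<^sup>2"
  using zero_le_power2[of "norm (c j) - norm (d j)"] by (simp add: power2_eq_square algebra_simps)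
 finally have "wt j * (norm (c j + d j))\<^sup>2 \<le> wt j * (2 * (norm (c j))\<^sup>2 + 2 * (norm (d j))\<^sup>2)"
  by (intro mult_left_mono wt_nonneg)
 then show "wt j * (norm (c j + d j))\<^sup>2 \<le> 2 * (wt j * (norm (c j))\<^sup>2) + 2 * (wt j * (norm (d j))\<^sup>2)"
  by (simp add: algebra_simps)
qed (simp add: wt_nonneg)

lemma Eset_zero: "(\<lambda>_. 0) \<in> Eset" by (simp add: Eset_def)

lemma Eset_scaleR: "c \<in> Eset ==> (\<lambda>j. r *\<^sub>R c j) \<in> Eset"
 by (rule Eset_le[of _ "\<bar>r\<bar>"]) auto

lemma Eset_uminus: "c \<in> Eset ==> (\<lambda>j. - c j) \<in> Eset"
 by (rule Eset_le[of _ 1]) auto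

lemma Eset_diff: "c \<in> Eset ==> d \<in> Eset ==> (\<lambda>j. c j - d j) \<in> Eset"
 using Eset_add[OF _ Eset_uminus, of c d] by simp

lemma Eset_inner_summable:
 assumes "c \<in> Eset" "d \<in> Eset"
 shows "(\<lambda>j. wt j * (c j \<bullet> d j)) summable_on UNIV"
proof -
 have pol: "x \<bullet> y = (1/4) * ((norm (x + y))\<^sup>2 + (-1) * (norm (x - y))\<^sup>2)" for x y :: "real^'n::finite"
  by (simp add: power2_norm_eq_inner inner_add_left inner_add_right inner_diff_left inner_diff_right inner_commute)
 have "(\<lambda>j. (1/4) * (wt j * (norm (c j + d j))\<^sup>2 + (-1) * (wt j * (norm (c j - d j))\<^sup>2))) summable_on UNIV"
  using Eset_add[OF assms] Eset_diff[OF assms]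
  by (intro summable_on_cmult_right summable_on_add) (auto simp: Eset_iff)
 then show ?thesis unfolding pol by (simp add: algebra_simps)
qed

text \<open>As a type the space becomes an instance of \<open>real_inner\<close>, which brings
  norms, limits and continuity; \<open>Einner_cf\<close> and \<open>Enorm_cf\<close> tie them to the
  given \<open>Einner\<close> and \<open>Enorm\<close>.\<close>

typedef (overloaded) ('n::finite) hs = "Eset :: 'n coeff set"
 morphisms cf Hs using Eset_zero by blast

lemma cf_mem [simp]: "cf x \<in> Eset" using cf by blast

lemma cf_Hs [simp]: "c \<in> Eset ==> cf (Hs c) = c" by (rule Hs_inverse)

instantiation hs :: (finite) real_vector
begin

definition "0 = Hs (\<lambda>_. 0)"
definition "x + y = Hs (\<lambda>j. cf x j + cf y j)"
definition "x - y = Hs (\<lambda>j. cf x j - cf y j)"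
definition "- x = Hs (\<lambda>j. - cf x j)"
definition "r *\<^sub>R x = Hs (\<lambda>j. r *\<^sub>R cf x j)"

lemma cf_simps': "cf (0 :: 'a hs) j = 0" "cf (x + y) j = cf x j + cf y j"
 "cf (x - y) j = cf x j - cf y j" "cf (- x) j = - cf x j"
 "cf (r *\<^sub>R x) j = r *\<^sub>R cf x j" for x y :: "'a hs"
 by (simp_all add: zero_hs_def plus_hs_def minus_hs_def uminus_hs_def scaleR_hs_def
   Eset_zero Eset_add Eset_diff Eset_uminus Eset_scaleR)

lemma hs_eqI': "(\<And>j. cf x j = cf y j) ==> x = (y :: 'a hs)"
 using cf_inject[of x y] by blast

instance
 by standard (rule hs_eqI', simp add: cf_simps' algebra_simps)+

end

lemma cf_zero [simp]: "cf 0 j = 0" and cf_add [simp]: "cf (x + y) j = cf x j + cf y j"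
 and cf_diff [simp]: "cf (x - y) j = cf x j - cf y j" and cf_uminus [simp]: "cf (- x) j = - cf x j"
 and cf_scaleR [simp]: "cf (r *\<^sub>R x) j = r *\<^sub>R cf x j"
 by (simp_all add: zero_hs_def plus_hs_def minus_hs_def uminus_hs_def scaleR_hs_def
   Eset_zero Eset_add Eset_diff Eset_uminus Eset_scaleR)

lemma hs_eqI: "(\<And>j. cf x j = cf y j) ==> x = y"
 using cf_inject[of x y] by blast

instantiation hs :: (finite) real_inner
begin

definition inner_hs :: "'a hs => 'a hs => real" where
 "inner_hs x y = infsum (\<lambda>j. wt j * (cf x j \<bullet> cf y j)) UNIV"
definition norm_hs :: "'a hs => real" where "norm_hs x = sqrt (x \<bullet> x)"
definition dist_hs :: "'a hs => 'a hs => real" where "dist_hs x y = norm (x - y)"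
definition sgn_hs :: "'a hs => 'a hs" where "sgn_hs x = x /\<^sub>R norm x"
definition uniformity_hs :: "('a hs \<times> 'a hs) filter" where
 "uniformity_hs = (INF e\<in>{0<..}. principal {(x, y). dist x y < e})"
definition open_hs :: "'a hs set => bool" where
 "open_hs U = (\<forall>x\<in>U. eventually (\<lambda>(x', y). x' = x \<longrightarrow> y \<in> U) uniformity)"

instance
proof
 fix x y z :: "'a hs" and a b :: real
 show "dist x y = norm (x - y)" by (simp add: dist_hs_def)
 show "sgn x = x /\<^sub>R norm x" by (simp add: sgn_hs_def)
 show "(uniformity :: ('a hs \<times> 'a hs) filter) = (INF e\<in>{0<..}. principal {(x, y). dist x y < e})"
  by (simp add: uniformity_hs_def)
 show "open U = (\<forall>x\<in>U. eventually (\<lambda>(x', y). x' = x \<longrightarrow> y \<in> U) uniformity)" for U :: "'a hs set"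
  by (simp add: open_hs_def)
 show "x \<bullet> y = y \<bullet> x" by (simp add: inner_hs_def inner_commute)
 show "(x + y) \<bullet> z = x \<bullet> z + y \<bullet> z"
  unfolding inner_hs_def
  by (subst infsum_add[symmetric]) (auto intro!: Eset_inner_summable infsum_cong simp: inner_add_left algebra_simps)
 show "(a *\<^sub>R x) \<bullet> y = a * (x \<bullet> y)"
  unfolding inner_hs_def
  by (subst infsum_cmult_right[symmetric]) (auto intro!: Eset_inner_summable infsum_cong)
 show "0 \<le> x \<bullet> x" unfolding inner_hs_def
  by (rule infsum_nonneg) (simp add: wt_nonneg)
 show "(x \<bullet> x = 0) = (x = 0)"
 proof
  assume 0: "x \<bullet> x = 0"
  show "x = 0"
  proof (rule hs_eqI)
   fix j
   have "wt j * (cf x j \<bullet> cf x j) = sum (\<lambda>j. wt j * (cf x j \<bullet> cf x j)) {j}" by simp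
   also have "\<dots> \<le> x \<bullet> x" unfolding inner_hs_def
    by (rule finite_sum_le_infsum) (auto intro!: Eset_inner_summable simp: wt_nonneg)
   finally have "wt j * (cf x j \<bullet> cf x j) \<le> 0" using 0 by simp
   then have "cf x j \<bullet> cf x j \<le> 0" using wt_pos[of j] by (simp add: mult_le_0_iff)
   then have "cf x j \<bullet> cf x j = 0" by (intro antisym) auto
   then show "cf x j = cf 0 j" by simp
  qed
 qed (simp add: inner_hs_def)
 show "norm x = sqrt (x \<bullet> x)" by (simp add: norm_hs_def)
qed

end

lemma hs_eq_iff: "x = y \<longleftrightarrow> (\<forall>j. cf x j = cf y j)"
 by (auto intro: hs_eqI)

lemma cf_sum [simp]: "cf (\<Sum>i\<in>A. f i) j = (\<Sum>i\<in>A. cf (f i) j)"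
 by (induction A rule: infinite_finite_induct) auto

lemma hs_inner_has_sum: "((\<lambda>j. wt j * (cf x j \<bullet> cf y j)) has_sum (x \<bullet> y)) UNIV"
 unfolding inner_hs_def by (intro has_sum_infsum Eset_inner_summable) auto

lemma hs_norm_has_sum: "((\<lambda>j. wt j * (norm (cf x j))\<^sup>2) has_sum (norm x)\<^sup>2) UNIV"
 using hs_inner_has_sum[of x x] by (simp add: power2_norm_eq_inner)

lemma hs_norm_finite_sum: "finite A ==> (\<Sum>j\<in>A. wt j * (norm (cf x j))\<^sup>2) \<le> (norm x)\<^sup>2"
 using hs_norm_has_sum[of x] by (intro has_sum_mono_neutral[OF has_sum_finite[of A]]) (auto simp: wt_nonneg)

lemma norm_cf_le: "norm (cf x j) \<le> norm x"
proof -
 have "wt j * (norm (cf x j))\<^sup>2 \<le> (norm x)\<^sup>2"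
  using hs_norm_finite_sum[of "{j}" x] by simp
 moreover have "1 * (norm (cf x j))\<^sup>2 \<le> wt j * (norm (cf x j))\<^sup>2"
  by (intro mult_right_mono wt_ge_1) auto
 ultimately have "(norm (cf x j))\<^sup>2 \<le> (norm x)\<^sup>2" by linarith
 then show ?thesis by (rule power2_le_imp_le) simp
qed

lemma Einner_cf:
 assumes "c \<in> Eset" "d \<in> Eset" shows "Einner c d = Hs c \<bullet> Hs d"
proof -
 have "((\<lambda>j::int. if j = 0 then c 0 \<bullet> d 0 else 0) has_sum (c 0 \<bullet> d 0)) UNIV"
  by (subst has_sum_cong_neutral[where T="{0}" and g="\<lambda>j. c 0 \<bullet> d 0"]) (auto intro: has_sum_finiteI)
 then have "((\<lambda>j. wt j * (c j \<bullet> d j) + (-1) * (if j = 0 then c 0 \<bullet> d 0 else 0)) has_sum (Hs c \<bullet> Hs d + (-1) * (c 0 \<bullet> d 0))) UNIV"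
  using hs_inner_has_sum[of "Hs c" "Hs d"] assms
  by (intro has_sum_add has_sum_cmult_right) auto
 moreover have "(wt j * (c j \<bullet> d j) + (-1) * (if j = 0 then c 0 \<bullet> d 0 else 0)) = frq \<bar>j\<bar> * (c j \<bullet> d j)" for j
  by (simp add: wt_def)
 ultimately have "((\<lambda>j. frq \<bar>j\<bar> * (c j \<bullet> d j)) has_sum (Hs c \<bullet> Hs d - c 0 \<bullet> d 0)) UNIV"
  by simp
 then show ?thesis by (simp add: Einner_def infsumI)
qed

lemma Enorm_cf: "c \<in> Eset ==> Enorm c = norm (Hs c)"
 by (simp add: Enorm_def Einner_cf norm_eq_sqrt_inner)

lemma Enorm_cf' [simp]: "Enorm (cf x) = norm x"
 by (simp add: Enorm_cf cf_inverse)

lemma Enorm_diff [simp]: "Enorm (\<lambda>j. cf x j - cf y j) = norm (x - y)"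
proof -
 have "(\<lambda>j. cf x j - cf y j) = cf (x - y)" by auto
 then show ?thesis by simp
qed

definition Pp :: "'n::finite hs => 'n hs" where "Pp x = Hs (Eplus (cf x))"
definition Pz :: "'n::finite hs => 'n hs" where "Pz x = Hs (Ezero (cf x))"
definition Pm :: "'n::finite hs => 'n hs" where "Pm x = Hs (Eminus (cf x))"

lemma Eplus_mem: "c \<in> Eset ==> Eplus c \<in> Eset"
 and Ezero_mem: "c \<in> Eset ==> Ezero c \<in> Eset"
 and Eminus_mem: "c \<in> Eset ==> Eminus c \<in> Eset"
 by (auto intro!: Eset_le[of _ 1 c] simp: Eplus_def Ezero_def Eminus_def)

lemma cf_Pp [simp]: "cf (Pp x) j = (if j > 0 then cf x j else 0)"
 and cf_Pz [simp]: "cf (Pz x) j = (if j = 0 then cf x j else 0)"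
 and cf_Pm [simp]: "cf (Pm x) j = (if j < 0 then cf x j else 0)"
 by (simp_all add: Pp_def Pz_def Pm_def Eplus_mem Ezero_mem Eminus_mem)
  (simp_all add: Eplus_def Ezero_def Eminus_def)

lemma cf_Pp_eq: "cf (Pp x) = Eplus (cf x)"
 and cf_Pm_eq: "cf (Pm x) = Eminus (cf x)"
 by (simp_all add: Pp_def Pz_def Pm_def Eplus_mem Ezero_mem Eminus_mem)

lemma P_decomp: "x = Pp x + Pz x + Pm x"
 by (rule hs_eqI) auto

lemma P_idem [simp]: "Pp (Pp x) = Pp x" "Pz (Pz x) = Pz x" "Pm (Pm x) = Pm x"
  "Pp (Pz x) = 0" "Pp (Pm x) = 0" "Pz (Pp x) = 0" "Pz (Pm x) = 0" "Pm (Pp x) = 0" "Pm (Pz x) = 0"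
 by (auto intro!: hs_eqI)

lemma P_inner_self: "Pp x \<bullet> y = Pp x \<bullet> Pp y" "Pz x \<bullet> y = Pz x \<bullet> Pz y" "Pm x \<bullet> y = Pm x \<bullet> Pm y"
 unfolding inner_hs_def by (intro infsum_cong; simp)+

lemma P_orth [simp]: "Pp x \<bullet> Pz y = 0" "Pp x \<bullet> Pm y = 0" "Pz x \<bullet> Pp y = 0"
 "Pz x \<bullet> Pm y = 0" "Pm x \<bullet> Pp y = 0" "Pm x \<bullet> Pz y = 0"
 by (simp_all add: P_inner_self(1)[of x "Pz y"] P_inner_self(1)[of x "Pm y"]
   P_inner_self(2)[of x "Pp y"] P_inner_self(2)[of x "Pm y"]
   P_inner_self(3)[of x "Pp y"] P_inner_self(3)[of x "Pz y"])

lemma norm_P_sq: "(norm x)\<^sup>2 = (norm (Pp x))\<^sup>2 + (norm (Pz x))\<^sup>2 + (norm (Pm x))\<^sup>2"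
proof -
 have "(norm x)\<^sup>2 = (Pp x + Pz x + Pm x) \<bullet> (Pp x + Pz x + Pm x)"
  using P_decomp[of x] by (simp add: power2_norm_eq_inner)
 then show ?thesis by (simp add: inner_add_left inner_add_right power2_norm_eq_inner)
qed

lemma norm_P_le: "norm (Pp x) \<le> norm x" "norm (Pz x) \<le> norm x" "norm (Pm x) \<le> norm x"
 by (rule power2_le_imp_le; simp add: norm_P_sq[of x])+

lemma linear_P: "linear Pp" "linear Pz" "linear Pm"
 by (auto intro!: linearI hs_eqI)

lemma bounded_linear_P: "bounded_linear Pp" "bounded_linear Pz" "bounded_linear Pm"
 by (auto intro!: bounded_linear_intro[of _ 1] hs_eqI simp: norm_P_le)

lemmas P_add [simp] = linear_add[OF linear_P(1)] linear_add[OF linear_P(2)] linear_add[OF linear_P(3)]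
lemmas P_diff [simp] = linear_diff[OF linear_P(1)] linear_diff[OF linear_P(2)] linear_diff[OF linear_P(3)]
lemmas P_scaleR [simp] = linear_cmul[OF linear_P(1)] linear_cmul[OF linear_P(2)] linear_cmul[OF linear_P(3)]
lemmas P_zero [simp] = linear_0[OF linear_P(1)] linear_0[OF linear_P(2)] linear_0[OF linear_P(3)]
lemmas P_uminus [simp] = linear_neg[OF linear_P(1)] linear_neg[OF linear_P(2)] linear_neg[OF linear_P(3)]
lemmas tendsto_P = bounded_linear.tendsto[OF bounded_linear_P(1)] bounded_linear.tendsto[OF bounded_linear_P(2)]
 bounded_linear.tendsto[OF bounded_linear_P(3)]
lemmas continuous_on_P = bounded_linear.continuous_on[OF bounded_linear_P(1)]
 bounded_linear.continuous_on[OF bounded_linear_P(2)] bounded_linear.continuous_on[OF bounded_linear_P(3)]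

section \<open>Loops of elements of the Hilbert space\<close>

definition crv :: "'n::finite hs => real => 'n st" where "crv x = Ecurve_of (cf x)"

lemma Ecurve_iff: "Ecurve c f \<longleftrightarrow> L2 f \<and> (\<forall>j. fcoeff j f = (c j, 0))"
 by (simp add: Ecurve_def L2_def fcoeff_def)

lemma summable_norm_cf: "(\<lambda>j. (norm (cf x j))\<^sup>2) summable_on UNIV"
proof (rule summable_on_comparison_test[OF has_sum_imp_summable[OF hs_norm_has_sum[of x]]])
 fix j show "(norm (cf x j))\<^sup>2 \<le> wt j * (norm (cf x j))\<^sup>2"
  using mult_right_mono[OF wt_ge_1[of j], of "(norm (cf x j))\<^sup>2"] by simp
qed simp

text \<open>The weights are at least 1, so the coefficients are square summable and Riesz-Fischer
  supplies a representative. This gives the choice in \<open>Ecurve_of\<close> its meaning.\<close>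

lemma crv_Ecurve: "Ecurve (cf x) (crv x)"
proof -
 have "(\<lambda>j. (norm (cf x j, 0 :: real^'a))\<^sup>2) summable_on UNIV"
  using summable_norm_cf[of x] by simp
 from Riesz_Fischer[OF this] obtain f :: "real => 'a st"
  where "L2 f" "\<And>j. fcoeff j f = (cf x j, 0)" by blast
 then have "Ecurve (cf x) f" by (simp add: Ecurve_iff)
 then show ?thesis unfolding crv_def Ecurve_of_def by (rule someI[where P="Ecurve (cf x)"])
qed

lemma L2_crv: "L2 (crv x)" and fcoeff_crv [simp]: "fcoeff j (crv x) = (cf x j, 0)"
 using crv_Ecurve by (auto simp: Ecurve_iff)

lemma crv_measurable [measurable]: "crv x \<in> borel_measurable I01"
 by (rule L2_measurable[OF L2_crv])

lemma crv_eqI: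
 assumes "L2 f" "\<And>j. fcoeff j f = (cf x j, 0)"
 shows "AE t in I01. crv x t = f t"
 by (rule L2_eqI_fcoeff) (use assms L2_crv in auto)

lemma crv_add: "AE t in I01. crv (x + y) t = crv x t + crv y t"
 by (rule crv_eqI) (auto intro!: L2_add L2_crv simp: fcoeff_add L2_crv)

lemma crv_diff: "AE t in I01. crv (x - y) t = crv x t - crv y t"
 by (rule crv_eqI) (auto intro!: L2_diff L2_crv simp: fcoeff_diff L2_crv)

lemma crv_scaleR: "AE t in I01. crv (r *\<^sub>R x) t = r *\<^sub>R crv x t"
 by (rule crv_eqI) (auto intro!: L2_scaleR L2_crv simp: fcoeff_scaleR)

lemma l2_crv_has_sum: "((\<lambda>j. (norm (cf x j))\<^sup>2) has_sum (l2 (crv x))\<^sup>2) UNIV"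
 using Parseval[OF L2_crv[of x]] by simp

lemma l2_crv_le: "l2 (crv x) \<le> norm x"
proof (rule power2_le_imp_le)
 show "(l2 (crv x))\<^sup>2 \<le> (norm x)\<^sup>2"
 proof (rule has_sum_mono[OF l2_crv_has_sum hs_norm_has_sum])
  fix j show "(norm (cf x j))\<^sup>2 \<le> wt j * (norm (cf x j))\<^sup>2"
   using mult_right_mono[OF wt_ge_1[of j], of "(norm (cf x j))\<^sup>2"] by simp
 qed
qed simp

lemma l2_crv_diff: "l2 (\<lambda>t. crv x t - crv y t) = l2 (crv (x - y))"
 by (intro l2_cong_AE L2_measurable L2_diff L2_crv) (use crv_diff[of x y] in eventually_elim, simp)

lemma crv_symmetric_integral:
 assumes "L2 y"
 shows "((\<lambda>j. cf x j \<bullet> fst (fcoeff j y)) has_sum (LINT t|I01. crv x t \<bullet> y t)) UNIV"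
 using Parseval_inner[OF L2_crv assms, of x] by (simp add: inner_prod_def)

text \<open>The vector of E that represents the functional sending \<open>x\<close> to the integral
  of \<open>crv x\<close> against \<open>y\<close>. Only \<open>fst\<close> of a coefficient counts,
  since the coefficients of \<open>crv x\<close> have second component zero.\<close>

definition rieszE :: "(real => 'n::finite st) => 'n hs" where
 "rieszE y = Hs (\<lambda>j. (1 / wt j) *\<^sub>R fst (fcoeff j y))"

lemma rieszE_mem:
 assumes "L2 y" shows "(\<lambda>j. (1 / wt j) *\<^sub>R fst (fcoeff j y)) \<in> Eset"
 unfolding Eset_iff
proof (rule summable_on_comparison_test[OF fcoeff_summable[OF assms]])
 fix j
 have "wt j * (norm ((1 / wt j) *\<^sub>R fst (fcoeff j y)))\<^sup>2 = (1 / wt j) * (norm (fst (fcoeff j y)))\<^sup>2"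
  using wt_pos[of j] by (simp add: power_mult_distrib power_divide power2_eq_square)
 also have "\<dots> \<le> 1 * (norm (fst (fcoeff j y)))\<^sup>2"
  using wt_ge_1[of j] by (intro mult_right_mono) auto
 also have "\<dots> \<le> (norm (fcoeff j y))\<^sup>2"
  using norm_fst_le[of "fst (fcoeff j y)" "snd (fcoeff j y)"] by (simp add: power_mono)
 finally show "wt j * (norm ((1 / wt j) *\<^sub>R fst (fcoeff j y)))\<^sup>2 \<le> (norm (fcoeff j y))\<^sup>2" .
qed (simp add: wt_nonneg)

lemma cf_rieszE: "L2 y ==> cf (rieszE y) j = (1 / wt j) *\<^sub>R fst (fcoeff j y)"
 by (simp add: rieszE_def rieszE_mem)

lemma rieszE_inner:
 assumes "L2 y" shows "rieszE y \<bullet> x = (LINT t|I01. crv x t \<bullet> y t)"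
proof -
 have "wt j * (cf (rieszE y) j \<bullet> cf x j) = cf x j \<bullet> fst (fcoeff j y)" for j
  using wt_pos[of j] by (simp add: cf_rieszE assms inner_commute)
 then have "((\<lambda>j. cf x j \<bullet> fst (fcoeff j y)) has_sum (rieszE y \<bullet> x)) UNIV"
  using hs_inner_has_sum[of "rieszE y" x] by simp
 then show ?thesis using crv_symmetric_integral[OF assms] has_sum_unique by blast
qed

lemma norm_rieszE_le: assumes "L2 y" shows "norm (rieszE y) \<le> l2 y"
proof (cases "norm (rieszE y) = 0")
 case True then show ?thesis using l2_nonneg by simp
next
 case False
 have "(norm (rieszE y))\<^sup>2 = (LINT t|I01. crv (rieszE y) t \<bullet> y t)"
  using rieszE_inner[OF assms, of "rieszE y"] by (simp add: power2_norm_eq_inner)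
 also have "\<dots> \<le> l2 (crv (rieszE y)) * l2 y"
  using L2_Cauchy_Schwarz[OF L2_crv assms, of "rieszE y"] by linarith
 also have "\<dots> \<le> norm (rieszE y) * l2 y"
  by (intro mult_right_mono l2_crv_le l2_nonneg)
 finally show ?thesis using False by (simp add: power2_eq_square)
qed

lemma rieszE_diff:
 assumes "L2 y" "L2 z" shows "rieszE y - rieszE z = rieszE (\<lambda>t. y t - z t)"
 by (rule hs_eqI) (simp add: cf_rieszE assms L2_diff fcoeff_diff scaleR_diff_right)

section \<open>Compactness of the embedding of E into the square-integrable loops\<close>

lemma tail_estimate:
 assumes "\<And>j. \<bar>j\<bar> \<le> int N ==> cf x j = 0"
 shows "2 * pi * real (Suc N) * (l2 (crv x))\<^sup>2 \<le> (norm x)\<^sup>2"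
proof (rule has_sum_mono[OF has_sum_cmult_right[OF l2_crv_has_sum] hs_norm_has_sum])
 fix j
 show "2 * pi * real (Suc N) * (norm (cf x j))\<^sup>2 \<le> wt j * (norm (cf x j))\<^sup>2"
 proof (cases "\<bar>j\<bar> \<le> int N")
  case True then show ?thesis using assms by simp
 next
  case False
  then have "real (Suc N) \<le> real_of_int \<bar>j\<bar>" by linarith
  then have "2 * pi * real (Suc N) \<le> frq \<bar>j\<bar>"
   by (intro mult_left_mono) auto
  then have "2 * pi * real (Suc N) \<le> wt j"
   using wt_ge_abs[of j] by linarith
  then show ?thesis by (rule mult_right_mono) simp
 qed
qed

definition trunc :: "nat => 'n::finite hs => 'n hs" where
 "trunc N x = Hs (\<lambda>j. if \<bar>j\<bar> \<le> int N then cf x j else 0)"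

lemma cf_trunc [simp]: "cf (trunc N x) j = (if \<bar>j\<bar> \<le> int N then cf x j else 0)"
proof -
 have "(\<lambda>j. if \<bar>j\<bar> \<le> int N then cf x j else 0) \<in> Eset"
  by (rule Eset_le[of _ 1 "cf x"]) auto
 then show ?thesis by (simp add: trunc_def)
qed

lemma norm_diff_trunc_le: "norm (x - trunc N x) \<le> norm x"
proof (rule power2_le_imp_le)
 show "(norm (x - trunc N x))\<^sup>2 \<le> (norm x)\<^sup>2"
  by (rule has_sum_mono[OF hs_norm_has_sum hs_norm_has_sum]) (auto simp: wt_nonneg)
qed simp

lemma l2_trunc: "(l2 (crv (trunc N x)))\<^sup>2 = (\<Sum>j\<in>{-int N..int N}. (norm (cf x j))\<^sup>2)"
proof -
 have "((\<lambda>j. (norm (cf (trunc N x) j))\<^sup>2) has_sum (\<Sum>j\<in>{-int N..int N}. (norm (cf x j))\<^sup>2)) UNIV"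
  by (subst has_sum_cong_neutral[where T="{-int N..int N}" and g="\<lambda>j. (norm (cf x j))\<^sup>2"]) (auto intro: has_sum_finite)
 then show ?thesis using l2_crv_has_sum has_sum_unique by blast
qed

lemma l2_crv_split: "l2 (crv x) \<le> l2 (crv (trunc N x)) + norm x / sqrt (2 * pi * real (Suc N))"
proof -
 have "AE t in I01. crv x t = crv (trunc N x) t + crv (x - trunc N x) t"
  using crv_diff[of x "trunc N x"] by eventually_elim simp
 then have "l2 (crv x) = l2 (\<lambda>t. crv (trunc N x) t + crv (x - trunc N x) t)"
  by (intro l2_cong_AE L2_measurable L2_add L2_crv)
 also have "\<dots> \<le> l2 (crv (trunc N x)) + l2 (crv (x - trunc N x))"
  by (intro l2_triangle L2_crv)
 also have "l2 (crv (x - trunc N x)) \<le> norm x / sqrt (2 * pi * real (Suc N))"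
 proof (rule power2_le_imp_le)
  have pos: "2 * pi * real (Suc N) > 0" by simp
  have "2 * pi * real (Suc N) * (l2 (crv (x - trunc N x)))\<^sup>2 \<le> (norm (x - trunc N x))\<^sup>2"
   by (rule tail_estimate) simp
  also have "\<dots> \<le> (norm x)\<^sup>2" by (intro power_mono norm_diff_trunc_le) simp
  finally show "(l2 (crv (x - trunc N x)))\<^sup>2 \<le> (norm x / sqrt (2 * pi * real (Suc N)))\<^sup>2"
   using pos by (simp add: power_divide field_simps)
 qed simp
 finally show ?thesis by simp
qed

text \<open>A subsequence converges in every coefficient. By \<open>tail_estimate\<close> the high
  modes are uniformly small in \<open>l2\<close>, so the convergence of finitely many coefficients
  suffices. In the norm of E the subsequence need not converge.\<close>

theorem hs_compact_L2:
 fixes x :: "nat => 'n::finite hs"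
 assumes "\<And>k. norm (x k) \<le> R"
 obtains r l where "strict_mono (r :: nat => nat)" "\<And>j. (\<lambda>k. cf (x (r k)) j) \<longlonglongrightarrow> cf l j"
  "(\<lambda>k. l2 (crv (x (r k) - l))) \<longlonglongrightarrow> 0" "norm l \<le> R"
proof -
 have R0: "0 \<le> R" using assms[of 0] norm_ge_zero[of "x 0"] by linarith
 obtain r where r: "strict_mono (r :: nat => nat)" "\<And>j. j \<in> UNIV ==> \<exists>l. (\<lambda>k. cf (x (r k)) j) \<longlonglongrightarrow> l"
  by (rule function_convergent_subsequence[of "UNIV :: int set" "\<lambda>k. cf (x k)" R])
   (use assms norm_cf_le order.trans in \<open>blast+\<close>)
 from r(2) obtain c where c: "\<And>j. (\<lambda>k. cf (x (r k)) j) \<longlonglongrightarrow> c j" by (metis UNIV_I)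
 have fin: "(\<Sum>j\<in>A. wt j * (norm (c j))\<^sup>2) \<le> R\<^sup>2" if "finite A" for A
 proof (rule LIMSEQ_le_const2)
  show "(\<lambda>k. \<Sum>j\<in>A. wt j * (norm (cf (x (r k)) j))\<^sup>2) \<longlonglongrightarrow> (\<Sum>j\<in>A. wt j * (norm (c j))\<^sup>2)"
   by (intro tendsto_intros c)
  have "(\<Sum>j\<in>A. wt j * (norm (cf (x (r k)) j))\<^sup>2) \<le> R\<^sup>2" for k
   using hs_norm_finite_sum[OF that, of "x (r k)"] power_mono[OF assms[of "r k"], of 2] by simp
  then show "\<exists>N. \<forall>k\<ge>N. (\<Sum>j\<in>A. wt j * (norm (cf (x (r k)) j))\<^sup>2) \<le> R\<^sup>2" by blast
 qed
 have cE: "c \<in> Eset" unfolding Eset_iff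
  by (rule nonneg_bdd_above_summable_on) (auto intro!: bdd_aboveI[of _ "R\<^sup>2"] fin simp: wt_nonneg)
 define l where "l = Hs c"
 have cl: "cf l = c" using cE by (simp add: l_def)
 have nl: "norm l \<le> R"
 proof (rule power2_le_imp_le[OF _ R0])
  show "(norm l)\<^sup>2 \<le> R\<^sup>2"
   by (rule has_sum_le_finite_sums[OF hs_norm_has_sum]) (use fin cl in auto)
 qed
 have "(\<lambda>k. l2 (crv (x (r k) - l))) \<longlonglongrightarrow> 0"
 proof (rule LIMSEQ_I)
  fix e :: real assume e: "0 < e"
  \<comment> \<open>The differences have norm at most \<open>2 * R\<close>, so the modes beyond
    \<open>N\<close> contribute less than \<open>e / 2\<close>.\<close>
  obtain N :: nat where N: "2 * R / sqrt (2 * pi * real (Suc N)) < e / 2"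
  proof -
   have "(\<lambda>N. 2 * R / sqrt (2 * pi * real (Suc N))) \<longlonglongrightarrow> 0"
    by real_asymp
   then have "\<forall>\<^sub>F N in sequentially. 2 * R / sqrt (2 * pi * real (Suc N)) < e / 2"
    using e by (intro order_tendstoD) auto
   then show ?thesis using that eventually_happens by force
  qed
  have "(\<lambda>k. (l2 (crv (trunc N (x (r k) - l))))\<^sup>2) \<longlonglongrightarrow> (\<Sum>j\<in>{-int N..int N}. (norm (cf l j - cf l j))\<^sup>2)"
   unfolding l2_trunc cf_diff cl by (intro tendsto_intros c)
  then have lim0: "(\<lambda>k. (l2 (crv (trunc N (x (r k) - l))))\<^sup>2) \<longlonglongrightarrow> 0" by simp
  have "\<forall>\<^sub>F k in sequentially. (l2 (crv (trunc N (x (r k) - l))))\<^sup>2 < (e/2)\<^sup>2"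
   using order_tendstoD(2)[OF lim0, of "(e/2)\<^sup>2"] e by simp
  then obtain k0 where k0: "\<And>k. k \<ge> k0 ==> (l2 (crv (trunc N (x (r k) - l))))\<^sup>2 < (e/2)\<^sup>2"
   by (auto simp: eventually_sequentially)
  show "\<exists>no. \<forall>n\<ge>no. norm (l2 (crv (x (r n) - l)) - 0) < e"
  proof (intro exI[of _ k0] allI impI)
   fix k assume k: "k0 \<le> k"
   have 1: "l2 (crv (trunc N (x (r k) - l))) < e / 2"
    using power2_less_imp_less[OF k0[OF k]] e by simp
   have "norm (x (r k) - l) \<le> 2 * R"
    using norm_triangle_ineq4[of "x (r k)" l] assms[of "r k"] nl by linarith
   then have "norm (x (r k) - l) / sqrt (2 * pi * real (Suc N)) \<le> 2 * R / sqrt (2 * pi * real (Suc N))"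
    by (intro divide_right_mono) auto
   then have "l2 (crv (x (r k) - l)) < e"
    using l2_crv_split[of "x (r k) - l" N] 1 N by linarith
   then show "norm (l2 (crv (x (r k) - l)) - 0) < e"
    using l2_nonneg[of "crv (x (r k) - l)"] by simp
  qed
 qed
 then show ?thesis using that r(1) c cl nl by metis
qed

section \<open>Regularity of weak periodic solutions\<close>

lemma tau0_tau0 [simp]: "tau0 (tau0 z) = z" by (simp add: tau0_def)
lemma linear_tau0: "linear tau0" by (rule linearI) (auto simp: tau0_def)
lemma bounded_linear_tau0: "bounded_linear tau0"
 using linear_tau0 by (rule linear_conv_bounded_linear[THEN iffD1])
lemmas tau0_add = linear_add[OF linear_tau0] and tau0_scaleR = linear_cmul[OF linear_tau0]
 and tau0_sum = linear_sum[OF linear_tau0]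
lemma tau0_J0: "tau0 (J0 z) = - J0 (tau0 z)" by (simp add: tau0_def J0_def)
lemma inner_tau0 [simp]: "tau0 z \<bullet> tau0 w = z \<bullet> w" by (simp add: tau0_def inner_prod_def)
lemma norm_tau0 [simp]: "norm (tau0 z) = norm z" by (simp add: norm_eq_sqrt_inner)
lemma tau0_rot: "tau0 (rot a z) = rot (- a) (tau0 z)"
 by (simp add: rot_eq tau0_add tau0_scaleR tau0_J0)
lemma snd_tau0 [simp]: "snd (tau0 z) = - snd z" by (simp add: tau0_def)
lemma tau0_fixed_iff: "tau0 z = z \<longleftrightarrow> snd z = 0"
 by (simp add: tau0_def prod_eq_iff vec_eq_iff)

lemma rot_2pi_int: "rot (frq j) z = z"
 using sin_int_2pin[of j] cos_int_2pin[of j] by (simp add: rot_eq)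

lemma rot_2pi_int_minus: "rot (frq j * (1 - t)) z = rot (- (frq j * t)) z"
proof -
 have "rot (frq j * (1 - t)) z = rot (- (frq j * t)) (rot (frq j) z)"
  by (simp add: rot_rot algebra_simps)
 then show ?thesis by (simp add: rot_2pi_int)
qed

lemma integral_I01_reflect:
 fixes f :: "real => 'a::euclidean_space"
 assumes "continuous_on {0..1} f"
 shows "(LINT t|I01. f (1 - t)) = (LINT t|I01. f t)"
proof -
 have c: "continuous_on {0..1} (\<lambda>t. f (1 - t))"
  by (rule continuous_on_compose2[OF assms]) (auto intro!: continuous_intros)
 have "(f has_integral integral {0..1} f) {0..1}"
  using assms integrable_continuous_real by blast
 then have "((\<lambda>t. f ((-1) *\<^sub>R t + 1)) has_integral ((1 / \<bar>-1\<bar> ^ DIM(real)) *\<^sub>R integral {0..1} f))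
   ((\<lambda>x. (1 / -1) *\<^sub>R x + - ((1 / -1) *\<^sub>R 1)) ` cbox 0 1)"
  by (intro has_integral_affinity) auto
 moreover have "((\<lambda>x::real. (1 / -1) *\<^sub>R x + - ((1 / -1) *\<^sub>R 1)) ` cbox 0 1) = {0..1}"
 proof -
  have "x \<in> (\<lambda>x. 1 - x) ` {0..1}" if "x \<in> {0..1}" for x :: real
   using that by (intro image_eqI[of _ _ "1 - x"]) auto
  then show ?thesis by (auto simp: cbox_interval)
 qed
 ultimately have "((\<lambda>t. f (1 - t)) has_integral integral {0..1} f) {0..1}"
  by simp
 then have "integral {0..1} (\<lambda>t. f (1 - t)) = integral {0..1} f" by (rule integral_unique)
 then show ?thesis
  using integral_I01_eq[OF L2_integrable[OF L2_continuous[OF c]]]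
   integral_I01_eq[OF L2_integrable[OF L2_continuous[OF assms]]] by simp
qed

lemma continuous_AE_eq:
 fixes f g :: "real => 'a::euclidean_space"
 assumes "continuous_on {0..1} f" "continuous_on {0..1} g" "AE t in I01. f t = g t" "t \<in> {0..1}"
 shows "f t = g t"
proof -
 have c: "continuous_on {0..1} (\<lambda>t. (norm (f t - g t))\<^sup>2)"
  using assms by (intro continuous_intros)
 have "(LINT t|I01. (norm (f t - g t))\<^sup>2) = (LINT t|I01. 0)"
  by (rule integral_cong_AE) (use assms continuous_I01_measurable[OF c] in auto)
 then have "integral {0..1} (\<lambda>t. (norm (f t - g t))\<^sup>2) = 0"
  using integral_I01_eq[OF L2_integrable[OF L2_continuous[OF c]]] by simp
 then have "\<forall>t\<in>{0..1}. (norm (f t - g t))\<^sup>2 = 0"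
  by (subst (asm) integral_eq_0_iff) (use c in auto)
 then show ?thesis using assms(4) by auto
qed

lemma has_vector_derivative_rot:
 assumes "(f has_vector_derivative f') (at t within S)"
 shows "((\<lambda>t. rot (c * t) (f t)) has_vector_derivative (c *\<^sub>R J0 (rot (c * t) (f t)) + rot (c * t) f')) (at t within S)"
proof -
 have J: "((\<lambda>t. J0 (f t)) has_vector_derivative J0 f') (at t within S)"
  by (rule bounded_linear.has_vector_derivative[OF bounded_linear_J0 assms])
 have c: "((\<lambda>t. cos (c * t)) has_vector_derivative - (sin (c * t) * c)) (at t within S)"
  "((\<lambda>t. sin (c * t)) has_vector_derivative cos (c * t) * c) (at t within S)"
  unfolding has_real_derivative_iff_has_vector_derivative[symmetric]
  by (auto intro!: derivative_eq_intros)
 have "((\<lambda>t. cos (c * t) *\<^sub>R f t + sin (c * t) *\<^sub>R J0 (f t)) has_vector_derivative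
   (cos (c * t) *\<^sub>R f' + (- (sin (c * t) * c)) *\<^sub>R f t) + (sin (c * t) *\<^sub>R J0 f' + (cos (c * t) * c) *\<^sub>R J0 (f t))) (at t within S)"
  by (intro has_vector_derivative_add has_vector_derivative_scaleR)
   (use assms J c in \<open>auto simp: has_real_derivative_iff_has_vector_derivative\<close>)
 then show ?thesis
  by (simp add: rot_eq J0_add J0_scaleR algebra_simps)
qed

lemma fcoeff_derivative:
 fixes z :: "real => 'n::finite st"
 assumes "\<And>t. t \<in> {0..1} ==> (z has_vector_derivative D t) (at t within {0..1})"
  and D: "continuous_on {0..1} D" and per: "z 1 = z 0"
 shows "fcoeff j D = (frq j) *\<^sub>R J0 (fcoeff j z)"
proof -
 let ?c = "- 2 * pi * real_of_int j"
 have z: "continuous_on {0..1} z"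
  using assms(1) by (intro continuous_on_vector_derivative) auto
 have cont: "continuous_on {0..1} (\<lambda>t. rot (?c * t) (f t))" if "continuous_on {0..1} f" for f :: "real => 'n st"
  using that by (intro continuous_intros)
 have int: "integrable I01 (\<lambda>t. rot (?c * t) (f t))" if "continuous_on {0..1} f" for f :: "real => 'n st"
  by (intro L2_integrable L2_continuous cont that)
 have J: "integrable I01 (\<lambda>t. J0 (rot (?c * t) (z t)))"
  by (rule integrable_bounded_linear[OF bounded_linear_J0 int[OF z]])
 have "(LINT t|I01. ?c *\<^sub>R J0 (rot (?c * t) (z t)) + rot (?c * t) (D t)) = rot (?c * 1) (z 1) - rot (?c * 0) (z 0)"
 proof (rule integral_FTC_I01)
  show "((\<lambda>t. rot (?c * t) (z t)) has_vector_derivative ?c *\<^sub>R J0 (rot (?c * t) (z t)) + rot (?c * t) (D t)) (at t within {0..1})"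
   if "t \<in> {0..1}" for t by (rule has_vector_derivative_rot[OF assms(1)[OF that]])
  show "continuous_on {0..1} (\<lambda>t. ?c *\<^sub>R J0 (rot (?c * t) (z t)) + rot (?c * t) (D t))"
   by (intro continuous_intros cont z D bounded_linear.continuous_on[OF bounded_linear_J0])
 qed
 also have "\<dots> = 0" using per rot_2pi_int[of "-j"] by simp
 also have "(LINT t|I01. ?c *\<^sub>R J0 (rot (?c * t) (z t)) + rot (?c * t) (D t)) =
   ?c *\<^sub>R J0 (fcoeff j z) + fcoeff j D"
 proof -
  have "(LINT t|I01. J0 (rot (?c * t) (z t))) = J0 (fcoeff j z)"
   unfolding fcoeff_def by (rule integral_bounded_linear[OF bounded_linear_J0 int[OF z]])
  moreover have "(LINT t|I01. ?c *\<^sub>R J0 (rot (?c * t) (z t)) + rot (?c * t) (D t)) =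
   ?c *\<^sub>R (LINT t|I01. J0 (rot (?c * t) (z t))) + (LINT t|I01. rot (?c * t) (D t))"
   using J int[OF D] by (subst Bochner_Integration.integral_add) auto
  ultimately show ?thesis by (simp add: fcoeff_def)
 qed
 finally show ?thesis by (simp add: algebra_simps add_eq_0_iff)
qed

text \<open>Reflecting the time variable conjugates the integrand by \<open>tau0\<close>, so the
  coefficient is fixed by \<open>tau0\<close>. This is why the coefficients in E are restricted to
  \<open>L0\<close>.\<close>

lemma fcoeff_symmetric:
 fixes z :: "real => 'n::finite st"
 assumes z: "continuous_on {0..1} z" and sym: "\<And>t. t \<in> {0..1} ==> z (1 - t) = tau0 (z t)"
 shows "snd (fcoeff j z) = 0"
proof -
 let ?c = "- 2 * pi * real_of_int j"
 have c: "continuous_on {0..1} (\<lambda>t. rot (?c * t) (z t))" by (intro continuous_intros z)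
 have "fcoeff j z = (LINT t|I01. rot (?c * (1 - t)) (z (1 - t)))"
  unfolding fcoeff_def by (rule integral_I01_reflect[OF c, symmetric])
 also have "\<dots> = (LINT t|I01. tau0 (rot (?c * t) (z t)))"
  by (rule Bochner_Integration.integral_cong) (use sym rot_2pi_int_minus[of "-j"] in \<open>simp_all add: tau0_rot space_restrict_space\<close>)
 also have "\<dots> = tau0 (fcoeff j z)"
  unfolding fcoeff_def
  by (rule integral_bounded_linear[OF bounded_linear_tau0]) (intro L2_integrable L2_continuous c)
 finally show ?thesis by (metis tau0_fixed_iff)
qed

text \<open>The period is fixed to 1; other periods and actions enter as a factor in front of
  \<open>V\<close>.\<close>

definition ham_loop :: "('n::finite st => 'n st) => (real => 'n st) => bool" where
 "ham_loop V z \<longleftrightarrow> (\<forall>t. (z has_vector_derivative J0 (V (z t))) (at t)) \<and>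
   (\<forall>t. z (t + 1) = z t) \<and> (\<forall>t. z (- t) = tau0 (z t))"

lemma ham_loop_continuous: "ham_loop V z ==> continuous_on S z"
 unfolding ham_loop_def
 by (meson continuous_at_imp_continuous_on has_vector_derivative_continuous)

lemma ham_loop_reflect: "ham_loop V z ==> z (1 - t) = tau0 (z t)"
 unfolding ham_loop_def by (metis add.commute uminus_add_conv_diff diff_conv_add_uminus)

lemma AE_continuous_measurable_comp:
 fixes V :: "'n::finite st => 'n st"
 assumes "continuous_on UNIV V" "f \<in> borel_measurable I01"
 shows "(\<lambda>t. V (f t)) \<in> borel_measurable I01"
 using measurable_compose[OF assms(2) borel_measurable_continuous_onI[OF assms(1)]] .

lemma ham_loop_element:
 fixes V :: "'n::finite st => 'n st"
 assumes "ham_loop V z" "continuous_on UNIV V"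
 obtains x where "AE t in I01. crv x t = z t"
  "\<And>j. fcoeff j (\<lambda>t. V (crv x t)) = (frq j) *\<^sub>R (cf x j, 0)"
proof -
 have z: "continuous_on {0..1} z" using ham_loop_continuous assms by blast
 have Vz: "continuous_on {0..1} (\<lambda>t. V (z t))"
  by (rule continuous_on_compose2[OF assms(2) z]) auto
 have D: "continuous_on {0..1} (\<lambda>t. J0 (V (z t)))"
  by (intro bounded_linear.continuous_on[OF bounded_linear_J0] Vz)
 have der: "(z has_vector_derivative J0 (V (z t))) (at t within {0..1})" for t
  using assms(1) unfolding ham_loop_def by (blast intro: has_vector_derivative_at_within)
 have per: "z 1 = z 0" using assms(1) unfolding ham_loop_def by (metis add_0)
 have fd: "fcoeff j (\<lambda>t. J0 (V (z t))) = (frq j) *\<^sub>R J0 (fcoeff j z)" for j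
  by (rule fcoeff_derivative[OF der D per])
 have snd0: "snd (fcoeff j z) = 0" for j
  by (rule fcoeff_symmetric[OF z]) (rule ham_loop_reflect[OF assms(1)])
 define c where "c j = fst (fcoeff j z)" for j
 have c: "fcoeff j z = (c j, 0)" for j using snd0[of j] by (simp add: c_def prod_eq_iff)
 \<comment> \<open>The coefficients of the continuous derivative are square summable and carry a
   factor \<open>frq j\<close>, whose square dominates \<open>\<bar>j\<bar>\<close>.\<close>
 have "c \<in> Eset" unfolding Eset_def mem_Collect_eq
 proof (rule summable_on_comparison_test[OF fcoeff_summable[OF L2_continuous[OF D]]])
  fix j
  have "real_of_int \<bar>j\<bar> \<le> (real_of_int j)\<^sup>2"
  proof -
   have "\<bar>j\<bar> * 1 \<le> \<bar>j\<bar> * \<bar>j\<bar>" if "j \<noteq> 0" using that by (intro mult_left_mono) auto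
   then have "\<bar>j\<bar> \<le> \<bar>j\<bar> * \<bar>j\<bar>" by (cases "j = 0") auto
   then have "real_of_int \<bar>j\<bar> \<le> real_of_int (\<bar>j\<bar> * \<bar>j\<bar>)" by linarith
   then show ?thesis by (simp add: power2_eq_square)
  qed
  also have "\<dots> \<le> (frq j)\<^sup>2"
  proof -
   have "1 \<le> (2 * pi)\<^sup>2"
    using pi_gt3 by (intro one_le_power) simp
   then have "1 * (real_of_int j)\<^sup>2 \<le> (2 * pi)\<^sup>2 * (real_of_int j)\<^sup>2"
    by (rule mult_right_mono) simp
   then show ?thesis by (simp add: power_mult_distrib)
  qed
  finally have "real_of_int \<bar>j\<bar> * (norm (c j))\<^sup>2 \<le> (frq j)\<^sup>2 * (norm (c j))\<^sup>2"
   by (intro mult_right_mono) auto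
  also have "\<dots> = (norm (fcoeff j (\<lambda>t. J0 (V (z t)))))\<^sup>2"
   unfolding fd c by (simp add: power_mult_distrib power2_eq_square)
  finally show "real_of_int \<bar>j\<bar> * (norm (c j))\<^sup>2 \<le> (norm (fcoeff j (\<lambda>t. J0 (V (z t)))))\<^sup>2" .
 qed simp
 then have cf: "cf (Hs c) = c" by simp
 have AE: "AE t in I01. crv (Hs c) t = z t"
  by (rule crv_eqI[OF L2_continuous[OF z]]) (simp add: c cf)
 have "fcoeff j (\<lambda>t. V (crv (Hs c) t)) = (frq j) *\<^sub>R (cf (Hs c) j, 0)" for j
 proof -
  have "fcoeff j (\<lambda>t. V (crv (Hs c) t)) = fcoeff j (\<lambda>t. V (z t))"
   by (rule fcoeff_cong_AE[OF AE_continuous_measurable_comp[OF assms(2) crv_measurable] continuous_I01_measurable[OF Vz]])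
    (use AE in eventually_elim, simp)
  moreover have "J0 (fcoeff j (\<lambda>t. V (z t))) = J0 ((frq j) *\<^sub>R (c j, 0))"
   by (simp only: fcoeff_J0[OF L2_continuous[OF Vz], symmetric] fd c J0_scaleR)
  then have "J0 (J0 (fcoeff j (\<lambda>t. V (z t)))) = J0 (J0 ((frq j) *\<^sub>R (c j, 0)))" by simp
  ultimately show ?thesis unfolding J0_J0 cf by (metis neg_equal_iff_equal)
 qed
 then show ?thesis using that AE by blast
qed

text \<open>\<open>V\<close> stands for the gradient of a Hamiltonian. The Lipschitz bound makes
  composition with \<open>V\<close> a Lipschitz map of square-integrable functions; the symmetry
  keeps the Fourier coefficients of composed loops in \<open>L0\<close>.\<close>

locale lipschitz_field =
 fixes V :: "'n::finite st => 'n st" and L :: real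
 assumes L_nonneg: "0 \<le> L"
  and V_lipschitz: "\<And>z w. norm (V z - V w) \<le> L * norm (z - w)"
  and V_tau0: "\<And>z. V (tau0 z) = tau0 (V z)"
begin

lemma V_continuous: "continuous_on S V"
proof -
 have "L-lipschitz_on S V"
  by (rule lipschitz_onI) (use V_lipschitz L_nonneg in \<open>auto simp: dist_norm\<close>)
 then show ?thesis by (rule lipschitz_on_continuous_on)
qed

lemma V_measurable: "f \<in> borel_measurable I01 ==> (\<lambda>t. V (f t)) \<in> borel_measurable I01"
 by (rule AE_continuous_measurable_comp[OF V_continuous])

lemma L2_V: assumes "L2 f" shows "L2 (\<lambda>t. V (f t))"
proof -
 have "L2 (\<lambda>t. V (f t) - V 0)"
  by (rule L2_bound[OF assms, of _ L])
   (use V_lipschitz[of _ 0] V_measurable[OF L2_measurable[OF assms]] in auto)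
 then have "L2 (\<lambda>t. (V (f t) - V 0) + V 0)" by (intro L2_add L2_const)
 then show ?thesis by simp
qed

lemma l2_V_diff:
 assumes "L2 f" "L2 g" shows "l2 (\<lambda>t. V (f t) - V (g t)) \<le> L * l2 (\<lambda>t. f t - g t)"
 by (rule l2_mono) (use assms V_lipschitz L_nonneg in \<open>auto intro!: L2_diff L2_V\<close>)

text \<open>The symmetry of \<open>crv x\<close> is known only through its coefficients, not
  pointwise. The truncated Fourier sums are continuous and pointwise symmetric, and they approximate
  \<open>crv x\<close> in \<open>l2\<close>, so the claim passes to the limit by the Lipschitz
  bound.\<close>

lemma snd_fcoeff_V_crv: "snd (fcoeff j (\<lambda>t. V (crv x t))) = 0"
proof -
 define S where "S N = fsum {-int N..int N} (\<lambda>j. (cf x j, 0 :: real^'n))" for N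
 have Sc: "continuous_on {0..1} (S N)" for N
  unfolding S_def fsum_def[abs_def] fmode_def by (intro continuous_intros)
 have Ssym: "S N (1 - t) = tau0 (S N t)" for N t
  unfolding S_def fsum_def fmode_def tau0_sum rot_2pi_int_minus tau0_rot by (simp add: tau0_def)
 have VSc: "continuous_on {0..1} (\<lambda>t. V (S N t))" for N
  by (rule continuous_on_compose2[OF V_continuous Sc]) auto
 have snd0: "snd (fcoeff j (\<lambda>t. V (S N t))) = 0" for N
  by (rule fcoeff_symmetric[OF VSc]) (simp add: Ssym V_tau0)
 have SAE: "AE t in I01. crv (trunc N x) t = S N t" for N
  by (rule crv_eqI) (auto simp: S_def L2_fsum fcoeff_fsum zero_prod_def)
 have bound: "norm (fcoeff j (\<lambda>t. V (crv x t)) - fcoeff j (\<lambda>t. V (S N t))) \<le> L * (norm x / sqrt (2 * pi * real (Suc N)))" for N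
 proof -
  have LS: "L2 (S N)" by (rule L2_continuous[OF Sc])
  have "norm (fcoeff j (\<lambda>t. V (crv x t)) - fcoeff j (\<lambda>t. V (S N t))) = norm (fcoeff j (\<lambda>t. V (crv x t) - V (S N t)))"
   by (simp add: fcoeff_diff L2_V L2_crv LS)
  also have "\<dots> \<le> l2 (\<lambda>t. V (crv x t) - V (S N t))"
   by (intro norm_fcoeff_le L2_diff L2_V L2_crv LS)
  also have "\<dots> \<le> L * l2 (\<lambda>t. crv x t - S N t)" by (intro l2_V_diff L2_crv LS)
  also have "l2 (\<lambda>t. crv x t - S N t) = l2 (crv (x - trunc N x))"
   by (intro l2_cong_AE L2_measurable L2_diff L2_crv LS)
    (use crv_diff[of x "trunc N x"] SAE[of N] in eventually_elim, simp)
  also have "\<dots> \<le> norm x / sqrt (2 * pi * real (Suc N))"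
  proof -
   have "trunc N (x - trunc N x) = 0" by (rule hs_eqI) simp
   moreover have "l2 (crv (0 :: 'n hs)) = 0"
    using l2_crv_le[of "0 :: 'n hs"] l2_nonneg[of "crv (0 :: 'n hs)"] by simp
   ultimately have "l2 (crv (x - trunc N x)) \<le> norm (x - trunc N x) / sqrt (2 * pi * real (Suc N))"
    using l2_crv_split[of "x - trunc N x" N] by simp
   also have "\<dots> \<le> norm x / sqrt (2 * pi * real (Suc N))"
    by (intro divide_right_mono norm_diff_trunc_le) simp
   finally show ?thesis .
  qed
  finally show ?thesis using L_nonneg by (simp add: mult_left_mono)
 qed
 have "norm (snd (fcoeff j (\<lambda>t. V (crv x t)))) \<le> L * (norm x / sqrt (2 * pi * real (Suc N)))" for N
 proof -
  have "norm (snd (fcoeff j (\<lambda>t. V (crv x t)))) = norm (snd (fcoeff j (\<lambda>t. V (crv x t)) - fcoeff j (\<lambda>t. V (S N t))))"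
   using snd0 by simp
  also have "\<dots> \<le> norm (fcoeff j (\<lambda>t. V (crv x t)) - fcoeff j (\<lambda>t. V (S N t)))"
   by (metis norm_snd_le prod.collapse)
  finally show ?thesis using bound[of N] by linarith
 qed
 moreover have "(\<lambda>N. L * (norm x / sqrt (2 * pi * real (Suc N)))) \<longlonglongrightarrow> 0"
  by real_asymp
 ultimately have "norm (snd (fcoeff j (\<lambda>t. V (crv x t)))) \<le> 0"
  by (intro LIMSEQ_le_const[where X="\<lambda>N. L * (norm x / sqrt (2 * pi * real (Suc N)))"]) auto
 then show ?thesis by simp
qed

text \<open>The hypothesis says that \<open>u\<close>, that is \<open>J0 (V (crv x t))\<close>, has
  the coefficients which a derivative of \<open>crv x\<close> would have. Integrating
  \<open>u\<close> gives a continuous function that agrees with \<open>crv x\<close> up to a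
  constant; inserting it into \<open>V\<close> makes the derivative continuous as well.\<close>

theorem weak_solution_regular:
 assumes crit: "\<And>j. fst (fcoeff j (\<lambda>t. V (crv x t))) = (frq j) *\<^sub>R cf x j"
 obtains z where "ham_loop V z" "AE t in I01. crv x t = z t"
proof -
 define y where "y t = V (crv x t)" for t
 have Ly: "L2 y" unfolding y_def[abs_def] by (intro L2_V L2_crv)
 have fy: "fcoeff j y = (frq j) *\<^sub>R (cf x j, 0)" for j
  using crit[of j] snd_fcoeff_V_crv[of j x] unfolding y_def[abs_def] by (simp add: prod_eq_iff)
 define u where "u t = J0 (y t)" for t
 have Lu: "L2 u" unfolding u_def[abs_def]
 proof (rule L2_bound[OF Ly, of _ 1])
  show "(\<lambda>t. J0 (y t)) \<in> borel_measurable I01"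
   by (rule AE_continuous_measurable_comp[OF linear_continuous_on[OF bounded_linear_J0] L2_measurable[OF Ly]])
 qed simp
 have fu: "fcoeff j u = (frq j) *\<^sub>R J0 (cf x j, 0)" for j
  unfolding u_def[abs_def] fcoeff_J0[OF Ly] fy by (simp only: J0_scaleR)
 have ui: "u absolutely_integrable_on {0..1}"
  using L2_integrable[OF Lu] by (simp add: absolutely_integrable_on_def set_integrable_def integrable_restrict_space)
 then have uint: "u integrable_on {0..1}" by (simp add: absolutely_integrable_on_def)
 define w where "w t = integral {0..t} u" for t
 have wc: "continuous_on {0..1} w"
  unfolding w_def[abs_def] by (rule indefinite_integral_continuous_1[OF uint])
 define A where "A N = {-int N..int N}" for N :: nat
 define SN where "SN N = fsum (A N) (\<lambda>j. (cf x j, 0 :: real^'n))" for N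
 define un where "un N = fsum (A N) (\<lambda>j. fcoeff j u)" for N
 have SNd: "(SN N has_vector_derivative un N t) (at t within T)" for N t T
  unfolding SN_def un_def fsum_def[abs_def] fu fmode_def
 proof (rule has_vector_derivative_sum)
  fix j
  have "((\<lambda>t. rot (frq j * t) (cf x j, 0 :: real^'n)) has_vector_derivative
   ((frq j) *\<^sub>R J0 (rot (frq j * t) (cf x j, 0)) + rot (frq j * t) 0)) (at t within T)"
   by (rule has_vector_derivative_rot) simp
  then show "((\<lambda>t. rot (frq j * t) (cf x j, 0 :: real^'n)) has_vector_derivative
   rot (frq j * t) ((frq j) *\<^sub>R J0 (cf x j, 0))) (at t within T)"
   by (simp add: rot_scaleR rot_J0)
 qed
 have unc: "continuous_on T (un N)" for N T
  unfolding un_def fsum_def[abs_def] fmode_def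
  by (intro continuous_on_sum linear_continuous_on_compose[OF _ linear_rot] continuous_intros)
 have Lun: "L2 (un N)" for N unfolding un_def by (rule L2_fsum)
 \<comment> \<open>\<open>SN N\<close> is a primitive of the Bessel partial sum \<open>un N\<close>,
   so the \<open>l2\<close> tail of \<open>u\<close> controls the distance from \<open>w\<close> to
   the shifted Fourier sums uniformly in \<open>t\<close>.\<close>
 have wn: "norm (w t - (SN N t - SN N 0)) \<le> l2 (\<lambda>t. u t - un N t)" if t: "t \<in> {0..1}" for N t
 proof -
  have un_int: "(un N has_integral (SN N t - SN N 0)) {0..t}"
   by (rule fundamental_theorem_of_calculus) (use t SNd in auto)
  have u_int: "(u has_integral w t) {0..t}"
   unfolding w_def by (rule integrable_integral, rule integrable_on_subinterval[OF uint]) (use t in auto)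
  have d: "((\<lambda>s. u s - un N s) has_integral (w t - (SN N t - SN N 0))) {0..t}"
   by (rule has_integral_diff[OF u_int un_int])
  have Ld: "L2 (\<lambda>s. u s - un N s)" by (intro L2_diff Lu Lun)
  have absd: "(\<lambda>s. u s - un N s) absolutely_integrable_on {0..1}"
   using L2_integrable[OF Ld] by (simp add: absolutely_integrable_on_def set_integrable_def integrable_restrict_space)
  have nint: "(\<lambda>s. norm (u s - un N s)) integrable_on {0..1}"
   using absd by (simp add: absolutely_integrable_on_def)
  have nint': "(\<lambda>s. norm (u s - un N s)) integrable_on {0..t}"
   by (rule integrable_on_subinterval[OF nint]) (use t in auto)
  have "norm (w t - (SN N t - SN N 0)) \<le> integral {0..t} (\<lambda>s. norm (u s - un N s))"
   unfolding integral_unique[OF d, symmetric]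
   by (rule integral_norm_bound_integral[OF _ nint']) (use d in auto)
  also have "\<dots> \<le> integral {0..1} (\<lambda>s. norm (u s - un N s))"
   by (rule integral_subset_le[OF _ nint' nint]) (use t in auto)
  also have "\<dots> = (LINT s|I01. norm (u s - un N s))"
   using integral_I01_eq[of "\<lambda>s. norm (u s - un N s)"] L2_integrable[OF Ld] by simp
  also have "\<dots> \<le> l2 (\<lambda>t. u t - un N t)" by (rule integral_norm_le_l2[OF Ld])
  finally show ?thesis .
 qed
 have unlim: "(\<lambda>N. l2 (\<lambda>t. u t - un N t)) \<longlonglongrightarrow> 0"
 proof -
  have "(\<lambda>N. \<Sum>j\<in>A N. (norm (fcoeff j u))\<^sup>2) \<longlonglongrightarrow> (l2 u)\<^sup>2"
  proof -
   have "filterlim A (finite_subsets_at_top UNIV) sequentially"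
    unfolding A_def by (rule symmetric_intervals_exhaust)
   then show ?thesis
    using Parseval[OF Lu] unfolding has_sum_def by (rule filterlim_compose[rotated])
  qed
  then have "(\<lambda>N. (l2 u)\<^sup>2 - (\<Sum>j\<in>A N. (norm (fcoeff j u))\<^sup>2)) \<longlonglongrightarrow> (l2 u)\<^sup>2 - (l2 u)\<^sup>2"
   by (intro tendsto_intros)
  then have "(\<lambda>N. (l2 (\<lambda>t. u t - un N t))\<^sup>2) \<longlonglongrightarrow> 0"
   using Bessel_identity[OF Lu] by (simp add: un_def A_def)
  then have "(\<lambda>N. sqrt ((l2 (\<lambda>t. u t - un N t))\<^sup>2)) \<longlonglongrightarrow> sqrt 0" by (rule tendsto_real_sqrt)
  then show ?thesis by (simp add: l2_nonneg)
 qed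
 have Lw: "L2 w" by (rule L2_continuous[OF wc])
 have fw: "fcoeff j w = (cf x j, 0)" if "j \<noteq> 0" for j
 proof -
  have "norm (fcoeff j w - (cf x j, 0)) \<le> l2 (\<lambda>t. u t - un N t)" if N: "N \<ge> nat \<bar>j\<bar>" for N
  proof -
   have L1: "L2 (SN N)" unfolding SN_def by (rule L2_fsum)
   have L2': "L2 (\<lambda>t. SN N t - SN N 0)" by (intro L2_diff L1 L2_const)
   have "fcoeff j (\<lambda>t. SN N 0) = 0"
   proof -
    have "fcoeff j (fmode 0 (SN N 0)) = 0" using \<open>j \<noteq> 0\<close> by (simp add: fcoeff_fmode)
    moreover have "fmode 0 (SN N 0) = (\<lambda>t. SN N 0)" by (auto simp: fmode_def)
    ultimately show ?thesis by simp
   qed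
   moreover have "j \<in> A N" using N by (auto simp: A_def)
   ultimately have "fcoeff j (\<lambda>t. SN N t - SN N 0) = (cf x j, 0)"
    unfolding fcoeff_diff[OF L1 L2_const] by (simp add: SN_def fcoeff_fsum A_def)
   then have "fcoeff j w - (cf x j, 0) = fcoeff j (\<lambda>t. w t - (SN N t - SN N 0))"
    by (simp add: fcoeff_diff[OF Lw L2'])
   also have "norm \<dots> \<le> (LINT t|I01. norm (rot (- 2 * pi * real_of_int j * t) (w t - (SN N t - SN N 0))))"
    unfolding fcoeff_def by (rule integral_norm_bound)
   also have "\<dots> \<le> (LINT t|I01. l2 (\<lambda>t. u t - un N t))"
   proof (rule integral_mono)
    show "integrable I01 (\<lambda>t. norm (rot (- 2 * pi * real_of_int j * t) (w t - (SN N t - SN N 0))))"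
     using L2_integrable[OF L2_diff[OF Lw L2']] by simp
   qed (use wn in auto)
   finally show ?thesis by simp
  qed
  then have "norm (fcoeff j w - (cf x j, 0)) \<le> 0"
   by (intro LIMSEQ_le_const[OF unlim]) blast
  then show ?thesis by simp
 qed
 \<comment> \<open>The primitive starts at 0, so its mean must be corrected to that of
   \<open>crv x\<close>.\<close>
 define z where "z t = w t + ((cf x 0, 0) - fcoeff 0 w)" for t
 have zc: "continuous_on {0..1} z" unfolding z_def[abs_def] by (intro continuous_intros wc)
 have zx: "AE t in I01. crv x t = z t"
 proof (rule crv_eqI[OF L2_continuous[OF zc]])
  fix j
  have "fcoeff j (\<lambda>t. c) = (if j = 0 then c else 0)" for c :: "'n st"
  proof -
   have "fmode 0 c = (\<lambda>t. c)" by (auto simp: fmode_def)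
   then show ?thesis using fcoeff_fmode[of j 0 c] by simp
  qed
  then show "fcoeff j z = (cf x j, 0)"
   unfolding z_def[abs_def] fcoeff_add[OF Lw L2_const] using fw by (cases "j = 0") auto
 qed
 have Vzc: "continuous_on {0..1} (\<lambda>t. V (z t))"
  by (rule continuous_on_compose2[OF V_continuous zc]) auto
 have JVzc: "continuous_on {0..1} (\<lambda>t. J0 (V (z t)))"
  by (intro bounded_linear.continuous_on[OF bounded_linear_J0] Vzc)
 have uz: "AE t in I01. u t = J0 (V (z t))"
  using zx by eventually_elim (simp add: u_def y_def)
 have wz: "w t = integral {0..t} (\<lambda>t. J0 (V (z t)))" if t: "t \<in> {0..1}" for t
 proof -
  have "AE t in lebesgue. t \<in> {0..1} \<longrightarrow> u t = J0 (V (z t))"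
   using uz by (subst (asm) AE_restrict_space_iff) auto
  then obtain Nn where N: "Nn \<in> null_sets lebesgue" "\<And>s. s \<in> {0..1} ==> s \<notin> Nn ==> u s = J0 (V (z s))"
   by (rule AE_E3) auto
  then have "negligible Nn" by (simp add: negligible_iff_null_sets)
  then show ?thesis unfolding w_def
   by (rule integral_spike) (use N t in auto)
 qed
 have zd: "(z has_vector_derivative J0 (V (z t))) (at t within {0..1})" if t: "t \<in> {0..1}" for t
 proof -
  have "((\<lambda>t. integral {0..t} (\<lambda>t. J0 (V (z t)))) has_vector_derivative J0 (V (z t))) (at t within {0..1})"
   by (rule integral_has_vector_derivative[OF JVzc t])
  then have "(w has_vector_derivative J0 (V (z t))) (at t within {0..1})"
   by (rule has_vector_derivative_transform[OF t, rotated]) (simp add: wz)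
  then show ?thesis unfolding z_def[abs_def] by (auto intro!: derivative_eq_intros)
 qed
 have z10: "z 1 = z 0"
 proof -
  have "w 1 = (LINT t|I01. u t)" unfolding w_def using integral_I01_eq[OF L2_integrable[OF Lu]] by simp
  also have "\<dots> = fcoeff 0 u" by (simp add: fcoeff_def)
  also have "\<dots> = 0" unfolding fu by simp
  finally show ?thesis by (simp add: z_def w_def)
 qed
 \<comment> \<open>Extending the derivative periodically and integrating it over the whole line
   avoids differentiating a periodic extension at the integers.\<close>
 define Y where "Y t = J0 (V (z (frac t)))" for t
 have Yper: "Y (t + 1) = Y t" for t by (simp add: Y_def frac_1_eq)
 have Y01: "Y t = J0 (V (z t))" if "t \<in> {0..1}" for t
 proof (cases "t = 1")
  case True then show ?thesis using z10 by (simp add: Y_def)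
 next
  case False then have "frac t = t" using that by (simp add: frac_eq)
  then show ?thesis by (simp add: Y_def)
 qed
 have Yc: "isCont Y t" for t
 proof -
  define k where "k = real_of_int \<lfloor>t\<rfloor>"
  have shift: "Y (s + k) = Y s" for s
   unfolding Y_def k_def by (simp add: frac_def)
  have c01: "continuous_on {0..1} Y"
   using JVzc by (rule continuous_on_eq) (simp add: Y01)
  have ck: "continuous_on {m..m+1} Y" if "m \<in> {k-1, k}" for m
  proof -
   have "Y s = Y (s - m)" for s
    using that shift[of "s - k"] Yper[of "s - k"] by (auto simp: algebra_simps)
   moreover have "continuous_on {m..m+1} (\<lambda>s. Y (s - m))"
    by (rule continuous_on_compose2[OF c01]) (auto intro!: continuous_intros)
   ultimately show ?thesis by simp
  qed
  have "continuous_on ({k-1..k} \<union> {k..k+1}) Y"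
   using ck[of "k-1"] ck[of k] by (intro continuous_on_closed_Un) auto
  moreover have "{k-1<..<k+1} \<subseteq> {k-1..k} \<union> {k..k+1}" by auto
  ultimately have "continuous_on {k-1<..<k+1} Y" by (rule continuous_on_subset)
  moreover have "t \<in> {k-1<..<k+1}" unfolding k_def by (auto; linarith)
  ultimately show ?thesis by (simp add: continuous_on_eq_continuous_at)
 qed
 obtain F where F: "\<And>t. (F has_vector_derivative Y t) (at t)"
  using einterval_antiderivative[of "-\<infinity>" "\<infinity>" Y] Yc by auto
 define zz where "zz t = F t + (z 0 - F 0)" for t
 have zzd: "(zz has_vector_derivative Y t) (at t)" for t
  unfolding zz_def[abs_def] using F[of t] by (auto intro!: derivative_eq_intros)
 have zz01: "zz t = z t" if t: "t \<in> {0..1}" for t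
 proof -
  have "(\<lambda>t. zz t - z t) t = (\<lambda>t. zz t - z t) 0"
  proof (rule has_vector_derivative_zero_constant[of "{0..1}" "\<lambda>t. zz t - z t"])
   show "((\<lambda>t. zz t - z t) has_vector_derivative 0) (at s within {0..1})" if "s \<in> {0..1}" for s
    using has_vector_derivative_diff[OF has_vector_derivative_at_within[OF zzd[of s]] zd[OF that]] Y01[OF that] by simp
  qed (use t in auto)
  then show ?thesis by (simp add: zz_def)
 qed
 have zzper: "zz (t + 1) = zz t" for t
 proof -
  have "(\<lambda>t. zz (t + 1) - zz t) t = (\<lambda>t. zz (t + 1) - zz t) 0"
  proof (rule has_vector_derivative_zero_constant[of UNIV "\<lambda>t. zz (t + 1) - zz t"])
   fix s
   have "((\<lambda>t. zz (t + 1)) has_vector_derivative Y (s + 1)) (at s)"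
   proof -
    have "((\<lambda>t::real. t + 1) has_vector_derivative 1) (at s)"
     by (auto intro!: derivative_eq_intros simp: has_real_derivative_iff_has_vector_derivative[symmetric])
    from vector_diff_chain_at[OF this zzd[of "s+1"]] show ?thesis by (simp add: o_def)
   qed
   then show "((\<lambda>t. zz (t + 1) - zz t) has_vector_derivative 0) (at s within UNIV)"
    using has_vector_derivative_diff[OF _ zzd[of s]] Yper[of s] by fastforce
  qed (simp, metis UNIV_I)
  then show ?thesis using zz01[of 1] zz01[of 0] z10 by simp
 qed
 have zzfrac: "zz t = z (frac t)" for t
 proof -
  have per_nat: "zz (s + real n) = zz s" for s n
  proof (induction n)
   case (Suc n)
   then show ?case using zzper[of "s + real n"] by (simp add: ac_simps)
  qed simp
  have "zz (frac t) = zz t"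
  proof (cases "\<lfloor>t\<rfloor> \<ge> 0")
   case True
   then have "t = frac t + real (nat \<lfloor>t\<rfloor>)" by (simp add: frac_def)
   then show ?thesis using per_nat[of "frac t" "nat \<lfloor>t\<rfloor>"] by simp
  next
   case False
   then have "frac t = t + real (nat (- \<lfloor>t\<rfloor>))" by (simp add: frac_def)
   then show ?thesis using per_nat[of t "nat (- \<lfloor>t\<rfloor>)"] by simp
  qed
  moreover have "frac t \<in> {0..1}" using frac_ge_0[of t] frac_lt_1[of t] by simp
  ultimately show ?thesis using zz01 by simp
 qed
 have zzode: "(zz has_vector_derivative J0 (V (zz t))) (at t)" for t
  using zzd[of t] by (simp add: Y_def zzfrac)
 have zzc: "continuous_on T zz" for T
  by (meson zzd continuous_at_imp_continuous_on has_vector_derivative_continuous)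
 have zzx: "AE t in I01. crv x t = zz t"
  using zx AE_space[of I01] by eventually_elim (simp add: zz01)
 have zzsym: "zz (- t) = tau0 (zz t)" for t
 proof -
  \<comment> \<open>The reflected loop has the same coefficients, all of them in \<open>L0\<close>;
    by uniqueness and continuity it equals \<open>zz\<close>.\<close>
  define v where "v t = tau0 (zz (1 - t))" for t
  have vc: "continuous_on {0..1} v" unfolding v_def[abs_def]
   by (intro bounded_linear.continuous_on[OF bounded_linear_tau0] continuous_on_compose2[OF zzc[of UNIV]] continuous_intros) auto
  have fzz: "fcoeff j zz = (cf x j, 0)" for j
   using fcoeff_cong_AE[OF continuous_I01_measurable[OF zzc] crv_measurable[of x], of j] zzx
   by (auto simp: eq_commute)
  have "fcoeff j v = (cf x j, 0)" for j
  proof -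
   let ?c = "- 2 * pi * real_of_int j"
   have c: "continuous_on {0..1} (\<lambda>t. rot (?c * t) (zz t))" by (intro continuous_intros zzc)
   have "fcoeff j v = (LINT t|I01. tau0 ((\<lambda>t. rot (?c * t) (zz t)) (1 - t)))"
    unfolding fcoeff_def v_def
    by (rule Bochner_Integration.integral_cong) (simp_all add: tau0_rot rot_2pi_int_minus)
   also have "\<dots> = tau0 (LINT t|I01. (\<lambda>t. rot (?c * t) (zz t)) (1 - t))"
    by (rule integral_bounded_linear[OF bounded_linear_tau0], intro L2_integrable L2_continuous,
      rule continuous_on_compose2[OF c]) (auto intro!: continuous_intros)
   also have "\<dots> = tau0 (fcoeff j zz)"
    unfolding fcoeff_def by (subst integral_I01_reflect[OF c]) simp
   finally show ?thesis using fzz by (simp add: tau0_def)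
  qed
  then have "AE t in I01. crv x t = v t" by (intro crv_eqI L2_continuous[OF vc])
  with zzx have "AE t in I01. v t = zz t" by eventually_elim simp
  then have vzz: "v s = zz s" if "s \<in> {0..1}" for s
   using continuous_AE_eq[OF vc zzc _ that] by blast
  have "frac t \<in> {0..1}" using frac_ge_0[of t] frac_lt_1[of t] by simp
  from vzz[OF this] have "tau0 (zz (1 - frac t)) = zz t" by (simp add: v_def) (simp add: zzfrac)
  moreover have "zz (1 - frac t) = zz (- t)"
  proof -
   have "1 - frac t = - t + real_of_int (1 + \<lfloor>t\<rfloor>)" by (simp add: frac_def)
   moreover have "frac (- t + real_of_int (1 + \<lfloor>t\<rfloor>)) = frac (- t)"
    unfolding frac_def floor_add_int[symmetric] by simp
   ultimately have "frac (1 - frac t) = frac (- t)" by metis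
   then show ?thesis by (simp add: zzfrac)
  qed
  ultimately show ?thesis by (metis tau0_tau0)
 qed
 have "ham_loop V zz" unfolding ham_loop_def using zzode zzper zzsym by blast
 then show ?thesis using that zzx by blast
qed

end

section \<open>Admissible deformations\<close>

definition gmap :: "('n::finite hs => real => real) => ('n hs => real => real) =>
  ('n hs => real => real) => ('n hs => real => 'n hs) => real => 'n hs => 'n hs" where
 "gmap a b c K u x = a x u *\<^sub>R Pp x + b x u *\<^sub>R Pz x + c x u *\<^sub>R Pm x + K x u"

definition cont2 :: "('n::finite hs => real => 'b::metric_space) => bool" where
 "cont2 f \<longleftrightarrow> continuous_on (UNIV \<times> {0..1}) (\<lambda>p. f (fst p) (snd p))"

definition posbdd :: "('n::finite hs => real => real) => bool" where
 "posbdd f \<longleftrightarrow> (\<forall>R. \<exists>\<alpha> \<beta>. 0 < \<alpha> \<and> (\<forall>x. norm x \<le> R \<longrightarrow> (\<forall>u\<in>{0..1}. \<alpha> \<le> f x u \<and> f x u \<le> \<beta>)))"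

text \<open>Sequential form of mapping bounded sets to relatively compact ones; the homotopy
  parameter varies along with the point.\<close>

definition relcpt :: "('n::finite hs => real => 'b::metric_space) => bool" where
 "relcpt K \<longleftrightarrow> (\<forall>R x u. (\<forall>k::nat. norm (x k) \<le> R \<and> u k \<in> {0..1}) \<longrightarrow>
   (\<exists>r l. strict_mono (r :: nat => nat) \<and> (\<lambda>k. K (x (r k)) (u (r k))) \<longlonglongrightarrow> l))"

text \<open>\<open>Gamma\<close> carried over to the type \<open>hs\<close>. Positivity of the three
  factors is contained in \<open>posbdd\<close>.\<close>

definition Gam :: "('n::finite hs => 'n hs) set" where
 "Gam = {h. \<exists>a b c K. cont2 a \<and> cont2 b \<and> cont2 c \<and> cont2 K \<and> posbdd a \<and> posbdd b \<and> posbdd c \<and> relcpt K \<and>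
   (\<forall>x. \<forall>u\<in>{0..1}. Pp x \<noteq> 0 \<longrightarrow> Pp (gmap a b c K u x) \<noteq> 0) \<and>
   (\<forall>x. gmap a b c K 0 x = x) \<and> (\<forall>x. h x = gmap a b c K 1 x)}"

definition Sp :: "'n::finite hs set" where "Sp = {x. Pp x = x \<and> norm x = 1}"

lemma cont2_iff: "cont2 f \<longleftrightarrow> (\<forall>x. \<forall>u\<in>{0..1}. \<forall>e>0. \<exists>d>0. \<forall>y. \<forall>v\<in>{0..1}.
   norm (y - x) < d \<and> \<bar>v - u\<bar> < d \<longrightarrow> dist (f y v) (f x u) < e)" (is "?L \<longleftrightarrow> ?R")
proof
 assume L: ?L
 show ?R
 proof (intro allI ballI impI)
  fix x :: "'a hs" and u e :: real assume u: "u \<in> {0..1}" and e: "0 < e"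
  from L u e obtain d where d: "d > 0" "\<And>p. p \<in> UNIV \<times> {0..1} ==> dist p (x, u) < d ==> dist (f (fst p) (snd p)) (f x u) < e"
   unfolding cont2_def continuous_on_iff by force
  show "\<exists>d>0. \<forall>y. \<forall>v\<in>{0..1}. norm (y - x) < d \<and> \<bar>v - u\<bar> < d \<longrightarrow> dist (f y v) (f x u) < e"
  proof (intro exI[of _ "d/2"] conjI allI ballI impI)
   fix y v assume v: "v \<in> {0..1}" and yv: "norm (y - x) < d/2 \<and> \<bar>v - u\<bar> < d/2"
   have "dist (y, v) (x, u) \<le> dist y x + dist v u"
    unfolding dist_Pair_Pair by (rule sqrt_sum_squares_le_sum) auto
   also have "\<dots> < d" using yv by (simp add: dist_norm)
   finally show "dist (f y v) (f x u) < e" using d(2)[of "(y, v)"] v by simp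
  qed (use d in simp)
 qed
next
 assume R: ?R
 show ?L unfolding cont2_def continuous_on_iff
 proof (intro ballI allI impI)
  fix p :: "'a hs \<times> real" and e :: real assume p: "p \<in> UNIV \<times> {0..1}" and e: "0 < e"
  from R p e obtain d where d: "d > 0" "\<And>y v. v \<in> {0..1} ==> norm (y - fst p) < d ==> \<bar>v - snd p\<bar> < d ==> dist (f y v) (f (fst p) (snd p)) < e"
   by (metis mem_Times_iff)
  show "\<exists>d>0. \<forall>x'\<in>UNIV \<times> {0..1}. dist x' p < d \<longrightarrow> dist (f (fst x') (snd x')) (f (fst p) (snd p)) < e"
  proof (intro exI[of _ d] conjI ballI impI)
   fix q assume q: "q \<in> UNIV \<times> {0..1::real}" "dist q p < d"
   have "dist (fst q) (fst p) \<le> dist q p" "dist (snd q) (snd p) \<le> dist q p"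
    by (auto intro: dist_fst_le dist_snd_le)
   then show "dist (f (fst q) (snd q)) (f (fst p) (snd p)) < e"
    using q by (intro d(2)) (auto simp: dist_norm)
  qed (use d in simp)
 qed
qed

section \<open>Stability of boundedness and relative compactness\<close>

lemma relcpt_bounded:
 fixes K :: "'n::finite hs => real => 'b::real_normed_vector"
 assumes "relcpt K"
 shows "\<exists>B. \<forall>x. norm x \<le> R \<longrightarrow> (\<forall>u\<in>{0..1}. norm (K x u) \<le> B)"
proof (rule ccontr)
 assume "\<not> ?thesis"
 then have "\<forall>k::nat. \<exists>x u. norm x \<le> R \<and> u \<in> {0..1} \<and> norm (K x u) > real k"
  by (meson not_le)
 then obtain x u where xu: "\<And>k::nat. norm (x k) \<le> R" "\<And>k. u k \<in> {0..1}" "\<And>k. norm (K (x k) (u k)) > real k"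
  by metis
 then obtain r l where r: "strict_mono (r :: nat => nat)" "(\<lambda>k. K (x (r k)) (u (r k))) \<longlonglongrightarrow> l"
  using assms unfolding relcpt_def by meson
 then have "Bseq (\<lambda>k. K (x (r k)) (u (r k)))" using convergentI convergent_imp_Bseq by blast
 then obtain B where B: "\<And>k. norm (K (x (r k)) (u (r k))) \<le> B" unfolding Bseq_def by blast
 obtain k :: nat where "B < real k" using reals_Archimedean2 by blast
 moreover have "real k \<le> real (r k)" using seq_suble[OF r(1)] by simp
 ultimately show False using xu(3)[of "r k"] B[of k] by linarith
qed

lemma relcpt_real:
 fixes f :: "'n::finite hs => real => real"
 assumes "\<And>R. \<exists>B. \<forall>x. norm x \<le> R \<longrightarrow> (\<forall>u\<in>{0..1}. \<bar>f x u\<bar> \<le> B)"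
 shows "relcpt f"
 unfolding relcpt_def
proof (intro allI impI)
 fix R :: real and x :: "nat => 'n hs" and u :: "nat => real"
 assume "\<forall>k. norm (x k) \<le> R \<and> u k \<in> {0..1}"
 moreover obtain B where "\<forall>x. norm x \<le> R \<longrightarrow> (\<forall>u\<in>{0..1}. \<bar>f x u\<bar> \<le> B)" using assms by blast
 ultimately have "\<forall>k. f (x k) (u k) \<in> cball 0 B" by auto
 then obtain l r where "strict_mono (r :: nat => nat)" "((\<lambda>k. f (x k) (u k)) \<circ> r) \<longlonglongrightarrow> l"
  using compact_imp_seq_compact[OF compact_cball[of "0::real" B]] unfolding seq_compact_def by metis
 then show "\<exists>r l. strict_mono (r :: nat => nat) \<and> (\<lambda>k. f (x (r k)) (u (r k))) \<longlonglongrightarrow> l"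
  by (auto simp: o_def)
qed

lemma relcpt_Pair:
 assumes "relcpt K1" "relcpt K2"
 shows "relcpt (\<lambda>x u. (K1 x u, K2 x u))"
 unfolding relcpt_def
proof (intro allI impI)
 fix R :: real and x :: "nat => 'a hs" and u :: "nat => real"
 assume xu: "\<forall>k. norm (x k) \<le> R \<and> u k \<in> {0..1}"
 then obtain r l where r: "strict_mono (r :: nat => nat)" "(\<lambda>k. K1 (x (r k)) (u (r k))) \<longlonglongrightarrow> l"
  using assms(1) unfolding relcpt_def by meson
 have "\<forall>k. norm (x (r k)) \<le> R \<and> u (r k) \<in> {0..1}" using xu by blast
 then obtain r' l' where r': "strict_mono (r' :: nat => nat)" "(\<lambda>k. K2 (x (r (r' k))) (u (r (r' k)))) \<longlonglongrightarrow> l'"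
  using assms(2) unfolding relcpt_def by (elim allE[of _ R] allE[of _ "\<lambda>k. x (r k)"] allE[of _ "\<lambda>k. u (r k)"]) auto
 have "(\<lambda>k. K1 (x (r (r' k))) (u (r (r' k)))) \<longlonglongrightarrow> l"
  using LIMSEQ_subseq_LIMSEQ[OF r(2) r'(1)] by (simp add: o_def)
 then have "(\<lambda>k. (K1 (x (r (r' k))) (u (r (r' k))), K2 (x (r (r' k))) (u (r (r' k))))) \<longlonglongrightarrow> (l, l')"
  using r'(2) by (rule tendsto_Pair)
 moreover have "strict_mono (\<lambda>k. r (r' k))" using strict_mono_o[OF r(1) r'(1)] by (simp add: o_def)
 ultimately show "\<exists>r l. strict_mono (r :: nat => nat) \<and> (\<lambda>k. (K1 (x (r k)) (u (r k)), K2 (x (r k)) (u (r k)))) \<longlonglongrightarrow> l"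
  by (intro exI[of _ "\<lambda>k. r (r' k)"] exI[of _ "(l, l')"]) auto
qed

lemma relcpt_compose:
 assumes "relcpt K" "continuous_on UNIV f"
 shows "relcpt (\<lambda>x u. f (K x u))"
 unfolding relcpt_def
proof (intro allI impI)
 fix R :: real and x :: "nat => 'a hs" and u :: "nat => real"
 assume "\<forall>k. norm (x k) \<le> R \<and> u k \<in> {0..1}"
 then obtain r l where r: "strict_mono (r :: nat => nat)" "(\<lambda>k. K (x (r k)) (u (r k))) \<longlonglongrightarrow> l"
  using assms(1) unfolding relcpt_def by meson
 have "(\<lambda>k. f (K (x (r k)) (u (r k)))) \<longlonglongrightarrow> f l"
  by (rule continuous_on_tendsto_compose[OF assms(2) r(2)]) auto
 then show "\<exists>r l. strict_mono (r :: nat => nat) \<and> (\<lambda>k. f (K (x (r k)) (u (r k)))) \<longlonglongrightarrow> l"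
  using r(1) by blast
qed

lemma relcpt_add:
 fixes K1 K2 :: "'n::finite hs => real => 'b::real_normed_vector"
 assumes "relcpt K1" "relcpt K2" shows "relcpt (\<lambda>x u. K1 x u + K2 x u)"
 using relcpt_compose[OF relcpt_Pair[OF assms], of "\<lambda>p. fst p + snd p"]
 by (simp add: continuous_on_add continuous_on_fst continuous_on_snd continuous_on_id)

lemma relcpt_scaleR:
 fixes K :: "'n::finite hs => real => 'b::real_normed_vector"
 assumes "relcpt f" "relcpt K" shows "relcpt (\<lambda>x u. f x u *\<^sub>R K x u)"
 using relcpt_compose[OF relcpt_Pair[OF assms], of "\<lambda>p. fst p *\<^sub>R snd p"]
 by (simp add: continuous_on_scaleR continuous_on_fst continuous_on_snd continuous_on_id)

lemma relcpt_subst: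
 fixes K :: "'n::finite hs => real => 'c::metric_space" and g :: "real => 'm::finite hs => 'n hs"
 assumes "relcpt K" "\<And>R. \<exists>R'. \<forall>x. norm x \<le> R \<longrightarrow> (\<forall>u\<in>{0..1}. norm (g u x) \<le> R')"
 shows "relcpt (\<lambda>x u. K (g u x) u)"
 unfolding relcpt_def
proof (intro allI impI)
 fix R :: real and x :: "nat => 'm hs" and u :: "nat => real"
 assume xu: "\<forall>k. norm (x k) \<le> R \<and> u k \<in> {0..1}"
 obtain R' where "\<forall>x. norm x \<le> R \<longrightarrow> (\<forall>u\<in>{0..1}. norm (g u x) \<le> R')" using assms(2) by blast
 with xu have "\<forall>k. norm (g (u k) (x k)) \<le> R' \<and> u k \<in> {0..1}" by blast
 then show "\<exists>r l. strict_mono (r :: nat => nat) \<and> (\<lambda>k. K (g (u (r k)) (x (r k))) (u (r k))) \<longlonglongrightarrow> l"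
  using assms(1) unfolding relcpt_def by (elim allE[of _ R'] allE[of _ "\<lambda>k. g (u k) (x k)"] allE[of _ u]) auto
qed

lemma posbdd_relcpt: "posbdd f ==> relcpt f"
proof (rule relcpt_real)
 fix R assume "posbdd f"
 then obtain \<alpha> \<beta> where "0 < \<alpha>" "\<forall>x. norm x \<le> R \<longrightarrow> (\<forall>u\<in>{0..1}. \<alpha> \<le> f x u \<and> f x u \<le> \<beta>)"
  unfolding posbdd_def by blast
 then show "\<exists>B. \<forall>x. norm x \<le> R \<longrightarrow> (\<forall>u\<in>{0..1}. \<bar>f x u\<bar> \<le> B)"
  by (intro exI[of _ \<beta>]) (smt (verit))
qed

lemma posbdd_mult:
 assumes "posbdd f" "posbdd g" shows "posbdd (\<lambda>x u. f x u * g x u)"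
 unfolding posbdd_def
proof
 fix R
 obtain \<alpha> \<beta> where 1: "0 < \<alpha>" "\<And>x u. norm x \<le> R ==> u\<in>{0..1} ==> \<alpha> \<le> f x u \<and> f x u \<le> \<beta>"
  using assms(1) unfolding posbdd_def by meson
 obtain \<alpha>' \<beta>' where 2: "0 < \<alpha>'" "\<And>x u. norm x \<le> R ==> u\<in>{0..1} ==> \<alpha>' \<le> g x u \<and> g x u \<le> \<beta>'"
  using assms(2) unfolding posbdd_def by meson
 have "\<alpha> * \<alpha>' \<le> f x u * g x u \<and> f x u * g x u \<le> \<beta> * \<beta>'" if "norm x \<le> R" "u \<in> {0..1}" for x u
  using 1(1) 2(1) 1(2)[OF that] 2(2)[OF that] by (intro conjI mult_mono) linarith+
 then show "\<exists>\<alpha> \<beta>. 0 < \<alpha> \<and> (\<forall>x. norm x \<le> R \<longrightarrow> (\<forall>u\<in>{0..1}. \<alpha> \<le> f x u * g x u \<and> f x u * g x u \<le> \<beta>))"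
  using 1(1) 2(1) by (meson mult_pos_pos)
qed

lemma posbdd_subst:
 assumes "posbdd f" "\<And>R. \<exists>R'. \<forall>x. norm x \<le> R \<longrightarrow> (\<forall>u\<in>{0..1}. norm (g u x) \<le> R')"
 shows "posbdd (\<lambda>x u. f (g u x) u)"
 using assms unfolding posbdd_def by meson

lemma gmap_bounded:
 fixes K :: "'n::finite hs => real => 'n hs"
 assumes "posbdd a" "posbdd b" "posbdd c" "relcpt K"
 shows "\<exists>R'. \<forall>x. norm x \<le> R \<longrightarrow> (\<forall>u\<in>{0..1}. norm (gmap a b c K u x) \<le> R')"
proof -
 obtain A where A: "\<forall>x. norm x \<le> R \<longrightarrow> (\<forall>u\<in>{0..1}. norm (a x u) \<le> A)"
  using relcpt_bounded[OF posbdd_relcpt[OF assms(1)]] by blast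
 obtain B where B: "\<forall>x. norm x \<le> R \<longrightarrow> (\<forall>u\<in>{0..1}. norm (b x u) \<le> B)"
  using relcpt_bounded[OF posbdd_relcpt[OF assms(2)]] by blast
 obtain C where C: "\<forall>x. norm x \<le> R \<longrightarrow> (\<forall>u\<in>{0..1}. norm (c x u) \<le> C)"
  using relcpt_bounded[OF posbdd_relcpt[OF assms(3)]] by blast
 obtain D where D: "\<forall>x. norm x \<le> R \<longrightarrow> (\<forall>u\<in>{0..1}. norm (K x u) \<le> D)"
  using relcpt_bounded[OF assms(4)] by blast
 have "norm (gmap a b c K u x) \<le> A * R + B * R + C * R + D" if "norm x \<le> R" "u \<in> {0..1}" for x u
 proof -
  have "norm (gmap a b c K u x) \<le> norm (a x u *\<^sub>R Pp x) + norm (b x u *\<^sub>R Pz x) + norm (c x u *\<^sub>R Pm x) + norm (K x u)"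
   unfolding gmap_def by (intro norm_triangle_mono order_refl)
  also have "\<dots> \<le> A * R + B * R + C * R + D"
  proof (intro add_mono)
   have "norm (a x u) \<le> A" "norm (b x u) \<le> B" "norm (c x u) \<le> C" using that A B C by blast+
   then have n: "0 \<le> A" "0 \<le> B" "0 \<le> C"
    using norm_ge_zero[of "a x u"] norm_ge_zero[of "b x u"] norm_ge_zero[of "c x u"] by linarith+
   show "norm (a x u *\<^sub>R Pp x) \<le> A * R" unfolding norm_scaleR
    using that A norm_P_le(1)[of x] n by (intro mult_mono) auto
   show "norm (b x u *\<^sub>R Pz x) \<le> B * R" unfolding norm_scaleR
    using that B norm_P_le(2)[of x] n by (intro mult_mono) auto
   show "norm (c x u *\<^sub>R Pm x) \<le> C * R" unfolding norm_scaleR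
    using that C norm_P_le(3)[of x] n by (intro mult_mono) auto
  qed (use that D in blast)
  finally show ?thesis .
 qed
 then show ?thesis by blast
qed

lemma cont2_gmap:
 assumes "cont2 a" "cont2 b" "cont2 c" "cont2 K"
 shows "cont2 (\<lambda>x u. gmap a b c K u x)"
 using assms unfolding cont2_def gmap_def
 by (intro continuous_intros continuous_on_P) auto

lemma cont2_subst:
 fixes f :: "'n::finite hs => real => 'b::metric_space" and g :: "real => 'm::finite hs => 'n hs"
 assumes "cont2 f" "cont2 (\<lambda>x u. g u x)"
 shows "cont2 (\<lambda>x u. f (g u x) u)"
proof -
 have "continuous_on (UNIV \<times> {0..1}) (\<lambda>p. (g (snd p) (fst p), snd p))"
  using assms(2) unfolding cont2_def by (intro continuous_intros) auto
 moreover have "(\<lambda>p. (g (snd p) (fst p), snd p)) ` (UNIV \<times> {0..1}) \<subseteq> UNIV \<times> {0..1}" by auto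
 ultimately show ?thesis
  using continuous_on_compose2[OF assms(1)[unfolded cont2_def]] unfolding cont2_def by fastforce
qed

text \<open>The two homotopies are run with the same parameter. Each outer factor multiplies the
  inner factor on the same part, and everything else is collected in a new compact term.\<close>

theorem Gam_compose:
 assumes "g \<in> Gam" "h \<in> Gam" shows "(\<lambda>x. h (g x)) \<in> Gam"
proof -
 from assms(1) obtain a b c K where 1: "cont2 a" "cont2 b" "cont2 c" "cont2 K" "posbdd a" "posbdd b" "posbdd c" "relcpt K"
   "\<And>x u. u \<in> {0..1} ==> Pp x \<noteq> 0 ==> Pp (gmap a b c K u x) \<noteq> 0"
   "\<And>x. gmap a b c K 0 x = x" "\<And>x. g x = gmap a b c K 1 x"
  unfolding Gam_def by blast
 from assms(2) obtain a' b' c' K' where 2: "cont2 a'" "cont2 b'" "cont2 c'" "cont2 K'" "posbdd a'" "posbdd b'" "posbdd c'" "relcpt K'"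
   "\<And>x u. u \<in> {0..1} ==> Pp x \<noteq> 0 ==> Pp (gmap a' b' c' K' u x) \<noteq> 0"
   "\<And>x. gmap a' b' c' K' 0 x = x" "\<And>x. h x = gmap a' b' c' K' 1 x"
  unfolding Gam_def by blast
 define G where "G = gmap a b c K"
 have Gc: "cont2 (\<lambda>x u. G u x)" unfolding G_def using 1 by (intro cont2_gmap)
 have Gb: "\<And>R. \<exists>R'. \<forall>x. norm x \<le> R \<longrightarrow> (\<forall>u\<in>{0..1}. norm (G u x) \<le> R')"
  unfolding G_def using 1 by (intro gmap_bounded)
 define A where "A x u = a' (G u x) u * a x u" for x u
 define B where "B x u = b' (G u x) u * b x u" for x u
 define C where "C x u = c' (G u x) u * c x u" for x u
 define KK where "KK x u = a' (G u x) u *\<^sub>R Pp (K x u) + b' (G u x) u *\<^sub>R Pz (K x u) + c' (G u x) u *\<^sub>R Pm (K x u) + K' (G u x) u" for x u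
 have eq: "gmap A B C KK u x = gmap a' b' c' K' u (G u x)" for u x
  by (rule hs_eqI) (auto simp: gmap_def G_def A_def B_def C_def KK_def algebra_simps)
 have s: "cont2 (\<lambda>x u. a' (G u x) u)" "cont2 (\<lambda>x u. b' (G u x) u)" "cont2 (\<lambda>x u. c' (G u x) u)" "cont2 (\<lambda>x u. K' (G u x) u)"
  using 2(1-4) Gc by (auto intro: cont2_subst)
 have cABC: "cont2 A" "cont2 B" "cont2 C"
  using s 1(1-4) unfolding cont2_def A_def B_def C_def by (auto intro!: continuous_on_mult)
 have cK: "cont2 KK"
  using s 1(1-4) unfolding cont2_def KK_def by (intro continuous_intros continuous_on_P) auto
 have pb: "posbdd A" "posbdd B" "posbdd C"
  unfolding A_def B_def C_def
  by (rule posbdd_mult[OF posbdd_subst[OF 2(5) Gb] 1(5)] posbdd_mult[OF posbdd_subst[OF 2(6) Gb] 1(6)]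
    posbdd_mult[OF posbdd_subst[OF 2(7) Gb] 1(7)])+
 have rK: "relcpt KK" unfolding KK_def
  by (intro relcpt_add relcpt_scaleR[OF relcpt_subst[OF posbdd_relcpt[OF 2(5)] Gb] relcpt_compose[OF 1(8) continuous_on_P(1)[OF continuous_on_id]]]
   relcpt_scaleR[OF relcpt_subst[OF posbdd_relcpt[OF 2(6)] Gb] relcpt_compose[OF 1(8) continuous_on_P(2)[OF continuous_on_id]]]
   relcpt_scaleR[OF relcpt_subst[OF posbdd_relcpt[OF 2(7)] Gb] relcpt_compose[OF 1(8) continuous_on_P(3)[OF continuous_on_id]]]
   relcpt_subst[OF 2(8) Gb])
 have "\<forall>x. \<forall>u\<in>{0..1}. Pp x \<noteq> 0 \<longrightarrow> Pp (gmap A B C KK u x) \<noteq> 0"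
  unfolding eq using 1(9) 2(9) unfolding G_def by blast
 moreover have "\<forall>x. gmap A B C KK 0 x = x" unfolding eq G_def 1 2 by simp
 moreover have "\<forall>x. h (g x) = gmap A B C KK 1 x" unfolding eq G_def 1 2 by simp
 ultimately show ?thesis unfolding Gam_def using cABC cK pb rK by blast
qed

text \<open>Admissible because the scaling is positive on each of the three parts and a constant
  loop has no component in E+. It carries the unit sphere to a small sphere around a constant
  loop.\<close>

lemma Gam_affine:
 fixes q :: "'n::finite hs"
 assumes "\<epsilon> > 0" "Pz q = q"
 shows "(\<lambda>x. \<epsilon> *\<^sub>R x + q) \<in> Gam"
proof -
 define a where "a = (\<lambda>(x :: 'n hs) u. (1 - u) + u * \<epsilon>)"
 define K where "K = (\<lambda>(x :: 'n hs) u. u *\<^sub>R q)"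
 have ac: "cont2 a" unfolding cont2_def a_def by (intro continuous_intros)
 have Kc: "cont2 K" unfolding cont2_def K_def by (intro continuous_intros)
 have apos: "min 1 \<epsilon> \<le> a x u \<and> a x u \<le> max 1 \<epsilon>" if "u \<in> {0..1}" for x u
 proof -
  have "(1 - u) * min 1 \<epsilon> + u * min 1 \<epsilon> \<le> (1 - u) * 1 + u * \<epsilon>"
   using that by (intro add_mono mult_left_mono) auto
  moreover have "(1 - u) * 1 + u * \<epsilon> \<le> (1 - u) * max 1 \<epsilon> + u * max 1 \<epsilon>"
   using that by (intro add_mono mult_left_mono) auto
  ultimately show ?thesis by (simp add: a_def algebra_simps)
 qed
 have ab: "posbdd a" unfolding posbdd_def
  using apos assms(1) by (intro allI exI[of _ "min 1 \<epsilon>"] exI[of _ "max 1 \<epsilon>"]) auto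
 have "relcpt (\<lambda>(x :: 'n hs) u. u)"
  by (rule relcpt_real) (auto intro!: exI[of _ 1])
 moreover have "relcpt (\<lambda>(x :: 'n hs) u. q)" unfolding relcpt_def
  using strict_mono_id by auto
 ultimately have Kr: "relcpt K" unfolding K_def by (rule relcpt_scaleR)
 have eq: "gmap a a a K u x = a x u *\<^sub>R x + u *\<^sub>R q" for u x
  by (rule hs_eqI) (auto simp: gmap_def K_def)
 have nz: "\<forall>x. \<forall>u\<in>{0..1}. Pp x \<noteq> 0 \<longrightarrow> Pp (gmap a a a K u x) \<noteq> 0"
 proof (intro allI ballI impI)
  fix x :: "'n hs" and u :: real assume u: "u \<in> {0..1}" and x: "Pp x \<noteq> 0"
  have "Pp q = 0" using assms(2) P_idem(4)[of q] by simp
  then have "Pp (gmap a a a K u x) = a x u *\<^sub>R Pp x" by (simp add: eq)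
  moreover have "a x u > 0" using apos[OF u, of x] assms(1) by linarith
  ultimately show "Pp (gmap a a a K u x) \<noteq> 0" using x by simp
 qed
 have e0: "\<forall>x. gmap a a a K 0 x = x" unfolding eq by (simp add: a_def)
 have e1: "\<forall>x. \<epsilon> *\<^sub>R x + q = gmap a a a K 1 x" unfolding eq by (simp add: a_def)
 show ?thesis unfolding Gam_def mem_Collect_eq
  by (intro exI[of _ a] exI[of _ K] conjI) (fact ac Kc ab Kr nz e0 e1)+
qed

subsection \<open>Translation to the coefficient formulation\<close>

lemma defo_cf:
 assumes "K (cf x) u \<in> Eset"
 shows "defo a b c K u (cf x) = cf (gmap (\<lambda>x. a (cf x)) (\<lambda>x. b (cf x)) (\<lambda>x. c (cf x)) (\<lambda>x u. Hs (K (cf x) u)) u x)"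
 using assms by (auto simp: defo_def gmap_def Eplus_def Ezero_def Eminus_def)

lemma Econt_real_cf: "Econt_real f \<longleftrightarrow> cont2 (\<lambda>x. f (cf x))"
proof -
 have *: "(\<forall>x\<in>Eset. P x) \<longleftrightarrow> (\<forall>x :: 'a hs. P (cf x))" for P
  by (metis cf_mem cf_Hs)
 show ?thesis unfolding Econt_real_def cont2_iff * by (simp add: dist_real_def)
qed

lemma Econt_E_cf:
 assumes "\<And>x u. x \<in> Eset ==> u \<in> {0..1} ==> K x u \<in> Eset"
 shows "Econt_E K \<longleftrightarrow> cont2 (\<lambda>x u. Hs (K (cf x) u))"
proof -
 have *: "(\<forall>x\<in>Eset. P x) \<longleftrightarrow> (\<forall>x :: 'a hs. P (cf x))" for P
  by (metis cf_mem cf_Hs)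
 have "Enorm (\<lambda>j. K (cf y) v j - K (cf x) u j) = dist (Hs (K (cf y) v)) (Hs (K (cf x) u))" if "u \<in> {0..1}" "v \<in> {0..1}" for x y u v
  using Enorm_diff[of "Hs (K (cf y) v)" "Hs (K (cf x) u)"]
  unfolding cf_Hs[OF assms[OF cf_mem that(1)]] cf_Hs[OF assms[OF cf_mem that(2)]] dist_norm .
 then show ?thesis unfolding Econt_E_def cont2_iff * by (simp cong: ball_cong_simp)
qed

lemma pos_relcompact_cf: "pos_relcompact_real f \<longleftrightarrow> posbdd (\<lambda>x. f (cf x))"
proof
 assume L: "pos_relcompact_real f"
 show "posbdd (\<lambda>x. f (cf x))" unfolding posbdd_def
 proof
  fix R
  define B where "B = cf ` {x :: 'a hs. norm x \<le> R}"
  have "B \<subseteq> Eset" "Ebounded B" by (auto simp: B_def Ebounded_def)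
  with L obtain \<alpha> \<beta> where "0 < \<alpha>" "\<forall>x\<in>B. \<forall>u\<in>{0..1}. \<alpha> \<le> f x u \<and> f x u \<le> \<beta>"
   unfolding pos_relcompact_real_def by blast
  then show "\<exists>\<alpha> \<beta>. 0 < \<alpha> \<and> (\<forall>x. norm x \<le> R \<longrightarrow> (\<forall>u\<in>{0..1}. \<alpha> \<le> f (cf x) u \<and> f (cf x) u \<le> \<beta>))"
   unfolding B_def by blast
 qed
next
 assume R: "posbdd (\<lambda>x. f (cf x))"
 show "pos_relcompact_real f" unfolding pos_relcompact_real_def
 proof (intro allI impI)
  fix B :: "'a coeff set" assume B: "B \<subseteq> Eset \<and> Ebounded B"
  then obtain M where M: "\<forall>x\<in>B. Enorm x \<le> M" by (auto simp: Ebounded_def)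
  obtain \<alpha> \<beta> where ab: "0 < \<alpha>" "\<forall>x. norm x \<le> M \<longrightarrow> (\<forall>u\<in>{0..1}. \<alpha> \<le> f (cf x) u \<and> f (cf x) u \<le> \<beta>)"
   using R unfolding posbdd_def by meson
  have "\<forall>x\<in>B. \<forall>u\<in>{0..1}. \<alpha> \<le> f x u \<and> f x u \<le> \<beta>"
  proof
   fix x assume "x \<in> B"
   then have xE: "x \<in> Eset" using B by blast
   have "norm (Hs x) \<le> M" using bspec[OF M \<open>x \<in> B\<close>] Enorm_cf[OF xE] by simp
   then show "\<forall>u\<in>{0..1}. \<alpha> \<le> f x u \<and> f x u \<le> \<beta>" using ab(2) cf_Hs[OF xE] by metis
  qed
  then show "\<exists>\<alpha> \<beta>. 0 < \<alpha> \<and> (\<forall>x\<in>B. \<forall>u\<in>{0..1}. \<alpha> \<le> f x u \<and> f x u \<le> \<beta>)" using ab(1) by blast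
 qed
qed

lemma Erelcompact_cf:
 fixes K :: "'n::finite coeff => real => 'n coeff"
 assumes K: "\<And>x u. x \<in> Eset ==> u \<in> {0..1} ==> K x u \<in> Eset"
 shows "(\<forall>B. B \<subseteq> Eset \<and> Ebounded B \<longrightarrow> Erelcompact {K x u |x u. x \<in> B \<and> u \<in> {0..1}}) \<longleftrightarrow>
  relcpt (\<lambda>x u. Hs (K (cf x) u))"
proof
 assume L: "\<forall>B. B \<subseteq> Eset \<and> Ebounded B \<longrightarrow> Erelcompact {K x u |x u. x \<in> B \<and> u \<in> {0..1}}"
 show "relcpt (\<lambda>x u. Hs (K (cf x) u))" unfolding relcpt_def
 proof (intro allI impI)
  fix R and x :: "nat => 'n hs" and u :: "nat => real" assume xu: "\<forall>k. norm (x k) \<le> R \<and> u k \<in> {0..1}"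
  define B where "B = cf ` {x :: 'n hs. norm x \<le> R}"
  have "B \<subseteq> Eset" "Ebounded B" by (auto simp: B_def Ebounded_def)
  then have E: "Erelcompact {K x u |x u. x \<in> B \<and> u \<in> {0..1}}" using L by blast
  have "\<forall>k. K (cf (x k)) (u k) \<in> {K x u |x u. x \<in> B \<and> u \<in> {0..1}}"
   using xu unfolding B_def by blast
  then obtain r l where r: "strict_mono (r :: nat => nat)" "l \<in> Eset" "(\<lambda>k. Enorm (\<lambda>j. K (cf (x (r k))) (u (r k)) j - l j)) \<longlonglongrightarrow> 0"
   using E[unfolded Erelcompact_def, rule_format, of "\<lambda>k. K (cf (x k)) (u k)"] by auto
  have "Enorm (\<lambda>j. K (cf (x (r k))) (u (r k)) j - l j) = norm (Hs (K (cf (x (r k))) (u (r k))) - Hs l)" for k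
   using Enorm_diff[of "Hs (K (cf (x (r k))) (u (r k)))" "Hs l"] K[of "cf (x (r k))" "u (r k)"] xu r(2) by simp
  then have "(\<lambda>k. Hs (K (cf (x (r k))) (u (r k)))) \<longlonglongrightarrow> Hs l"
   using r(3) by (simp add: tendsto_iff dist_norm)
  then show "\<exists>r l. strict_mono (r :: nat => nat) \<and> (\<lambda>k. Hs (K (cf (x (r k))) (u (r k)))) \<longlonglongrightarrow> l"
   using r(1) by blast
 qed
next
 assume R: "relcpt (\<lambda>x u. Hs (K (cf x) u))"
 show "\<forall>B. B \<subseteq> Eset \<and> Ebounded B \<longrightarrow> Erelcompact {K x u |x u. x \<in> B \<and> u \<in> {0..1}}"
  unfolding Erelcompact_def
 proof (intro allI impI)
  fix B :: "'n coeff set" and s :: "nat => 'n coeff"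
  assume B: "B \<subseteq> Eset \<and> Ebounded B" and s: "\<forall>k. s k \<in> {K x u |x u. x \<in> B \<and> u \<in> {0..1}}"
  then obtain M where M: "\<forall>x\<in>B. Enorm x \<le> M" by (auto simp: Ebounded_def)
  from s have "\<forall>k. \<exists>x u. s k = K x u \<and> x \<in> B \<and> u \<in> {0..1}" by blast
  then obtain x u where xu: "\<And>k. s k = K (x k) (u k)" "\<And>k. x k \<in> B" "\<And>k. u k \<in> {0..1}" by metis
  have xE: "x k \<in> Eset" for k using xu(2) B by blast
  have "\<forall>k. norm (Hs (x k)) \<le> M \<and> u k \<in> {0..1}" using xu(3) bspec[OF M xu(2)] Enorm_cf[OF xE] by simp
  then obtain r l where r: "strict_mono (r :: nat => nat)" "(\<lambda>k. Hs (K (cf (Hs (x (r k)))) (u (r k)))) \<longlonglongrightarrow> l"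
   using R unfolding relcpt_def by (elim allE[of _ M] allE[of _ "\<lambda>k. Hs (x k)"] allE[of _ u]) auto
  have "Enorm (\<lambda>j. s (r k) j - cf l j) = dist (Hs (K (cf (Hs (x (r k)))) (u (r k)))) l" for k
   using Enorm_diff[of "Hs (K (x (r k)) (u (r k)))" l] K[OF xE xu(3), of "r k" "r k"] xE xu(1) by (simp add: dist_norm)
  then have "(\<lambda>k. Enorm (\<lambda>j. s (r k) j - cf l j)) \<longlonglongrightarrow> 0"
   using tendsto_dist_iff[THEN iffD1, OF r(2)] by simp
  then show "\<exists>r l. strict_mono (r :: nat => nat) \<and> l \<in> Eset \<and> (\<lambda>k. Enorm (\<lambda>j. s (r k) j - l j)) \<longlonglongrightarrow> 0"
   using r(1) cf_mem by blast
 qed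
qed

lemma cf_eq_0_iff: "cf x = (\<lambda>_. 0) \<longleftrightarrow> x = 0"
 by (auto simp: hs_eq_iff fun_eq_iff)

lemma Eplus_cf_neq_0: "Eplus (cf x) \<noteq> (\<lambda>_. 0) \<longleftrightarrow> Pp x \<noteq> 0"
 unfolding cf_Pp_eq[symmetric] cf_eq_0_iff ..

text \<open>An element of \<open>Gamma\<close> is unconstrained outside E, so only the values at
  \<open>cf x\<close> can be compared.\<close>

lemma Gamma_iff_Gam:
 "\<gamma> \<in> Gamma \<longleftrightarrow> (\<exists>h\<in>Gam. \<forall>x. \<gamma> (cf x) = cf (h x))"
proof
 assume "\<gamma> \<in> Gamma"
 then obtain a b c K where g:
   "\<forall>x\<in>Eset. \<forall>u\<in>{0..1}. a x u > 0 \<and> b x u > 0 \<and> c x u > 0 \<and> K x u \<in> Eset"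
   "Econt_real a" "Econt_real b" "Econt_real c" "Econt_E K"
   "pos_relcompact_real a" "pos_relcompact_real b" "pos_relcompact_real c"
   "\<forall>B. B \<subseteq> Eset \<and> Ebounded B \<longrightarrow> Erelcompact {K x u |x u. x \<in> B \<and> u \<in> {0..1}}"
   "\<forall>x\<in>Eset. \<forall>u\<in>{0..1}. Eplus x \<noteq> (\<lambda>_. 0) \<longrightarrow> Eplus (defo a b c K u x) \<noteq> (\<lambda>_. 0)"
   "\<forall>x\<in>Eset. defo a b c K 0 x = x" "\<forall>x\<in>Eset. \<gamma> x = defo a b c K 1 x"
  unfolding Gamma_def by blast
 have K: "K x u \<in> Eset" if "x \<in> Eset" "u \<in> {0..1}" for x u using g(1) that by blast
 let ?g = "gmap (\<lambda>x. a (cf x)) (\<lambda>x. b (cf x)) (\<lambda>x. c (cf x)) (\<lambda>x u. Hs (K (cf x) u))"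
 have d: "defo a b c K u (cf x) = cf (?g u x)" if "u \<in> {0..1}" for u x
  by (rule defo_cf) (rule K[OF cf_mem that])
 have "?g 1 \<in> Gam" unfolding Gam_def mem_Collect_eq
 proof (intro exI conjI allI ballI impI)
  show "cont2 (\<lambda>x u. Hs (K (cf x) u))" using g(5) Econt_E_cf[of K] K by blast
  show "relcpt (\<lambda>x u. Hs (K (cf x) u))" using g(9) Erelcompact_cf[of K] K by blast
  show "Pp (?g u x) \<noteq> 0" if "u \<in> {0..1}" "Pp x \<noteq> 0" for u x
   using g(10)[rule_format, of "cf x" u] that d[OF that(1), of x] Eplus_cf_neq_0[of x] Eplus_cf_neq_0[of "?g u x"] by simp
  show "?g 0 x = x" for x using g(11)[rule_format, OF cf_mem, of x] d[of 0 x] by (simp add: cf_inject)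
 qed (use g in \<open>simp_all add: Econt_real_cf pos_relcompact_cf\<close>)
 moreover have "\<gamma> (cf x) = cf (?g 1 x)" for x using g(12) d[of 1 x] by simp
 ultimately show "\<exists>h\<in>Gam. \<forall>x. \<gamma> (cf x) = cf (h x)" by blast
next
 assume "\<exists>h\<in>Gam. \<forall>x. \<gamma> (cf x) = cf (h x)"
 then obtain h where h: "h \<in> Gam" "\<And>x. \<gamma> (cf x) = cf (h x)" by blast
 from h(1) obtain a b c K where g: "cont2 a" "cont2 b" "cont2 c" "cont2 K" "posbdd a" "posbdd b" "posbdd c" "relcpt K"
   "\<And>x u. u \<in> {0..1} ==> Pp x \<noteq> 0 ==> Pp (gmap a b c K u x) \<noteq> 0"
   "\<And>x. gmap a b c K 0 x = x" "\<And>x. h x = gmap a b c K 1 x"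
  unfolding Gam_def by blast
 define a' where "a' c = a (Hs c)" for c
 define b' where "b' c = b (Hs c)" for c
 define c' where "c' d = c (Hs d)" for d
 define K' where "K' d u = cf (K (Hs d) u)" for d u
 have id: "(\<lambda>x. a' (cf x)) = a" "(\<lambda>x. b' (cf x)) = b" "(\<lambda>x. c' (cf x)) = c" "(\<lambda>x u. Hs (K' (cf x) u)) = K"
  by (auto simp: a'_def b'_def c'_def K'_def cf_inverse)
 have d: "defo a' b' c' K' u (cf x) = cf (gmap a b c K u x)" for u x
  using defo_cf[of K' x u a' b' c'] unfolding id by (simp add: K'_def)
 have d': "defo a' b' c' K' u x = cf (gmap a b c K u (Hs x))" if "x \<in> Eset" for u x
  using d[of u "Hs x"] that by simp
 have pos: "f x u > 0" if "posbdd f" "u \<in> {0..1}" for f x and u :: real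
  using that unfolding posbdd_def by (metis less_le_trans order_refl)
 have K'E: "K' x u \<in> Eset" for x u by (simp add: K'_def)
 show "\<gamma> \<in> Gamma" unfolding Gamma_def mem_Collect_eq
 proof (intro exI conjI)
  show "\<forall>x\<in>Eset. \<forall>u\<in>{0..1}. a' x u > 0 \<and> b' x u > 0 \<and> c' x u > 0 \<and> K' x u \<in> Eset"
   using pos[OF g(5)] pos[OF g(6)] pos[OF g(7)] K'E unfolding a'_def b'_def c'_def by blast
  show "Econt_real a'" "Econt_real b'" "Econt_real c'" unfolding Econt_real_cf id by fact+
  show "Econt_E K'" using Econt_E_cf[of K'] K'E g(4) id by simp
  show "pos_relcompact_real a'" "pos_relcompact_real b'" "pos_relcompact_real c'" unfolding pos_relcompact_cf id by fact+
  show "\<forall>B. B \<subseteq> Eset \<and> Ebounded B \<longrightarrow> Erelcompact {K' x u |x u. x \<in> B \<and> u \<in> {0..1}}"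
   using Erelcompact_cf[of K'] K'E g(8) id by simp
  show "\<forall>x\<in>Eset. \<forall>u\<in>{0..1}. Eplus x \<noteq> (\<lambda>_. 0) \<longrightarrow> Eplus (defo a' b' c' K' u x) \<noteq> (\<lambda>_. 0)"
  proof (intro ballI impI)
   fix x :: "'a coeff" and u :: real assume x: "x \<in> Eset" "u \<in> {0..1}" "Eplus x \<noteq> (\<lambda>_. 0)"
   then have "Pp (Hs x) \<noteq> 0" using Eplus_cf_neq_0[of "Hs x"] by simp
   then show "Eplus (defo a' b' c' K' u x) \<noteq> (\<lambda>_. 0)"
    unfolding d'[OF x(1)] Eplus_cf_neq_0 using g(9) x(2) by blast
  qed
  show "\<forall>x\<in>Eset. defo a' b' c' K' 0 x = x" using d' g(10) by simp
  show "\<forall>x\<in>Eset. \<gamma> x = defo a' b' c' K' 1 x"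
   using d' g(11) h(2) by (metis cf_Hs)
 qed
qed

lemma Splus_eq: "Splus = cf ` Sp"
proof -
 have iff: "c \<in> Splus \<longleftrightarrow> c \<in> Eset \<and> Hs c \<in> Sp" for c :: "'a coeff"
 proof (cases "c \<in> Eset")
  case True
  have "Ezero c = (\<lambda>_. 0) \<and> Eminus c = (\<lambda>_. 0) \<longleftrightarrow> Pp (Hs c) = Hs c"
  proof
   assume *: "Ezero c = (\<lambda>_. 0) \<and> Eminus c = (\<lambda>_. 0)"
   show "Pp (Hs c) = Hs c"
   proof (rule hs_eqI)
    fix j
    have "j = 0 ==> c j = 0" "j < 0 ==> c j = 0"
     using * by (auto simp: Ezero_def Eminus_def dest: fun_cong[of _ _ j])
    then show "cf (Pp (Hs c)) j = cf (Hs c) j" using True by (cases "j > 0"; cases "j = 0") auto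
   qed
  next
   assume *: "Pp (Hs c) = Hs c"
   have "cf (Pp (Hs c)) j = c j" for j using * True by simp
   then have "j \<le> 0 ==> c j = 0" for j using True by (metis cf_Pp not_le)
   then show "Ezero c = (\<lambda>_. 0) \<and> Eminus c = (\<lambda>_. 0)" by (auto simp: Ezero_def Eminus_def)
  qed
  then show ?thesis using True by (auto simp: Splus_def Sp_def Enorm_cf)
 qed (simp add: Splus_def)
 show ?thesis
 proof (intro Set.set_eqI iffI)
  fix c :: "'a coeff" assume "c \<in> Splus"
  then have "c = cf (Hs c)" "Hs c \<in> Sp" using iff by auto
  then show "c \<in> cf ` Sp" by blast
 next
  fix c :: "'a coeff" assume "c \<in> cf ` Sp"
  then obtain x where "c = cf x" "x \<in> Sp" by blast
  then show "c \<in> Splus" using iff by (simp add: cf_inverse)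
 qed
qed

theorem cEH_fun_eq: "cEH_fun H = (SUP h\<in>Gam. INF x\<in>Sp. PhiH H (cf (h x)))"
proof -
 have a: "(INF x\<in>\<gamma> ` Splus. PhiH H x) = (INF x\<in>Sp. PhiH H (cf (h x)))" if "\<forall>x. \<gamma> (cf x) = cf (h x)" for \<gamma> h
  unfolding Splus_eq image_image using that by simp
 show ?thesis unfolding cEH_fun_def
 proof (rule antisym)
  show "(SUP h\<in>Gamma. INF x\<in>h ` Splus. PhiH H x) \<le> (SUP h\<in>Gam. INF x\<in>Sp. PhiH H (cf (h x)))"
  proof (rule SUP_least)
   fix \<gamma> :: "'a coeff => 'a coeff" assume "\<gamma> \<in> Gamma"
   then obtain h where "h \<in> Gam" "\<forall>x. \<gamma> (cf x) = cf (h x)" using Gamma_iff_Gam by blast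
   then show "(INF x\<in>\<gamma> ` Splus. PhiH H x) \<le> (SUP h\<in>Gam. INF x\<in>Sp. PhiH H (cf (h x)))"
    unfolding a[OF \<open>\<forall>x. \<gamma> (cf x) = cf (h x)\<close>] by (intro SUP_upper)
  qed
  show "(SUP h\<in>Gam. INF x\<in>Sp. PhiH H (cf (h x))) \<le> (SUP h\<in>Gamma. INF x\<in>h ` Splus. PhiH H x)"
  proof (rule SUP_least)
   fix h :: "'a hs => 'a hs" assume h: "h \<in> Gam"
   define \<gamma> where "\<gamma> c = cf (h (Hs c))" for c
   have e: "\<forall>x. \<gamma> (cf x) = cf (h x)" by (simp add: \<gamma>_def cf_inverse)
   then have "\<gamma> \<in> Gamma" using h Gamma_iff_Gam by blast
   then show "(INF x\<in>Sp. PhiH H (cf (h x))) \<le> (SUP h\<in>Gamma. INF x\<in>h ` Splus. PhiH H x)"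
    using a[OF e] by (metis (no_types, lifting) SUP_upper)
  qed
 qed
qed

lemma cEH_fun_geI:
 "h \<in> Gam ==> (\<And>x. x \<in> Sp ==> C \<le> PhiH H (cf (h x))) ==> C \<le> cEH_fun H"
 unfolding cEH_fun_eq by (rule SUP_upper2) (auto intro: INF_greatest)

lemma cEH_fun_leI:
 "(\<And>h. h \<in> Gam ==> \<exists>x\<in>Sp. PhiH H (cf (h x)) \<le> C) ==> cEH_fun H \<le> C"
 unfolding cEH_fun_eq by (rule SUP_least) (meson INF_lower2)

lemma PhiH_cf: "PhiH H (cf x) = ereal ((1/2) * ((norm (Pp x))\<^sup>2 - (norm (Pm x))\<^sup>2))
  - enn2ereal (\<integral>\<^sup>+ t. ennreal (H (crv x t)) \<partial>I01)"
 unfolding PhiH_def crv_def[symmetric] cf_Pp_eq[symmetric] cf_Pm_eq[symmetric] by simp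

lemma PhiH_antimono:
 assumes "\<And>z. H z \<le> H' z" shows "PhiH H' c \<le> PhiH H c"
proof -
 have "(\<integral>\<^sup>+ t. ennreal (H (Ecurve_of c t)) \<partial>I01) \<le> (\<integral>\<^sup>+ t. ennreal (H' (Ecurve_of c t)) \<partial>I01)"
  by (intro nn_integral_mono ennreal_leI assms)
 then show ?thesis unfolding PhiH_def
  by (intro ereal_minus_mono order_refl) (simp add: less_eq_ennreal.rep_eq)
qed

lemma cEH_fun_antimono: "(\<And>z. H z \<le> H' z) ==> cEH_fun H' \<le> cEH_fun H"
 unfolding cEH_fun_def
 by (intro SUP_subset_mono INF_superset_mono subset_refl PhiH_antimono)

section \<open>The action functional of a Hamiltonian with Lipschitz gradient\<close>

lemma hs_compact_L2_ex:
 fixes x :: "nat => 'n::finite hs"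
 assumes "\<And>k. norm (x k) \<le> R"
 shows "\<exists>r l. strict_mono (r :: nat => nat) \<and> (\<forall>j. (\<lambda>k. cf (x (r k)) j) \<longlonglongrightarrow> cf l j) \<and>
  (\<lambda>k. l2 (crv (x (r k) - l))) \<longlonglongrightarrow> 0 \<and> norm l \<le> R"
 by (rule hs_compact_L2[of x R, OF assms]) blast

lemma quadratic_approx_has_derivative:
 fixes H :: "'a::euclidean_space => real"
 assumes "\<And>w. \<bar>H w - H z - v \<bullet> (w - z)\<bar> \<le> C * (norm (w - z))\<^sup>2"
 shows "(H has_derivative (\<lambda>h. v \<bullet> h)) (at z)"
proof (rule has_derivativeI_sandwich[where e=1 and H="\<lambda>w. C * norm (w - z)"])
 show "bounded_linear (\<lambda>h. v \<bullet> h)" by (rule bounded_linear_inner_right)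
 show "((\<lambda>w. C * norm (w - z)) \<longlongrightarrow> 0) (at z)"
  by (rule tendsto_eq_intros refl)+ simp
 show "norm (H y - H z - v \<bullet> (y - z)) / norm (y - z) \<le> C * norm (y - z)" if "y \<noteq> z" for y
  using assms[of y] that by (simp add: divide_le_eq power2_eq_square mult_ac)
qed simp

lemma const_element: "\<exists>Q :: 'n::finite hs. Pz Q = Q \<and> (AE t in I01. crv Q t = (q, 0))"
proof -
 define c where "c = (\<lambda>j::int. if j = 0 then q else 0 :: real^'n)"
 have "c \<in> Eset" unfolding Eset_def mem_Collect_eq c_def
  by (subst summable_on_cong_neutral[where T="{}" and g="\<lambda>_. 0"]) auto
 define Q where "Q = Hs c"
 have cQ: "cf Q = c" using \<open>c \<in> Eset\<close> by (simp add: Q_def)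
 have "Pz Q = Q" by (rule hs_eqI) (simp add: cQ c_def)
 moreover have "AE t in I01. crv Q t = (q, 0)"
 proof (rule crv_eqI[OF L2_const])
  fix j
  have "fmode 0 (q, 0 :: real^'n) = (\<lambda>t. (q, 0))" by (auto simp: fmode_def)
  then show "fcoeff j (\<lambda>t. (q, 0 :: real^'n)) = (cf Q j, 0)"
   using fcoeff_fmode[of j 0 "(q, 0 :: real^'n)"] by (auto simp: cQ c_def zero_prod_def)
 qed
 ultimately show ?thesis by blast
qed

text \<open>The quadratic estimate is the integrated form of a Lipschitz gradient. Integrating it
  along a loop yields Taylor estimates on E directly, without differentiating under the integral
  sign.\<close>

locale hamiltonian = lipschitz_field V L for V :: "'n::finite st => 'n st" and L +
 fixes H :: "'n st => real"
 assumes H_nonneg: "\<And>z. 0 \<le> H z"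
  and H_quad: "\<And>z w. \<bar>H w - H z - V z \<bullet> (w - z)\<bar> \<le> L * (norm (w - z))\<^sup>2"
begin

lemma H_has_derivative: "(H has_derivative (\<lambda>h. V z \<bullet> h)) (at z)"
 by (rule quadratic_approx_has_derivative[OF H_quad])

lemma H_continuous: "continuous_on S H"
 by (intro continuous_at_imp_continuous_on ballI has_derivative_continuous[OF H_has_derivative])

lemma H_measurable: "f \<in> borel_measurable I01 ==> (\<lambda>t. H (f t)) \<in> borel_measurable I01"
 using measurable_compose[OF _ borel_measurable_continuous_onI[OF H_continuous]] .

lemma H_integrable:
 assumes "L2 f" shows "integrable I01 (\<lambda>t. H (f t))"
proof (rule Bochner_Integration.integrable_bound)
 show "integrable I01 (\<lambda>t. \<bar>H 0\<bar> + norm (V 0) * norm (f t) + L * (norm (f t))\<^sup>2)"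
  using assms L2_integrable[OF assms] by (auto simp: L2_def)
 show "(\<lambda>t. H (f t)) \<in> borel_measurable I01" by (rule H_measurable[OF L2_measurable[OF assms]])
 show "AE t in I01. norm (H (f t)) \<le> norm (\<bar>H 0\<bar> + norm (V 0) * norm (f t) + L * (norm (f t))\<^sup>2)"
 proof (rule AE_I2)
  fix t
  have "\<bar>V 0 \<bullet> f t\<bar> \<le> norm (V 0) * norm (f t)" by (rule Cauchy_Schwarz_ineq2)
  then have "\<bar>H (f t)\<bar> \<le> \<bar>H 0\<bar> + norm (V 0) * norm (f t) + L * (norm (f t))\<^sup>2"
   using H_quad[of "f t" 0] by simp
  then show "norm (H (f t)) \<le> norm (\<bar>H 0\<bar> + norm (V 0) * norm (f t) + L * (norm (f t))\<^sup>2)"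
   by simp
 qed
qed

section \<open>Gradient and Taylor estimate of the action functional\<close>

definition gradH :: "'n hs => 'n hs" where "gradH x = rieszE (\<lambda>t. V (crv x t))"
definition IH :: "'n hs => real" where "IH x = (LINT t|I01. H (crv x t))"
definition Phi :: "'n hs => real" where "Phi x = ((norm (Pp x))\<^sup>2 - (norm (Pm x))\<^sup>2) / 2 - IH x"
definition gPhi :: "'n hs => 'n hs" where "gPhi x = Pp x - Pm x - gradH x"

lemma L2_V_crv: "L2 (\<lambda>t. V (crv x t))" by (rule L2_V[OF L2_crv])

text \<open>The right side has the \<open>l2\<close> distance rather than the norm of E; combined
  with \<open>hs_compact_L2\<close> this makes \<open>gradH\<close> compact.\<close>

lemma gradH_lipschitz_L2: "norm (gradH x - gradH y) \<le> L * l2 (crv (x - y))"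
proof -
 have "norm (gradH x - gradH y) \<le> l2 (\<lambda>t. V (crv x t) - V (crv y t))"
  unfolding gradH_def rieszE_diff[OF L2_V_crv L2_V_crv] by (intro norm_rieszE_le L2_diff L2_V_crv)
 also have "\<dots> \<le> L * l2 (\<lambda>t. crv x t - crv y t)" by (rule l2_V_diff[OF L2_crv L2_crv])
 finally show ?thesis by (simp add: l2_crv_diff)
qed

lemma gradH_lipschitz: "norm (gradH x - gradH y) \<le> L * norm (x - y)"
 using gradH_lipschitz_L2[of x y] mult_left_mono[OF l2_crv_le[of "x - y"] L_nonneg] by linarith

lemma gradH_inner: "gradH x \<bullet> d = (LINT t|I01. crv d t \<bullet> V (crv x t))"
 unfolding gradH_def by (rule rieszE_inner[OF L2_V_crv])

lemma IH_quad: "\<bar>IH y - IH x - gradH x \<bullet> (y - x)\<bar> \<le> L * (l2 (crv (y - x)))\<^sup>2"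
proof -
 let ?d = "crv (y - x)"
 have d: "AE t in I01. ?d t = crv y t - crv x t" by (rule crv_diff)
 have int: "integrable I01 (\<lambda>t. H (crv y t))" "integrable I01 (\<lambda>t. H (crv x t))"
  "integrable I01 (\<lambda>t. ?d t \<bullet> V (crv x t))" "integrable I01 (\<lambda>t. (norm (?d t))\<^sup>2)"
  using H_integrable[OF L2_crv] L2_inner_integrable[OF L2_crv L2_V_crv] L2_crv[of "y - x"] by (auto simp: L2_def)
 have "\<bar>IH y - IH x - gradH x \<bullet> (y - x)\<bar> = \<bar>\<integral>t. H (crv y t) - H (crv x t) - ?d t \<bullet> V (crv x t) \<partial>I01\<bar>"
  unfolding IH_def gradH_inner using int by simp
 also have "\<dots> \<le> (LINT t|I01. \<bar>H (crv y t) - H (crv x t) - ?d t \<bullet> V (crv x t)\<bar>)"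
  by (rule integral_abs_bound)
 also have "\<dots> \<le> (LINT t|I01. L * (norm (?d t))\<^sup>2)"
 proof (rule integral_mono_AE)
  show "AE t in I01. \<bar>H (crv y t) - H (crv x t) - ?d t \<bullet> V (crv x t)\<bar> \<le> L * (norm (?d t))\<^sup>2"
   using d by eventually_elim (use H_quad in \<open>simp add: inner_commute\<close>)
 qed (use int in auto)
 finally show ?thesis by (simp add: l2_power2)
qed

text \<open>The quadratic form contributes 1/2 and the potential term at most \<open>L\<close>. The
  estimate identifies \<open>gPhi\<close> as the gradient of \<open>Phi\<close>.\<close>

lemma Phi_quad: "\<bar>Phi y - Phi x - gPhi x \<bullet> (y - x)\<bar> \<le> (1/2 + L) * (norm (y - x))\<^sup>2"
proof -
 define d where "d = y - x"
 have y: "y = x + d" by (simp add: d_def)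
 have "(norm (Pp y))\<^sup>2 = (norm (Pp x))\<^sup>2 + 2 * (Pp x \<bullet> Pp d) + (norm (Pp d))\<^sup>2"
  "(norm (Pm y))\<^sup>2 = (norm (Pm x))\<^sup>2 + 2 * (Pm x \<bullet> Pm d) + (norm (Pm d))\<^sup>2"
  unfolding y by (simp_all add: power2_norm_eq_inner inner_add_left inner_add_right inner_commute)
 then have "Phi y - Phi x - gPhi x \<bullet> d = ((norm (Pp d))\<^sup>2 - (norm (Pm d))\<^sup>2) / 2 - (IH y - IH x - gradH x \<bullet> d)"
  unfolding Phi_def gPhi_def inner_diff_left P_inner_self(1)[of x d] P_inner_self(3)[of x d]
  by (simp add: field_simps)
 moreover have "\<bar>((norm (Pp d))\<^sup>2 - (norm (Pm d))\<^sup>2) / 2\<bar> \<le> (1/2) * (norm d)\<^sup>2"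
  using norm_P_sq[of d] by (simp add: abs_le_iff)
 moreover have "\<bar>IH y - IH x - gradH x \<bullet> d\<bar> \<le> L * (norm d)\<^sup>2"
  using IH_quad[of y x] power_mono[OF l2_crv_le[of d] l2_nonneg, of 2] L_nonneg unfolding d_def
  by (meson mult_left_mono order.trans)
 ultimately have "\<bar>Phi y - Phi x - gPhi x \<bullet> d\<bar> \<le> (1/2) * (norm d)\<^sup>2 + L * (norm d)\<^sup>2" by linarith
 then show ?thesis by (simp add: d_def algebra_simps)
qed

lemma continuous_gradH: "continuous_on S gradH"
proof -
 have "L-lipschitz_on S gradH"
  by (rule lipschitz_onI) (use gradH_lipschitz L_nonneg in \<open>auto simp: dist_norm\<close>)
 then show ?thesis by (rule lipschitz_on_continuous_on)
qed

lemma continuous_gPhi: "continuous_on S gPhi"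
 unfolding gPhi_def by (intro continuous_intros continuous_on_P continuous_gradH)

lemma Phi_tendsto:
 assumes "x \<longlonglongrightarrow> l" shows "(\<lambda>k. Phi (x k)) \<longlonglongrightarrow> Phi l"
proof -
 have d: "(\<lambda>k. x k - l) \<longlonglongrightarrow> 0" using assms by (simp add: LIM_zero_iff)
 have "(\<lambda>k. (1/2 + L) * (norm (x k - l))\<^sup>2 + norm (gPhi l) * norm (x k - l)) \<longlonglongrightarrow> (1/2 + L) * (norm (0::'n hs))\<^sup>2 + norm (gPhi l) * norm (0::'n hs)"
  by (intro tendsto_intros d)
 then have b: "(\<lambda>k. (1/2 + L) * (norm (x k - l))\<^sup>2 + norm (gPhi l) * norm (x k - l)) \<longlonglongrightarrow> 0" by simp
 have "norm (Phi (x k) - Phi l) \<le> (1/2 + L) * (norm (x k - l))\<^sup>2 + norm (gPhi l) * norm (x k - l)" for k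
  using Phi_quad[of "x k" l] Cauchy_Schwarz_ineq2[of "gPhi l" "x k - l"] by (auto simp: abs_le_iff)
 then have "(\<lambda>k. Phi (x k) - Phi l) \<longlonglongrightarrow> 0"
  by (intro tendsto_0_le[OF b, of _ 1]) (auto intro!: always_eventually order.trans[OF _ abs_ge_self])
 then show ?thesis by (simp add: LIM_zero_iff)
qed

lemma continuous_Phi: "continuous_on UNIV Phi"
 unfolding continuous_on_sequentially using Phi_tendsto by (auto simp: o_def)

lemma IH_nonneg: "0 \<le> IH x"
 unfolding IH_def by (rule Bochner_Integration.integral_nonneg) (rule H_nonneg)

lemma Phi_le: "Phi x \<le> (norm (Pp x))\<^sup>2 / 2"
 using IH_nonneg[of x] zero_le_power2[of "norm (Pm x)"] unfolding Phi_def diff_divide_distrib by linarith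

lemma PhiH_eq: "PhiH H (cf x) = ereal (Phi x)"
proof -
 have "(\<integral>\<^sup>+ t. ennreal (H (crv x t)) \<partial>I01) = ennreal (IH x)"
  unfolding IH_def by (rule nn_integral_eq_integral[OF H_integrable[OF L2_crv]]) (simp add: H_nonneg)
 then show ?thesis unfolding PhiH_cf by (simp add: Phi_def IH_nonneg)
qed

section \<open>Compactness of the gradient term and critical points\<close>

lemma gradH_seq_compact:
 assumes "\<And>k. norm (x k) \<le> R"
 obtains r l where "strict_mono (r :: nat => nat)" "\<And>j. (\<lambda>k. cf (x (r k)) j) \<longlonglongrightarrow> cf l j"
  "(\<lambda>k. gradH (x (r k))) \<longlonglongrightarrow> gradH l" "(\<lambda>k. l2 (crv (x (r k) - l))) \<longlonglongrightarrow> 0"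
proof -
 obtain r l where r: "strict_mono (r :: nat => nat)" "\<And>j. (\<lambda>k. cf (x (r k)) j) \<longlonglongrightarrow> cf l j"
  "(\<lambda>k. l2 (crv (x (r k) - l))) \<longlonglongrightarrow> 0" "norm l \<le> R"
  using hs_compact_L2_ex[of x R, OF assms] by blast
 have "(\<lambda>k. gradH (x (r k)) - gradH l) \<longlonglongrightarrow> 0"
  by (rule tendsto_0_le[OF r(3), of _ L])
   (use gradH_lipschitz_L2 in \<open>auto intro!: always_eventually simp: mult.commute abs_of_nonneg[OF l2_nonneg]\<close>)
 then have "(\<lambda>k. gradH (x (r k))) \<longlonglongrightarrow> gradH l" by (simp add: LIM_zero_iff)
 then show ?thesis using that r by blast
qed

lemma gradH_seq_compact_ex:
 assumes "\<And>k. norm (x k) \<le> R"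
 shows "\<exists>r l. strict_mono (r :: nat => nat) \<and> (\<forall>j. (\<lambda>k. cf (x (r k)) j) \<longlonglongrightarrow> cf l j) \<and>
  (\<lambda>k. gradH (x (r k))) \<longlonglongrightarrow> gradH l"
 by (rule gradH_seq_compact[of x R, OF assms]) blast

lemma relcpt_gradH: "relcpt (\<lambda>x u. gradH x)"
 unfolding relcpt_def
proof (intro allI impI)
 fix R and x :: "nat => 'n hs" and u :: "nat => real" assume "\<forall>k. norm (x k) \<le> R \<and> u k \<in> {0..1}"
 then have R: "norm (x k) \<le> R" for k by blast
 show "\<exists>r l. strict_mono (r :: nat => nat) \<and> (\<lambda>k. gradH (x (r k))) \<longlonglongrightarrow> l"
  by (rule gradH_seq_compact[of x R, OF R]) (intro exI conjI)
qed

lemma cf_Pz_tendsto: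
 fixes x :: "nat => 'n hs"
 assumes "(\<lambda>k. cf (x k) 0) \<longlonglongrightarrow> cf l 0" shows "(\<lambda>k. Pz (x k)) \<longlonglongrightarrow> Pz l"
proof -
 have n: "norm (Pz y) = norm (cf y 0)" for y :: "'n hs"
 proof -
  have "((\<lambda>j. wt j * (norm (cf (Pz y) j))\<^sup>2) has_sum (norm (cf y 0))\<^sup>2) UNIV"
   by (subst has_sum_cong_neutral[where T="{0}" and g="\<lambda>j. (norm (cf y 0))\<^sup>2"]) (auto intro: has_sum_finiteI)
  then have "(norm (Pz y))\<^sup>2 = (norm (cf y 0))\<^sup>2" using hs_norm_has_sum has_sum_unique by blast
  then show ?thesis by simp
 qed
 have "norm (Pz (x k) - Pz l) = norm (cf (x k) 0 - cf l 0)" for k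
  using n[of "x k - l"] by simp
 then show ?thesis using assms by (simp add: tendsto_iff dist_norm)
qed

text \<open>In Fourier coordinates the two signed projections and the weight combine to the factor
  \<open>frq j\<close>, the symbol of the derivative.\<close>

lemma critical_fcoeff:
 assumes "gPhi x = 0"
 shows "fst (fcoeff j (\<lambda>t. V (crv x t))) = (frq j) *\<^sub>R cf x j"
proof -
 have "cf (gPhi x) j = 0" using assms by simp
 then have e: "(if j > 0 then cf x j else 0) - (if j < 0 then cf x j else 0) = (1 / wt j) *\<^sub>R fst (fcoeff j (\<lambda>t. V (crv x t)))"
  by (simp add: gPhi_def gradH_def cf_rieszE[OF L2_V_crv])
 have "fst (fcoeff j (\<lambda>t. V (crv x t))) = wt j *\<^sub>R ((1 / wt j) *\<^sub>R fst (fcoeff j (\<lambda>t. V (crv x t))))"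
  using wt_pos[of j] by simp
 also have "\<dots> = (frq j) *\<^sub>R cf x j"
  unfolding e[symmetric] by (simp add: wt_def)
 finally show ?thesis .
qed

lemma critical_regular:
 assumes "gPhi x = 0"
 obtains z where "ham_loop V z" "AE t in I01. crv x t = z t"
 using weak_solution_regular[OF critical_fcoeff[OF assms]] by blast

text \<open>The quadratic part is half the pairing of its gradient with the loop. At a critical
  point the value is therefore the integral of a Legendre-type expression, which is constant along
  loops on a level of the gauge.\<close>

lemma Phi_eq_gradient:
 "Phi x = (gPhi x \<bullet> x) / 2 + (LINT t|I01. (V (crv x t) \<bullet> crv x t) / 2 - H (crv x t))"
proof -
 have int: "integrable I01 (\<lambda>t. H (crv x t))" "integrable I01 (\<lambda>t. V (crv x t) \<bullet> crv x t)"
  using H_integrable[OF L2_crv] L2_inner_integrable[OF L2_V_crv L2_crv] by auto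
 have "gradH x \<bullet> x = (LINT t|I01. V (crv x t) \<bullet> crv x t)"
  unfolding gradH_inner by (simp add: inner_commute)
 moreover have "gPhi x \<bullet> x = (norm (Pp x))\<^sup>2 - (norm (Pm x))\<^sup>2 - gradH x \<bullet> x"
  unfolding gPhi_def inner_diff_left P_inner_self(1)[of x x] P_inner_self(3)[of x x] by (simp add: power2_norm_eq_inner)
 ultimately show ?thesis using int by (simp add: Phi_def IH_def field_simps)
qed

section \<open>Explicit gradient steps as admissible deformations\<close>

definition step_size :: real where "step_size = 1 / (2 * (1 + L))"

text \<open>The last bound lets the quadratic error of a step consume at most half of the
  first-order gain; being below 1 keeps the factor of the minus part positive.\<close>

lemma step_size: "0 < step_size" "step_size < 1" "(1/2 + L) * step_size \<le> 1/2"
 using L_nonneg by (auto simp: step_size_def field_simps)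

lemma Phi_ascent:
 assumes "0 \<le> s" "s \<le> step_size"
 shows "Phi x + s / 2 * (norm (gPhi x))\<^sup>2 \<le> Phi (x + s *\<^sub>R gPhi x)"
proof -
 define N where "N = (norm (gPhi x))\<^sup>2"
 have N: "0 \<le> N" by (simp add: N_def)
 have "\<bar>Phi (x + s *\<^sub>R gPhi x) - Phi x - s * N\<bar> \<le> (1/2 + L) * (s\<^sup>2 * N)"
  using Phi_quad[of "x + s *\<^sub>R gPhi x" x] by (simp add: N_def power_mult_distrib power2_norm_eq_inner)
 moreover have "(1/2 + L) * (s\<^sup>2 * N) \<le> s / 2 * N"
 proof -
  have "(1/2 + L) * s \<le> 1/2"
   using step_size(3) mult_left_mono[OF assms(2), of "1/2 + L"] L_nonneg by linarith
  then have "((1/2 + L) * s) * (s * N) \<le> (1/2) * (s * N)" using assms(1) N by (intro mult_right_mono) auto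
  then show ?thesis by (simp add: power2_eq_square mult_ac)
 qed
 ultimately show ?thesis by (simp add: N_def abs_le_iff)
qed

text \<open>For positive \<open>\<beta>\<close> this is 0 up to \<open>\<beta> / 2\<close> and 1
  from \<open>\<beta>\<close> on: steps are taken in full where they are needed and switched off
  before \<open>Phi\<close> becomes nonpositive.\<close>

definition cutoff :: "real => real => real" where
 "cutoff \<beta> p = min 1 (max 0 (2 * p / \<beta> - 1))"

definition ascent :: "real => 'n hs => 'n hs" where
 "ascent \<beta> x = x + (step_size * cutoff \<beta> (Phi x)) *\<^sub>R gPhi x"

text \<open>A step multiplies the plus part by \<open>1 + \<theta>\<close> and the minus part by
  \<open>1 - \<theta>\<close>; the rest is a multiple of the compact \<open>gradH\<close>. The plus
  part cannot be lost: a step is trivial unless \<open>Phi\<close> is positive, it does not lower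
  \<open>Phi\<close>, and positive \<open>Phi\<close> forces a nonzero plus part.\<close>

lemma ascent_Gam:
 assumes "0 < \<beta>" shows "ascent \<beta> \<in> Gam"
proof -
 define \<theta> where "\<theta> x u = u * (step_size * cutoff \<beta> (Phi x))" for x :: "'n hs" and u
 have cut: "0 \<le> cutoff \<beta> p" "cutoff \<beta> p \<le> 1" for p by (auto simp: cutoff_def)
 have \<theta>: "0 \<le> \<theta> x u" "\<theta> x u \<le> step_size" if "u \<in> {0..1}" for x u
 proof -
  have c: "0 \<le> step_size * cutoff \<beta> (Phi x)" "step_size * cutoff \<beta> (Phi x) \<le> step_size"
   using cut[of "Phi x"] step_size by (auto intro: mult_left_le)
  then show "0 \<le> \<theta> x u" using that by (auto simp: \<theta>_def)
  have "u * (step_size * cutoff \<beta> (Phi x)) \<le> 1 * (step_size * cutoff \<beta> (Phi x))"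
   using that c by (intro mult_right_mono) auto
  then show "\<theta> x u \<le> step_size" using c by (simp add: \<theta>_def)
 qed
 have cP: "continuous_on (UNIV \<times> {0..1::real}) (\<lambda>p. Phi (fst p))"
  by (rule continuous_on_compose2[OF continuous_Phi]) (auto intro: continuous_intros)
 have cg: "continuous_on (UNIV \<times> {0..1::real}) (\<lambda>p. gradH (fst p))"
  by (rule continuous_on_compose2[OF continuous_gradH[of UNIV]]) (auto intro: continuous_intros)
 have c\<theta>: "cont2 \<theta>" unfolding cont2_def \<theta>_def cutoff_def
  using assms by (intro continuous_intros cP) auto
 define a where "a x u = 1 + \<theta> x u" for x u
 define c where "c x u = 1 - \<theta> x u" for x u
 define K where "K x u = (- \<theta> x u) *\<^sub>R gradH x" for x u
 have cont: "cont2 a" "cont2 c" "cont2 (\<lambda>(x :: 'n hs) u. 1)"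
  using c\<theta> unfolding cont2_def a_def c_def by (intro continuous_intros; simp)+
 have contK: "cont2 K"
  using c\<theta> cg unfolding cont2_def K_def by (intro continuous_intros) auto
 have pa: "posbdd a" "posbdd (\<lambda>(x :: 'n hs) u. 1)"
  unfolding posbdd_def a_def
 proof -
  have "1 \<le> 1 + \<theta> x u \<and> 1 + \<theta> x u \<le> 2" if "u \<in> {0..1}" for x u
   using \<theta>[OF that, of x] step_size by linarith
  then show "\<forall>R. \<exists>\<alpha> \<beta>. 0 < \<alpha> \<and> (\<forall>x. norm x \<le> R \<longrightarrow> (\<forall>u\<in>{0..1}. \<alpha> \<le> 1 + \<theta> x u \<and> 1 + \<theta> x u \<le> \<beta>))"
   by (intro allI exI[of _ 1] exI[of _ 2]) auto
  show "\<forall>R. \<exists>\<alpha> \<beta>. (0::real) < \<alpha> \<and> (\<forall>x :: 'n hs. norm x \<le> R \<longrightarrow> (\<forall>u\<in>{0..1::real}. \<alpha> \<le> 1 \<and> (1::real) \<le> \<beta>))"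
   by (intro allI exI[of _ 1] exI[of _ 2]) auto
 qed
 have pc: "posbdd c"
  unfolding posbdd_def c_def
 proof -
  have "1 - step_size \<le> 1 - \<theta> x u \<and> 1 - \<theta> x u \<le> 1" if "u \<in> {0..1}" for x u
   using \<theta>[OF that, of x] step_size by linarith
  then show "\<forall>R. \<exists>\<alpha> \<beta>. 0 < \<alpha> \<and> (\<forall>x. norm x \<le> R \<longrightarrow> (\<forall>u\<in>{0..1}. \<alpha> \<le> 1 - \<theta> x u \<and> 1 - \<theta> x u \<le> \<beta>))"
   using step_size by (intro allI exI[of _ "1 - step_size"] exI[of _ 1]) auto
 qed
 have rK: "relcpt K" unfolding K_def
 proof (rule relcpt_scaleR[OF _ relcpt_gradH])
  show "relcpt (\<lambda>x u. - \<theta> x u)"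
   by (rule relcpt_real) (use \<theta> in \<open>auto intro!: exI[of _ step_size]\<close>)
 qed
 have eq: "gmap a (\<lambda>x u. 1) c K u x = x + \<theta> x u *\<^sub>R gPhi x" for u x
  by (rule hs_eqI) (auto simp: gmap_def a_def c_def K_def gPhi_def algebra_simps)
 have nz: "\<forall>x. \<forall>u\<in>{0..1}. Pp x \<noteq> 0 \<longrightarrow> Pp (gmap a (\<lambda>x u. 1) c K u x) \<noteq> 0"
 proof (intro allI ballI impI)
  fix x :: "'n hs" and u :: real assume u: "u \<in> {0..1}" and x: "Pp x \<noteq> 0"
  show "Pp (gmap a (\<lambda>x u. 1) c K u x) \<noteq> 0"
  proof (cases "Phi x > 0")
   case False
   then have "2 * Phi x / \<beta> \<le> 0" using assms by (simp add: divide_le_0_iff)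
   then have "cutoff \<beta> (Phi x) = 0" by (simp add: cutoff_def)
   then show ?thesis using x unfolding eq by (simp add: \<theta>_def)
  next
   case True
   then have "0 < Phi (x + \<theta> x u *\<^sub>R gPhi x)"
    using Phi_ascent[OF \<theta>(1)[OF u] \<theta>(2)[OF u], of x x] \<theta>(1)[OF u, of x] zero_le_power2[of "norm (gPhi x)"]
    by (smt (verit) divide_nonneg_nonneg mult_nonneg_nonneg)
   then have "0 < (norm (Pp (x + \<theta> x u *\<^sub>R gPhi x)))\<^sup>2 / 2"
    using Phi_le order_less_le_trans by blast
   then show ?thesis unfolding eq by auto
  qed
 qed
 have e0: "\<forall>x. gmap a (\<lambda>x u. 1) c K 0 x = x" unfolding eq by (simp add: \<theta>_def)
 have e1: "\<forall>x. ascent \<beta> x = gmap a (\<lambda>x u. 1) c K 1 x" unfolding eq by (simp add: \<theta>_def ascent_def)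
 show ?thesis unfolding Gam_def mem_Collect_eq
  by (intro exI[of _ a] exI[of _ "\<lambda>x u. 1"] exI[of _ c] exI[of _ K] conjI)
   (fact cont contK pa pc rK nz e0 e1)+
qed

lemma Gam_funpow: "g \<in> Gam ==> h \<in> Gam ==> (\<lambda>x. (h ^^ m) (g x)) \<in> Gam"
proof (induction m)
 case (Suc m)
 then show ?case using Gam_compose[of "\<lambda>x. (h ^^ m) (g x)" h] by simp
qed simp

lemma ascent_step:
 assumes "0 < \<beta>" "\<beta> \<le> Phi x" shows "ascent \<beta> x = x + step_size *\<^sub>R gPhi x"
proof -
 have "1 \<le> 2 * Phi x / \<beta> - 1" using assms by (simp add: field_simps)
 then show ?thesis by (simp add: ascent_def cutoff_def)
qed

text \<open>The Euler scheme for the gradient flow of \<open>Phi\<close> replaces the flow: its norm grows at most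
 exponentially in the gain of \<open>Phi\<close>, so that the Cerami-type bound becomes uniform.\<close>

lemma ascent_reaches:
 assumes \<beta>: "0 < \<beta>" and B: "0 < B" and \<delta>: "0 < \<delta>"
  and cerami: "\<And>x. \<beta> \<le> Phi x ==> Phi x \<le> B ==> \<delta> \<le> (1 + norm x) * norm (gPhi x)"
 shows "\<exists>m. \<forall>x. norm x \<le> R \<and> \<beta> \<le> Phi x \<longrightarrow> B \<le> Phi ((ascent \<beta> ^^ m) x)"
proof -
 \<comment> \<open>\<open>R'\<close> bounds \<open>1 + norm\<close> of every iterate below the level
   \<open>B\<close>, since the total gain until then is at most \<open>B\<close>. The constant
   \<open>gain\<close> is the increase per step that the Cerami bound then guarantees.\<close>
 define R' where "R' = (1 + max 0 R) * exp (2 * B / \<delta>)"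
 have R': "0 < R'" by (simp add: R'_def add_pos_nonneg)
 define gain where "gain = step_size / 2 * (\<delta> / R')\<^sup>2"
 have gain: "0 < gain" using step_size \<delta> R' by (simp add: gain_def)
 obtain m :: nat where m: "B / gain < real m" using reals_Archimedean2 by blast
 have "B \<le> Phi ((ascent \<beta> ^^ m) x)" if x: "norm x \<le> R" "\<beta> \<le> Phi x" for x
 proof (rule ccontr)
  assume "\<not> ?thesis"
  then have less: "Phi ((ascent \<beta> ^^ m) x) < B" by simp
  define y where "y k = (ascent \<beta> ^^ k) x" for k
  have y0: "y 0 = x" and ySuc: "y (Suc k) = ascent \<beta> (y k)" for k by (simp_all add: y_def)
  have ge: "\<beta> \<le> Phi (y k) \<and> Phi (y k) + step_size / 2 * (norm (gPhi (y k)))\<^sup>2 \<le> Phi (y (Suc k))" for k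
  proof (induction k)
   case 0
   then show ?case using x Phi_ascent[of step_size x] step_size ascent_step[OF \<beta>, of x] by (simp add: y0 ySuc)
  next
   case (Suc k)
   then have "\<beta> \<le> Phi (y (Suc k))" using step_size by (smt (verit) divide_nonneg_nonneg mult_nonneg_nonneg zero_le_power2)
   then show ?case using Phi_ascent[of step_size "y (Suc k)"] step_size ascent_step[OF \<beta>] by (simp add: ySuc[of "Suc k"])
  qed
  have mono: "Phi (y k) \<le> Phi (y (Suc k))" for k
  proof -
   have "0 \<le> step_size / 2 * (norm (gPhi (y k)))\<^sup>2" using step_size by simp
   then show ?thesis using ge[of k] by linarith
  qed
  have monoL: "Phi (y k) \<le> Phi (y l)" if "k \<le> l" for k l
   using that by (rule lift_Suc_mono_le[of "\<lambda>k. Phi (y k)", OF mono])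
  have ltB: "Phi (y k) < B" if "k \<le> m" for k
   using monoL[OF that] less by (simp add: y_def)
  have norm_bound: "1 + norm (y k) \<le> (1 + norm x) * exp (2 / \<delta> * (Phi (y k) - Phi x))" if "k \<le> m" for k
   using that
  proof (induction k)
   case 0 then show ?case by (simp add: y0)
  next
   case (Suc k)
   define n d where "n = 1 + norm (y k)" and "d = norm (gPhi (y k))"
   have n: "1 \<le> n" by (simp add: n_def)
   have nd: "\<delta> \<le> n * d" unfolding n_def d_def using ge[of k] ltB[of k] Suc.prems by (intro cerami) auto
   have d0: "0 \<le> d" by (simp add: d_def)
   have "1 + norm (y (Suc k)) \<le> n + step_size * d"
    using ascent_step[OF \<beta>, of "y k"] ge[of k] norm_triangle_ineq[of "y k" "step_size *\<^sub>R gPhi (y k)"] step_size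
    by (simp add: ySuc n_def d_def)
   \<comment> \<open>The bound \<open>\<delta> \<le> n * d\<close> trades the factor
     \<open>d\<close> for \<open>n * d\<^sup>2 / \<delta>\<close>, and
     \<open>step_size * d\<^sup>2\<close> is paid for by the gain of \<open>Phi\<close>.\<close>
   also have "\<dots> \<le> n + n * (step_size * d\<^sup>2 / \<delta>)"
   proof -
    have "\<delta> * d \<le> (n * d) * d" using nd d0 by (rule mult_right_mono)
    then have "d \<le> n * d\<^sup>2 / \<delta>" using \<delta> by (simp add: field_simps power2_eq_square)
    then have "step_size * d \<le> step_size * (n * d\<^sup>2 / \<delta>)" using step_size by (intro mult_left_mono) auto
    then show ?thesis by (simp add: mult_ac)
   qed
   also have "\<dots> = n * (1 + step_size * d\<^sup>2 / \<delta>)" by (simp add: algebra_simps)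
   also have "\<dots> \<le> n * exp (step_size * d\<^sup>2 / \<delta>)"
    using n exp_ge_add_one_self[of "step_size * d\<^sup>2 / \<delta>"] by (intro mult_left_mono) auto
   also have "\<dots> \<le> n * exp (2 / \<delta> * (Phi (y (Suc k)) - Phi (y k)))"
   proof -
    have "step_size * d\<^sup>2 \<le> 2 * (Phi (y (Suc k)) - Phi (y k))" using ge[of k] by (simp add: d_def field_simps)
    then have "step_size * d\<^sup>2 / \<delta> \<le> 2 * (Phi (y (Suc k)) - Phi (y k)) / \<delta>" using \<delta> by (intro divide_right_mono) auto
    then show ?thesis using n by simp
   qed
   also have "\<dots> \<le> ((1 + norm x) * exp (2 / \<delta> * (Phi (y k) - Phi x))) * exp (2 / \<delta> * (Phi (y (Suc k)) - Phi (y k)))"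
    using Suc by (intro mult_right_mono) (auto simp: n_def)
   also have "\<dots> = (1 + norm x) * exp (2 / \<delta> * (Phi (y (Suc k)) - Phi x))"
    by (simp add: exp_add[symmetric] algebra_simps)
   finally show ?case .
  qed
  have gk: "Phi (y k) + gain \<le> Phi (y (Suc k))" if "k < m" for k
  proof -
   have "2 / \<delta> * (Phi (y k) - Phi x) \<le> 2 / \<delta> * B"
    using ltB[of k] that x \<beta> \<delta> by (intro mult_left_mono) auto
   then have "(1 + norm x) * exp (2 / \<delta> * (Phi (y k) - Phi x)) \<le> R'"
    unfolding R'_def using x by (intro mult_mono) (auto simp: add_nonneg_nonneg)
   then have nR: "1 + norm (y k) \<le> R'" using norm_bound[of k] that by linarith
   have "\<delta> \<le> (1 + norm (y k)) * norm (gPhi (y k))" using ge[of k] ltB[of k] that by (intro cerami) auto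
   also have "\<dots> \<le> R' * norm (gPhi (y k))" using nR by (intro mult_right_mono) auto
   finally have "\<delta> / R' \<le> norm (gPhi (y k))" using R' by (simp add: field_simps)
   then have "(\<delta> / R')\<^sup>2 \<le> (norm (gPhi (y k)))\<^sup>2" using \<delta> R' by (intro power_mono) auto
   then have "gain \<le> step_size / 2 * (norm (gPhi (y k)))\<^sup>2" unfolding gain_def using step_size by (intro mult_left_mono) auto
   then show ?thesis using ge[of k] by linarith
  qed
  have "Phi x + real k * gain \<le> Phi (y k)" if "k \<le> m" for k
   using that
  proof (induction k)
   case (Suc k)
   then show ?case using gk[of k] by (simp add: algebra_simps)
  qed (simp add: y0)
  from this[of m] have "Phi x + real m * gain \<le> Phi (y m)" by simp
  moreover have "B < real m * gain" using m gain by (simp add: field_simps)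
  ultimately show False using less x \<beta> by (simp add: y_def)
 qed
 then show ?thesis by blast
qed

text \<open>Norms on the starting sphere are bounded by \<open>\<epsilon> + norm q\<close>, so one
  number of steps serves all its points and the composition is a single admissible
  deformation.\<close>

theorem cEH_fun_lower:
 assumes "0 < \<beta>" "0 < B" "0 < \<delta>"
  and "\<And>x. \<beta> \<le> Phi x ==> Phi x \<le> B ==> \<delta> \<le> (1 + norm x) * norm (gPhi x)"
  and "0 < \<epsilon>" "Pz q = q" and start: "\<And>x. x \<in> Sp ==> \<beta> \<le> Phi (\<epsilon> *\<^sub>R x + q)"
 shows "ereal B \<le> cEH_fun H"
proof -
 obtain m where m: "\<And>x. norm x \<le> \<epsilon> + norm q ==> \<beta> \<le> Phi x ==> B \<le> Phi ((ascent \<beta> ^^ m) x)"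
  using ascent_reaches[OF assms(1-4), of "\<epsilon> + norm q"] by blast
 show ?thesis
 proof (rule cEH_fun_geI)
  show "(\<lambda>x. (ascent \<beta> ^^ m) (\<epsilon> *\<^sub>R x + q)) \<in> Gam"
   by (rule Gam_funpow[OF Gam_affine[OF assms(5,6)] ascent_Gam[OF assms(1)]])
  fix x :: "'n hs" assume x: "x \<in> Sp"
  have "norm (\<epsilon> *\<^sub>R x + q) \<le> \<epsilon> + norm q"
   using norm_triangle_ineq[of "\<epsilon> *\<^sub>R x" q] x assms(5) by (simp add: Sp_def)
  then show "ereal B \<le> PhiH H (cf ((ascent \<beta> ^^ m) (\<epsilon> *\<^sub>R x + q)))"
   unfolding PhiH_eq using m start[OF x] by simp
 qed
qed

text \<open>Along a sequence violating the bound \<open>Phi\<close> is nearly the integral of the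
  coercive expression, so the integrals of \<open>norm (crv x)\<close> stay bounded. If the norms in
  E were unbounded, a normalised subsequence would tend to 0 in \<open>l2\<close>, its gradient term
  with it, and all three parts would disappear, against norm 1. So the sequence is bounded,
  compactness of \<open>gradH\<close> lets a subsequence converge, and the limit is a forbidden
  critical point.\<close>

theorem cerami_bound:
 assumes "0 < \<kappa>" and coerc: "\<And>z. \<kappa> * norm z - C \<le> (V z \<bullet> z) / 2 - H z"
  and V0: "V 0 = 0"
  and nocrit: "\<And>x. gPhi x = 0 ==> \<beta> \<le> Phi x ==> Phi x \<le> B ==> False"
 shows "\<exists>\<delta>>0. \<forall>x. \<beta> \<le> Phi x \<and> Phi x \<le> B \<longrightarrow> \<delta> \<le> (1 + norm x) * norm (gPhi x)"
proof (rule ccontr)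
 assume neg: "\<not> ?thesis"
 have "\<exists>x. \<beta> \<le> Phi x \<and> Phi x \<le> B \<and> (1 + norm x) * norm (gPhi x) < 1 / real (Suc k)" for k
 proof -
  have "0 < 1 / real (Suc k)" by simp
  then show ?thesis using neg by (meson not_le)
 qed
 then obtain x where x: "\<And>k. \<beta> \<le> Phi (x k)" "\<And>k. Phi (x k) \<le> B" "\<And>k. (1 + norm (x k)) * norm (gPhi (x k)) < 1 / real (Suc k)"
  by metis
 have g_small: "norm (gPhi (x k)) \<le> 1 / real (Suc k)" for k
 proof -
  have "1 * norm (gPhi (x k)) \<le> (1 + norm (x k)) * norm (gPhi (x k))" by (intro mult_right_mono) auto
  then show ?thesis using x(3)[of k] by simp
 qed
 have gx: "norm (x k) * norm (gPhi (x k)) \<le> 1" "norm (gPhi (x k)) \<le> 1" for k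
 proof -
  have "1 / real (Suc k) \<le> 1" by simp
  then have "(1 + norm (x k)) * norm (gPhi (x k)) \<le> 1" using x(3)[of k] by linarith
  then have *: "norm (gPhi (x k)) + norm (x k) * norm (gPhi (x k)) \<le> 1" by (simp add: algebra_simps)
  have "0 \<le> norm (x k) * norm (gPhi (x k))" by simp
  then show "norm (x k) * norm (gPhi (x k)) \<le> 1" "norm (gPhi (x k)) \<le> 1"
   using * norm_ge_zero[of "gPhi (x k)"] by linarith+
 qed
 define C1 where "C1 = (\<bar>C\<bar> + \<bar>B\<bar> + 1) / \<kappa>"
 have L1: "(LINT t|I01. norm (crv (x k) t)) \<le> C1" for k
 proof -
  have int: "integrable I01 (\<lambda>t. (V (crv (x k) t) \<bullet> crv (x k) t) / 2 - H (crv (x k) t))"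
   using H_integrable[OF L2_crv] L2_inner_integrable[OF L2_V_crv L2_crv] by simp
  have intn: "integrable I01 (\<lambda>t. norm (crv (x k) t))" by (rule integrable_norm[OF L2_integrable[OF L2_crv]])
  have "\<kappa> * (LINT t|I01. norm (crv (x k) t)) - C = (LINT t|I01. \<kappa> * norm (crv (x k) t) - C)"
   using intn by simp
  also have "\<dots> \<le> (LINT t|I01. (V (crv (x k) t) \<bullet> crv (x k) t) / 2 - H (crv (x k) t))"
   using intn int coerc by (intro integral_mono) auto
  also have "\<dots> = Phi (x k) - (gPhi (x k) \<bullet> x k) / 2" using Phi_eq_gradient[of "x k"] by simp
  also have "\<dots> \<le> \<bar>B\<bar> + 1"
  proof -
   have "\<bar>gPhi (x k) \<bullet> x k\<bar> \<le> 1"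
    using Cauchy_Schwarz_ineq2[of "gPhi (x k)" "x k"] gx(1)[of k] by (simp add: mult.commute)
   then show ?thesis using x(2)[of k] by linarith
  qed
  finally have "\<kappa> * (LINT t|I01. norm (crv (x k) t)) \<le> \<bar>C\<bar> + \<bar>B\<bar> + 1" by linarith
  then show ?thesis unfolding C1_def using assms(1) by (simp add: field_simps)
 qed
 have "\<exists>R. \<forall>k. norm (x k) \<le> R"
 proof (rule ccontr)
  assume "\<not> ?thesis"
  then have "\<forall>m::nat. \<exists>k. real m < norm (x k)" by (meson not_le)
  then obtain f where f: "\<And>m::nat. real m < norm (x (f m))" by metis
  define w where "w m = x (f m)" for m
  have wpos: "0 < norm (w m)" and wm: "real m < norm (w m)" for m using f[of m] by (auto simp: w_def)
  define y where "y m = (1 / norm (w m)) *\<^sub>R w m" for m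
  have ny: "norm (y m) = 1" for m using wpos[of m] by (simp add: y_def)
  obtain r l where r: "strict_mono (r :: nat => nat)" "\<And>j. (\<lambda>k. cf (y (r k)) j) \<longlonglongrightarrow> cf l j"
   "(\<lambda>k. l2 (crv (y (r k) - l))) \<longlonglongrightarrow> 0" "norm l \<le> 1"
   using hs_compact_L2_ex[of y 1] ny by force
  have inv0: "(\<lambda>k. 1 / norm (w (r k))) \<longlonglongrightarrow> 0"
  proof (rule tendsto_0_le[where K=1])
   show "(\<lambda>k. 1 / real k) \<longlonglongrightarrow> 0" by (rule lim_1_over_n)
   show "\<forall>\<^sub>F k in sequentially. norm (1 / norm (w (r k))) \<le> norm (1 / real k) * 1"
    using eventually_gt_at_top[of 0]
   proof eventually_elim
    case (elim k)
    have "real k \<le> norm (w (r k))" using wm[of "r k"] seq_suble[OF r(1), of k] by linarith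
    then show ?case using elim by (simp add: frac_le)
   qed
  qed
  have yL1: "(LINT t|I01. norm (crv (y m) t)) \<le> C1 * (1 / norm (w m))" for m
  proof -
   have "(LINT t|I01. norm (crv (y m) t)) = (LINT t|I01. (1 / norm (w m)) * norm (crv (w m) t))"
    by (rule integral_cong_AE) (use crv_scaleR[of "1 / norm (w m)" "w m"] in \<open>auto simp: y_def elim: eventually_mono\<close>)
   also have "\<dots> = (1 / norm (w m)) * (LINT t|I01. norm (crv (w m) t))" by simp
   also have "\<dots> \<le> (1 / norm (w m)) * C1"
    unfolding w_def by (intro mult_left_mono L1) simp
   finally show ?thesis by (simp add: mult.commute)
  qed
  have l0: "(LINT t|I01. norm (crv l t)) \<le> l2 (crv (y (r k) - l)) + C1 * (1 / norm (w (r k)))" for k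
  proof -
   have i: "integrable I01 (\<lambda>t. norm (crv v t))" for v :: "'n hs" by (rule integrable_norm[OF L2_integrable[OF L2_crv]])
   have "AE t in I01. norm (crv l t) \<le> norm (crv (y (r k) - l) t) + norm (crv (y (r k)) t)"
    using crv_diff[of "y (r k)" l]
   proof eventually_elim
    case (elim t)
    then show ?case using norm_triangle_ineq4[of "crv (y (r k)) t" "crv (y (r k) - l) t"] by simp
   qed
   then have "(LINT t|I01. norm (crv l t)) \<le> (LINT t|I01. norm (crv (y (r k) - l) t) + norm (crv (y (r k)) t))"
    using i by (intro integral_mono_AE) auto
   also have "\<dots> = (LINT t|I01. norm (crv (y (r k) - l) t)) + (LINT t|I01. norm (crv (y (r k)) t))" using i by simp
   finally show ?thesis using integral_norm_le_l2[OF L2_crv, of "y (r k) - l"] yL1[of "r k"] by linarith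
  qed
  have "(\<lambda>k. l2 (crv (y (r k) - l)) + C1 * (1 / norm (w (r k)))) \<longlonglongrightarrow> 0 + C1 * 0"
   by (intro tendsto_intros r(3) inv0)
  then have "(LINT t|I01. norm (crv l t)) \<le> 0"
   using l0 by (intro LIMSEQ_le_const[where X="\<lambda>k. l2 (crv (y (r k) - l)) + C1 * (1 / norm (w (r k)))"]) auto
  moreover have "0 \<le> (LINT t|I01. norm (crv l t))" by simp
  ultimately have "(LINT t|I01. norm (crv l t)) = 0" by linarith
  then have "AE t in I01. norm (crv l t) = 0"
   by (subst (asm) integral_nonneg_eq_0_iff_AE) (use L2_integrable[OF L2_crv] in auto)
  then have "l2 (crv l) = l2 (\<lambda>t. 0 :: 'n st)" by (intro l2_cong_AE) auto
  then have l2l: "l2 (crv l) = 0" by (simp add: l2_def)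
  have yl2: "l2 (crv (y (r k))) \<le> l2 (crv (y (r k) - l))" for k
  proof -
   have "l2 (crv (y (r k))) = l2 (\<lambda>t. crv (y (r k) - l) t + crv l t)"
    by (intro l2_cong_AE L2_measurable L2_crv L2_add)
     (use crv_diff[of "y (r k)" l] in eventually_elim, simp)
   also have "\<dots> \<le> l2 (crv (y (r k) - l)) + l2 (crv l)" by (intro l2_triangle L2_crv)
   finally show ?thesis using l2l by simp
  qed
  have gradle: "norm (gradH v) \<le> L * l2 (crv v)" for v
  proof -
   have "norm (gradH v) \<le> l2 (\<lambda>t. V (crv v t))" unfolding gradH_def by (rule norm_rieszE_le[OF L2_V_crv])
   also have "\<dots> \<le> L * l2 (crv v)"
    using V_lipschitz[of _ 0] V0 L_nonneg by (intro l2_mono L2_V_crv L2_crv) auto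
   finally show ?thesis .
  qed
  \<comment> \<open>The first square bounds the plus and minus parts, through the small gradient and
    the linear growth of \<open>gradH\<close>; the second bounds the zero part. Both tend to
    0.\<close>
  have ubound: "1 \<le> (1 / norm (w (r k)) + L * l2 (crv (y (r k) - l)))\<^sup>2 + (l2 (crv (y (r k) - l)))\<^sup>2" for k
  proof -
   let ?y = "y (r k)" and ?w = "w (r k)" and ?n = "norm (w (r k))" and ?l = "l2 (crv (y (r k) - l))"
   have "l2 (crv ?w) = ?n * l2 (crv ?y)"
   proof -
    have "?w = ?n *\<^sub>R ?y" using wpos[of "r k"] by (simp add: y_def)
    then have "AE t in I01. crv ?w t = ?n *\<^sub>R crv ?y t" using crv_scaleR[of ?n ?y] by simp
    then have "l2 (crv ?w) = l2 (\<lambda>t. ?n *\<^sub>R crv ?y t)" by (intro l2_cong_AE L2_measurable L2_crv L2_scaleR)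
    then show ?thesis by (simp add: l2_scaleR)
   qed
   then have gw: "norm (gradH ?w) \<le> ?n * (L * l2 (crv ?y))" using gradle[of ?w] by (simp add: mult_ac)
   have "norm (Pp ?w - Pm ?w) \<le> norm (gPhi ?w) + norm (gradH ?w)"
    using norm_triangle_ineq[of "gPhi ?w" "gradH ?w"] by (simp add: gPhi_def)
   then have "norm (Pp ?w - Pm ?w) \<le> 1 + ?n * (L * l2 (crv ?y))"
    using gw gx(2)[of "f (r k)"] by (simp add: w_def)
   then have "(1 / ?n) * norm (Pp ?w - Pm ?w) \<le> (1 / ?n) * (1 + ?n * (L * l2 (crv ?y)))"
    using wpos[of "r k"] by (intro mult_left_mono) auto
   moreover have "(1 / ?n) * norm (Pp ?w - Pm ?w) = norm (Pp ?y - Pm ?y)"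
   proof -
    have "Pp ?y - Pm ?y = (1 / ?n) *\<^sub>R (Pp ?w - Pm ?w)" by (simp add: y_def scaleR_diff_right)
    then show ?thesis by simp
   qed
   moreover have "(1 / ?n) * (1 + ?n * (L * l2 (crv ?y))) = 1 / ?n + L * l2 (crv ?y)"
    using wpos[of "r k"] by (simp add: field_simps)
   ultimately have 1: "norm (Pp ?y - Pm ?y) \<le> 1 / ?n + L * ?l"
    using mult_left_mono[OF yl2[of k] L_nonneg] by linarith
   have 2: "norm (Pz ?y) \<le> ?l"
   proof -
    have "(norm (Pz ?y))\<^sup>2 = (norm (cf ?y 0))\<^sup>2"
    proof -
     have "((\<lambda>j. wt j * (norm (cf (Pz ?y) j))\<^sup>2) has_sum (norm (cf ?y 0))\<^sup>2) UNIV"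
      by (subst has_sum_cong_neutral[where T="{0}" and g="\<lambda>j. (norm (cf ?y 0))\<^sup>2"]) (auto intro: has_sum_finiteI)
     then show ?thesis using hs_norm_has_sum has_sum_unique by blast
    qed
    then have "norm (Pz ?y) = norm (cf ?y 0)" by simp
    also have "\<dots> \<le> l2 (crv ?y)" using norm_fcoeff_le[OF L2_crv, of 0 ?y] by simp
    finally show ?thesis using yl2[of k] by linarith
   qed
   have "1 = (norm ?y)\<^sup>2" using ny by simp
   also have "\<dots> = (norm (Pp ?y - Pm ?y))\<^sup>2 + (norm (Pz ?y))\<^sup>2"
    unfolding norm_P_sq[of ?y] by (simp add: power2_norm_eq_inner inner_diff_left inner_diff_right)
   also have "\<dots> \<le> (1 / ?n + L * ?l)\<^sup>2 + ?l\<^sup>2"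
    using 1 2 by (intro add_mono power_mono) auto
   finally show ?thesis .
  qed
  have "(\<lambda>k. (1 / norm (w (r k)) + L * l2 (crv (y (r k) - l)))\<^sup>2 + (l2 (crv (y (r k) - l)))\<^sup>2) \<longlonglongrightarrow> (0 + L * 0)\<^sup>2 + 0\<^sup>2"
   by (intro tendsto_intros r(3) inv0)
  then have "1 \<le> (0 + L * 0)\<^sup>2 + (0::real)\<^sup>2"
   by (rule LIMSEQ_le_const) (use ubound in blast)
  then show False by simp
 qed
 then obtain R where R: "\<And>k. norm (x k) \<le> R" by blast
 obtain r l where r: "strict_mono (r :: nat => nat)" "\<And>j. (\<lambda>k. cf (x (r k)) j) \<longlonglongrightarrow> cf l j"
  "(\<lambda>k. gradH (x (r k))) \<longlonglongrightarrow> gradH l" using gradH_seq_compact_ex[of x R, OF R] by blast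
 have g0: "(\<lambda>k. gPhi (x (r k))) \<longlonglongrightarrow> 0"
 proof (rule tendsto_0_le[where K=1])
  show "(\<lambda>k. 1 / real (Suc k)) \<longlonglongrightarrow> 0" using LIMSEQ_inverse_real_of_nat by (simp add: inverse_eq_divide)
  have "norm (gPhi (x (r k))) \<le> 1 / real (Suc k)" for k
  proof -
   have "1 / real (Suc (r k)) \<le> 1 / real (Suc k)" using seq_suble[OF r(1), of k] by (simp add: frac_le)
   then show ?thesis using g_small[of "r k"] by linarith
  qed
  then show "\<forall>\<^sub>F k in sequentially. norm (gPhi (x (r k))) \<le> norm (1 / real (Suc k)) * 1" by simp
 qed
 \<comment> \<open>The full gradient tends to 0, so the plus and minus parts follow the convergent
   \<open>gradH\<close>; the zero part converges with its single coefficient.\<close>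
 have D: "(\<lambda>k. Pp (x (r k)) - Pm (x (r k))) \<longlonglongrightarrow> gradH l"
  using tendsto_add[OF g0 r(3)] by (simp add: gPhi_def)
 have "(\<lambda>k. Pp (x (r k))) \<longlonglongrightarrow> Pp (gradH l)" using tendsto_P(1)[OF D] by simp
 moreover have "(\<lambda>k. Pm (x (r k))) \<longlonglongrightarrow> - Pm (gradH l)" using tendsto_minus[OF tendsto_P(3)[OF D]] by simp
 moreover have "(\<lambda>k. Pz (x (r k))) \<longlonglongrightarrow> Pz l" by (rule cf_Pz_tendsto[OF r(2)])
 ultimately have "(\<lambda>k. Pp (x (r k)) + Pz (x (r k)) + Pm (x (r k))) \<longlonglongrightarrow> Pp (gradH l) + Pz l + - Pm (gradH l)"
  by (intro tendsto_add)
 then obtain l' where l': "(\<lambda>k. x (r k)) \<longlonglongrightarrow> l'" unfolding P_decomp[symmetric] by blast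
 have "(\<lambda>k. gPhi (x (r k))) \<longlonglongrightarrow> gPhi l'"
  by (rule continuous_on_tendsto_compose[OF continuous_gPhi[of UNIV] l']) auto
 then have "gPhi l' = 0" using g0 LIMSEQ_unique by blast
 moreover have "\<beta> \<le> Phi l'" by (rule LIMSEQ_le_const[OF Phi_tendsto[OF l']]) (use x in blast)
 moreover have "Phi l' \<le> B" by (rule LIMSEQ_le_const2[OF Phi_tendsto[OF l']]) (use x in blast)
 ultimately show False by (rule nocrit)
qed

section \<open>Positivity of the action on a small sphere of E+\<close>

lemma trunc_pointwise:
 fixes x :: "'n hs"
 assumes "norm x \<le> 1" shows "AE t in I01. norm (crv (trunc N x) t) \<le> real (2 * N + 1)"
proof -
 have "AE t in I01. crv (trunc N x) t = fsum {-int N..int N} (\<lambda>j. (cf x j, 0)) t"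
  by (rule crv_eqI) (auto simp: L2_fsum fcoeff_fsum zero_prod_def)
 then show ?thesis
 proof eventually_elim
  case (elim t)
  have "norm (crv (trunc N x) t) \<le> (\<Sum>j\<in>{-int N..int N}. norm (fmode j (cf x j, 0 :: real^'n) t))"
   unfolding elim fsum_def by (rule norm_sum)
  also have "\<dots> \<le> (\<Sum>j\<in>{-int N..int N}. 1)"
   using norm_cf_le[of x] assms by (intro sum_mono) (auto intro: order.trans)
  finally show ?case by simp
 qed
qed

text \<open>Elements of the sphere are not uniformly bounded functions, so a small radius does not
  keep the loop inside the zero region of \<open>H\<close>. The low modes are bounded; wherever the
  loop leaves the ball of radius \<open>r\<close>, the high modes make up at least half of it, and
  these are small in \<open>l2\<close>. At least half of the quadratic term
  \<open>\<epsilon>\<^sup>2 / 2\<close> survives.\<close>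

theorem small_sphere:
 assumes "0 < r" "0 \<le> C" and near: "\<And>w. norm w < r ==> H ((q, 0) + w) = 0"
  and quad: "\<And>w. H ((q, 0) + w) \<le> C * (norm w)\<^sup>2"
 obtains \<epsilon> \<beta> Q where "0 < \<epsilon>" "0 < \<beta>" "Pz Q = Q" "\<And>x. x \<in> Sp ==> \<beta> \<le> Phi (\<epsilon> *\<^sub>R x + Q)"
proof -
 obtain Q :: "'n hs" where PQ: "Pz Q = Q" and crvQ: "AE t in I01. crv Q t = (q, 0)" using const_element by blast
 \<comment> \<open>By \<open>tail_estimate\<close> this makes \<open>16 * C\<close> times the
   squared \<open>l2\<close> tail at most 1.\<close>
 obtain N :: nat where N: "8 * C < real N" using reals_Archimedean2 by blast
 define M where "M = real (2 * N + 1)"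
 have M: "1 \<le> M" by (simp add: M_def)
 \<comment> \<open>\<open>M\<close> bounds the low modes pointwise; with this
   \<open>\<epsilon>\<close>, leaving the ball means that \<open>norm v\<close> is at least
   \<open>2 * M\<close>.\<close>
 define \<epsilon> where "\<epsilon> = r / (2 * M)"
 have \<epsilon>: "0 < \<epsilon>" using assms(1) M by (simp add: \<epsilon>_def)
 have "\<epsilon>\<^sup>2 / 4 \<le> Phi (\<epsilon> *\<^sub>R x + Q)" if x: "x \<in> Sp" for x
 proof -
  have nx: "norm x = 1" "Pp x = x" using x by (auto simp: Sp_def)
  let ?T = "crv (x - trunc N x)"
  have "AE t in I01. H (crv (\<epsilon> *\<^sub>R x + Q) t) \<le> 4 * C * \<epsilon>\<^sup>2 * (norm (?T t))\<^sup>2"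
   using crv_add[of "\<epsilon> *\<^sub>R x" Q] crv_scaleR[of \<epsilon> x] crvQ trunc_pointwise[OF eq_refl[OF nx(1)], of N] crv_diff[of x "trunc N x"]
  proof eventually_elim
   case (elim t)
   define v where "v = crv x t"
   have e: "crv (\<epsilon> *\<^sub>R x + Q) t = (q, 0) + \<epsilon> *\<^sub>R v" using elim by (simp add: v_def)
   have tr: "norm (crv (trunc N x) t) \<le> M" using elim nx by (simp add: M_def)
   show ?case
   proof (cases "norm (\<epsilon> *\<^sub>R v) < r")
    case True
    then show ?thesis using near[OF True] assms(2) unfolding e by simp
   next
    case False
    then have "r \<le> \<epsilon> * norm v" using \<epsilon> by simp
    then have "2 * M \<le> norm v" using assms(1) M by (simp add: \<epsilon>_def field_simps)
    moreover have "norm v \<le> norm (crv (trunc N x) t) + norm (?T t)"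
     using norm_triangle_ineq[of "crv (trunc N x) t" "?T t"] elim by (simp add: v_def)
    ultimately have "norm v \<le> 2 * norm (?T t)" using tr by linarith
    then have "(norm v)\<^sup>2 \<le> (2 * norm (?T t))\<^sup>2" by (intro power_mono) auto
    then have "C * \<epsilon>\<^sup>2 * (norm v)\<^sup>2 \<le> C * \<epsilon>\<^sup>2 * (2 * norm (?T t))\<^sup>2" using assms(2) by (intro mult_left_mono) auto
    then show ?thesis using quad[of "\<epsilon> *\<^sub>R v"] unfolding e by (simp add: power_mult_distrib mult_ac)
   qed
  qed
  then have "IH (\<epsilon> *\<^sub>R x + Q) \<le> (LINT t|I01. 4 * C * \<epsilon>\<^sup>2 * (norm (?T t))\<^sup>2)"
   unfolding IH_def using H_integrable[OF L2_crv] L2_crv[of "x - trunc N x"] by (intro integral_mono_AE) (auto simp: L2_def)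
  also have "\<dots> = 4 * C * \<epsilon>\<^sup>2 * (l2 ?T)\<^sup>2" by (simp add: l2_power2)
  also have "\<dots> \<le> \<epsilon>\<^sup>2 / 4"
  proof -
   have "2 * pi * real (Suc N) * (l2 ?T)\<^sup>2 \<le> (norm (x - trunc N x))\<^sup>2" by (rule tail_estimate) simp
   also have "\<dots> \<le> 1" using norm_diff_trunc_le[of x N] nx power_mono[of "norm (x - trunc N x)" 1 2] by simp
   finally have t1: "2 * pi * real (Suc N) * (l2 ?T)\<^sup>2 \<le> 1" .
   have "16 * C \<le> 2 * pi * real (Suc N)"
   proof -
    have "2 * real N \<le> 2 * pi * real (Suc N)" using pi_gt3 by (intro mult_mono) auto
    then show ?thesis using N by linarith
   qed
   then have "16 * C * (l2 ?T)\<^sup>2 \<le> 2 * pi * real (Suc N) * (l2 ?T)\<^sup>2" by (intro mult_right_mono) auto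
   then have "16 * C * (l2 ?T)\<^sup>2 \<le> 1" using t1 by linarith
   then have "(\<epsilon>\<^sup>2 / 4) * (16 * C * (l2 ?T)\<^sup>2) \<le> (\<epsilon>\<^sup>2 / 4) * 1" by (intro mult_left_mono) auto
   then show ?thesis by (simp add: mult_ac)
  qed
  finally have I: "IH (\<epsilon> *\<^sub>R x + Q) \<le> \<epsilon>\<^sup>2 / 4" .
  have "Pp Q = 0" "Pm Q = 0" using PQ by (metis P_idem(4), metis P_idem(9))
  moreover have "Pm x = 0" using nx(2) by (metis P_idem(8))
  ultimately have "Phi (\<epsilon> *\<^sub>R x + Q) = \<epsilon>\<^sup>2 / 2 - IH (\<epsilon> *\<^sub>R x + Q)"
   using nx by (simp add: Phi_def power_mult_distrib)
  then show ?thesis using I by simp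
 qed
 moreover have "0 < \<epsilon>\<^sup>2 / 4" using \<epsilon> by simp
 ultimately show ?thesis using that \<epsilon> PQ by blast
qed

end

section \<open>Squared gauges and their periodic characteristics\<close>

lemma lipschitz_gradient_quadratic:
 fixes H :: "'a::euclidean_space => real"
 assumes der: "\<And>z. (H has_derivative (\<lambda>h. V z \<bullet> h)) (at z)"
  and lip: "\<And>z w. norm (V z - V w) \<le> L * norm (z - w)" and L: "0 \<le> L"
 shows "\<bar>H w - H z - V z \<bullet> (w - z)\<bar> \<le> L * (norm (w - z))\<^sup>2"
proof -
 define d where "d = w - z"
 define k where "k t = H (z + t *\<^sub>R d)" for t
 have k': "(k has_real_derivative V (z + t *\<^sub>R d) \<bullet> d) (at t)" for t
 proof -
  have "((\<lambda>t. z + t *\<^sub>R d) has_derivative (\<lambda>s. s *\<^sub>R d)) (at t)"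
   by (auto intro!: derivative_eq_intros)
  from diff_chain_at[OF this der]
  have "(k has_derivative ((\<lambda>h. V (z + t *\<^sub>R d) \<bullet> h) \<circ> (\<lambda>s. s *\<^sub>R d))) (at t)"
   by (simp add: k_def[abs_def] o_def)
  moreover have "((\<lambda>h. V (z + t *\<^sub>R d) \<bullet> h) \<circ> (\<lambda>s. s *\<^sub>R d)) = (*) (V (z + t *\<^sub>R d) \<bullet> d)"
   by (auto simp: o_def)
  ultimately show ?thesis by (simp add: has_field_derivative_def)
 qed
 obtain \<xi> where \<xi>: "0 < \<xi>" "\<xi> < 1" "k 1 - k 0 = (1 - 0) * (V (z + \<xi> *\<^sub>R d) \<bullet> d)"
  using MVT2[of 0 1 k "\<lambda>t. V (z + t *\<^sub>R d) \<bullet> d"] k' by auto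
 then have "H w - H z - V z \<bullet> d = (V (z + \<xi> *\<^sub>R d) - V z) \<bullet> d"
  by (simp add: k_def d_def inner_diff_left)
 also have "\<bar>\<dots>\<bar> \<le> norm (V (z + \<xi> *\<^sub>R d) - V z) * norm d" by (rule Cauchy_Schwarz_ineq2)
 also have "\<dots> \<le> (L * norm (\<xi> *\<^sub>R d)) * norm d"
  using lip[of "z + \<xi> *\<^sub>R d" z] by (intro mult_right_mono) auto
 also have "\<dots> \<le> (L * norm d) * norm d"
  using \<xi> L by (intro mult_right_mono mult_left_mono) (auto intro: mult_left_le_one_le)
 finally show ?thesis by (simp add: d_def power2_eq_square mult_ac)
qed

text \<open>For \<open>f = prof \<Lambda> \<rho>\<close> the difference \<open>s f'(s) - f(s)\<close> is nonpositive for \<open>s \<le> 1\<close> and at least \<open>f'(s)\<close> for \<open>s \<ge> 1\<close>: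
 a loop at level \<open>G = s\<close> that is critical for \<open>f \<circ> G\<close> with positive value has multiplier \<open>f'(s)\<close> at most that value.\<close>

definition up :: "real => real => real" where "up \<rho> s = max 0 (s - 1 - \<rho>)"
definition lo :: "real => real => real" where "lo \<rho> s = max 0 (1 - \<rho> - s)"
definition prof :: "real => real => real => real" where
 "prof \<Lambda> \<rho> s = \<Lambda> * ((sqrt (1 + up \<rho> s) - 1)\<^sup>2 + (lo \<rho> s)\<^sup>2)"
definition dprof :: "real => real => real => real" where
 "dprof \<Lambda> \<rho> s = \<Lambda> * ((1 - 1 / sqrt (1 + up \<rho> s)) - 2 * lo \<rho> s)"

lemma up_nonneg: "0 \<le> up \<rho> s" and lo_nonneg: "0 \<le> lo \<rho> s" by (simp_all add: up_def lo_def)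

lemma sqrt_up: "1 \<le> sqrt (1 + up \<rho> s)" using up_nonneg[of \<rho> s] by simp

text \<open>The quadratic estimate holds across the kink at 0, so no one-sided derivatives have to
  be compared.\<close>

lemma DERIV_max_square: "((\<lambda>s::real. (max 0 s)\<^sup>2) has_real_derivative 2 * max 0 s) (at s)"
proof -
 have "((\<lambda>s::real. (max 0 s)\<^sup>2) has_derivative (\<lambda>h. (2 * max 0 s) \<bullet> h)) (at s)"
 proof (rule quadratic_approx_has_derivative[where C=1])
  fix w :: real
  have "\<bar>(max 0 w)\<^sup>2 - (max 0 s)\<^sup>2 - (2 * max 0 s) * (w - s)\<bar> \<le> (w - s)\<^sup>2"
  proof -
   consider "0 \<le> w" "0 \<le> s" | "w < 0" "s < 0" | "0 \<le> w" "s < 0" | "w < 0" "0 \<le> s" by linarith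
   then show ?thesis
   proof cases
    case 1
    then have "(max 0 w)\<^sup>2 - (max 0 s)\<^sup>2 - (2 * max 0 s) * (w - s) = (w - s)\<^sup>2"
     by (simp add: power2_eq_square algebra_simps)
    then show ?thesis by simp
   next
    case 3
    then have "w\<^sup>2 \<le> (w - s)\<^sup>2" by (intro power_mono) auto
    then show ?thesis using 3 by simp
   next
    case 4
    have "(w - s)\<^sup>2 = w\<^sup>2 + (s\<^sup>2 + 2 * s * (- w))" by (simp add: power2_eq_square algebra_simps)
    moreover have "\<bar>- s\<^sup>2 - 2 * s * (w - s)\<bar> = s\<^sup>2 + 2 * s * (- w)"
    proof -
     have "- s\<^sup>2 - 2 * s * (w - s) = s\<^sup>2 + 2 * s * (- w)" by (simp add: power2_eq_square algebra_simps)
     moreover have "0 \<le> s\<^sup>2 + 2 * s * (- w)" using 4 by (intro add_nonneg_nonneg mult_nonneg_nonneg) auto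
     ultimately show ?thesis by simp
    qed
    ultimately show ?thesis using 4 by simp
   qed auto
  qed
  then show "\<bar>(max 0 w)\<^sup>2 - (max 0 s)\<^sup>2 - (2 * max 0 s) \<bullet> (w - s)\<bar> \<le> 1 * (norm (w - s))\<^sup>2" by simp
 qed
 moreover have "(\<lambda>h. (2 * max 0 s) \<bullet> h) = (*) (2 * max 0 s)" by auto
 ultimately show ?thesis by (simp add: has_field_derivative_def)
qed

lemma DERIV_sqrt_max_square:
 "((\<lambda>s::real. (sqrt (1 + max 0 s) - 1)\<^sup>2) has_real_derivative (1 - 1 / sqrt (1 + max 0 s))) (at s)"
proof -
 consider "s < 0" | "s > 0" | "s = 0" by linarith
 then show ?thesis
 proof cases
  case 1
  have "((\<lambda>s::real. 0) has_real_derivative 0) (at s)" by simp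
  then have "((\<lambda>s::real. (sqrt (1 + max 0 s) - 1)\<^sup>2) has_real_derivative 0) (at s)"
   by (rule has_field_derivative_transform_within_open[where S="{..<0}"]) (use 1 in auto)
  then show ?thesis using 1 by simp
 next
  case 2
  have "((\<lambda>s::real. (sqrt (1 + s) - 1)\<^sup>2) has_real_derivative (1 - 1 / sqrt (1 + s))) (at s)"
   using 2 by (auto intro!: derivative_eq_intros simp: field_simps)
  then have "((\<lambda>s::real. (sqrt (1 + max 0 s) - 1)\<^sup>2) has_real_derivative (1 - 1 / sqrt (1 + s))) (at s)"
   by (rule has_field_derivative_transform_within_open[where S="{0<..}"]) (use 2 in auto)
  then show ?thesis using 2 by simp
 next
  case 3
  have "((\<lambda>s::real. (sqrt (1 + max 0 s) - 1)\<^sup>2) has_derivative (\<lambda>h. 0 \<bullet> h)) (at 0)"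
  proof (rule quadratic_approx_has_derivative[where C=1])
   fix w :: real
   have "sqrt (1 + M) \<le> 1 + M" if "0 \<le> M" for M :: real
    using that by (intro real_le_lsqrt) (auto simp: power2_eq_square algebra_simps)
   then have "sqrt (1 + max 0 w) \<le> 1 + max 0 w" by simp
   then have "(sqrt (1 + max 0 w) - 1)\<^sup>2 \<le> (max 0 w)\<^sup>2" by (intro power_mono) auto
   also have "\<dots> \<le> w\<^sup>2" by (auto simp: max_def)
   finally show "\<bar>(sqrt (1 + max 0 w) - 1)\<^sup>2 - (sqrt (1 + max 0 0) - 1)\<^sup>2 - 0 \<bullet> (w - 0)\<bar> \<le> 1 * (norm (w - 0))\<^sup>2"
    by simp
  qed
  moreover have "(\<lambda>h::real. 0 \<bullet> h) = (*) 0" by auto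
  ultimately show ?thesis using 3 by (simp add: has_field_derivative_def)
 qed
qed

lemma prof_DERIV: "(prof \<Lambda> \<rho> has_real_derivative dprof \<Lambda> \<rho> s) (at s)"
proof -
 have 1: "((\<lambda>s. (sqrt (1 + up \<rho> s) - 1)\<^sup>2) has_real_derivative (1 - 1 / sqrt (1 + up \<rho> s)) * 1) (at s)"
  unfolding up_def
  by (rule DERIV_chain2[OF DERIV_sqrt_max_square]) (auto intro!: derivative_eq_intros)
 have 2: "((\<lambda>s. (lo \<rho> s)\<^sup>2) has_real_derivative (2 * lo \<rho> s) * (-1)) (at s)"
  unfolding lo_def
  by (rule DERIV_chain2[OF DERIV_max_square]) (auto intro!: derivative_eq_intros)
 show ?thesis unfolding prof_def[abs_def] dprof_def
  using DERIV_cmult[OF DERIV_add[OF 1 2], of \<Lambda>] by (simp add: algebra_simps)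
qed

lemma prof_nonneg: "0 < \<Lambda> ==> 0 \<le> prof \<Lambda> \<rho> s"
 unfolding prof_def by (intro mult_nonneg_nonneg add_nonneg_nonneg) auto

text \<open>The slope \<open>\<Lambda> / 2\<close> in place of \<open>\<Lambda>\<close> absorbs the
  square root. The bound serves the finiteness of the capacity in
  \<open>cEH_fun_prof_finite\<close>.\<close>

lemma prof_growth:
 assumes "0 < \<Lambda>" "\<rho> < 1" shows "\<Lambda> * (s / 2 - 3/2) \<le> prof \<Lambda> \<rho> s"
proof -
 define w where "w = sqrt (1 + up \<rho> s)"
 have w: "1 \<le> w" "w\<^sup>2 = 1 + up \<rho> s" using sqrt_up[of \<rho> s] up_nonneg[of \<rho> s] by (auto simp: w_def)
 have "s - 2 \<le> up \<rho> s" using assms(2) by (simp add: up_def)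
 then have "s - 1 \<le> w\<^sup>2" using w by simp
 moreover have "w\<^sup>2 / 2 - 1 \<le> (w - 1)\<^sup>2"
  using zero_le_power2[of "w - 2"] by (simp add: power2_eq_square field_simps)
 ultimately have "s / 2 - 3/2 \<le> (w - 1)\<^sup>2" by linarith
 then have "s / 2 - 3/2 \<le> (w - 1)\<^sup>2 + (lo \<rho> s)\<^sup>2" using zero_le_power2[of "lo \<rho> s"] by linarith
 then show ?thesis unfolding prof_def w_def[symmetric] using assms(1) by (intro mult_left_mono) auto
qed

text \<open>This is the purpose of the square root in \<open>prof\<close>: the slope stays below
  \<open>\<Lambda>\<close>, yet the Legendre expression grows at least like \<open>sqrt s\<close>,
  that is, linearly in \<open>norm z\<close> at \<open>s = G z\<close>.\<close>

lemma prof_legendre_coercive: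
 assumes "0 < \<Lambda>" "0 < \<rho>" "\<rho> < 1" "0 \<le> s"
 shows "\<Lambda> * (sqrt s - 5) \<le> dprof \<Lambda> \<rho> s * s - prof \<Lambda> \<rho> s"
proof (cases "s \<ge> 1 + \<rho>")
 case True
 define w where "w = sqrt (1 + up \<rho> s)"
 have l0: "lo \<rho> s = 0" using True assms(2) by (simp add: lo_def)
 have u: "up \<rho> s = s - 1 - \<rho>" using True by (simp add: up_def)
 have w: "1 \<le> w" using sqrt_up by (simp add: w_def)
 have s: "s = w\<^sup>2 + \<rho>" using u up_nonneg[of \<rho> s] by (simp add: w_def)
 have "sqrt s \<le> w + 2"
 proof (rule real_le_lsqrt)
  have "w\<^sup>2 + \<rho> \<le> w\<^sup>2 + 4 * w + 4" using w assms(3) by linarith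
  then show "s \<le> (w + 2)\<^sup>2" using s by (simp add: power2_eq_square algebra_simps)
 qed (use w in auto)
 moreover have "(1 - 1 / w) * s - (w - 1)\<^sup>2 \<ge> w - 1"
 proof -
  have "(1 - 1 / w) * s - (w - 1)\<^sup>2 = w + \<rho> - 1 - \<rho> / w"
   unfolding s using w by (simp add: power2_eq_square field_simps)
  moreover have "\<rho> / w \<le> \<rho>" using w assms(2) by (simp add: divide_le_eq)
  ultimately show ?thesis by linarith
 qed
 ultimately have "sqrt s - 5 \<le> (1 - 1 / w) * s - (w - 1)\<^sup>2" by linarith
 then have "\<Lambda> * (sqrt s - 5) \<le> \<Lambda> * ((1 - 1 / w) * s - (w - 1)\<^sup>2)" using assms(1) by (intro mult_left_mono) auto
 also have "\<dots> = dprof \<Lambda> \<rho> s * s - prof \<Lambda> \<rho> s"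
  unfolding dprof_def prof_def l0 w_def[symmetric] by (simp add: algebra_simps)
 finally show ?thesis .
next
 case False
 then have u: "up \<rho> s = 0" by (simp add: up_def)
 have l: "0 \<le> lo \<rho> s" "lo \<rho> s \<le> 1" using assms by (auto simp: lo_def)
 have "lo \<rho> s * s \<le> 1"
 proof (cases "s \<le> 1")
  case True
  then show ?thesis using l assms(4) by (intro mult_le_one) auto
 next
  case False
  then have "lo \<rho> s = 0" using assms(2) by (simp add: lo_def)
  then show ?thesis by simp
 qed
 moreover have "(lo \<rho> s)\<^sup>2 \<le> 1" using l by (simp add: power_le_one)
 moreover have "sqrt s \<le> 2" using False assms(3) by (intro real_le_lsqrt) auto
 ultimately have "sqrt s - 5 \<le> - 2 * (lo \<rho> s * s) - (lo \<rho> s)\<^sup>2" by linarith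
 then have "\<Lambda> * (sqrt s - 5) \<le> \<Lambda> * (- 2 * (lo \<rho> s * s) - (lo \<rho> s)\<^sup>2)" using assms(1) by (intro mult_left_mono) auto
 then show ?thesis by (simp add: dprof_def prof_def u algebra_simps)
qed

lemma prof_legendre_inner:
 assumes "0 < \<Lambda>" "0 < \<rho>" "0 \<le> s" "s \<le> 1" shows "dprof \<Lambda> \<rho> s \<le> 0"
proof -
 have "up \<rho> s = 0" using assms by (simp add: up_def)
 then show ?thesis using assms lo_nonneg[of \<rho> s] by (simp add: dprof_def mult_le_0_iff)
qed

lemma prof_legendre_outer:
 assumes "0 < \<Lambda>" "0 < \<rho>" "1 \<le> s"
 shows "dprof \<Lambda> \<rho> s \<le> dprof \<Lambda> \<rho> s * s - prof \<Lambda> \<rho> s" "0 \<le> dprof \<Lambda> \<rho> s"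
proof -
 define w where "w = sqrt (1 + up \<rho> s)"
 have w: "1 \<le> w" "w\<^sup>2 = 1 + up \<rho> s" using sqrt_up[of \<rho> s] up_nonneg[of \<rho> s] by (auto simp: w_def)
 have l0: "lo \<rho> s = 0" using assms by (simp add: lo_def)
 have "up \<rho> s \<le> s - 1" using assms by (simp add: up_def)
 then have "w\<^sup>2 - 1 \<le> s - 1" using w by simp
 then have "(1 - 1 / w) * (w\<^sup>2 - 1) \<le> (1 - 1 / w) * (s - 1)" using w by (intro mult_left_mono) auto
 moreover have "(1 - 1 / w) * (w\<^sup>2 - 1) = (w - 1)\<^sup>2 * ((w + 1) / w)"
  using w by (simp add: power2_eq_square field_simps)
 moreover have "(w - 1)\<^sup>2 * 1 \<le> (w - 1)\<^sup>2 * ((w + 1) / w)" using w by (intro mult_left_mono) auto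
 ultimately have "(w - 1)\<^sup>2 \<le> (1 - 1 / w) * (s - 1)" by linarith
 then have "\<Lambda> * (w - 1)\<^sup>2 \<le> \<Lambda> * ((1 - 1 / w) * (s - 1))" using assms(1) by (intro mult_left_mono) auto
 moreover define D where "D = \<Lambda> * (1 - 1 / w)"
 moreover have "\<Lambda> * ((1 - 1 / w) * (s - 1)) = D * s - D"
  by (simp only: D_def right_diff_distrib left_diff_distrib mult.assoc mult_1_right)
 moreover have "dprof \<Lambda> \<rho> s = D" "prof \<Lambda> \<rho> s = \<Lambda> * (w - 1)\<^sup>2"
  unfolding dprof_def prof_def l0 w_def[symmetric] D_def by simp_all
 ultimately show "dprof \<Lambda> \<rho> s \<le> dprof \<Lambda> \<rho> s * s - prof \<Lambda> \<rho> s" by simp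
 show "0 \<le> dprof \<Lambda> \<rho> s" unfolding dprof_def l0 w_def[symmetric] using w assms(1) by simp
qed

text \<open>Away from the zone around 1 the profile with \<open>\<Lambda> = 1\<close> is bounded
  below by a positive multiple of \<open>1 + s\<close>, so a large \<open>\<Lambda>\<close>
  wins.\<close>

lemma prof_dominates:
 assumes "0 < \<rho>" "\<rho> < 1" "0 \<le> C"
 shows "\<exists>\<Lambda>>0. \<forall>s\<ge>0. 2 * \<rho> \<le> \<bar>s - 1\<bar> \<longrightarrow> C * (1 + s) \<le> prof \<Lambda> \<rho> s"
proof -
 \<comment> \<open>The two factors come from bounding \<open>4 + 2 * u\<close> and
   \<open>1 + s\<close> by multiples of \<open>u\<close>, which is possible because \<open>u\<close>
   is at least \<open>\<rho>\<close> on the outer side.\<close>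
 define M where "M = (4 / \<rho> + 2) * (3 / \<rho> + 1)"
 have M: "0 < M" using assms(1) by (simp add: M_def add_pos_pos)
 define \<Lambda> where "\<Lambda> = C * M + 2 * C / \<rho>\<^sup>2 + 1"
 have \<Lambda>: "C * M \<le> \<Lambda>" "2 * C / \<rho>\<^sup>2 \<le> \<Lambda>" "0 < \<Lambda>" using assms M by (auto simp: \<Lambda>_def add_nonneg_pos)
 have "C * (1 + s) \<le> prof \<Lambda> \<rho> s" if s: "0 \<le> s" "2 * \<rho> \<le> \<bar>s - 1\<bar>" for s
 proof (cases "s \<ge> 1")
  case True
  define u w where "u = up \<rho> s" and "w = sqrt (1 + u)"
  have u: "u = s - 1 - \<rho>" "\<rho> \<le> u" using True s(2) assms(1) by (auto simp: u_def up_def)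
  have w: "1 \<le> w" "w\<^sup>2 = 1 + u" using u assms(1) by (auto simp: w_def)
  have "(w + 1)\<^sup>2 \<le> 4 + 2 * u" using w zero_le_power2[of "w - 1"] by (simp add: power2_eq_square algebra_simps)
  have "u = (w - 1) * (w + 1)" using w(2) by (simp add: power2_eq_square algebra_simps)
  then have "u\<^sup>2 = (w - 1)\<^sup>2 * (w + 1)\<^sup>2" by (simp add: power_mult_distrib)
  also have "\<dots> \<le> (w - 1)\<^sup>2 * (4 + 2 * u)" using \<open>(w + 1)\<^sup>2 \<le> 4 + 2 * u\<close> by (intro mult_left_mono) auto
  finally have 1: "u\<^sup>2 \<le> (w - 1)\<^sup>2 * (4 + 2 * u)" .
  have 2: "4 + 2 * u \<le> (4 / \<rho> + 2) * u" "1 + s \<le> (3 / \<rho> + 1) * u"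
  proof -
   have "1 \<le> u / \<rho>" using u(2) assms(1) by (simp add: le_divide_eq)
   moreover from this have "1 + s \<le> 3 * (u / \<rho>) + u" using u(1) assms(2) by linarith
   ultimately show "4 + 2 * u \<le> (4 / \<rho> + 2) * u" "1 + s \<le> (3 / \<rho> + 1) * u"
    by (simp_all add: distrib_right)
  qed
  have "(1 + s) * (4 + 2 * u) \<le> ((3 / \<rho> + 1) * u) * ((4 / \<rho> + 2) * u)"
   using 2 u assms(1) True by (intro mult_mono) auto
  also have "\<dots> = M * u\<^sup>2" by (simp add: M_def power2_eq_square mult_ac)
  also have "\<dots> \<le> M * ((w - 1)\<^sup>2 * (4 + 2 * u))" using 1 M by (intro mult_left_mono) auto
  finally have "(1 + s) * (4 + 2 * u) \<le> (M * (w - 1)\<^sup>2) * (4 + 2 * u)" by (simp add: mult_ac)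
  then have "1 + s \<le> M * (w - 1)\<^sup>2" using u assms(1) by (simp add: mult_le_cancel_right)
  then have "C * (1 + s) \<le> C * M * (w - 1)\<^sup>2" using mult_left_mono[OF _ assms(3)] by (simp add: mult.assoc)
  also have "\<dots> \<le> \<Lambda> * (w - 1)\<^sup>2" using \<Lambda>(1) by (intro mult_right_mono) auto
  also have "\<dots> \<le> prof \<Lambda> \<rho> s" unfolding prof_def w_def u_def using \<Lambda>(3) by (intro mult_left_mono) auto
  finally show ?thesis .
 next
  case False
  then have "\<rho> \<le> lo \<rho> s" using s assms by (auto simp: lo_def)
  then have "\<rho>\<^sup>2 \<le> (lo \<rho> s)\<^sup>2" using assms(1) by (intro power_mono) auto
  have "C * (1 + s) \<le> C * 2" using False assms(3) by (intro mult_left_mono) auto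
  also have "\<dots> = 2 * C / \<rho>\<^sup>2 * \<rho>\<^sup>2" using assms(1) by simp
  also have "\<dots> \<le> \<Lambda> * (lo \<rho> s)\<^sup>2" using \<Lambda> \<open>\<rho>\<^sup>2 \<le> (lo \<rho> s)\<^sup>2\<close> by (intro mult_mono) auto
  also have "\<dots> \<le> prof \<Lambda> \<rho> s" unfolding prof_def using \<Lambda>(3) by (intro mult_left_mono) auto
  finally show ?thesis .
 qed
 then show ?thesis using \<Lambda>(3) by blast
qed

text \<open>The square of the gauge of a convex body with 0 inside, together with its gradient.
  \<open>G_sub\<close> is convexity, \<open>F_inner\<close> is Euler's identity in degree 2, and a
  positive \<open>m\<close> reflects that the body is bounded.\<close>

locale convex_gauge =
 fixes G :: "'n::finite st => real" and F :: "'n st => 'n st" and L m :: real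
 assumes L_nonneg: "0 \<le> L"
  and F_lipschitz: "\<And>z w. norm (F z - F w) \<le> L * norm (z - w)"
  and G_sub: "\<And>z w. G z + F z \<bullet> (w - z) \<le> G w"
  and G_scale: "\<And>s z. 0 \<le> s ==> G (s *\<^sub>R z) = s\<^sup>2 * G z"
  and F_scale: "\<And>s z. 0 \<le> s ==> F (s *\<^sub>R z) = s *\<^sub>R F z"
  and m_pos: "0 < m"
  and G_lower: "\<And>z. m * (norm z)\<^sup>2 \<le> G z"
  and F_inner: "\<And>z. F z \<bullet> z = 2 * G z"

locale gauge = convex_gauge G F L m for G :: "'n::finite st => real" and F :: "'n st => 'n st" and L m :: real +
 assumes F_tau0: "\<And>z. F (tau0 z) = tau0 (F z)"
begin

lemma G_tau0: "G (tau0 z) = G z"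
 using F_inner[of "tau0 z"] F_inner[of z] by (simp add: F_tau0)

lemma G_nonneg: "0 \<le> G z"
 using G_lower[of z] m_pos by (smt (verit) mult_nonneg_nonneg zero_le_power2)

lemma G_zero [simp]: "G 0 = 0" using G_scale[of 0 0] by simp
lemma F_zero [simp]: "F 0 = 0" using F_scale[of 0 0] by simp

text \<open>Convexity gives the lower estimate directly and, with the two points exchanged, the
  upper one up to the variation of \<open>F\<close>. Thus \<open>F\<close> is seen to be the
  gradient without differentiating \<open>G\<close> first.\<close>

lemma G_quad: "\<bar>G w - G z - F z \<bullet> (w - z)\<bar> \<le> L * (norm (w - z))\<^sup>2"
proof -
 have "G w - G z - F z \<bullet> (w - z) \<le> (F w - F z) \<bullet> (w - z)"
  using G_sub[of w z] by (simp add: inner_diff_left inner_diff_right)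
 also have "\<dots> \<le> norm (F w - F z) * norm (w - z)" by (rule norm_cauchy_schwarz)
 also have "\<dots> \<le> (L * norm (w - z)) * norm (w - z)" by (intro mult_right_mono F_lipschitz) simp
 finally show ?thesis using G_sub[of z w] by (simp add: power2_eq_square mult_ac abs_le_iff)
qed

sublocale hamiltonian F L G
 by unfold_locales (use L_nonneg F_lipschitz F_tau0 G_nonneg G_quad in auto)

lemma hamiltonian_scale:
 assumes "0 \<le> A" shows "hamiltonian (\<lambda>z. A *\<^sub>R F z) (A * L) (\<lambda>z. A * G z)"
proof
 show "0 \<le> A * L" using assms L_nonneg by simp
 show "norm (A *\<^sub>R F z - A *\<^sub>R F w) \<le> A * L * norm (z - w)" for z w
  using mult_left_mono[OF F_lipschitz assms, of z w] assms by (simp add: scaleR_diff_right[symmetric] mult_ac)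
 show "A *\<^sub>R F (tau0 z) = tau0 (A *\<^sub>R F z)" for z by (simp add: F_tau0 tau0_scaleR)
 show "0 \<le> A * G z" for z using assms G_nonneg by simp
 show "\<bar>A * G w - A * G z - A *\<^sub>R F z \<bullet> (w - z)\<bar> \<le> A * L * (norm (w - z))\<^sup>2" for z w
 proof -
  have "A * G w - A * G z - A *\<^sub>R F z \<bullet> (w - z) = A * (G w - G z - F z \<bullet> (w - z))"
   by (simp add: algebra_simps)
  then show ?thesis using mult_left_mono[OF G_quad assms, of w z] assms by (simp add: abs_mult mult_ac)
 qed
qed

lemma norm_F_le: "norm (F z) \<le> L * norm z"
 using F_lipschitz[of z 0] by simp

lemma norm_sqrt_G: "sqrt m * norm z \<le> sqrt (G z)"
 using real_sqrt_le_mono[OF G_lower[of z]] m_pos by (simp add: real_sqrt_mult)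

lemma G_upper: "G z \<le> L * (norm z)\<^sup>2"
 using G_quad[of z 0] by simp

lemma G_chain:
 assumes "(z has_vector_derivative v) (at t)"
 shows "((\<lambda>t. G (z t)) has_real_derivative F (z t) \<bullet> v) (at t)"
proof -
 from diff_chain_at[OF assms[unfolded has_vector_derivative_def] H_has_derivative]
 have "((\<lambda>t. G (z t)) has_derivative ((\<lambda>h. F (z t) \<bullet> h) \<circ> (\<lambda>s. s *\<^sub>R v))) (at t)"
  by (simp add: o_def)
 moreover have "((\<lambda>h. F (z t) \<bullet> h) \<circ> (\<lambda>s. s *\<^sub>R v)) = (*) (F (z t) \<bullet> v)"
  by (auto simp: o_def)
 ultimately show ?thesis by (simp add: has_field_derivative_def)
qed

lemma G_conserved:
 assumes "ham_loop (\<lambda>z. \<phi> z *\<^sub>R F z) z" shows "G (z t) = G (z 0)"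
proof -
 have "((\<lambda>t. G (z t)) has_real_derivative 0) (at t)" for t
 proof -
  have "(z has_vector_derivative J0 (\<phi> (z t) *\<^sub>R F (z t))) (at t)" using assms by (simp add: ham_loop_def)
  from G_chain[OF this] show ?thesis by (simp add: J0_scaleR)
 qed
 then show ?thesis using DERIV_isconst_all[of "\<lambda>t. G (z t)" t 0] by blast
qed

text \<open>By \<open>brake_to_spec\<close> the positive actions of brake characteristics belong
  here. Loops need not be injective, so multiples of a multiplier occur too; only the smallest one
  has to come from an embedded loop.\<close>

definition spec :: "real => bool" where
 "spec A \<longleftrightarrow> 0 < A \<and> (\<exists>z. ham_loop (\<lambda>z. A *\<^sub>R F z) z \<and> (\<forall>t. G (z t) = 1))"

text \<open>On a level of \<open>G\<close> the factor is constant, and since \<open>F\<close> is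
  homogeneous of degree 1, rescaling the loop to the level 1 leaves the multiplier
  unchanged.\<close>

lemma spec_normalise:
 assumes "ham_loop (\<lambda>z. f (G z) *\<^sub>R F z) z" "0 < f (G (z 0))" "0 < G (z 0)"
 shows "spec (f (G (z 0)))"
proof -
 define s where "s = G (z 0)"
 have Gz: "G (z t) = s" for t unfolding s_def by (rule G_conserved[OF assms(1)])
 define c where "c = 1 / sqrt s"
 have c: "0 < c" using assms(3) by (simp add: c_def s_def)
 have "ham_loop (\<lambda>z. f s *\<^sub>R F z) (\<lambda>t. c *\<^sub>R z t)"
  unfolding ham_loop_def
 proof (intro conjI allI)
  fix t
  have "(z has_vector_derivative J0 (f s *\<^sub>R F (z t))) (at t)"
   using assms(1) unfolding ham_loop_def Gz by blast
  then have "((\<lambda>t. c *\<^sub>R z t) has_vector_derivative c *\<^sub>R J0 (f s *\<^sub>R F (z t))) (at t)"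
   by (rule bounded_linear.has_vector_derivative[OF bounded_linear_scaleR_right])
  then show "((\<lambda>t. c *\<^sub>R z t) has_vector_derivative J0 (f s *\<^sub>R F (c *\<^sub>R z t))) (at t)"
   using F_scale[of c "z t"] c by (simp add: J0_scaleR mult.commute)
  show "c *\<^sub>R z (t + 1) = c *\<^sub>R z t" using assms(1) by (simp add: ham_loop_def)
  show "c *\<^sub>R z (- t) = tau0 (c *\<^sub>R z t)" using assms(1) by (simp add: ham_loop_def tau0_scaleR)
 qed
 moreover have "G (c *\<^sub>R z t) = 1" for t
 proof -
  have "0 < s" using assms(3) by (simp add: s_def)
  then have "c\<^sup>2 * s = 1" by (simp add: c_def power_divide)
  then show ?thesis using G_scale[of c "z t"] c Gz[of t] by simp
 qed
 ultimately show ?thesis using assms(2) unfolding spec_def s_def by blast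
qed

section \<open>Lipschitz estimates for a profile composed with the gauge\<close>

lemma G_diff_le: "\<bar>G z - G w\<bar> \<le> 2 * L * (norm z + norm w) * norm (z - w)"
proof -
 have "\<bar>G z - G w - F w \<bullet> (z - w)\<bar> \<le> L * (norm (z - w))\<^sup>2" by (rule G_quad)
 moreover have "\<bar>F w \<bullet> (z - w)\<bar> \<le> (L * norm w) * norm (z - w)"
  using Cauchy_Schwarz_ineq2[of "F w" "z - w"] mult_right_mono[OF norm_F_le[of w], of "norm (z - w)"] by simp
 ultimately have "\<bar>G z - G w\<bar> \<le> L * norm w * norm (z - w) + L * (norm (z - w))\<^sup>2" by linarith
 also have "\<dots> \<le> L * norm w * norm (z - w) + L * ((norm z + norm w) * norm (z - w))"
  using norm_triangle_ineq4[of z w] L_nonneg unfolding power2_eq_square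
  by (intro add_left_mono mult_left_mono mult_right_mono) auto
 also have "\<dots> \<le> L * ((norm z + norm w) * norm (z - w)) + L * ((norm z + norm w) * norm (z - w))"
  using L_nonneg unfolding mult.assoc by (intro add_right_mono mult_left_mono mult_right_mono) auto
 finally show ?thesis by (simp add: algebra_simps)
qed

text \<open>The square root of \<open>G\<close> is the gauge itself, which is Lipschitz although
  \<open>G\<close> is not.\<close>

lemma sqrt_G_diff_le: "\<bar>sqrt (G z) - sqrt (G w)\<bar> \<le> 2 * L / sqrt m * norm (z - w)"
proof (cases "sqrt (G z) + sqrt (G w) = 0")
 case True
 then have "sqrt (G z) = 0" "sqrt (G w) = 0"
  using real_sqrt_ge_zero[OF G_nonneg[of z]] real_sqrt_ge_zero[OF G_nonneg[of w]] by linarith+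
 then show ?thesis using L_nonneg m_pos by simp
next
 case False
 then have pos: "0 < sqrt (G z) + sqrt (G w)"
  using real_sqrt_ge_zero[OF G_nonneg[of z]] real_sqrt_ge_zero[OF G_nonneg[of w]] by linarith
 have "\<bar>sqrt (G z) - sqrt (G w)\<bar> * (sqrt (G z) + sqrt (G w)) = \<bar>G z - G w\<bar>"
 proof -
  have "(sqrt (G z) - sqrt (G w)) * (sqrt (G z) + sqrt (G w)) = G z - G w"
   using G_nonneg[of z] G_nonneg[of w] by (simp add: algebra_simps)
  then show ?thesis using pos by (metis abs_mult abs_of_pos)
 qed
 also have "\<dots> \<le> 2 * L * (norm z + norm w) * norm (z - w)" by (rule G_diff_le)
 also have "\<dots> \<le> 2 * L * ((sqrt (G z) + sqrt (G w)) / sqrt m) * norm (z - w)"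
  using norm_sqrt_G[of z] norm_sqrt_G[of w] L_nonneg m_pos
  by (intro mult_right_mono mult_left_mono) (auto simp: field_simps)
 finally have "\<bar>sqrt (G z) - sqrt (G w)\<bar> * (sqrt (G z) + sqrt (G w)) \<le> (2 * L / sqrt m * norm (z - w)) * (sqrt (G z) + sqrt (G w))"
  by (simp add: field_simps)
 then show ?thesis using pos by (rule mult_right_le_imp_le)
qed

text \<open>\<open>F\<close> is unbounded, so the variation of its factor must be small where
  \<open>F\<close> is large. The factor varies like the difference of the values of \<open>X\<close>
  divided by \<open>X z * X w\<close>, and one of these denominators absorbs
  \<open>norm (F w)\<close>.\<close>

lemma field_lipschitz_up:
 assumes "0 < \<rho>" "\<rho> < 1"
 shows "norm ((1 - 1 / sqrt (1 + up \<rho> (G z))) *\<^sub>R F z - (1 - 1 / sqrt (1 + up \<rho> (G w))) *\<^sub>R F w) \<le>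
  (L + 2 * L / sqrt m * (2 * (2 * L / sqrt m))) * norm (z - w)"
proof -
 define X where "X z = sqrt (1 + up \<rho> (G z))" for z
 have X1: "1 \<le> X z" for z unfolding X_def by (rule sqrt_up)
 have GX: "sqrt (G z) \<le> 2 * X z" for z
 proof -
  have "G z \<le> 4 * (1 + up \<rho> (G z))" using assms by (auto simp: up_def max_def)
  then have "sqrt (G z) \<le> sqrt (4 * (1 + up \<rho> (G z)))" by (rule real_sqrt_le_mono)
  also have "\<dots> = 2 * X z" by (simp only: X_def real_sqrt_mult real_sqrt_four)
  finally show ?thesis .
 qed
 have XX: "\<bar>X z - X w\<bar> \<le> 2 * \<bar>sqrt (G z) - sqrt (G w)\<bar>"
 proof -
  have "(X z - X w) * (X z + X w) = up \<rho> (G z) - up \<rho> (G w)"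
   using up_nonneg by (simp add: X_def algebra_simps)
  then have "\<bar>X z - X w\<bar> * (X z + X w) = \<bar>up \<rho> (G z) - up \<rho> (G w)\<bar>"
   using X1[of z] X1[of w] by (metis abs_mult abs_of_nonneg add_nonneg_nonneg order.trans zero_le_one)
  also have "\<dots> \<le> \<bar>G z - G w\<bar>" by (simp add: up_def max_def)
  also have "\<dots> = \<bar>sqrt (G z) - sqrt (G w)\<bar> * (sqrt (G z) + sqrt (G w))"
  proof -
   have "(sqrt (G z) - sqrt (G w)) * (sqrt (G z) + sqrt (G w)) = G z - G w"
    using G_nonneg[of z] G_nonneg[of w] by (simp add: algebra_simps)
   then show ?thesis
    using real_sqrt_ge_zero[OF G_nonneg[of z]] real_sqrt_ge_zero[OF G_nonneg[of w]]
    by (metis abs_mult abs_of_nonneg add_nonneg_nonneg)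
  qed
  also have "\<dots> \<le> \<bar>sqrt (G z) - sqrt (G w)\<bar> * (2 * (X z + X w))"
   using GX[of z] GX[of w] by (intro mult_left_mono) auto
  finally have "\<bar>X z - X w\<bar> * (X z + X w) \<le> (2 * \<bar>sqrt (G z) - sqrt (G w)\<bar>) * (X z + X w)"
   by (simp only: mult_ac)
  moreover have "0 < X z + X w" using X1[of z] X1[of w] by linarith
  ultimately show ?thesis by simp
 qed
 have Fw: "norm (F w) \<le> 2 * L / sqrt m * X w"
 proof -
  have "norm w \<le> 2 * X w / sqrt m" using norm_sqrt_G[of w] GX[of w] m_pos by (simp add: field_simps)
  then have "L * norm w \<le> L * (2 * X w / sqrt m)" using L_nonneg by (rule mult_left_mono)
  then show ?thesis using norm_F_le[of w] by (simp add: mult_ac)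
 qed
 have "(1 - 1 / X z) *\<^sub>R F z - (1 - 1 / X w) *\<^sub>R F w = (1 - 1 / X z) *\<^sub>R (F z - F w) + (1 / X w - 1 / X z) *\<^sub>R F w"
  by (simp add: algebra_simps)
 also have "norm \<dots> \<le> \<bar>1 - 1 / X z\<bar> * norm (F z - F w) + \<bar>1 / X w - 1 / X z\<bar> * norm (F w)"
  using norm_triangle_ineq by (metis norm_scaleR)
 also have "\<dots> \<le> 1 * (L * norm (z - w)) + 2 * L / sqrt m * (2 * (2 * L / sqrt m * norm (z - w)))"
 proof (rule add_mono)
  show "\<bar>1 - 1 / X z\<bar> * norm (F z - F w) \<le> 1 * (L * norm (z - w))"
   using X1[of z] F_lipschitz by (intro mult_mono) auto
  have "\<bar>1 / X w - 1 / X z\<bar> = \<bar>X z - X w\<bar> / (X z * X w)"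
   using X1[of z] X1[of w] by (simp add: field_simps abs_divide abs_mult)
  then have "\<bar>1 / X w - 1 / X z\<bar> * norm (F w) \<le> \<bar>X z - X w\<bar> / (X z * X w) * (2 * L / sqrt m * X w)"
   using Fw X1[of z] X1[of w] by (simp only:) (intro mult_left_mono, auto)
  also have "\<dots> = 2 * L / sqrt m * \<bar>X z - X w\<bar> / X z" using X1[of z] X1[of w] by simp (simp add: mult_ac)
  also have "\<dots> \<le> 2 * L / sqrt m * \<bar>X z - X w\<bar>"
  proof -
   have n: "0 \<le> 2 * L / sqrt m * \<bar>X z - X w\<bar>" using L_nonneg m_pos by simp
   show ?thesis using divide_left_mono[OF X1[of z] n] X1[of z] by simp
  qed
  also have "\<dots> \<le> 2 * L / sqrt m * (2 * (2 * L / sqrt m * norm (z - w)))"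
   using XX sqrt_G_diff_le[of z w] L_nonneg m_pos by (intro mult_left_mono) auto
  finally show "\<bar>1 / X w - 1 / X z\<bar> * norm (F w) \<le> 2 * L / sqrt m * (2 * (2 * L / sqrt m * norm (z - w)))" .
 qed
 finally show ?thesis by (simp add: X_def algebra_simps)
qed

text \<open>\<open>lo\<close> vanishes from the level 1 on, so \<open>F\<close> matters only where
  it is bounded. Ordering the points lets the lower one carry the variation of
  \<open>lo\<close>.\<close>

lemma field_lipschitz_lo:
 assumes "0 < \<rho>" "\<rho> < 1"
 shows "norm (lo \<rho> (G z) *\<^sub>R F z - lo \<rho> (G w) *\<^sub>R F w) \<le>
  (L + L / sqrt m * (2 * (2 * L / sqrt m))) * norm (z - w)"
proof -
 have *: "norm (lo \<rho> (G z) *\<^sub>R F z - lo \<rho> (G w) *\<^sub>R F w) \<le>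
  (L + L / sqrt m * (2 * (2 * L / sqrt m))) * norm (z - w)" if le: "G w \<le> G z" for z w
 proof (cases "G w \<le> 1")
  case False
  then have "lo \<rho> (G w) = 0" "lo \<rho> (G z) = 0" using assms le by (auto simp: lo_def)
  then show ?thesis using L_nonneg m_pos by simp
 next
  case True
  define a b where "a = sqrt (G w)" and "b = sqrt (G z)"
  have ab: "0 \<le> a" "a \<le> b" "a \<le> 1" "G w = a\<^sup>2" "G z = b\<^sup>2"
   using le True G_nonneg by (auto simp: a_def b_def)
  have lo_diff: "\<bar>lo \<rho> (G z) - lo \<rho> (G w)\<bar> \<le> 2 * \<bar>b - a\<bar>"
  proof -
   have "lo \<rho> (G z) \<le> lo \<rho> (G w)" using le by (simp add: lo_def)
   moreover have "lo \<rho> (G w) - lo \<rho> (G z) \<le> 2 * (b - a)"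
   proof (cases "b \<le> 1")
    case True
    have "lo \<rho> (G w) - lo \<rho> (G z) \<le> b\<^sup>2 - a\<^sup>2" using le unfolding ab(4,5) by (auto simp: lo_def)
    also have "\<dots> = (b - a) * (b + a)" by (simp add: power2_eq_square algebra_simps)
    also have "\<dots> \<le> (b - a) * 2" using ab True by (intro mult_left_mono) auto
    finally show ?thesis by simp
   next
    case False
    have "1 - a\<^sup>2 \<le> 2 * (1 - a)" using zero_le_power2[of "1 - a"] by (simp add: power2_eq_square algebra_simps)
    moreover have "lo \<rho> (G w) \<le> 1 - a\<^sup>2"
     using assms ab True by (simp add: lo_def)
    ultimately have "lo \<rho> (G w) \<le> 2 * (1 - a)" by linarith
    also have "\<dots> \<le> 2 * (b - a)" using False by simp
    finally show ?thesis using lo_nonneg[of \<rho> "G z"] by linarith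
   qed
   ultimately show ?thesis using ab(2) by simp
  qed
  have Fw: "norm (F w) \<le> L / sqrt m"
  proof -
   have "sqrt m * norm w \<le> 1" using norm_sqrt_G[of w] ab(3) unfolding a_def by linarith
   then have "norm w \<le> 1 / sqrt m" using m_pos by (simp add: pos_le_divide_eq mult.commute)
   then have "L * norm w \<le> L * (1 / sqrt m)" using L_nonneg by (rule mult_left_mono)
   then show ?thesis using norm_F_le[of w] by simp
  qed
  have lo1: "\<bar>lo \<rho> (G z)\<bar> \<le> 1" using assms G_nonneg[of z] by (simp add: lo_def)
  have "lo \<rho> (G z) *\<^sub>R F z - lo \<rho> (G w) *\<^sub>R F w = lo \<rho> (G z) *\<^sub>R (F z - F w) + (lo \<rho> (G z) - lo \<rho> (G w)) *\<^sub>R F w"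
   by (simp add: algebra_simps)
  also have "norm \<dots> \<le> \<bar>lo \<rho> (G z)\<bar> * norm (F z - F w) + \<bar>lo \<rho> (G z) - lo \<rho> (G w)\<bar> * norm (F w)"
   using norm_triangle_ineq by (metis norm_scaleR)
  also have "\<dots> \<le> 1 * (L * norm (z - w)) + (2 * (2 * L / sqrt m * norm (z - w))) * (L / sqrt m)"
  proof (rule add_mono)
   show "\<bar>lo \<rho> (G z)\<bar> * norm (F z - F w) \<le> 1 * (L * norm (z - w))"
    using lo1 F_lipschitz by (intro mult_mono) auto
   have "\<bar>lo \<rho> (G z) - lo \<rho> (G w)\<bar> \<le> 2 * (2 * L / sqrt m * norm (z - w))"
    using lo_diff sqrt_G_diff_le[of z w] by (simp add: a_def b_def)
   then show "\<bar>lo \<rho> (G z) - lo \<rho> (G w)\<bar> * norm (F w) \<le> (2 * (2 * L / sqrt m * norm (z - w))) * (L / sqrt m)"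
    using Fw L_nonneg m_pos by (intro mult_mono) auto
  qed
  finally show ?thesis by (simp add: algebra_simps)
 qed
 show ?thesis
 proof (cases "G w \<le> G z")
  case True then show ?thesis by (rule *)
 next
  case False
  then show ?thesis using *[of z w] by (simp add: norm_minus_commute)
 qed
qed

lemma hamiltonian_prof:
 assumes "0 < \<Lambda>" "0 < \<rho>" "\<rho> < 1"
 obtains L' where "hamiltonian (\<lambda>z. dprof \<Lambda> \<rho> (G z) *\<^sub>R F z) L' (\<lambda>z. prof \<Lambda> \<rho> (G z))"
proof -
 define C1 where "C1 = L + 2 * L / sqrt m * (2 * (2 * L / sqrt m))"
 define C2 where "C2 = L + L / sqrt m * (2 * (2 * L / sqrt m))"
 define L' where "L' = \<Lambda> * (C1 + 2 * C2)"
 have L'0: "0 \<le> L'" using assms(1) L_nonneg m_pos by (simp add: L'_def C1_def C2_def)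
 have lip: "norm (dprof \<Lambda> \<rho> (G z) *\<^sub>R F z - dprof \<Lambda> \<rho> (G w) *\<^sub>R F w) \<le> L' * norm (z - w)" for z w
 proof -
  let ?u = "(1 - 1 / sqrt (1 + up \<rho> (G z))) *\<^sub>R F z - (1 - 1 / sqrt (1 + up \<rho> (G w))) *\<^sub>R F w"
  let ?l = "lo \<rho> (G z) *\<^sub>R F z - lo \<rho> (G w) *\<^sub>R F w"
  have "dprof \<Lambda> \<rho> (G z) *\<^sub>R F z - dprof \<Lambda> \<rho> (G w) *\<^sub>R F w = \<Lambda> *\<^sub>R (?u - 2 *\<^sub>R ?l)"
   unfolding dprof_def by (simp add: algebra_simps)
  also have "norm \<dots> \<le> \<Lambda> * (norm ?u + 2 * norm ?l)"
   using norm_triangle_ineq4[of ?u "2 *\<^sub>R ?l"] assms(1) by simp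
  also have "\<dots> \<le> \<Lambda> * (C1 * norm (z - w) + 2 * (C2 * norm (z - w)))"
   using field_lipschitz_up[OF assms(2,3), of z w] field_lipschitz_lo[OF assms(2,3), of z w] assms(1)
   unfolding C1_def C2_def by (intro mult_left_mono add_mono) auto
  finally show ?thesis by (simp add: L'_def algebra_simps)
 qed
 have der: "((\<lambda>z. prof \<Lambda> \<rho> (G z)) has_derivative (\<lambda>h. (dprof \<Lambda> \<rho> (G z) *\<^sub>R F z) \<bullet> h)) (at z)" for z
 proof -
  from diff_chain_at[OF H_has_derivative[of z] prof_DERIV[of \<Lambda> \<rho> "G z", unfolded has_field_derivative_def]]
  have "((\<lambda>z. prof \<Lambda> \<rho> (G z)) has_derivative ((*) (dprof \<Lambda> \<rho> (G z)) \<circ> (\<lambda>h. F z \<bullet> h))) (at z)"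
   by (simp add: o_def)
  moreover have "((*) (dprof \<Lambda> \<rho> (G z)) \<circ> (\<lambda>h. F z \<bullet> h)) = (\<lambda>h. (dprof \<Lambda> \<rho> (G z) *\<^sub>R F z) \<bullet> h)" by auto
  ultimately show ?thesis by simp
 qed
 have "hamiltonian (\<lambda>z. dprof \<Lambda> \<rho> (G z) *\<^sub>R F z) L' (\<lambda>z. prof \<Lambda> \<rho> (G z))"
 proof
  show "dprof \<Lambda> \<rho> (G (tau0 z)) *\<^sub>R F (tau0 z) = tau0 (dprof \<Lambda> \<rho> (G z) *\<^sub>R F z)" for z
   by (simp add: G_tau0 F_tau0 tau0_scaleR)
 qed (use L'0 lip prof_nonneg[OF assms(1)] lipschitz_gradient_quadratic[OF der lip L'0] in blast)+
 then show ?thesis using that by blast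
qed

text \<open>A critical point lives on one level \<open>s\<close> of \<open>G\<close>. For
  \<open>s \<le> 1\<close> its value is nonpositive; for larger \<open>s\<close> and positive value
  its multiplier lies in \<open>spec\<close> and is at most that value. Both exclude values between
  \<open>\<beta>\<close> and \<open>B\<close>.\<close>

theorem cEH_fun_prof_lower:
 assumes "0 < \<Lambda>" "0 < \<rho>" "\<rho> < 1" "0 < B" and nospec: "\<And>A. spec A ==> B < A"
  and q: "G (q, 0) = 1"
 shows "ereal B \<le> cEH_fun (\<lambda>z. prof \<Lambda> \<rho> (G z))"
proof -
 define V where "V z = dprof \<Lambda> \<rho> (G z) *\<^sub>R F z" for z
 define H where "H z = prof \<Lambda> \<rho> (G z)" for z
 obtain L' where "hamiltonian V L' H" using hamiltonian_prof[OF assms(1-3)] unfolding V_def H_def by blast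
 then interpret P: hamiltonian V L' H .
 have zero: "H z = 0 \<and> V z = 0" if "\<bar>G z - 1\<bar> \<le> \<rho>" for z
 proof -
  have "up \<rho> (G z) = 0" "lo \<rho> (G z) = 0" using that by (auto simp: up_def lo_def)
  then show ?thesis by (simp add: H_def V_def prof_def dprof_def)
 qed
 have Vz: "(V z \<bullet> z) / 2 - H z = dprof \<Lambda> \<rho> (G z) * G z - prof \<Lambda> \<rho> (G z)" for z
  by (simp add: V_def H_def F_inner)
 obtain r where r: "0 < r" "\<And>w. norm w < r ==> \<bar>G ((q,0) + w) - 1\<bar> \<le> \<rho>"
 proof -
  have "isCont G (q, 0)" using H_has_derivative has_derivative_continuous by blast
  then obtain d where d: "0 < d" "\<And>z. dist z (q,0) < d ==> dist (G z) (G (q,0)) < \<rho>"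
   using assms(2) unfolding continuous_at_eps_delta dist_norm by metis
  show ?thesis
  proof (rule that[OF d(1)])
   fix w :: "'n st" assume "norm w < d"
   then show "\<bar>G ((q,0) + w) - 1\<bar> \<le> \<rho>" using d(2)[of "(q,0) + w"] q by (simp add: dist_norm)
  qed
 qed
 have Hq: "H ((q, 0) + w) \<le> L' * (norm w)\<^sup>2" for w
  using P.H_quad[of "(q,0) + w" "(q,0)"] zero[of "(q,0)"] q assms(2) by simp
 obtain \<epsilon> \<beta> Q where start: "0 < \<epsilon>" "0 < \<beta>" "Pz Q = Q" "\<And>x. x \<in> Sp ==> \<beta> \<le> P.Phi (\<epsilon> *\<^sub>R x + Q)"
  by (rule P.small_sphere[OF r(1) P.L_nonneg _ Hq]) (use r(2) zero in blast)+
 have nocrit: False if x: "P.gPhi x = 0" "\<beta> \<le> P.Phi x" "P.Phi x \<le> B" for x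
 proof -
  obtain z where z: "ham_loop V z" "AE t in I01. crv x t = z t" using P.critical_regular[OF x(1)] by blast
  define s where "s = G (z 0)"
  have Gz: "G (z t) = s" for t
   unfolding s_def by (rule G_conserved) (use z(1) in \<open>simp add: V_def[abs_def]\<close>)
  have s0: "0 \<le> s" by (simp add: s_def G_nonneg)
  have "P.Phi x = (LINT t|I01. (V (crv x t) \<bullet> crv x t) / 2 - H (crv x t))"
   using P.Phi_eq_gradient[of x] x(1) by simp
  also have "\<dots> = (LINT t|I01. dprof \<Lambda> \<rho> s * s - prof \<Lambda> \<rho> s)"
  proof (rule integral_cong_AE)
   show "(\<lambda>t. (V (crv x t) \<bullet> crv x t) / 2 - H (crv x t)) \<in> borel_measurable I01"
    using P.H_measurable[OF crv_measurable] P.V_measurable[OF crv_measurable] by measurable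
   show "AE t in I01. (V (crv x t) \<bullet> crv x t) / 2 - H (crv x t) = dprof \<Lambda> \<rho> s * s - prof \<Lambda> \<rho> s"
    using z(2) by eventually_elim (simp add: Vz Gz)
  qed simp
  finally have Phi: "P.Phi x = dprof \<Lambda> \<rho> s * s - prof \<Lambda> \<rho> s" by simp
  show False
  proof (cases "s \<le> 1")
   case True
   have "dprof \<Lambda> \<rho> s * s \<le> 0" using prof_legendre_inner[OF assms(1,2) s0 True] s0 by (rule mult_nonpos_nonneg)
   then show False using Phi prof_nonneg[OF assms(1), of \<rho> s] x(2) start(2) by linarith
  next
   case False
   then have s1: "1 \<le> s" by simp
   have "dprof \<Lambda> \<rho> s \<noteq> 0"
   proof
    assume "dprof \<Lambda> \<rho> s = 0"
    then show False using Phi prof_nonneg[OF assms(1), of \<rho> s] x(2) start(2) by simp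
   qed
   then have pos: "0 < dprof \<Lambda> \<rho> s" using prof_legendre_outer(2)[OF assms(1,2) s1] by simp
   have "spec (dprof \<Lambda> \<rho> (G (z 0)))"
    by (rule spec_normalise) (use z(1) pos s1 in \<open>simp_all add: V_def[abs_def] s_def\<close>)
   then have "B < dprof \<Lambda> \<rho> s" using nospec s_def by simp
   then show False using prof_legendre_outer(1)[OF assms(1,2) s1] Phi x(3) by linarith
  qed
 qed
 have "\<exists>\<delta>>0. \<forall>x. \<beta> \<le> P.Phi x \<and> P.Phi x \<le> B \<longrightarrow> \<delta> \<le> (1 + norm x) * norm (P.gPhi x)"
 proof (rule P.cerami_bound[where \<kappa>="\<Lambda> * sqrt m" and C="\<Lambda> * 5"])
  show "0 < \<Lambda> * sqrt m" using assms(1) m_pos by simp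
  show "\<Lambda> * sqrt m * norm z - \<Lambda> * 5 \<le> (V z \<bullet> z) / 2 - H z" for z
  proof -
   have "\<Lambda> * (sqrt m * norm z) \<le> \<Lambda> * sqrt (G z)" using norm_sqrt_G[of z] assms(1) by (intro mult_left_mono) auto
   then show ?thesis unfolding Vz
    using prof_legendre_coercive[OF assms(1-3) G_nonneg[of z]] by (simp add: algebra_simps)
  qed
  show "V 0 = 0" by (simp add: V_def)
 qed (use nocrit in blast)
 then obtain \<delta> where "0 < \<delta>" "\<And>x. \<beta> \<le> P.Phi x ==> P.Phi x \<le> B ==> \<delta> \<le> (1 + norm x) * norm (P.gPhi x)" by blast
 then have "ereal B \<le> cEH_fun H"
  using P.cEH_fun_lower[OF start(2) assms(4) _ _ start(1,3,4)] by blast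
 then show ?thesis by (simp add: H_def[abs_def])
qed

theorem cEH_fun_lower_bound:
 assumes "0 < \<rho>" "\<rho> < 1" "0 < B" "0 \<le> C" and nospec: "\<And>A. spec A ==> B < A" and q: "G (q, 0) = 1"
  and zero: "\<And>z. \<bar>G z - 1\<bar> \<le> 2 * \<rho> ==> H0 z = 0" and growth: "\<And>z. H0 z \<le> C * (1 + G z)"
 shows "ereal B \<le> cEH_fun H0"
proof -
 obtain \<Lambda> where \<Lambda>: "0 < \<Lambda>" "\<And>s. 0 \<le> s ==> 2 * \<rho> \<le> \<bar>s - 1\<bar> ==> C * (1 + s) \<le> prof \<Lambda> \<rho> s"
  using prof_dominates[OF assms(1,2,4)] by blast
 have "H0 z \<le> prof \<Lambda> \<rho> (G z)" for z
 proof (cases "\<bar>G z - 1\<bar> \<le> 2 * \<rho>")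
  case True then show ?thesis using zero prof_nonneg[OF \<Lambda>(1)] by simp
 next
  case False
  then show ?thesis using \<Lambda>(2)[OF G_nonneg[of z]] growth[of z] by linarith
 qed
 then have "cEH_fun (\<lambda>z. prof \<Lambda> \<rho> (G z)) \<le> cEH_fun H0" by (rule cEH_fun_antimono)
 then show ?thesis using cEH_fun_prof_lower[OF \<Lambda>(1) assms(1-3) nospec q] by (rule order.trans[rotated])
qed

section \<open>Multipliers as critical points, and the bound on a half space\<close>

lemma spec_critical:
 assumes "spec A"
 obtains x where "Pp x - Pm x = A *\<^sub>R gradH x" "Pz (gradH x) = 0" "AE t in I01. G (crv x t) = 1"
proof -
 from assms obtain z where A: "0 < A" and z: "ham_loop (\<lambda>z. A *\<^sub>R F z) z" "\<And>t. G (z t) = 1" unfolding spec_def by blast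
 have "continuous_on UNIV (\<lambda>z. A *\<^sub>R F z)" by (intro continuous_intros V_continuous)
 from ham_loop_element[OF z(1) this] obtain x where x: "AE t in I01. crv x t = z t"
  "\<And>j. fcoeff j (\<lambda>t. A *\<^sub>R F (crv x t)) = (frq j) *\<^sub>R (cf x j, 0)" by blast
 have g: "cf (A *\<^sub>R gradH x) j = (1 / wt j) *\<^sub>R (frq j) *\<^sub>R cf x j" for j
 proof -
  have "cf (A *\<^sub>R gradH x) j = (1 / wt j) *\<^sub>R (A *\<^sub>R fst (fcoeff j (\<lambda>t. F (crv x t))))"
   by (simp add: gradH_def cf_rieszE[OF L2_V_crv])
  also have "A *\<^sub>R fst (fcoeff j (\<lambda>t. F (crv x t))) = fst (fcoeff j (\<lambda>t. A *\<^sub>R F (crv x t)))"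
   by (simp add: fcoeff_scaleR)
  finally show ?thesis by (simp add: x(2))
 qed
 \<comment> \<open>The symbol of the derivative divided by the weight is the sign of
   \<open>j\<close>.\<close>
 have w: "(1 / wt j) * (frq j) = (if j > 0 then 1 else if j < 0 then -1 else 0)" for j
  by (auto simp: wt_def)
 have 1: "Pp x - Pm x = A *\<^sub>R gradH x"
  by (rule hs_eqI) (unfold g scaleR_scaleR w, auto)
 then have "A *\<^sub>R Pz (gradH x) = Pz (Pp x - Pm x)" by simp
 then have 2: "Pz (gradH x) = 0" using A by simp
 have 3: "AE t in I01. G (crv x t) = 1" using x(1) by eventually_elim (simp add: z(2))
 show ?thesis using that[OF 1 2 3] .
qed

lemma IH_sub: "IH x + gradH x \<bullet> (y - x) \<le> IH y"
proof -
 have int: "integrable I01 (\<lambda>t. G (crv y t))" "integrable I01 (\<lambda>t. G (crv x t))"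
  "integrable I01 (\<lambda>t. crv (y - x) t \<bullet> F (crv x t))"
  using H_integrable[OF L2_crv] L2_inner_integrable[OF L2_crv L2_V_crv] by auto
 have "IH x + gradH x \<bullet> (y - x) = (LINT t|I01. G (crv x t) + crv (y - x) t \<bullet> F (crv x t))"
  unfolding IH_def gradH_inner using int by simp
 also have "\<dots> \<le> IH y" unfolding IH_def
 proof (rule integral_mono_AE)
  show "AE t in I01. G (crv x t) + crv (y - x) t \<bullet> F (crv x t) \<le> G (crv y t)"
   using crv_diff[of y x] by eventually_elim (use G_sub in \<open>simp add: inner_commute\<close>)
 qed (use int in auto)
 finally show ?thesis .
qed

lemma gradH_scale: "0 \<le> s ==> gradH (s *\<^sub>R x) = s *\<^sub>R gradH x"
proof (rule hs_eqI)
 fix j assume s: "0 \<le> s"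
 have "fcoeff j (\<lambda>t. F (crv (s *\<^sub>R x) t)) = fcoeff j (\<lambda>t. s *\<^sub>R F (crv x t))"
  by (rule fcoeff_cong_AE[OF L2_measurable[OF L2_V_crv] L2_measurable[OF L2_scaleR[OF L2_V_crv]]])
   (use crv_scaleR[of s x] in eventually_elim, simp add: F_scale s)
 then show "cf (gradH (s *\<^sub>R x)) j = cf (s *\<^sub>R gradH x) j"
  by (simp add: gradH_def cf_rieszE[OF L2_V_crv] fcoeff_scaleR)
qed

lemma IH_scale: assumes "0 \<le> s" shows "IH (s *\<^sub>R x) = s\<^sup>2 * IH x"
proof -
 have "IH (s *\<^sub>R x) = (LINT t|I01. s\<^sup>2 * G (crv x t))" unfolding IH_def
  by (rule integral_cong_AE[OF H_measurable[OF crv_measurable]])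
   (use H_measurable[OF crv_measurable, of x] crv_scaleR[of s x] in \<open>auto simp: G_scale assms elim: eventually_mono\<close>)
 then show ?thesis by (simp add: IH_def)
qed

lemma gradH_inner_self: "gradH x \<bullet> x = 2 * IH x"
 by (simp add: gradH_inner IH_def inner_commute[of "crv x _"] F_inner)

text \<open>Concavity of the action on a half space makes the closed characteristic a maximiser there.\<close>

lemma half_space_bound:
 assumes x: "Pp x - Pm x = A *\<^sub>R gradH x" and A: "0 \<le> A" and s: "0 \<le> s" and y: "Pp y = s *\<^sub>R Pp x"
 shows "((norm (Pp y))\<^sup>2 - (norm (Pm y))\<^sup>2) / 2 \<le> A * IH y"
proof -
 \<comment> \<open>As \<open>v\<close> has no plus part, the only second-order term left is
   \<open>- (norm (Pm v))\<^sup>2 / 2\<close>; the linear terms cancel because \<open>x\<close> is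
   critical.\<close>
 define v where "v = y - s *\<^sub>R x"
 have yv: "y = s *\<^sub>R x + v" by (simp add: v_def)
 have Pv: "Pp v = 0" using y by (simp add: v_def)
 have q0: "(norm (Pp x))\<^sup>2 - (norm (Pm x))\<^sup>2 = 2 * (A * IH x)"
 proof -
  have "(Pp x - Pm x) \<bullet> x = A * (gradH x \<bullet> x)" using x by simp
  moreover have "(Pp x - Pm x) \<bullet> x = (norm (Pp x))\<^sup>2 - (norm (Pm x))\<^sup>2"
   unfolding inner_diff_left P_inner_self(1)[of x x] P_inner_self(3)[of x x] by (simp add: power2_norm_eq_inner)
  ultimately show ?thesis by (simp add: gradH_inner_self)
 qed
 have "A * (IH (s *\<^sub>R x) + gradH (s *\<^sub>R x) \<bullet> v) \<le> A * IH y"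
  using IH_sub[of "s *\<^sub>R x" y] A by (intro mult_left_mono) (auto simp: v_def)
 moreover have "A * (gradH x \<bullet> v) = - (Pm x \<bullet> Pm v)"
 proof -
  have "A * (gradH x \<bullet> v) = (Pp x - Pm x) \<bullet> v" using x by simp
  also have "\<dots> = Pp x \<bullet> Pp v - Pm x \<bullet> Pm v"
   unfolding inner_diff_left P_inner_self(1)[of x v] P_inner_self(3)[of x v] ..
  finally show ?thesis by (simp add: Pv)
 qed
 then have "A * (gradH (s *\<^sub>R x) \<bullet> v) = - s * (Pm x \<bullet> Pm v)" using s by (simp add: gradH_scale mult.left_commute[of A s])
 moreover have "A * IH (s *\<^sub>R x) = s\<^sup>2 * ((norm (Pp x))\<^sup>2 - (norm (Pm x))\<^sup>2) / 2"
  using q0 s by (simp add: IH_scale)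
 moreover have "(norm (Pm y))\<^sup>2 = s\<^sup>2 * (norm (Pm x))\<^sup>2 + 2 * s * (Pm x \<bullet> Pm v) + (norm (Pm v))\<^sup>2"
 proof -
  have "Pm y = s *\<^sub>R Pm x + Pm v" by (subst yv) simp
  then show ?thesis
   by (simp only: power2_norm_eq_inner inner_add_left inner_add_right inner_scaleR_left inner_scaleR_right
     inner_commute[of "Pm v" "Pm x"] power2_eq_square[of s]) (simp add: algebra_simps)
 qed
 moreover have "(norm (Pp y))\<^sup>2 = s\<^sup>2 * (norm (Pp x))\<^sup>2" using y by (simp add: power_mult_distrib)
 ultimately show ?thesis
  by (simp add: algebra_simps) (use zero_le_power2[of "norm (Pm v)"] in linarith)
qed

end

section \<open>Intersection property of admissible deformations\<close>

text \<open>Index set of an orthonormal basis of E+: a positive frequency and a coordinate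
  direction.\<close>

definition modes :: "(int \<times> 'n::finite) set" where "modes = {0<..} \<times> UNIV"

lemma infinite_modes: "infinite (modes :: (int \<times> 'n::finite) set)"
proof -
 have "infinite ({0<..} :: int set)" by (rule infinite_Ioi)
 then show ?thesis unfolding modes_def by (simp add: finite_cartesian_product_iff)
qed

lemma countable_modes: "countable (modes :: (int \<times> 'n::finite) set)"
 by (rule countable_subset[of _ "UNIV :: (int \<times> 'n) set"]) (auto intro: countable_finite countable_SIGMA simp: modes_def)

definition midx :: "nat => int \<times> 'n::finite" where "midx = from_nat_into modes"

lemma bij_midx: "bij_betw midx UNIV (modes :: (int \<times> 'n::finite) set)"
 unfolding midx_def by (rule bij_betw_from_nat_into[OF countable_modes infinite_modes])

lemma inj_midx: "inj (midx :: nat => int \<times> 'n::finite)"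
 by (rule bij_betw_imp_inj_on[OF bij_midx])

lemma range_midx: "range midx = (modes :: (int \<times> 'n::finite) set)"
 by (rule bij_betw_imp_surj_on[OF bij_midx])

lemma midx_pos: "0 < fst (midx k :: int \<times> 'n::finite)"
proof -
 have "(midx k :: int \<times> 'n) \<in> modes" unfolding range_midx[symmetric] by simp
 then show ?thesis by (auto simp: modes_def)
qed

definition bas :: "nat => 'n::finite hs" where
 "bas k = Hs (\<lambda>j. if j = fst (midx k :: int \<times> 'n) then (1 / sqrt (wt j)) *\<^sub>R axis (snd (midx k)) 1 else 0)"

lemma finite_support_Eset: "finite {j. c j \<noteq> 0} ==> c \<in> Eset"
 unfolding Eset_iff
 by (subst summable_on_cong_neutral[where T="{j. c j \<noteq> 0}" and g="\<lambda>j. wt j * (norm (c j))\<^sup>2"]) auto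

lemma cf_bas: "cf (bas k :: 'n::finite hs) j = (if j = fst (midx k :: int \<times> 'n) then (1 / sqrt (wt j)) *\<^sub>R axis (snd (midx k)) 1 else 0)"
proof -
 have "(\<lambda>j. if j = fst (midx k :: int \<times> 'n) then (1 / sqrt (wt j)) *\<^sub>R axis (snd (midx k)) 1 else 0) \<in> (Eset :: 'n coeff set)"
  by (rule finite_support_Eset) (rule finite_subset[of _ "{fst (midx k :: int \<times> 'n)}"], auto)
 then show ?thesis by (simp add: bas_def)
qed

lemma inner_bas: "bas k \<bullet> x = sqrt (wt (fst (midx k :: int \<times> 'n::finite))) * (cf (x :: 'n hs) (fst (midx k :: int \<times> 'n)) $ snd (midx k))"
proof -
 let ?j = "fst (midx k :: int \<times> 'n)" and ?i = "snd (midx k :: int \<times> 'n)"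
 have "((\<lambda>j. wt j * (cf (bas k :: 'n hs) j \<bullet> cf x j)) has_sum (wt ?j * (cf (bas k :: 'n hs) ?j \<bullet> cf x ?j))) UNIV"
  by (subst has_sum_cong_neutral[where T="{?j}" and g="\<lambda>j. wt j * (cf (bas k) j \<bullet> cf x j)"])
   (auto simp: cf_bas intro: has_sum_finiteI)
 then have "bas k \<bullet> x = wt ?j * (cf (bas k) ?j \<bullet> cf x ?j)" using hs_inner_has_sum has_sum_unique by blast
 also have "\<dots> = (wt ?j / sqrt (wt ?j)) * (cf x ?j $ ?i)" by (simp add: cf_bas inner_axis inner_commute[of "axis _ _"])
 also have "wt ?j / sqrt (wt ?j) = sqrt (wt ?j)" using wt_pos[of ?j] by (simp add: real_div_sqrt)
 finally show ?thesis .
qed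

lemma bas_orthonormal: "bas k \<bullet> (bas l :: 'n::finite hs) = (if k = l then 1 else 0)"
proof -
 have inj: "inj (midx :: nat => int \<times> 'n)" by (rule inj_midx)
 show ?thesis
 proof (cases "k = l")
  case True
  then show ?thesis using wt_pos[of "fst (midx l :: int \<times> 'n)"] by (simp add: inner_bas cf_bas axis_def)
 next
  case False
  then have "midx k \<noteq> (midx l :: int \<times> 'n)" using inj by (simp add: inj_eq)
  then show ?thesis using False by (auto simp: inner_bas cf_bas axis_def prod_eq_iff)
 qed
qed

lemma Pp_bas [simp]: "Pp (bas k) = (bas k :: 'n::finite hs)"
 by (rule hs_eqI) (use midx_pos[of k, where 'n='n] in \<open>auto simp: cf_bas\<close>)

text \<open>Orthogonal projection onto the span of the first \<open>p + 1\<close> basis vectors;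
  \<open>emb\<close> is the matching isometry from coordinate sequences.\<close>

definition Tp :: "nat => 'n::finite hs => 'n hs" where "Tp p x = (\<Sum>k\<le>p. (bas k \<bullet> x) *\<^sub>R bas k)"

definition emb :: "nat => (nat => real) => 'n::finite hs" where "emb p \<xi> = (\<Sum>k\<le>p. \<xi> k *\<^sub>R bas k)"

lemma bas_inner_emb: "bas l \<bullet> emb p \<xi> = (if l \<le> p then \<xi> l else 0)"
proof -
 have "bas l \<bullet> (emb p \<xi> :: 'n::finite hs) = (\<Sum>k\<le>p. if k = l then \<xi> k else 0)"
  unfolding emb_def inner_sum_right inner_scaleR_right bas_orthonormal
  by (rule sum.cong) auto
 then show ?thesis by (simp add: sum.delta)
qed

lemma norm_emb: "(norm (emb p \<xi>))\<^sup>2 = (\<Sum>k\<le>p. (\<xi> k)\<^sup>2)"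
proof -
 have "(norm (emb p \<xi> :: 'n::finite hs))\<^sup>2 = (\<Sum>k\<le>p. \<xi> k * (bas k \<bullet> (emb p \<xi> :: 'n hs)))"
  unfolding power2_norm_eq_inner by (subst emb_def) (simp add: inner_sum_left)
 then show ?thesis by (simp add: bas_inner_emb power2_eq_square)
qed

lemma Tp_emb: "Tp p x = emb p (\<lambda>k. bas k \<bullet> x)" by (simp add: Tp_def emb_def)

lemma Tp_of_emb: "Tp p (emb p \<xi>) = emb p \<xi>"
 unfolding Tp_def emb_def[of p \<xi>] bas_inner_emb[unfolded emb_def] by (rule sum.cong) auto

lemma norm_Tp: "(norm (Tp p x))\<^sup>2 = (\<Sum>k\<le>p. (bas k \<bullet> x)\<^sup>2)"
 by (simp add: Tp_emb norm_emb)

lemma Pp_emb [simp]: "Pp (emb p \<xi>) = emb p \<xi>"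
proof -
 have "Pp (emb p \<xi>) = (\<Sum>k\<le>p. Pp (\<xi> k *\<^sub>R bas k))" unfolding emb_def by (rule linear_sum[OF linear_P(1)])
 then show ?thesis by (simp add: emb_def)
qed

lemma linear_Tp: "linear (Tp p)"
 by (rule linearI) (auto simp: Tp_def inner_add_right scaleR_add_left sum.distrib scaleR_sum_right)

lemmas Tp_add = linear_add[OF linear_Tp] and Tp_diff = linear_diff[OF linear_Tp]
 and Tp_scaleR = linear_cmul[OF linear_Tp]

lemma norm_diff_Tp: "norm (x - Tp p x) \<le> norm x"
proof (rule power2_le_imp_le)
 have "x \<bullet> Tp p x = (norm (Tp p x))\<^sup>2"
  unfolding norm_Tp by (simp add: Tp_def inner_sum_right inner_commute[of x] power2_eq_square)
 then have "(norm (x - Tp p x))\<^sup>2 = (norm x)\<^sup>2 - (norm (Tp p x))\<^sup>2"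
  by (simp add: power2_norm_eq_inner inner_diff_left inner_diff_right inner_commute[of "Tp p x" x])
 then show "(norm (x - Tp p x))\<^sup>2 \<le> (norm x)\<^sup>2" by simp
qed simp

lemma cf_Tp:
 assumes "0 < j"
 shows "cf (Tp p (x :: 'n::finite hs)) j $ i = (if \<exists>k\<le>p. midx k = (j, i) then cf x j $ i else 0)"
proof -
 have inj: "inj (midx :: nat => int \<times> 'n)" by (rule inj_midx)
 have t: "((bas k \<bullet> x) *\<^sub>R cf (bas k :: 'n hs) j) $ i = (if midx k = (j, i) then cf x j $ i else 0)" for k
  using wt_pos[of j] by (auto simp: inner_bas cf_bas axis_def prod_eq_iff)
 have "cf (Tp p x) j $ i = (\<Sum>k\<le>p. if midx k = (j, i) then cf x j $ i else 0)"
  unfolding Tp_def cf_sum cf_scaleR by (simp add: t[simplified])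
 also have "\<dots> = (if \<exists>k\<le>p. midx k = (j, i) then cf x j $ i else 0)"
 proof (cases "\<exists>k\<le>p. midx k = (j, i)")
  case True
  then obtain k where k: "k \<le> p" "midx k = (j, i)" by blast
  have "midx l = (j, i) \<longleftrightarrow> l = k" for l using k(2) inj by (metis injD)
  then show ?thesis using k by (simp add: sum.delta)
 qed auto
 finally show ?thesis .
qed

lemma trunc_tendsto: "(\<lambda>N. norm (x - trunc N x)) \<longlonglongrightarrow> 0"
proof -
 let ?g = "\<lambda>j. wt j * (norm (cf x j))\<^sup>2"
 define A where "A N = {-int N..int N}" for N :: nat
 have "filterlim A (finite_subsets_at_top UNIV) sequentially"
  unfolding A_def by (rule symmetric_intervals_exhaust)
 then have lim: "(\<lambda>N. sum ?g (A N)) \<longlonglongrightarrow> (norm x)\<^sup>2"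
  using hs_norm_has_sum[of x] unfolding has_sum_def by (rule filterlim_compose[rotated])
 have "(norm (x - trunc N x))\<^sup>2 = (norm x)\<^sup>2 - sum ?g (A N)" for N
 proof -
  have "((\<lambda>j. if j \<in> A N then ?g j else 0) has_sum sum ?g (A N)) UNIV"
   by (subst has_sum_cong_neutral[where T="A N" and g="?g"]) (auto simp: A_def intro: has_sum_finite)
  then have "((\<lambda>j. ?g j + (-1) * (if j \<in> A N then ?g j else 0)) has_sum ((norm x)\<^sup>2 + (-1) * sum ?g (A N))) UNIV"
   by (intro has_sum_add has_sum_cmult_right hs_norm_has_sum)
  moreover have "?g j + (-1) * (if j \<in> A N then ?g j else 0) = wt j * (norm (cf (x - trunc N x) j))\<^sup>2" for j
   by (auto simp: A_def)
  ultimately have "((\<lambda>j. wt j * (norm (cf (x - trunc N x) j))\<^sup>2) has_sum ((norm x)\<^sup>2 + (-1) * sum ?g (A N))) UNIV"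
   by simp
  then show ?thesis using hs_norm_has_sum[of "x - trunc N x"] has_sum_unique by fastforce
 qed
 moreover have "(\<lambda>N. (norm x)\<^sup>2 - sum ?g (A N)) \<longlonglongrightarrow> (norm x)\<^sup>2 - (norm x)\<^sup>2" by (intro tendsto_intros lim)
 ultimately have "(\<lambda>N. (norm (x - trunc N x))\<^sup>2) \<longlonglongrightarrow> 0" by simp
 then have "(\<lambda>N. sqrt ((norm (x - trunc N x))\<^sup>2)) \<longlonglongrightarrow> sqrt 0" by (rule tendsto_real_sqrt)
 then show ?thesis by simp
qed

text \<open>A truncation involves finitely many modes, which an initial segment of the enumeration
  eventually contains. \<open>Tp p\<close> then fixes the truncation, and the rest is small by
  \<open>norm_diff_Tp\<close>.\<close>

lemma Tp_tendsto:
 fixes x :: "'n::finite hs"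
 assumes "Pp x = x" shows "(\<lambda>p. norm (x - Tp p x)) \<longlonglongrightarrow> 0"
proof (rule LIMSEQ_I)
 fix e :: real assume e: "0 < e"
 obtain N where N: "norm (x - trunc N x) < e"
  using order_tendstoD(2)[OF trunc_tendsto e] eventually_happens[of _ sequentially] by fastforce
 define S where "S = ({0<..int N} \<times> UNIV :: (int \<times> 'n) set)"
 have "finite S" by (simp add: S_def)
 have "S \<subseteq> modes" by (auto simp: S_def modes_def)
 then have "S \<subseteq> range midx" unfolding range_midx .
 then obtain K where K: "finite K" "S = midx ` K" using \<open>finite S\<close> by (meson finite_subset_image)
 define P where "P = Max (insert 0 K)"
 show "\<exists>no. \<forall>p\<ge>no. norm (norm (x - Tp p x) - 0) < e"
 proof (intro exI[of _ P] allI impI)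
  fix p assume p: "P \<le> p"
  have fix_trunc: "Tp p (trunc N x) = trunc N x"
  proof (rule hs_eqI)
   fix j
   show "cf (Tp p (trunc N x)) j = cf (trunc N x) j"
   proof (cases "0 < j")
    case False
    have "cf x j = cf (Pp x) j" using assms by simp
    then have "cf x j = 0" using False by simp
    moreover have "cf (Tp p (trunc N x)) j = cf (Pp (Tp p (trunc N x))) j" by (simp add: Tp_emb)
    ultimately show ?thesis using False by simp
   next
    case True
    show ?thesis
    proof (cases "j \<le> int N")
     case False
     then show ?thesis using True by (simp add: vec_eq_iff cf_Tp)
    next
     case jN: True
     have "\<exists>k\<le>p. midx k = (j, i)" for i :: 'n
     proof -
      have "(j, i) \<in> S" using True jN by (simp add: S_def)
      then obtain k where "k \<in> K" "midx k = (j, i)" using K(2) by (metis imageE)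
      moreover have "k \<le> P" unfolding P_def using K(1) \<open>k \<in> K\<close> by (intro Max_ge) auto
      ultimately show ?thesis using p by (meson order.trans)
     qed
     then show ?thesis using True by (simp add: vec_eq_iff cf_Tp)
    qed
   qed
  qed
  have "x - Tp p x = (x - trunc N x) - Tp p (x - trunc N x)" using fix_trunc by (simp add: Tp_diff)
  then have "norm (x - Tp p x) \<le> norm (x - trunc N x)" using norm_diff_Tp by metis
  then show "norm (norm (x - Tp p x) - 0) < e" using N by simp
 qed
qed

text \<open>Pointwise convergence of the projections becomes uniform on a relatively compact image,
  since by \<open>norm_diff_Tp\<close> taking the remainder does not increase distances.\<close>

lemma Tp_uniform:
 fixes K :: "'n::finite hs => real => 'n hs"
 assumes K: "relcpt K" "\<And>x u. Pp (K x u) = K x u" and e: "0 < e"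
 shows "\<exists>p0. \<forall>p\<ge>p0. \<forall>x u. norm x \<le> R \<longrightarrow> u \<in> {0..1} \<longrightarrow> norm (K x u - Tp p (K x u)) \<le> e"
proof (rule ccontr)
 assume "\<not> ?thesis"
 then have "\<forall>p0. \<exists>p x u. p \<ge> p0 \<and> norm x \<le> R \<and> u \<in> {0..1} \<and> e < norm (K x u - Tp p (K x u))"
  by (meson not_le)
 then obtain p x u where pxu: "\<And>k::nat. p k \<ge> k" "\<And>k. norm (x k) \<le> R" "\<And>k. u k \<in> {0..1}"
  "\<And>k. e < norm (K (x k) (u k) - Tp (p k) (K (x k) (u k)))" by metis
 then obtain r l where r: "strict_mono (r :: nat => nat)" "(\<lambda>k. K (x (r k)) (u (r k))) \<longlonglongrightarrow> l"
  using K(1) unfolding relcpt_def by meson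
 have "(\<lambda>k. Pp (K (x (r k)) (u (r k)))) \<longlonglongrightarrow> Pp l" by (rule tendsto_P(1)[OF r(2)])
 then have Pl: "Pp l = l" using r(2) K(2) LIMSEQ_unique by fastforce
 have le: "e \<le> norm (K (x (r k)) (u (r k)) - l) + norm (l - Tp (p (r k)) l)" for k
 proof -
  let ?v = "K (x (r k)) (u (r k))" and ?T = "Tp (p (r k))"
  have "?v - ?T ?v = ((?v - l) - ?T (?v - l)) + (l - ?T l)" by (simp add: Tp_diff)
  then have "norm (?v - ?T ?v) \<le> norm ((?v - l) - ?T (?v - l)) + norm (l - ?T l)" by (metis norm_triangle_ineq)
  then show ?thesis using norm_diff_Tp[of "?v - l" "p (r k)"] pxu(4)[of "r k"] by linarith
 qed
 have "filterlim (\<lambda>k. p (r k)) at_top sequentially"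
  by (rule filterlim_at_top_mono[OF filterlim_subseq[OF r(1)]]) (use pxu(1) in auto)
 from filterlim_compose[OF Tp_tendsto[OF Pl] this]
 have "(\<lambda>k. norm (l - Tp (p (r k)) l)) \<longlonglongrightarrow> 0" .
 moreover have "(\<lambda>k. norm (K (x (r k)) (u (r k)) - l)) \<longlonglongrightarrow> 0"
  using tendsto_norm[OF LIM_zero[OF r(2)]] by simp
 ultimately have "(\<lambda>k. norm (K (x (r k)) (u (r k)) - l) + norm (l - Tp (p (r k)) l)) \<longlonglongrightarrow> 0 + 0" by (intro tendsto_add)
 then have "e \<le> 0" using le by (intro LIMSEQ_le_const[where X="\<lambda>k. norm (K (x (r k)) (u (r k)) - l) + norm (l - Tp (p (r k)) l)"]) auto
 then show False using e by simp
qed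

text \<open>The unit sphere of dimension \<open>p\<close>, realised by sequences vanishing beyond
  \<open>p\<close>: the underlying set of \<open>nsphere p\<close>.\<close>

definition usphere :: "nat => (nat => real) set" where
 "usphere p = {x. (\<Sum>i\<le>p. x i ^ 2) = 1 \<and> (\<forall>i>p. x i = 0)}"

lemma not_contractible_usphere: "\<not> contractible (usphere p)"
proof -
 have "nsphere p = top_of_set (usphere p)"
  unfolding nsphere usphere_def by (simp add: euclidean_product_topology)
 then show ?thesis using non_contractible_space_nsphere[of p] by simp
qed

lemma emb_Sp: "\<xi> \<in> usphere p ==> emb p \<xi> \<in> (Sp :: 'n::finite hs set)"
proof -
 assume \<xi>: "\<xi> \<in> usphere p"
 have "(norm (emb p \<xi> :: 'n hs))\<^sup>2 = (\<Sum>k\<le>p. (\<xi> k)\<^sup>2)" by (rule norm_emb)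
 then have "norm (emb p \<xi> :: 'n hs) = 1" using \<xi>
  by (simp add: usphere_def power2_eq_1_iff) (use norm_ge_zero[of "emb p \<xi> :: 'n hs"] in linarith)
 then show ?thesis by (simp add: Sp_def)
qed

lemma continuous_emb: "continuous_on S f ==> continuous_on S (\<lambda>x. emb p (f x))"
proof -
 assume "continuous_on S f"
 then have "continuous_on S (\<lambda>x. f x k)" for k by (rule continuous_on_product_then_coordinatewise)
 then show ?thesis unfolding emb_def by (intro continuous_on_sum continuous_on_scaleR continuous_on_const)
qed

definition nrm :: "nat => 'n::finite hs => nat => real" where
 "nrm p w k = (if k \<le> p then (bas k \<bullet> w) / norm (Tp p w) else 0)"

lemma nrm_usphere:
 assumes "Tp p w \<noteq> 0" shows "nrm p w \<in> usphere p"
proof -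
 have pos: "0 < (norm (Tp p w))\<^sup>2" using assms by simp
 have "(\<Sum>i\<le>p. (nrm p w i)\<^sup>2) = (\<Sum>i\<le>p. (bas i \<bullet> w)\<^sup>2) / (norm (Tp p w))\<^sup>2"
  by (simp add: nrm_def power_divide sum_divide_distrib)
 also have "\<dots> = 1" unfolding norm_Tp[symmetric] using pos by simp
 finally show ?thesis by (simp add: usphere_def nrm_def)
qed

lemma homotopy_nrm:
 fixes W :: "real \<times> (nat => real) => 'n::finite hs"
 assumes W: "continuous_on ({0..1} \<times> usphere p) W"
  and nz: "\<And>u \<xi>. u \<in> {0..1} ==> \<xi> \<in> usphere p ==> Tp p (W (u, \<xi>)) \<noteq> 0"
 shows "homotopic_with_canon (\<lambda>x. True) (usphere p) (usphere p) (\<lambda>\<xi>. nrm p (W (0, \<xi>))) (\<lambda>\<xi>. nrm p (W (1, \<xi>)))"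
 unfolding homotopic_with_def
proof (intro exI conjI allI ballI)
 have TW: "continuous_on ({0..1} \<times> usphere p) (\<lambda>x. norm (Tp p (W x)))"
  unfolding Tp_def by (intro continuous_intros W)
 have c: "continuous_on ({0..1} \<times> usphere p) (\<lambda>x. nrm p (W x))"
 proof (rule continuous_on_coordinatewise_then_product)
  fix i
  show "continuous_on ({0..1} \<times> usphere p) (\<lambda>x. nrm p (W x) i)"
  proof (cases "i \<le> p")
   case True
   have "continuous_on ({0..1} \<times> usphere p) (\<lambda>x. (bas i \<bullet> W x) / norm (Tp p (W x)))"
    by (intro continuous_intros W TW) (use nz in auto)
   then show ?thesis using True by (simp add: nrm_def)
  qed (simp add: nrm_def)
 qed
 have "(\<lambda>x. nrm p (W x)) \<in> {0..1} \<times> usphere p \<rightarrow> usphere p"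
  using nz by (auto intro!: nrm_usphere)
 then show "continuous_map (prod_topology (top_of_set {0..1}) (top_of_set (usphere p))) (top_of_set (usphere p)) (\<lambda>x. nrm p (W x))"
  using c by simp
qed auto

text \<open>If no image of the sphere met the ray through \<open>e\<close>, the plus part could be
  deformed without zeros, first along the homotopy to \<open>h\<close> and then along segments to
  \<open>- e\<close>. Projected to finite dimension and normalised, this would contract a sphere to
  a point. The projection is harmless because the compact term is uniformly close to its
  finite-dimensional part.\<close>

theorem Gam_intersection:
 fixes e :: "'n::finite hs"
 assumes h: "h \<in> Gam" and e: "Pp e = e" "e \<noteq> 0"
 shows "\<exists>x\<in>Sp. \<exists>s\<ge>0. Pp (h x) = s *\<^sub>R e"
proof (rule ccontr)
 assume neg: "\<not> ?thesis"
 from h obtain a b c K where g: "cont2 a" "cont2 b" "cont2 c" "cont2 K" "posbdd a" "posbdd b" "posbdd c" "relcpt K"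
   "\<And>x u. u \<in> {0..1} ==> Pp x \<noteq> 0 ==> Pp (gmap a b c K u x) \<noteq> 0"
   "\<And>x. gmap a b c K 0 x = x" "\<And>x. h x = gmap a b c K 1 x"
  unfolding Gam_def by blast
 have apos: "0 < a x u" if "u \<in> {0..1}" for x u
  using g(5) that unfolding posbdd_def by (metis less_le_trans order_refl)
 \<comment> \<open>Dividing by the positive factor \<open>a\<close> affects neither zeros nor the
   ray, and leaves the identity plus a compact term.\<close>
 define \<kappa> where "\<kappa> x u = (1 / a x u) *\<^sub>R Pp (K x u)" for x u
 have P\<kappa>: "Pp (\<kappa> x u) = \<kappa> x u" for x u by (simp add: \<kappa>_def)
 have PG: "Pp (gmap a b c K u x) = a x u *\<^sub>R (x + \<kappa> x u)" if "x \<in> Sp" "u \<in> {0..1}" for x u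
  using apos[OF that(2), of x] that(1) by (simp add: gmap_def \<kappa>_def Sp_def scaleR_add_right)
 have rk: "relcpt \<kappa>" unfolding \<kappa>_def
 proof (rule relcpt_scaleR)
  show "relcpt (\<lambda>x u. Pp (K x u))" by (rule relcpt_compose[OF g(8) continuous_on_P(1)[OF continuous_on_id]])
  show "relcpt (\<lambda>x u. 1 / a x u)"
  proof (rule relcpt_real)
   fix R
   obtain \<alpha> \<beta> where ab: "0 < \<alpha>" "\<forall>x. norm x \<le> R \<longrightarrow> (\<forall>u\<in>{0..1}. \<alpha> \<le> a x u \<and> a x u \<le> \<beta>)"
    using g(5) unfolding posbdd_def by meson
   then have "\<bar>1 / a x u\<bar> \<le> 1 / \<alpha>" if "norm x \<le> R" "u \<in> {0..1}" for x u
    using that apos[OF that(2), of x] by (simp add: frac_le)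
   then show "\<exists>B. \<forall>x. norm x \<le> R \<longrightarrow> (\<forall>u\<in>{0..1}. \<bar>1 / a x u\<bar> \<le> B)" by blast
  qed
 qed
 have ck: "continuous_on (UNIV \<times> {0..1}) (\<lambda>p. \<kappa> (fst p) (snd p))"
  unfolding \<kappa>_def using g(1,4) unfolding cont2_def
  by (intro continuous_intros continuous_on_P) (auto, metis apos atLeastAtMost_iff less_irrefl)
 have k_seq: "(\<lambda>k. \<kappa> (x k) (u k)) \<longlonglongrightarrow> \<kappa> x' u'"
  if "x \<longlonglongrightarrow> x'" "u \<longlonglongrightarrow> u'" "\<And>k. u k \<in> {0..1}" "u' \<in> {0..1}" for x u x' u'
  using continuous_on_tendsto_compose[OF ck, of "\<lambda>k. (x k, u k)" "(x', u')" sequentially] that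
  by (auto intro: tendsto_Pair)
 have Sp_closed: "x' \<in> Sp" if "x \<longlonglongrightarrow> x'" "\<And>k. x k \<in> Sp" for x :: "nat => 'n hs" and x'
 proof -
  have "(\<lambda>k. Pp (x k)) \<longlonglongrightarrow> Pp x'" "(\<lambda>k. norm (x k)) \<longlonglongrightarrow> norm x'"
   by (intro tendsto_P(1) tendsto_norm that(1))+
  moreover have "(\<lambda>k. Pp (x k)) = x" "(\<lambda>k. norm (x k)) = (\<lambda>k. 1)" using that(2) by (auto simp: Sp_def)
  ultimately have "x \<longlonglongrightarrow> Pp x'" "norm x' = 1" by (simp_all add: LIMSEQ_const_iff)
  then have "Pp x' = x'" using that(1) by (metis LIMSEQ_unique)
  then show ?thesis using \<open>norm x' = 1\<close> by (simp add: Sp_def)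
 qed
 have nz1: "x + \<kappa> x u \<noteq> 0" if "x \<in> Sp" "u \<in> {0..1}" for x u
 proof -
  have "Pp x \<noteq> 0" using that(1) by (auto simp: Sp_def)
  then have "Pp (gmap a b c K u x) \<noteq> 0" by (rule g(9)[OF that(2)])
  then show ?thesis unfolding PG[OF that] by (metis scaleR_zero_right)
 qed
 have nz2: "x + \<kappa> x 1 \<noteq> s *\<^sub>R e" if "x \<in> Sp" "0 \<le> s" for x s
 proof
  assume "x + \<kappa> x 1 = s *\<^sub>R e"
  then have "Pp (h x) = (a x 1 * s) *\<^sub>R e" using PG[OF that(1), of 1] g(11) by simp
  moreover have "0 \<le> a x 1 * s" using apos[of 1 x] that(2) by simp
  ultimately show False using neg that(1) by blast
 qed
 have nSp: "norm x \<le> 1" if "x \<in> Sp" for x :: "'n hs" using that by (simp add: Sp_def)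
 \<comment> \<open>The condition \<open>s * (1 - u) = 0\<close> used below describes two stages:
   first \<open>u\<close> runs with \<open>s = 0\<close>, then \<open>s\<close> runs with
   \<open>u = 1\<close>.\<close>
 define W where "W x u s = (1 - s) *\<^sub>R (x + \<kappa> x u) - s *\<^sub>R e" for x u s
 have nzW: "W x u s \<noteq> 0" if x: "x \<in> Sp" and us: "u \<in> {0..1}" "s \<in> {0..1}" "s * (1 - u) = 0" for x u s
 proof
  assume W0: "W x u s = 0"
  consider "s = 0" | "u = 1" "s = 1" | "u = 1" "s < 1" using us by fastforce
  then show False
  proof cases
   case 1
   then show ?thesis using W0 nz1[OF x us(1)] by (simp add: W_def)
  next
   case 2
   then show ?thesis using W0 e(2) by (simp add: W_def)
  next
   case 3
   have "inverse (1 - s) *\<^sub>R ((1 - s) *\<^sub>R (x + \<kappa> x 1)) = inverse (1 - s) *\<^sub>R (s *\<^sub>R e)"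
    using W0 3(1) by (simp add: W_def)
   then have "x + \<kappa> x 1 = (inverse (1 - s) * s) *\<^sub>R e" using 3(2) by simp
   moreover have "0 \<le> inverse (1 - s) * s" using 3(2) us(2) by simp
   ultimately show ?thesis using nz2[OF x] by blast
  qed
 qed
 \<comment> \<open>\<open>Sp\<close> is not compact, but \<open>\<kappa>\<close> has relatively
   compact image: when \<open>W\<close> tends to 0, the points \<open>x\<close> themselves converge
   along a subsequence unless \<open>s\<close> tends to 1. In that case only \<open>- e\<close>
   would remain in the limit, which is not zero.\<close>
 have "\<exists>\<delta>>0. \<forall>x\<in>Sp. \<forall>u\<in>{0..1}. \<forall>s\<in>{0..1}. s * (1 - u) = 0 \<longrightarrow> \<delta> \<le> norm (W x u s)"
 proof (rule ccontr)
  assume n: "\<not> ?thesis"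
  have "\<exists>x u s. x \<in> Sp \<and> u \<in> {0..1} \<and> s \<in> {0..1} \<and> s * (1 - u) = 0 \<and> norm (W x u s) < 1 / real (Suc k)" for k
  proof -
   have "0 < 1 / real (Suc k)" by simp
   then show ?thesis using n by (meson not_le)
  qed
  then obtain x u s where xs: "\<And>k. x k \<in> Sp" "\<And>k. u k \<in> {0..1::real}" "\<And>k. s k \<in> {0..1::real}"
   "\<And>k. s k * (1 - u k) = 0" "\<And>k. norm (W (x k) (u k) (s k)) < 1 / real (Suc k)"
   by metis
  obtain \<sigma> r0 where r0: "\<sigma> \<in> {0..1}" "strict_mono (r0 :: nat => nat)" "(s \<circ> r0) \<longlonglongrightarrow> \<sigma>"
   using compact_Icc[of 0 "1::real"] xs(3) unfolding compact_def by blast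
  have "relcpt (\<lambda>(x::'n hs) (u::real). u)" by (rule relcpt_real) (auto intro!: exI[of _ 1])
  from relcpt_Pair[OF rk this] have rp: "relcpt (\<lambda>x u. (\<kappa> x u, u))" .
  have "\<forall>k. norm ((x \<circ> r0) k) \<le> 1 \<and> (u \<circ> r0) k \<in> {0..1}" using nSp xs by simp
  then obtain r1 l where r1: "strict_mono (r1 :: nat => nat)" "(\<lambda>k. (\<kappa> ((x \<circ> r0) (r1 k)) ((u \<circ> r0) (r1 k)), (u \<circ> r0) (r1 k))) \<longlonglongrightarrow> l"
   using rp unfolding relcpt_def by meson
  define r v where "r = r0 \<circ> r1" and "v = snd l"
  have r: "strict_mono r" unfolding r_def by (rule strict_mono_o[OF r0(2) r1(1)])
  have l1: "(\<lambda>k. \<kappa> (x (r k)) (u (r k))) \<longlonglongrightarrow> fst l" and l2: "(\<lambda>k. u (r k)) \<longlonglongrightarrow> v"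
   using tendsto_fst[OF r1(2)] tendsto_snd[OF r1(2)] by (simp_all add: r_def v_def)
  have ls: "(\<lambda>k. s (r k)) \<longlonglongrightarrow> \<sigma>" using LIMSEQ_subseq_LIMSEQ[OF r0(3) r1(1)] by (simp add: r_def o_def)
  have v01: "v \<in> {0..1}"
   using closed_sequentially[OF closed_atLeastAtMost, of "\<lambda>k. u (r k)" 0 1 v] xs(2) l2 by blast
  have "(\<lambda>k. s (r k) * (1 - u (r k))) \<longlonglongrightarrow> \<sigma> * (1 - v)" by (intro tendsto_intros ls l2)
  then have \<sigma>v: "\<sigma> * (1 - v) = 0" unfolding xs(4) by (simp add: LIMSEQ_const_iff)
  have z: "(\<lambda>k. W (x (r k)) (u (r k)) (s (r k))) \<longlonglongrightarrow> 0"
  proof (rule tendsto_0_le[where K=1])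
   show "(\<lambda>k. 1 / real (Suc k)) \<longlonglongrightarrow> 0" using LIMSEQ_inverse_real_of_nat by (simp add: inverse_eq_divide)
   have "norm (W (x (r k)) (u (r k)) (s (r k))) \<le> 1 / real (Suc k)" for k
   proof -
    have "1 / real (Suc (r k)) \<le> 1 / real (Suc k)" using seq_suble[OF r, of k] by (simp add: frac_le)
    then show ?thesis using xs(5)[of "r k"] by linarith
   qed
   then show "\<forall>\<^sub>F k in sequentially. norm (W (x (r k)) (u (r k)) (s (r k))) \<le> norm (1 / real (Suc k)) * 1" by simp
  qed
  have "(\<lambda>k. W (x (r k)) (u (r k)) (s (r k)) + s (r k) *\<^sub>R e - (1 - s (r k)) *\<^sub>R \<kappa> (x (r k)) (u (r k)))
    \<longlonglongrightarrow> 0 + \<sigma> *\<^sub>R e - (1 - \<sigma>) *\<^sub>R fst l"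
   by (intro tendsto_intros z ls l1)
  then have w: "(\<lambda>k. (1 - s (r k)) *\<^sub>R x (r k)) \<longlonglongrightarrow> \<sigma> *\<^sub>R e - (1 - \<sigma>) *\<^sub>R fst l"
   by (simp add: W_def scaleR_add_right)
  show False
  proof (cases "\<sigma> = 1")
   case True
   have "norm ((1 - s (r k)) *\<^sub>R x (r k)) = 1 - s (r k)" for k
    using xs(1)[of "r k"] xs(3)[of "r k"] by (simp add: Sp_def)
   then have "(\<lambda>k. 1 - s (r k)) \<longlonglongrightarrow> norm e" using tendsto_norm[OF w] True by simp
   moreover have "(\<lambda>k. 1 - s (r k)) \<longlonglongrightarrow> 1 - 1" using tendsto_diff[OF tendsto_const[of 1] ls] True by simp
   ultimately have "norm e = 0" using LIMSEQ_unique by fastforce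
   then show False using e(2) by simp
  next
   case False
   then have \<sigma>1: "\<sigma> < 1" using r0(1) by simp
   have ev: "\<forall>\<^sub>F k in sequentially. s (r k) < 1" using order_tendstoD(2)[OF ls \<sigma>1] .
   define x' where "x' = inverse (1 - \<sigma>) *\<^sub>R (\<sigma> *\<^sub>R e - (1 - \<sigma>) *\<^sub>R fst l)"
   have "(\<lambda>k. inverse (1 - s (r k)) *\<^sub>R ((1 - s (r k)) *\<^sub>R x (r k))) \<longlonglongrightarrow> x'"
    unfolding x'_def by (intro tendsto_intros ls w) (use \<sigma>1 in simp)
   then have xl: "(\<lambda>k. x (r k)) \<longlonglongrightarrow> x'"
    by (rule Lim_transform_eventually) (use ev in eventually_elim, simp)
   have "(\<lambda>k. W (x (r k)) (u (r k)) (s (r k))) \<longlonglongrightarrow> W x' v \<sigma>"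
    unfolding W_def by (intro tendsto_intros ls xl k_seq l2 xs(2) v01)
   then have "W x' v \<sigma> = 0" using z LIMSEQ_unique by blast
   then show False using nzW[OF Sp_closed[OF xl xs(1)] v01 r0(1) \<sigma>v] by blast
  qed
 qed
 then obtain \<delta> where \<delta>: "0 < \<delta>" "\<And>x u s. x \<in> Sp ==> u \<in> {0..1} ==> s \<in> {0..1} ==> s * (1 - u) = 0 ==> \<delta> \<le> norm (W x u s)"
  by blast
 \<comment> \<open>Projection errors of size \<open>d\<close> enter with the weights
   \<open>1 - s\<close> and \<open>s\<close>, so together they stay below the lower bound
   \<open>\<delta>\<close> of \<open>norm W\<close>.\<close>
 define d where "d = \<delta> / 2"
 have d: "0 < d" "d < \<delta>" using \<delta>(1) by (auto simp: d_def)
 obtain p1 where p1: "\<And>p x u. p \<ge> p1 ==> norm x \<le> 1 ==> u \<in> {0..1} ==> norm (\<kappa> x u - Tp p (\<kappa> x u)) \<le> d"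
  using Tp_uniform[OF rk P\<kappa> d(1), of 1] by blast
 obtain p2 where p2: "\<And>p. p \<ge> p2 ==> norm (e - Tp p e) < d"
  using order_tendstoD(2)[OF Tp_tendsto[OF e(1)] d(1)] by (auto simp: eventually_sequentially)
 define p where "p = max p1 p2"
 define X :: "(nat => real) => 'n hs" where "X = emb p"
 have TS: "Tp p (X \<xi>) = X \<xi>" for \<xi> unfolding X_def by (rule Tp_of_emb)
 have XS: "X \<xi> \<in> Sp" if "\<xi> \<in> usphere p" for \<xi> unfolding X_def by (rule emb_Sp[OF that])
 \<comment> \<open>One parameter \<open>t\<close> runs through both stages, each in half of the
   time.\<close>
 define \<mu> \<nu> where "\<mu> t = min 1 (2 * t)" and "\<nu> t = max 0 (2 * t - 1)" for t :: real
 have \<mu>\<nu>: "\<mu> t \<in> {0..1}" "\<nu> t \<in> {0..1}" "\<nu> t * (1 - \<mu> t) = 0" if "t \<in> {0..1}" for t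
  using that by (auto simp: \<mu>_def \<nu>_def min_def max_def)
 have "homotopic_with_canon (\<lambda>x. True) (usphere p) (usphere p)
  (\<lambda>\<xi>. nrm p ((\<lambda>y. W (X (snd y)) (\<mu> (fst y)) (\<nu> (fst y))) (0, \<xi>)))
  (\<lambda>\<xi>. nrm p ((\<lambda>y. W (X (snd y)) (\<mu> (fst y)) (\<nu> (fst y))) (1, \<xi>)))"
 proof (rule homotopy_nrm)
  let ?D = "{0..1} \<times> usphere p"
  have X: "continuous_on ?D (\<lambda>y. X (snd y))"
   unfolding X_def by (intro continuous_emb continuous_on_snd continuous_on_id)
  have m: "continuous_on ?D (\<lambda>y. \<mu> (fst y))" "continuous_on ?D (\<lambda>y. \<nu> (fst y))"
   unfolding \<mu>_def \<nu>_def by (intro continuous_intros)+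
  have "continuous_on ?D (\<lambda>y. (X (snd y), \<mu> (fst y)))" by (intro continuous_on_Pair X m)
  then have "continuous_on ?D (\<lambda>y. \<kappa> (X (snd y)) (\<mu> (fst y)))"
   using continuous_on_compose2[OF ck, of ?D "\<lambda>y. (X (snd y), \<mu> (fst y))"] \<mu>\<nu>(1) by fastforce
  then show "continuous_on ?D (\<lambda>y. W (X (snd y)) (\<mu> (fst y)) (\<nu> (fst y)))"
   unfolding W_def by (intro continuous_on_diff continuous_on_scaleR continuous_on_add continuous_on_const X m)
  fix t :: real and \<xi> assume t: "t \<in> {0..1}" and \<xi>: "\<xi> \<in> usphere p"
  define u s where "u = \<mu> t" and "s = \<nu> t"
  have us: "u \<in> {0..1}" "s \<in> {0..1}" "s * (1 - u) = 0" using \<mu>\<nu>[OF t] by (auto simp: u_def s_def)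
  let ?w = "W (X \<xi>) u s" and ?k = "\<kappa> (X \<xi>) u"
  have "?w = Tp p ?w + ((1 - s) *\<^sub>R (?k - Tp p ?k) - s *\<^sub>R (e - Tp p e))"
   by (simp add: W_def Tp_add Tp_diff Tp_scaleR TS algebra_simps)
  then have "norm ?w \<le> norm (Tp p ?w) + norm ((1 - s) *\<^sub>R (?k - Tp p ?k) - s *\<^sub>R (e - Tp p e))"
   by (metis norm_triangle_ineq)
  moreover have "norm ((1 - s) *\<^sub>R (?k - Tp p ?k) - s *\<^sub>R (e - Tp p e)) \<le> (1 - s) * d + s * d"
  proof -
   have "(1 - s) * norm (?k - Tp p ?k) \<le> (1 - s) * d" "s * norm (e - Tp p e) \<le> s * d"
    using us p1[of p "X \<xi>" u] p2[of p] nSp[OF XS[OF \<xi>]] by (auto simp: p_def intro!: mult_left_mono)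
   then show ?thesis
    using norm_triangle_ineq4[of "(1 - s) *\<^sub>R (?k - Tp p ?k)" "s *\<^sub>R (e - Tp p e)"] us(2) by simp
  qed
  moreover have "(1 - s) * d + s * d = d" by (simp add: algebra_simps)
  ultimately have "0 < norm (Tp p ?w)" using \<delta>(2)[OF XS[OF \<xi>] us] d(2) by linarith
  then show "Tp p ((\<lambda>y. W (X (snd y)) (\<mu> (fst y)) (\<nu> (fst y))) (t, \<xi>)) \<noteq> 0" by (auto simp: u_def s_def)
 qed
 then have H: "homotopic_with_canon (\<lambda>x. True) (usphere p) (usphere p) (\<lambda>\<xi>. nrm p (X \<xi> + \<kappa> (X \<xi>) 0)) (\<lambda>\<xi>. nrm p (- e))"
  by (simp add: W_def \<mu>_def \<nu>_def)
 \<comment> \<open>At time 0 the map is a positive multiple of the identity, and normalisation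
   removes the factor.\<close>
 have H0: "nrm p (X \<xi> + \<kappa> (X \<xi>) 0) = id \<xi>" if \<xi>: "\<xi> \<in> usphere p" for \<xi>
 proof -
  have a0: "0 < a (X \<xi>) 0" by (rule apos) simp
  have "Pp (X \<xi>) = X \<xi>" by (simp add: X_def)
  then have "X \<xi> = a (X \<xi>) 0 *\<^sub>R (X \<xi> + \<kappa> (X \<xi>) 0)" using PG[OF XS[OF \<xi>], of 0] g(10) by simp
  then have "(1 / a (X \<xi>) 0) *\<^sub>R X \<xi> = (1 / a (X \<xi>) 0) *\<^sub>R (a (X \<xi>) 0 *\<^sub>R (X \<xi> + \<kappa> (X \<xi>) 0))" by simp
  then have e: "X \<xi> + \<kappa> (X \<xi>) 0 = (1 / a (X \<xi>) 0) *\<^sub>R X \<xi>" using a0 by simp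
  have n1: "norm (X \<xi>) = 1" using XS[OF \<xi>] by (simp add: Sp_def)
  have "nrm p (X \<xi> + \<kappa> (X \<xi>) 0) k = \<xi> k" for k
  proof (cases "k \<le> p")
   case True
   then show ?thesis unfolding e nrm_def Tp_scaleR TS using a0 n1 by (simp add: X_def bas_inner_emb)
  next
   case False
   then show ?thesis using \<xi> by (simp add: nrm_def usphere_def)
  qed
  then show ?thesis by auto
 qed
 from H have "homotopic_with_canon (\<lambda>x. True) (usphere p) (usphere p) id (\<lambda>\<xi>. nrm p (- e))"
  by (rule homotopic_with_eq) (use H0 in auto)
 then have "contractible (usphere p)" unfolding contractible_def by blast
 then show False using not_contractible_usphere by blast
qed

section \<open>The minimal action and the upper bound for the capacity\<close>

text \<open>The right side truncates negative values at 0, which can only increase the integral. It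
  serves where the lower bound of a Hamiltonian takes negative values.\<close>

lemma nn_integral_ge_integral:
 assumes "integrable M f" shows "ennreal (\<integral>x. f x \<partial>M) \<le> (\<integral>\<^sup>+x. ennreal (f x) \<partial>M)"
proof -
 have m: "integrable M (\<lambda>x. max 0 (f x))" using assms by (intro integrable_max) auto
 have "(\<integral>x. f x \<partial>M) \<le> (\<integral>x. max 0 (f x) \<partial>M)" using assms m by (intro integral_mono) auto
 then have "ennreal (\<integral>x. f x \<partial>M) \<le> ennreal (\<integral>x. max 0 (f x) \<partial>M)" by (rule ennreal_leI)
 also have "\<dots> = (\<integral>\<^sup>+x. ennreal (max 0 (f x)) \<partial>M)" by (rule nn_integral_eq_integral[OF m, symmetric]) simp
 also have "\<dots> = (\<integral>\<^sup>+x. ennreal (f x) \<partial>M)" by (intro nn_integral_cong) (simp add: ennreal_eq_0_iff max_def)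
 finally show ?thesis .
qed

context gauge
begin

theorem cEH_fun_upper_bound:
 assumes "spec A" and H0: "\<And>z. A * (G z - 1) - \<epsilon> \<le> H0 z"
 shows "cEH_fun H0 \<le> ereal (A + \<epsilon>)"
proof (rule cEH_fun_leI)
 fix h :: "'n hs => 'n hs" assume h: "h \<in> Gam"
 have A: "0 < A" using assms(1) by (simp add: spec_def)
 obtain x where x: "Pp x - Pm x = A *\<^sub>R gradH x" "Pz (gradH x) = 0" "AE t in I01. G (crv x t) = 1"
  using spec_critical[OF assms(1)] by blast
 have IHx: "IH x = 1"
 proof -
  have "IH x = (LINT t|I01. 1)" unfolding IH_def
   by (rule integral_cong_AE) (use H_measurable[OF crv_measurable] x(3) in auto)
  then show ?thesis by simp
 qed
 have "Pp x \<noteq> 0"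
 proof
  assume 0: "Pp x = 0"
  have "(Pp x - Pm x) \<bullet> x = A * (gradH x \<bullet> x)" using x(1) by simp
  then have "(norm (Pp x))\<^sup>2 - (norm (Pm x))\<^sup>2 = 2 * A"
   unfolding inner_diff_left P_inner_self(1)[of x x] P_inner_self(3)[of x x]
   by (simp add: gradH_inner_self IHx power2_norm_eq_inner)
  then show False using 0 A zero_le_power2[of "norm (Pm x)"] by simp
 qed
 then obtain y0 s where y0: "y0 \<in> Sp" "0 \<le> s" "Pp (h y0) = s *\<^sub>R Pp x"
  using Gam_intersection[OF h, of "Pp x"] by auto
 define y where "y = h y0"
 define q where "q = (1/2) * ((norm (Pp y))\<^sup>2 - (norm (Pm y))\<^sup>2)"
 have q: "q \<le> A * IH y"
  using half_space_bound[OF x(1) _ y0(2,3)] A by (simp add: q_def y_def)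
 \<comment> \<open>\<open>H0\<close> need not be integrable along \<open>crv y\<close>; only its
   lower bound is, so the estimate is made in the extended nonnegative integral.\<close>
 define r where "r = A * IH y - (A + \<epsilon>)"
 have int: "integrable I01 (\<lambda>t. A * (G (crv y t) - 1) - \<epsilon>)" using H_integrable[OF L2_crv] by simp
 have "(LINT t|I01. A * (G (crv y t) - 1) - \<epsilon>) = r"
  using H_integrable[OF L2_crv, of y] by (simp add: r_def IH_def algebra_simps)
 then have "ennreal r \<le> (\<integral>\<^sup>+t. ennreal (A * (G (crv y t) - 1) - \<epsilon>) \<partial>I01)"
  using nn_integral_ge_integral[OF int] by simp
 also have "\<dots> \<le> (\<integral>\<^sup>+t. ennreal (H0 (crv y t)) \<partial>I01)" by (intro nn_integral_mono ennreal_leI H0)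
 finally have "enn2ereal (ennreal r) \<le> enn2ereal (\<integral>\<^sup>+t. ennreal (H0 (crv y t)) \<partial>I01)"
  by (simp add: less_eq_ennreal.rep_eq)
 then have N: "ereal r \<le> enn2ereal (\<integral>\<^sup>+t. ennreal (H0 (crv y t)) \<partial>I01)"
  by (metis dual_order.trans e2ennreal_ereal enn2ereal_nonneg enn2ereal_ennreal ereal_less_eq(3) linorder_le_cases zero_ereal_def)
 have "PhiH H0 (cf y) \<le> ereal q - ereal r"
  unfolding PhiH_cf q_def[symmetric] by (intro ereal_minus_mono order_refl N)
 also have "\<dots> \<le> ereal (A + \<epsilon>)" using q by (simp add: r_def)
 finally show "\<exists>x\<in>Sp. PhiH H0 (cf (h x)) \<le> ereal (A + \<epsilon>)" using y0(1) y_def by blast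
qed

text \<open>This supplies the symmetric point of the level around which the small sphere is
  placed.\<close>

lemma unit_level_L0: obtains q where "G (q, 0) = 1"
proof -
 obtain v :: "real^'n" where v: "norm v = 1" using vector_choose_size[of 1] by auto
 define g where "g = G (v, 0)"
 have "m * (norm (v, 0 :: real^'n))\<^sup>2 \<le> g" unfolding g_def by (rule G_lower)
 then have g: "0 < g" using m_pos v by simp
 have "G ((1 / sqrt g) *\<^sub>R (v, 0)) = (1 / sqrt g)\<^sup>2 * g" unfolding g_def by (rule G_scale) (use g in \<open>simp add: g_def\<close>)
 also have "\<dots> = 1" using g by (simp add: power_divide)
 finally show ?thesis using that[of "(1 / sqrt g) *\<^sub>R v"] by simp
qed

section \<open>Existence of a smallest multiplier\<close>

lemma cEH_fun_prof_finite:
 assumes "0 < \<rho>" "\<rho> < 1"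
 shows "\<exists>\<Lambda>>0. cEH_fun (\<lambda>z. prof \<Lambda> \<rho> (G z)) \<le> ereal (3 / 2 * \<Lambda>)"
proof -
 define e where "e = (bas 0 :: 'n hs)"
 define j where "j = fst (midx 0 :: int \<times> 'n)"
 \<comment> \<open>With this \<open>\<Lambda>\<close> the growth of the profile, seen in the single
   mode \<open>j\<close>, compensates the positive part \<open>s\<^sup>2 / 2\<close> of the action
   on the ray through \<open>e\<close>.\<close>
 define \<Lambda> where "\<Lambda> = wt j / m"
 have \<Lambda>: "0 < \<Lambda>" using wt_pos m_pos by (simp add: \<Lambda>_def)
 define H where "H z = prof \<Lambda> \<rho> (G z)" for z
 obtain V L' where "hamiltonian V L' H" using hamiltonian_prof[OF \<Lambda> assms] unfolding H_def by blast
 then interpret P: hamiltonian V L' H .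
 have ne: "norm e = 1" unfolding e_def by (simp add: norm_eq_sqrt_inner bas_orthonormal)
 have ce: "(norm (cf e j))\<^sup>2 = 1 / wt j"
  using wt_pos[of j] by (simp add: e_def j_def cf_bas power_divide)
 have "cEH_fun H \<le> ereal (3 / 2 * \<Lambda>)"
 proof (rule cEH_fun_leI)
  fix h :: "'n hs => 'n hs" assume h: "h \<in> Gam"
  have "e \<noteq> 0" using ne by auto
  then obtain y0 s where y0: "y0 \<in> Sp" "0 \<le> s" "Pp (h y0) = s *\<^sub>R e"
   using Gam_intersection[OF h, of e] by (auto simp: e_def)
  define y where "y = h y0"
  have intG: "integrable I01 (\<lambda>t. (norm (crv y t))\<^sup>2)" using L2_crv[of y] by (simp add: L2_def)
  have "j > 0" unfolding j_def by (rule midx_pos)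
  have "cf y j = cf (Pp y) j" using \<open>j > 0\<close> by simp
  then have cfy: "(norm (cf y j))\<^sup>2 = s\<^sup>2 / wt j" using y0(3) ce by (simp add: y_def power_mult_distrib)
  have "(norm (fcoeff j (crv y)))\<^sup>2 \<le> (l2 (crv y))\<^sup>2" by (intro power_mono norm_fcoeff_le L2_crv) simp
  then have l2y: "s\<^sup>2 / wt j \<le> (l2 (crv y))\<^sup>2" using cfy by simp
  have "\<Lambda> * m / 2 * (l2 (crv y))\<^sup>2 - 3 / 2 * \<Lambda> = (LINT t|I01. \<Lambda> * m / 2 * (norm (crv y t))\<^sup>2 - 3 / 2 * \<Lambda>)"
   using intG by (simp add: l2_power2)
  also have "\<dots> \<le> P.IH y" unfolding P.IH_def
  proof (rule integral_mono)
   show "integrable I01 (\<lambda>t. \<Lambda> * m / 2 * (norm (crv y t))\<^sup>2 - 3 / 2 * \<Lambda>)" using intG by simp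
   show "integrable I01 (\<lambda>t. H (crv y t))" by (rule P.H_integrable[OF L2_crv])
   fix t
   have "\<Lambda> * (m * (norm (crv y t))\<^sup>2) \<le> \<Lambda> * G (crv y t)" using G_lower \<Lambda> by (intro mult_left_mono) auto
   then show "\<Lambda> * m / 2 * (norm (crv y t))\<^sup>2 - 3 / 2 * \<Lambda> \<le> H (crv y t)"
    using prof_growth[OF \<Lambda> assms(2), of "G (crv y t)"] unfolding H_def by (simp add: algebra_simps)
  qed
  finally have 1: "\<Lambda> * m / 2 * (l2 (crv y))\<^sup>2 - 3 / 2 * \<Lambda> \<le> P.IH y" .
  have "\<Lambda> * m / 2 * (s\<^sup>2 / wt j) \<le> \<Lambda> * m / 2 * (l2 (crv y))\<^sup>2" using l2y \<Lambda> m_pos by (intro mult_left_mono) auto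
  moreover have "\<Lambda> * m / 2 * (s\<^sup>2 / wt j) = s\<^sup>2 / 2" using m_pos wt_pos[of j] by (simp add: \<Lambda>_def)
  moreover have "(norm (Pp y))\<^sup>2 = s\<^sup>2" using y0(3) ne by (simp add: y_def)
  moreover have "(p - n) / 2 - I \<le> k" if "a \<le> b" "a = c / 2" "p = c" "b - k \<le> I" "0 \<le> n" for a b c k n p I :: real
   using that by argo
  ultimately have "P.Phi y \<le> 3 / 2 * \<Lambda>"
   using 1 zero_le_power2[of "norm (Pm y)"] unfolding P.Phi_def by blast
  then show "\<exists>x\<in>Sp. PhiH H (cf (h x)) \<le> ereal (3 / 2 * \<Lambda>)"
   using y0(1) unfolding y_def by (intro bexI[of _ y0]) (simp_all add: P.PhiH_eq)
 qed
 then show ?thesis using \<Lambda> unfolding H_def by blast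
qed

text \<open>Without any multiplier the lower bound would hold for every positive \<open>B\<close>;
  \<open>3 * \<Lambda>\<close> already exceeds the upper bound.\<close>

lemma spec_nonempty: "\<exists>A. spec A"
proof (rule ccontr)
 assume no: "\<not> ?thesis"
 obtain q where q: "G (q, 0) = 1" by (rule unit_level_L0)
 obtain \<Lambda> where \<Lambda>: "0 < \<Lambda>" "cEH_fun (\<lambda>z. prof \<Lambda> (1/2) (G z)) \<le> ereal (3 / 2 * \<Lambda>)"
  using cEH_fun_prof_finite[of "1/2"] by auto
 have "ereal (3 * \<Lambda>) \<le> cEH_fun (\<lambda>z. prof \<Lambda> (1/2) (G z))"
  by (rule cEH_fun_prof_lower[OF \<Lambda>(1) _ _ _ _ q]) (use no \<Lambda>(1) in auto)
 then have "ereal (3 * \<Lambda>) \<le> ereal (3 / 2 * \<Lambda>)" using \<Lambda>(2) by (rule order.trans)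
 then show False using \<Lambda>(1) by simp
qed

text \<open>Solutions whose multipliers tend to the infimum lie on \<open>G = 1\<close>, hence are
  bounded in \<open>l2\<close>, and the critical equation turns this into a bound in E. Compactness
  of \<open>gradH\<close> then gives a limit solution.\<close>

theorem spec_minimum: "\<exists>A0. spec A0 \<and> (\<forall>A. spec A \<longrightarrow> A0 \<le> A)"
proof -
 define S where "S = {A. spec A}"
 have ne: "S \<noteq> {}" using spec_nonempty by (simp add: S_def)
 have pos: "0 < A" if "A \<in> S" for A using that by (simp add: S_def spec_def)
 have bdd: "bdd_below S" by (rule bdd_belowI[of _ 0]) (use pos in fastforce)
 define A0 where "A0 = Inf S"
 have A0: "0 \<le> A0" unfolding A0_def using ne pos by (intro cInf_greatest) (auto intro: less_imp_le)
 have le: "A0 \<le> A" if "A \<in> S" for A unfolding A0_def by (rule cInf_lower[OF that bdd])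
 have "\<exists>A\<in>S. A < A0 + 1 / real (Suc k)" for k
  using cInf_lessD[OF ne, of "A0 + 1 / real (Suc k)"] unfolding A0_def by simp
 then obtain Ak where Ak: "\<And>k. Ak k \<in> S" "\<And>k. Ak k < A0 + 1 / real (Suc k)" by metis
 have Aklim: "Ak \<longlonglongrightarrow> A0"
 proof (rule tendsto_sandwich[of "\<lambda>_. A0" _ _ "\<lambda>k. A0 + 1 / real (Suc k)"])
  have "(\<lambda>k. A0 + 1 / real (Suc k)) \<longlonglongrightarrow> A0 + 0"
   by (intro tendsto_add tendsto_const) (use LIMSEQ_inverse_real_of_nat in \<open>simp add: inverse_eq_divide\<close>)
  then show "(\<lambda>k. A0 + 1 / real (Suc k)) \<longlonglongrightarrow> A0" by simp
 qed (use le Ak in \<open>auto intro!: always_eventually less_imp_le\<close>)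
 have "\<exists>x. Pp x - Pm x = Ak k *\<^sub>R gradH x \<and> Pz (gradH x) = 0 \<and> (AE t in I01. G (crv x t) = 1)" for k
  using spec_critical[of "Ak k"] Ak(1)[of k] by (auto simp: S_def)
 then obtain x where x: "\<And>k. Pp (x k) - Pm (x k) = Ak k *\<^sub>R gradH (x k)" "\<And>k. Pz (gradH (x k)) = 0"
  "\<And>k. AE t in I01. G (crv (x k) t) = 1" by metis
 have IHx: "IH (x k) = 1" for k
 proof -
  have "IH (x k) = (LINT t|I01. 1)" unfolding IH_def
   by (rule integral_cong_AE) (use H_measurable[OF crv_measurable] x(3) in auto)
  then show ?thesis by simp
 qed
 define c where "c = 1 / sqrt m"
 have l2x: "l2 (crv (x k)) \<le> c" for k
 proof (rule power2_le_imp_le)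
  have i: "integrable I01 (\<lambda>t. (norm (crv (x k) t))\<^sup>2)" using L2_crv[of "x k"] by (simp add: L2_def)
  have "m * (l2 (crv (x k)))\<^sup>2 = (LINT t|I01. m * (norm (crv (x k) t))\<^sup>2)" by (simp add: l2_power2)
  also have "\<dots> \<le> IH (x k)" unfolding IH_def using i H_integrable[OF L2_crv] G_lower by (intro integral_mono) auto
  finally show "(l2 (crv (x k)))\<^sup>2 \<le> c\<^sup>2" using m_pos by (simp add: IHx c_def power_divide field_simps)
 qed (use m_pos in \<open>simp add: c_def\<close>)
 have c0: "0 \<le> c" using m_pos by (simp add: c_def)
 have gradx: "norm (gradH (x k)) \<le> L * c" for k
 proof -
  have "norm (gradH (x k)) \<le> l2 (\<lambda>t. F (crv (x k) t))" unfolding gradH_def by (rule norm_rieszE_le[OF L2_V_crv])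
  also have "\<dots> \<le> L * l2 (crv (x k))" using norm_F_le L_nonneg by (intro l2_mono L2_V_crv L2_crv) auto
  also have "\<dots> \<le> L * c" using l2x L_nonneg by (intro mult_left_mono) auto
  finally show ?thesis .
 qed
 define R where "R = sqrt (((A0 + 1) * (L * c))\<^sup>2 + c\<^sup>2)"
 have xR: "norm (x k) \<le> R" for k
 proof -
  have Akle: "0 \<le> Ak k" "Ak k \<le> A0 + 1"
   using pos[OF Ak(1)[of k]] Ak(2)[of k] by (auto intro: less_imp_le order.strict_trans2)
    (smt (verit) divide_le_eq_1 of_nat_0_le_iff of_nat_Suc)
  have "norm (Pp (x k) - Pm (x k)) \<le> (A0 + 1) * (L * c)"
   unfolding x(1) norm_scaleR using Akle gradx[of k] A0 by (intro mult_mono) auto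
  then have "(norm (Pp (x k) - Pm (x k)))\<^sup>2 \<le> ((A0 + 1) * (L * c))\<^sup>2" by (intro power_mono) auto
  moreover have "(norm (Pp (x k) - Pm (x k)))\<^sup>2 = (norm (Pp (x k)))\<^sup>2 + (norm (Pm (x k)))\<^sup>2"
   by (simp add: power2_norm_eq_inner inner_diff_left inner_diff_right)
  moreover have "(norm (Pz (x k)))\<^sup>2 \<le> c\<^sup>2"
  proof -
   have "((\<lambda>j. wt j * (norm (cf (Pz (x k)) j))\<^sup>2) has_sum (norm (cf (x k) 0))\<^sup>2) UNIV"
    by (subst has_sum_cong_neutral[where T="{0}" and g="\<lambda>j. (norm (cf (x k) 0))\<^sup>2"]) (auto intro: has_sum_finiteI)
   then have "(norm (Pz (x k)))\<^sup>2 = (norm (cf (x k) 0))\<^sup>2" using hs_norm_has_sum has_sum_unique by blast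
   also have "\<dots> \<le> c\<^sup>2" using norm_fcoeff_le[OF L2_crv, of 0 "x k"] l2x[of k] by (intro power_mono) auto
   finally show ?thesis .
  qed
  ultimately have "(norm (x k))\<^sup>2 \<le> ((A0 + 1) * (L * c))\<^sup>2 + c\<^sup>2" unfolding norm_P_sq[of "x k"] by linarith
  then show ?thesis unfolding R_def by (rule real_le_rsqrt)
 qed
 obtain r l where r: "strict_mono (r :: nat => nat)" "\<And>j. (\<lambda>k. cf (x (r k)) j) \<longlonglongrightarrow> cf l j"
  "(\<lambda>k. gradH (x (r k))) \<longlonglongrightarrow> gradH l" using gradH_seq_compact_ex[of x R, OF xR] by blast
 have Akr: "(\<lambda>k. Ak (r k)) \<longlonglongrightarrow> A0" using LIMSEQ_subseq_LIMSEQ[OF Aklim r(1)] by (simp add: o_def)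
 have D: "(\<lambda>k. Pp (x (r k)) - Pm (x (r k))) \<longlonglongrightarrow> A0 *\<^sub>R gradH l"
  unfolding x(1) by (intro tendsto_scaleR Akr r(3))
 have "(\<lambda>k. Pp (x (r k))) \<longlonglongrightarrow> Pp (A0 *\<^sub>R gradH l)" using tendsto_P(1)[OF D] by simp
 moreover have "(\<lambda>k. Pm (x (r k))) \<longlonglongrightarrow> - Pm (A0 *\<^sub>R gradH l)" using tendsto_minus[OF tendsto_P(3)[OF D]] by simp
 moreover have "(\<lambda>k. Pz (x (r k))) \<longlonglongrightarrow> Pz l" by (rule cf_Pz_tendsto[OF r(2)])
 ultimately have "(\<lambda>k. Pp (x (r k)) + Pz (x (r k)) + Pm (x (r k))) \<longlonglongrightarrow> Pp (A0 *\<^sub>R gradH l) + Pz l + - Pm (A0 *\<^sub>R gradH l)"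
  by (intro tendsto_add)
 then obtain y where y: "(\<lambda>k. x (r k)) \<longlonglongrightarrow> y" unfolding P_decomp[symmetric] by blast
 have gy: "(\<lambda>k. gradH (x (r k))) \<longlonglongrightarrow> gradH y"
  by (rule continuous_on_tendsto_compose[OF continuous_gradH[of UNIV] y]) auto
 have crit: "Pp y - Pm y = A0 *\<^sub>R gradH y"
 proof (rule LIMSEQ_unique)
  show "(\<lambda>k. Pp (x (r k)) - Pm (x (r k))) \<longlonglongrightarrow> Pp y - Pm y" by (intro tendsto_diff tendsto_P y)
  show "(\<lambda>k. Pp (x (r k)) - Pm (x (r k))) \<longlonglongrightarrow> A0 *\<^sub>R gradH y" unfolding x(1) by (intro tendsto_scaleR Akr gy)
 qed
 have Pz0: "Pz (gradH y) = 0"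
  using tendsto_P(2)[OF gy] LIMSEQ_unique[OF _ tendsto_const[of 0]] unfolding x(2) by blast
 have IHy: "IH y = 1"
 proof -
  have "(\<lambda>k. Phi (x (r k))) \<longlonglongrightarrow> Phi y" by (rule Phi_tendsto[OF y])
  moreover have "(\<lambda>k. ((norm (Pp (x (r k))))\<^sup>2 - (norm (Pm (x (r k))))\<^sup>2) / 2 - Phi (x (r k))) \<longlonglongrightarrow>
    ((norm (Pp y))\<^sup>2 - (norm (Pm y))\<^sup>2) / 2 - Phi y"
   by (intro tendsto_intros tendsto_P y calculation) auto
  ultimately have "(\<lambda>k. IH (x (r k))) \<longlonglongrightarrow> IH y" by (simp add: Phi_def)
  then show ?thesis unfolding IHx by (simp add: LIMSEQ_const_iff)
 qed
 \<comment> \<open>Multiplier 0 would leave a constant loop \<open>p\<close> in \<open>L0\<close>.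
   The zero part of the gradient vanishes, so \<open>F p\<close> is orthogonal to \<open>p\<close>,
   and Euler's identity gives \<open>G p = 0\<close>, against the mean value 1.\<close>
 have "A0 \<noteq> 0"
 proof
  assume "A0 = 0"
  then have "Pp y - Pm y = 0" using crit by simp
  then have "Pp (Pp y - Pm y) = 0" "Pm (Pp y - Pm y) = 0" by simp_all
  then have "Pp y = 0" "Pm y = 0" by simp_all
  then have "y = Pz y" using P_decomp[of y] by simp
  define p where "p = (cf y 0, 0 :: real^'n)"
  have crvp: "AE t in I01. crv y t = p"
  proof (rule crv_eqI[OF L2_const])
   fix j
   have "cf y j = (if j = 0 then cf y 0 else 0)" using \<open>y = Pz y\<close> by (metis cf_Pz)
   moreover have "fmode 0 p = (\<lambda>t. p)" by (auto simp: fmode_def)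
   then have "fcoeff j (\<lambda>t. p) = (if j = 0 then p else 0)" using fcoeff_fmode[of j 0 p] by simp
   ultimately show "fcoeff j (\<lambda>t. p) = (cf y j, 0)" by (auto simp: p_def zero_prod_def)
  qed
  have "fcoeff 0 (\<lambda>t. F (crv y t)) = fcoeff 0 (\<lambda>t. F p)"
   by (rule fcoeff_cong_AE[OF L2_measurable[OF L2_V_crv]]) (use crvp in \<open>auto elim: eventually_mono\<close>)
  also have "\<dots> = F p" by (simp add: fcoeff_def)
  finally have "cf (Pz (gradH y)) 0 = fst (F p)" by (simp add: gradH_def cf_rieszE[OF L2_V_crv])
  then have "fst (F p) = 0" using Pz0 by simp
  then have "F p \<bullet> p = 0" by (simp add: p_def inner_prod_def)
  then have "G p = 0" using F_inner[of p] by simp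
  have "IH y = (LINT t|I01. 0)" unfolding IH_def
   by (rule integral_cong_AE) (use H_measurable[OF crv_measurable] crvp \<open>G p = 0\<close> in \<open>auto elim: eventually_mono\<close>)
  then show False using IHy by simp
 qed
 then have A0pos: "0 < A0" using A0 by simp
 interpret P: hamiltonian "\<lambda>z. A0 *\<^sub>R F z" "A0 * L" "\<lambda>z. A0 * G z" by (rule hamiltonian_scale[OF A0])
 have Pg: "P.gradH y = A0 *\<^sub>R gradH y"
  by (rule hs_eqI) (simp add: P.gradH_def gradH_def cf_rieszE[OF L2_V_crv] cf_rieszE[OF P.L2_V_crv] fcoeff_scaleR)
 have "P.gPhi y = 0" unfolding P.gPhi_def Pg using crit by simp
 from P.critical_regular[OF this] obtain z where z: "ham_loop (\<lambda>z. A0 *\<^sub>R F z) z" "AE t in I01. crv y t = z t" by blast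
 have Gz: "G (z t) = G (z 0)" for t by (rule G_conserved[OF z(1)])
 have "IH y = (LINT t|I01. G (z 0))" unfolding IH_def
  by (rule integral_cong_AE) (use H_measurable[OF crv_measurable] z(2) Gz in \<open>auto elim: eventually_mono\<close>)
 then have "G (z 0) = 1" using IHy by simp
 then have "spec A0" unfolding spec_def using A0pos z(1) Gz by metis
 then show ?thesis using le unfolding S_def by blast
qed

end

section \<open>Brake characteristics as loops of the gauge field\<close>

text \<open>Gronwall's argument: \<open>exp (- 2 * K * t)\<close> times the squared distance is
  nonincreasing, and the opposite sign in the exponent settles the times before
  \<open>s\<close>.\<close>

lemma lipschitz_ODE_unique:
 fixes V :: "'a::real_inner => 'a"
 assumes V: "\<And>a b. norm (V a - V b) \<le> K * norm (a - b)"
  and y: "\<And>t. (y has_vector_derivative V (y t)) (at t)" and z: "\<And>t. (z has_vector_derivative V (z t)) (at t)"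
  and "y s = z s"
 shows "y t = z t"
proof -
 define w where "w t = y t - z t" for t
 define w' where "w' t = V (y t) - V (z t)" for t
 have dw: "(w has_vector_derivative w' t) (at t)" for t
  unfolding w_def w'_def by (intro has_vector_derivative_diff y z)
 have du: "((\<lambda>t. w t \<bullet> w t) has_real_derivative 2 * (w t \<bullet> w' t)) (at t)" for t
 proof -
  have "((\<lambda>t. w t \<bullet> w t) has_derivative (\<lambda>h. w t \<bullet> (h *\<^sub>R w' t) + (h *\<^sub>R w' t) \<bullet> w t)) (at t)"
   using dw[of t] unfolding has_vector_derivative_def by (intro has_derivative_inner)
  moreover have "(\<lambda>h. w t \<bullet> (h *\<^sub>R w' t) + (h *\<^sub>R w' t) \<bullet> w t) = (*) (2 * (w t \<bullet> w' t))"
   by (auto simp: inner_commute[of "w' t"])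
  ultimately show ?thesis by (simp add: has_field_derivative_def)
 qed
 have b: "\<bar>w t \<bullet> w' t\<bar> \<le> K * (w t \<bullet> w t)" for t
 proof -
  have "\<bar>w t \<bullet> w' t\<bar> \<le> norm (w t) * (K * norm (w t))"
   using order.trans[OF Cauchy_Schwarz_ineq2 mult_left_mono[OF V norm_ge_zero], of "w t" "y t" "z t"]
   by (simp add: w_def w'_def)
  then show ?thesis by (simp add: dot_square_norm power2_eq_square mult_ac)
 qed
 have de: "((\<lambda>t. exp (c * t) * (w t \<bullet> w t)) has_real_derivative exp (c * t) * (c * (w t \<bullet> w t) + 2 * (w t \<bullet> w' t))) (at t)" for c t
  by (rule derivative_eq_intros du | simp add: algebra_simps)+
 have ws: "w s = 0" using assms(4) by (simp add: w_def)
 have "w t \<bullet> w t \<le> 0"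
 proof (cases "s \<le> t")
  case True
  have "exp (- 2 * K * t) * (w t \<bullet> w t) \<le> exp (- 2 * K * s) * (w s \<bullet> w s)"
  proof (rule DERIV_nonpos_imp_nonincreasing[OF True])
   fix r
   have "- 2 * K * (w r \<bullet> w r) + 2 * (w r \<bullet> w' r) \<le> 0" using b[of r] by linarith
   then show "\<exists>y. ((\<lambda>t. exp (- 2 * K * t) * (w t \<bullet> w t)) has_real_derivative y) (at r) \<and> y \<le> 0"
    by (intro exI[of _ "exp (- 2 * K * r) * (- 2 * K * (w r \<bullet> w r) + 2 * (w r \<bullet> w' r))"] conjI de)
     (simp add: mult_le_0_iff)
  qed
  then show ?thesis using ws by (simp add: mult_le_0_iff)
 next
  case False
  then have "t \<le> s" by simp
  then have "exp (2 * K * t) * (w t \<bullet> w t) \<le> exp (2 * K * s) * (w s \<bullet> w s)"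
  proof (rule DERIV_nonneg_imp_nondecreasing)
   fix r
   have "0 \<le> 2 * K * (w r \<bullet> w r) + 2 * (w r \<bullet> w' r)" using b[of r] by linarith
   then show "\<exists>y. ((\<lambda>t. exp (2 * K * t) * (w t \<bullet> w t)) has_real_derivative y) (at r) \<and> 0 \<le> y"
    by (intro exI[of _ "exp (2 * K * r) * (2 * K * (w r \<bullet> w r) + 2 * (w r \<bullet> w' r))"] conjI de)
     (simp add: zero_le_mult_iff)
  qed
  then show ?thesis using ws by (simp add: mult_le_0_iff)
 qed
 then have "w t = 0" using inner_ge_zero[of "w t"] by (simp add: order.antisym)
 then show ?thesis by (simp add: w_def)
qed

text \<open>The constant gain per period makes \<open>P\<close> unbounded on both sides, hence onto.
  Its inverse is the change of time that gives a characteristic a constant speed factor.\<close>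

lemma increasing_bijection_derivative:
 fixes P \<kappa> :: "real => real"
 assumes dP: "\<And>t. (P has_real_derivative \<kappa> t) (at t)" and pos: "\<And>t. 0 < \<kappa> t"
  and T: "0 < T" "0 < a" and per: "\<And>t. P (t + T) = P t + a"
 shows "\<exists>Q. (\<forall>t. Q (P t) = t) \<and> (\<forall>s. P (Q s) = s) \<and> (\<forall>s. (Q has_real_derivative inverse (\<kappa> (Q s))) (at s))"
proof -
 have mono: "P s < P t" if "s < t" for s t
  by (rule DERIV_pos_imp_increasing[OF that]) (use dP pos in blast)
 have inj: "inj P" by (rule injI) (metis mono less_irrefl linorder_neqE)
 have cont: "isCont P t" for t using dP DERIV_isCont by blast
 have n: "P (real n * T) = P 0 + real n * a" for n
  by (induction n) (use per[of "real _ * T"] in \<open>simp_all add: algebra_simps\<close>)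
 have n': "P (- real n * T) = P 0 - real n * a" for n
 proof (induction n)
  case (Suc n)
  have "P (- real (Suc n) * T + T) = P (- real (Suc n) * T) + a" by (rule per)
  moreover have "- real (Suc n) * T + T = - real n * T" by (simp add: algebra_simps)
  ultimately show ?case using Suc by (simp add: algebra_simps)
 qed simp
 have surj: "\<exists>t. P t = y" for y
 proof -
  obtain n where n1: "\<bar>y - P 0\<bar> / a < real n" using reals_Archimedean2 by blast
  then have "\<bar>y - P 0\<bar> < real n * a" using T(2) by (simp add: pos_divide_less_eq)
  then have "P (- real n * T) \<le> y" "y \<le> P (real n * T)" unfolding n n' by auto
  moreover have "- real n * T \<le> real n * T" using T(1) by simp
  ultimately show ?thesis using IVT[of P "- real n * T" y "real n * T"] cont by blast
 qed
 define Q where "Q = inv_into UNIV P"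
 have QP: "Q (P t) = t" for t unfolding Q_def by (rule inv_f_f[OF inj])
 have PQ: "P (Q s) = s" for s unfolding Q_def using surj by (metis f_inv_into_f rangeI)
 have "(Q has_real_derivative inverse (\<kappa> (Q s))) (at s)" for s
 proof (rule DERIV_inverse_function[where a="s - 1" and b="s + 1" and f=P])
  have "isCont Q (P (Q s))" by (rule isCont_inverse_function[of 1]) (use QP cont in auto)
  then show "isCont Q s" by (simp add: PQ)
  show "\<kappa> (Q s) \<noteq> 0" using pos[of "Q s"] by simp
 qed (use dP PQ in auto)
 then show ?thesis using QP PQ by blast
qed

text \<open>Adding a constant loop in \<open>L0\<close> is admissible and changes neither the plus
  nor the minus part.\<close>

lemma cEH_fun_translate_le:
 fixes H :: "'n::finite st => real"
 assumes "q \<in> L0" shows "cEH_fun H \<le> cEH_fun (\<lambda>z. H (z - q))"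
proof -
 obtain Q :: "'n hs" where Q: "Pz Q = Q" "AE t in I01. crv Q t = (fst q, 0)" using const_element by blast
 have q: "q = (fst q, 0)" using assms by (simp add: L0_def prod_eq_iff)
 have PQ: "Pp Q = 0" "Pm Q = 0" using arg_cong[OF Q(1), of Pp] arg_cong[OF Q(1), of Pm] by auto
 have eq: "PhiH (\<lambda>z. H (z - q)) (cf (x + Q)) = PhiH H (cf x)" for x
 proof -
  have "AE t in I01. crv (x + Q) t - q = crv x t"
   using crv_add[of x Q] Q(2) by eventually_elim (metis add_diff_cancel q)
  then have "(\<integral>\<^sup>+ t. ennreal (H (crv (x + Q) t - q)) \<partial>I01) = (\<integral>\<^sup>+ t. ennreal (H (crv x t)) \<partial>I01)"
   by (intro nn_integral_cong_AE) (auto elim!: eventually_mono)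
  then show ?thesis unfolding PhiH_cf by (simp add: PQ)
 qed
 show ?thesis
 proof (subst cEH_fun_eq, rule SUP_least)
  fix h :: "'n hs => 'n hs" assume h: "h \<in> Gam"
  have "(\<lambda>x. 1 *\<^sub>R h x + Q) \<in> Gam" by (rule Gam_compose[OF h Gam_affine[OF _ Q(1)]]) simp
  then have "(\<lambda>x. h x + Q) \<in> Gam" by simp
  then show "(INF x\<in>Sp. PhiH H (cf (h x))) \<le> cEH_fun (\<lambda>z. H (z - q))"
   by (rule cEH_fun_geI) (auto simp: eq intro: INF_lower)
 qed
qed

lemma cEH_fun_translate:
 fixes H :: "'n::finite st => real"
 assumes "q \<in> L0" shows "cEH_fun (\<lambda>z. H (z - q)) = cEH_fun H"
proof (rule antisym)
 have "- q \<in> L0" using assms by (simp add: L0_def)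
 from cEH_fun_translate_le[OF this, of "\<lambda>z. H (z - q)"] show "cEH_fun (\<lambda>z. H (z - q)) \<le> cEH_fun H" by simp
qed (rule cEH_fun_translate_le[OF assms])

lemma FB_translate:
 fixes H :: "'n::finite st => real"
 assumes "H \<in> FB B" "q \<in> L0" shows "(\<lambda>z. H (z - q)) \<in> FB ((+) q ` B)"
proof -
 from assms(1) obtain C z0 a b U where H: "continuous_on UNIV H" "\<And>z. 0 \<le> H z" "\<And>z. H (tau0 z) = H z"
  "interior {z. H z = 0} \<inter> L0 \<noteq> {}" "compact C" "z0 \<in> L0" "a > 2 * pi"
  "\<And>z. z \<notin> C ==> H z = a * (norm z)\<^sup>2 + z \<bullet> z0 + b" "open U" "closure B \<subseteq> U" "\<And>z. z \<in> U ==> H z = 0"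
  unfolding FB_def by blast
 have tq: "tau0 q = q" using assms(2) by (simp add: tau0_fixed_iff L0_def)
 obtain p where p: "p \<in> interior {z. H z = 0}" "p \<in> L0" using H(4) by blast
 have "(+) q ` interior {z. H z = 0} \<subseteq> interior {z. H (z - q) = 0}"
  by (rule interior_maximal) (use interior_subset[of "{z. H z = 0}"] in \<open>auto intro!: open_translation\<close>)
 then have "q + p \<in> interior {z. H (z - q) = 0} \<inter> L0" using p assms(2) by (auto simp: L0_def)
 moreover have "\<exists>C z0' a' b'. compact C \<and> z0' \<in> L0 \<and> a' > 2 * pi \<and> (\<forall>z. z \<notin> C \<longrightarrow> H (z - q) = a' * (norm z)\<^sup>2 + z \<bullet> z0' + b')"
 proof (intro exI conjI allI impI)
  show "compact ((+) q ` C)" using H(5) by (rule compact_translation)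
  \<comment> \<open>Expanding the shifted square moves \<open>- 2 * a\<close> times \<open>q\<close>
    into the linear term, which stays in \<open>L0\<close>.\<close>
  show "z0 - (2 * a) *\<^sub>R q \<in> L0" using H(6) assms(2) by (simp add: L0_def)
  show "a > 2 * pi" by (rule H(7))
  fix z assume "z \<notin> (+) q ` C"
  then have "z - q \<notin> C" by (metis add.commute diff_add_cancel imageI)
  then have "H (z - q) = a * (norm (z - q))\<^sup>2 + (z - q) \<bullet> z0 + b" by (rule H(8))
  also have "\<dots> = a * (norm z)\<^sup>2 + z \<bullet> (z0 - (2 * a) *\<^sub>R q) + (a * (norm q)\<^sup>2 - q \<bullet> z0 + b)"
   by (simp add: power2_norm_eq_inner inner_diff_left inner_diff_right inner_commute[of q z] algebra_simps)
  finally show "H (z - q) = a * (norm z)\<^sup>2 + z \<bullet> (z0 - (2 * a) *\<^sub>R q) + (a * (norm q)\<^sup>2 - q \<bullet> z0 + b)" .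
 qed
 moreover have "open ((+) q ` U)" "closure ((+) q ` B) \<subseteq> (+) q ` U" "\<forall>z\<in>(+) q ` U. H (z - q) = 0"
  using H(9-11) by (auto intro: open_translation simp: closure_translation)
 moreover have "continuous_on UNIV (\<lambda>z. H (z - q))"
  by (rule continuous_on_compose2[OF H(1)]) (auto intro!: continuous_intros)
 moreover have "H (tau0 z - q) = H (z - q)" for z
  using H(3)[of "z - q"] linear_diff[OF linear_tau0, of z q] tq by simp
 ultimately show ?thesis unfolding FB_def using H(2) by blast
qed

lemma cEH_tau0_bdd_translate_le:
 fixes B :: "'n::finite st set"
 assumes "q \<in> L0" shows "cEH_tau0_bdd ((+) q ` B) \<le> cEH_tau0_bdd B"
 unfolding cEH_tau0_bdd_def
proof (rule INF_greatest)
 fix H assume "H \<in> FB B"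
 from INF_lower[OF FB_translate[OF this assms], of cEH_fun]
 show "(INF H\<in>FB ((+) q ` B). cEH_fun H) \<le> cEH_fun H" by (simp add: cEH_fun_translate[OF assms])
qed

lemma cEH_tau0_bdd_translate:
 fixes B :: "'n::finite st set"
 assumes "q \<in> L0" shows "cEH_tau0_bdd ((+) q ` B) = cEH_tau0_bdd B"
proof (rule antisym)
 have "- q \<in> L0" using assms by (simp add: L0_def)
 from cEH_tau0_bdd_translate_le[OF this, of "(+) q ` B"]
 show "cEH_tau0_bdd B \<le> cEH_tau0_bdd ((+) q ` B)" by (simp add: image_comp o_def)
qed (rule cEH_tau0_bdd_translate_le[OF assms])

context gauge
begin

section \<open>Characteristics on the unit level of the gauge\<close>

abbreviation "lev \<equiv> {z. G z = 1}"

lemma F_nz: "G p = 1 ==> F p \<noteq> 0" using F_inner[of p] by auto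

lemma tangent_lev:
 assumes p: "G p = 1" shows "tangent_space lev p = {v. F p \<bullet> v = 0}"
proof (intro Set.set_eqI iffI)
 fix v assume "v \<in> tangent_space lev p"
 then have "\<exists>c. (\<forall>t. G (c t) = 1) \<and> c 0 = p \<and> (c has_vector_derivative v) (at 0)"
  by (simp add: tangent_space_def)
 then obtain c where c: "\<And>t. G (c t) = 1" "c 0 = p" "(c has_vector_derivative v) (at 0)" by blast
 have "((\<lambda>t. G (c t)) has_real_derivative F (c 0) \<bullet> v) (at 0)" by (rule G_chain[OF c(3)])
 then have "((\<lambda>t. 1 :: real) has_real_derivative F p \<bullet> v) (at 0)" by (simp add: c)
 then have "F p \<bullet> v = 0" by (rule DERIV_unique) simp
 then show "v \<in> {v. F p \<bullet> v = 0}" by simp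
next
 fix v assume "v \<in> {v. F p \<bullet> v = 0}"
 then have v: "F p \<bullet> v = 0" by simp
 have ge: "1 \<le> G (p + t *\<^sub>R v)" for t using G_sub[of p "p + t *\<^sub>R v"] p v by simp
 \<comment> \<open>The tangent line is pulled back radially to the level. Convexity keeps
   \<open>G\<close> at least 1 on the line, so the curve is defined for all \<open>t\<close>, as
   \<open>tangent_space\<close> demands.\<close>
 define c where "c t = (1 / sqrt (G (p + t *\<^sub>R v))) *\<^sub>R (p + t *\<^sub>R v)" for t
 have "G (c t) = 1" for t
 proof -
  have "G (c t) = (1 / sqrt (G (p + t *\<^sub>R v)))\<^sup>2 * G (p + t *\<^sub>R v)"
   unfolding c_def by (rule G_scale) (use ge[of t] in simp)
  then show ?thesis using ge[of t] by (simp add: power_divide)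
 qed
 moreover have "c 0 = p" using p by (simp add: c_def)
 moreover have "(c has_vector_derivative v) (at 0)"
 proof -
  have d: "((\<lambda>t. p + t *\<^sub>R v) has_vector_derivative v) (at 0)"
   by (auto intro!: derivative_eq_intros)
  have "((\<lambda>t. G (p + t *\<^sub>R v)) has_real_derivative F (p + 0 *\<^sub>R v) \<bullet> v) (at 0)" by (rule G_chain[OF d])
  then have g: "((\<lambda>t. G (p + t *\<^sub>R v)) has_real_derivative 0) (at 0)" by (simp add: v)
  have s: "((\<lambda>t. sqrt (G (p + t *\<^sub>R v))) has_real_derivative 0) (at 0)"
   using DERIV_chain2[OF DERIV_real_sqrt g] p by simp
  have "((\<lambda>t. 1 / sqrt (G (p + t *\<^sub>R v))) has_real_derivative 0) (at 0)"
   using DERIV_divide[OF DERIV_const[of 1] s] p by simp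
  from has_vector_derivative_scaleR[OF this d] show ?thesis unfolding c_def using p by simp
 qed
 ultimately have "\<exists>c. (\<forall>t. G (c t) = 1) \<and> c 0 = p \<and> (c has_vector_derivative v) (at 0)" by blast
 then show "v \<in> tangent_space lev p" by (simp add: tangent_space_def)
qed

lemma char_kernel_lev:
 assumes p: "G p = 1" shows "char_kernel lev p = range (\<lambda>k. k *\<^sub>R J0 (F p))"
proof (intro Set.set_eqI iffI)
 have om: "omega0 u v = J0 u \<bullet> v" for u v :: "'n st"
  by (simp add: omega0_def J0_def inner_prod_def)
 {
  fix v assume "v \<in> char_kernel lev p"
  then have v: "\<And>w. F p \<bullet> w = 0 ==> J0 v \<bullet> w = 0"
   by (auto simp: char_kernel_def tangent_lev[OF p] om)
  \<comment> \<open>This makes \<open>w\<close> the part of \<open>J0 v\<close> orthogonal to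
    \<open>F p\<close>. It is therefore tangent, and testing the kernel condition with it gives
    \<open>w = 0\<close>.\<close>
  define c where "c = (J0 v \<bullet> F p) / (F p \<bullet> F p)"
  define w where "w = J0 v - c *\<^sub>R F p"
  have w0: "F p \<bullet> w = 0"
   using F_nz[OF p] by (simp add: w_def c_def inner_diff_right inner_commute)
  have "w \<bullet> w = J0 v \<bullet> w - c * (F p \<bullet> w)" by (simp add: w_def inner_diff_left)
  then have "w = 0" using v[OF w0] w0 by simp
  then have "J0 v = c *\<^sub>R F p" by (simp add: w_def)
  then have "J0 (J0 v) = c *\<^sub>R J0 (F p)" by (simp add: J0_scaleR)
  then have "v = (- c) *\<^sub>R J0 (F p)" by (metis J0_J0 minus_minus scaleR_minus_left)
  then show "v \<in> range (\<lambda>k. k *\<^sub>R J0 (F p))" by blast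
 next
  fix v assume "v \<in> range (\<lambda>k. k *\<^sub>R J0 (F p))"
  then show "v \<in> char_kernel lev p"
   by (auto simp: char_kernel_def tangent_lev[OF p] om J0_scaleR)
 }
qed

text \<open>Minimality yields injectivity. If the loop meets itself after a time
  \<open>d < 1\<close>, uniqueness makes \<open>d\<close> a period, and running through that period
  in unit time gives the smaller multiplier \<open>A * d\<close>.\<close>

lemma spec_to_brake:
 assumes "spec A" and min: "\<And>B. spec B ==> A \<le> B"
 shows "\<exists>z. brake_char tau0 lev z 1 \<and> action z 1 = A"
proof -
 obtain z where A: "0 < A" and hl: "ham_loop (\<lambda>z. A *\<^sub>R F z) z" and Gz: "\<And>t. G (z t) = 1"
  using assms(1) unfolding spec_def by blast
 have dz: "(z has_vector_derivative J0 (A *\<^sub>R F (z t))) (at t)" for t using hl by (simp add: ham_loop_def)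
 have vz: "vector_derivative z (at t) = J0 (A *\<^sub>R F (z t))" for t using dz by (rule vector_derivative_at)
 have per: "z (t + 1) = z t" and refl: "z (- t) = tau0 (z t)" for t using hl by (simp_all add: ham_loop_def)
 have inj: "inj_on z {0..<1}"
 proof (rule linorder_inj_onI')
  fix s t assume st: "s \<in> {0..<1}" "t \<in> {0..<1::real}" "s < t"
  show "z s \<noteq> z t"
  proof
   assume eq: "z s = z t"
   define d where "d = t - s"
   have d: "0 < d" "d < 1" using st by (auto simp: d_def)
   have zd: "z (r + d) = z r" for r
   proof (rule lipschitz_ODE_unique[of "\<lambda>z. J0 (A *\<^sub>R F z)" "A * L" "\<lambda>r. z (r + d)" z s])
    fix a b :: "'n st"
    have "norm (J0 (A *\<^sub>R F a) - J0 (A *\<^sub>R F b)) = A * norm (F a - F b)"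
     using A by (simp add: linear_diff[OF linear_J0, symmetric] scaleR_diff_right[symmetric])
    also have "\<dots> \<le> A * (L * norm (a - b))" using A F_lipschitz by (intro mult_left_mono) auto
    finally show "norm (J0 (A *\<^sub>R F a) - J0 (A *\<^sub>R F b)) \<le> A * L * norm (a - b)" by (simp add: mult.assoc)
   next
    fix r
    have "((\<lambda>r. r + d) has_vector_derivative 1) (at r)" by (auto intro!: derivative_eq_intros)
    from vector_diff_chain_at[OF this dz] show "((\<lambda>r. z (r + d)) has_vector_derivative J0 (A *\<^sub>R F (z (r + d)))) (at r)"
     by (simp add: o_def)
   qed (use dz eq in \<open>auto simp: d_def\<close>)
   have "ham_loop (\<lambda>z. (A * d) *\<^sub>R F z) (\<lambda>t. z (d * t))"
    unfolding ham_loop_def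
   proof (intro conjI allI)
    fix t
    have "((\<lambda>t. d * t) has_vector_derivative d) (at t)" by (auto intro!: derivative_eq_intros)
    from vector_diff_chain_at[OF this dz] show "((\<lambda>t. z (d * t)) has_vector_derivative J0 ((A * d) *\<^sub>R F (z (d * t)))) (at t)"
     by (simp add: o_def J0_scaleR mult.commute)
    show "z (d * (t + 1)) = z (d * t)" using zd[of "d * t"] by (simp add: distrib_left)
    show "z (d * - t) = tau0 (z (d * t))" using refl[of "d * t"] by simp
   qed
   then have "spec (A * d)" unfolding spec_def using A d Gz by auto
   then have "A \<le> A * d" by (rule min)
   then show False using A d by simp
  qed
 qed
 have "brake_char tau0 lev z 1"
  unfolding brake_char_def
 proof (intro conjI allI)
  have "continuous_on UNIV (\<lambda>t. J0 (A *\<^sub>R F (z t)))"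
   by (intro bounded_linear.continuous_on[OF bounded_linear_J0] continuous_intros
     continuous_on_compose2[OF V_continuous ham_loop_continuous[OF hl]]) auto
  then show "z C1_differentiable_on UNIV" unfolding C1_differentiable_on_def
   by (intro exI[of _ "\<lambda>t. J0 (A *\<^sub>R F (z t))"] conjI ballI dz)
  show "z (1 - t) = tau0 (z t)" for t by (rule ham_loop_reflect[OF hl])
  show "vector_derivative z (at t) \<noteq> 0" for t
   using F_nz[OF Gz[of t]] A by (metis vz J0_scaleR norm_J0 norm_eq_zero scaleR_eq_0_iff less_irrefl)
  show "vector_derivative z (at t) \<in> char_kernel lev (z t)" for t
   unfolding char_kernel_lev[OF Gz] vz by (auto simp: J0_scaleR)
 qed (use per inj Gz in auto)
 moreover have "action z 1 = A"
  unfolding action_def vz by (simp add: J0_scaleR F_inner Gz)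
 ultimately show ?thesis by blast
qed

text \<open>The velocity is a factor \<open>\<kappa>\<close> times \<open>J0 (F x)\<close>. By
  Euler's identity on the level, the action up to time \<open>t\<close> is the primitive
  \<open>P\<close> of \<open>\<kappa>\<close>, and taking \<open>P\<close> as the new time makes the
  factor constant.\<close>

lemma brake_to_spec:
 assumes br: "brake_char tau0 lev x T" and a: "0 < action x T"
 shows "spec (action x T)"
proof -
 have T: "0 < T" and per: "\<And>t. x (t + T) = x t" and C1: "x C1_differentiable_on UNIV"
  and nz: "\<And>t. vector_derivative x (at t) \<noteq> 0" and G1: "\<And>t. G (x t) = 1"
  and ker: "\<And>t. vector_derivative x (at t) \<in> char_kernel lev (x t)" and refl: "\<And>t. x (T - t) = tau0 (x t)"
  using br unfolding brake_char_def by auto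
 obtain x' where x': "\<And>t. (x has_vector_derivative x' t) (at t)" "continuous_on UNIV x'"
  using C1 unfolding C1_differentiable_on_def by auto
 have vx: "vector_derivative x (at t) = x' t" for t using x'(1) by (rule vector_derivative_at)
 define \<kappa> where "\<kappa> t = (J0 (F (x t)) \<bullet> x' t) / (F (x t) \<bullet> F (x t))" for t
 have Fx: "F (x t) \<bullet> F (x t) \<noteq> 0" for t using F_nz[OF G1] by simp
 have k: "x' t = \<kappa> t *\<^sub>R J0 (F (x t))" for t
 proof -
  obtain c where "x' t = c *\<^sub>R J0 (F (x t))" using ker[of t] unfolding char_kernel_lev[OF G1] vx by blast
  moreover from this have "\<kappa> t = c" using Fx[of t] by (simp add: \<kappa>_def)
  ultimately show ?thesis by simp
 qed
 have k0: "\<kappa> t \<noteq> 0" for t using nz[of t] k[of t] by (auto simp: vx)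
 have cx: "continuous_on UNIV x"
  by (intro continuous_at_imp_continuous_on ballI has_vector_derivative_continuous[OF x'(1)])
 have cF: "continuous_on UNIV (\<lambda>t. F (x t))" by (rule continuous_on_compose2[OF V_continuous cx]) auto
 have ck: "continuous_on UNIV \<kappa>" unfolding \<kappa>_def
  by (intro continuous_intros bounded_linear.continuous_on[OF bounded_linear_J0] cF x'(2)) (use Fx in auto)
 \<comment> \<open>These symmetries make the change of time odd and additive over periods, so the
   new loop is again closed and symmetric.\<close>
 have even: "\<kappa> (- t) = \<kappa> t" and pk: "\<kappa> (t + T) = \<kappa> t" for t
 proof -
  have xr: "x (- t) = tau0 (x t)" for t using refl[of "t"] per[of "- t"] by (simp add: add.commute)
  have "((\<lambda>t. - t) has_vector_derivative -1) (at t)" by (auto intro!: derivative_eq_intros)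
  from vector_diff_chain_at[OF this x'(1)] have "((\<lambda>t. x (- t)) has_vector_derivative - x' (- t)) (at t)" by (simp add: o_def)
  moreover have "((\<lambda>t. tau0 (x t)) has_vector_derivative tau0 (x' t)) (at t)"
   by (rule bounded_linear.has_vector_derivative[OF bounded_linear_tau0 x'(1)])
  ultimately have "- x' (- t) = tau0 (x' t)" unfolding xr by (rule vector_derivative_unique_at)
  then have "x' (- t) = - tau0 (x' t)" by (metis minus_minus)
  moreover have "J0 (tau0 (F (x t))) = - tau0 (J0 (F (x t)))" by (simp add: tau0_J0)
  ultimately show "\<kappa> (- t) = \<kappa> t" by (simp add: \<kappa>_def xr F_tau0)
  have "((\<lambda>t. t + T) has_vector_derivative 1) (at t)" by (auto intro!: derivative_eq_intros)
  from vector_diff_chain_at[OF this x'(1)] have "((\<lambda>t. x (t + T)) has_vector_derivative x' (t + T)) (at t)" by (simp add: o_def)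
  then have "x' (t + T) = x' t" unfolding per using x'(1) by (rule vector_derivative_unique_at)
  then show "\<kappa> (t + T) = \<kappa> t" by (simp add: \<kappa>_def per)
 qed
 have "isCont \<kappa> t" for t using ck by (simp add: continuous_on_eq_continuous_at)
 then obtain P0 where P0: "\<And>t. (P0 has_vector_derivative \<kappa> t) (at t)"
  using einterval_antiderivative[of "-\<infinity>" \<infinity> \<kappa>] by auto
 define P where "P t = P0 t - P0 0" for t
 have dP: "(P has_real_derivative \<kappa> t) (at t)" for t
  unfolding P_def has_real_derivative_iff_has_vector_derivative using has_vector_derivative_diff[OF P0 has_vector_derivative_const] by simp
 define a where "a = action x T"
 have "(\<kappa> has_integral P T - P 0) {0..T}"
  using T dP by (intro fundamental_theorem_of_calculus)
   (auto simp: has_real_derivative_iff_has_vector_derivative intro: has_vector_derivative_at_within)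
 moreover have "a = integral {0..T} \<kappa>"
 proof -
  have "(- J0 (vector_derivative x (at t))) \<bullet> x t = 2 * \<kappa> t" for t
   unfolding vx k by (simp add: J0_scaleR F_inner G1)
  then show ?thesis unfolding a_def action_def by simp
 qed
 ultimately have PT: "P T = a" by (simp add: P_def integral_unique)
 have a0: "0 < a" using assms(2) by (simp add: a_def)
 \<comment> \<open>A continuous \<open>\<kappa>\<close> without zeros has one sign, and the positive
   action decides which.\<close>
 have pos: "0 < \<kappa> t" for t
 proof (rule ccontr)
  assume "\<not> 0 < \<kappa> t"
  have neg: "\<kappa> s < 0" for s
  proof (rule ccontr)
   assume "\<not> \<kappa> s < 0"
   have "connected (range \<kappa>)" by (rule connected_continuous_image[OF ck connected_UNIV])
   then have "0 \<in> range \<kappa>"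
    using connectedD_interval[of "range \<kappa>" "\<kappa> t" "\<kappa> s" 0] \<open>\<not> \<kappa> s < 0\<close> \<open>\<not> 0 < \<kappa> t\<close> by auto
   then show False using k0 by (metis imageE)
  qed
  have "P T < P 0" by (rule DERIV_neg_imp_decreasing[OF T]) (use dP neg in blast)
  then show False using PT a0 by (simp add: P_def)
 qed
 have Pper: "P (t + T) = P t + a" for t
 proof -
  have "((\<lambda>t. P (t + T) - P t) has_real_derivative 0) (at t)" for t
  proof -
   have "((\<lambda>t. P (t + T)) has_real_derivative \<kappa> t) (at t)"
    using dP[of "t + T"] by (simp only: DERIV_shift pk)
   from DERIV_diff[OF this dP] show ?thesis by simp
  qed
  then have "P (t + T) - P t = P (0 + T) - P 0" using DERIV_isconst_all[of "\<lambda>t. P (t + T) - P t"] by blast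
  then show ?thesis using PT by (simp add: P_def)
 qed
 have Podd: "P (- t) = - P t" for t
 proof -
  have "((\<lambda>t. P (- t) + P t) has_real_derivative 0) (at t)" for t
  proof -
   have "((\<lambda>t. P (- t)) has_real_derivative - \<kappa> t) (at t)"
    using dP[of "- t"] by (simp only: DERIV_mirror even)
   from DERIV_add[OF this dP] show ?thesis by simp
  qed
  then have "P (- t) + P t = P (- 0) + P 0" using DERIV_isconst_all[of "\<lambda>t. P (- t) + P t"] by blast
  then show ?thesis by (simp add: P_def)
 qed
 obtain Q where Q: "\<And>t. Q (P t) = t" "\<And>s. P (Q s) = s" "\<And>s. (Q has_real_derivative inverse (\<kappa> (Q s))) (at s)"
  using increasing_bijection_derivative[OF dP pos T a0 Pper] by blast
 have Qper: "Q (s + a) = Q s + T" for s using Pper[of "Q s"] Q(1)[of "Q s + T"] by (simp add: Q(2))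
 have Qodd: "Q (- s) = - Q s" for s using Podd[of "Q s"] Q(1)[of "- Q s"] by (simp add: Q(2))
 have "ham_loop (\<lambda>z. a *\<^sub>R F z) (\<lambda>s. x (Q (a * s)))"
  unfolding ham_loop_def
 proof (intro conjI allI)
  fix s
  have "((\<lambda>s. Q (a * s)) has_real_derivative inverse (\<kappa> (Q (a * s))) * a) (at s)"
   by (rule DERIV_chain2[OF Q(3)]) (auto intro!: derivative_eq_intros)
  have e: "inverse (\<kappa> (Q (a * s))) * a * \<kappa> (Q (a * s)) = a" using k0 by simp
  from vector_diff_chain_at[OF \<open>((\<lambda>s. Q (a * s)) has_real_derivative _) _\<close>[unfolded has_real_derivative_iff_has_vector_derivative] x'(1)]
  show "((\<lambda>s. x (Q (a * s))) has_vector_derivative J0 (a *\<^sub>R F (x (Q (a * s))))) (at s)"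
   unfolding o_def k scaleR_scaleR J0_scaleR e .
  show "x (Q (a * (s + 1))) = x (Q (a * s))" by (simp add: distrib_left Qper per)
  have "x (- t) = tau0 (x t)" for t using refl[of "t"] per[of "- t"] by (simp add: add.commute)
  then show "x (Q (a * - s)) = tau0 (x (Q (a * s)))" using Qodd[of "a * s"] by simp
 qed
 then show ?thesis unfolding spec_def a_def[symmetric] using a0 G1 by blast
qed

section \<open>Capacities of the level and of the sublevel\<close>

lemma compact_sublevel: "compact {z. G z \<le> c}"
proof -
 have "closed {z. G z \<le> c}" by (rule closed_Collect_le[OF H_continuous continuous_on_const])
 moreover have "norm z \<le> sqrt (c / m)" if "G z \<le> c" for z
 proof (rule real_le_rsqrt)
  show "(norm z)\<^sup>2 \<le> c / m" using G_lower[of z] that m_pos by (simp add: pos_le_divide_eq mult.commute)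
 qed
 ultimately show ?thesis unfolding compact_eq_bounded_closed by (auto intro!: boundedI)
qed

text \<open>By homogeneity, shrinking a point of the level towards 0 moves it into the open
  sublevel.\<close>

lemma frontier_sublevel: "frontier {z. G z < 1} = lev" and closure_sublevel: "closure {z. G z < 1} = {z. G z \<le> 1}"
proof -
 have op: "open {z. G z < 1}" by (rule open_Collect_less[OF H_continuous continuous_on_const])
 show cl: "closure {z. G z < 1} = {z. G z \<le> 1}"
 proof
  show "closure {z. G z < 1} \<subseteq> {z. G z \<le> 1}"
   by (rule closure_minimal) (auto intro: compact_imp_closed[OF compact_sublevel])
  show "{z. G z \<le> 1} \<subseteq> closure {z. G z < 1}"
  proof (clarsimp simp only: subset_iff mem_Collect_eq closure_sequential)
   fix z assume z: "G z \<le> 1"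
   show "\<exists>x. (\<forall>n. G (x n) < 1) \<and> x \<longlonglongrightarrow> z"
   proof (intro exI[of _ "\<lambda>n. (1 - 1 / real (Suc n)) *\<^sub>R z"] conjI allI)
    fix n
    have "G ((1 - 1 / real (Suc n)) *\<^sub>R z) = (1 - 1 / real (Suc n))\<^sup>2 * G z" by (rule G_scale) simp
    also have "\<dots> \<le> (1 - 1 / real (Suc n))\<^sup>2 * 1" using z by (intro mult_left_mono) auto
    also have "\<dots> < 1" by (simp add: power_less_one_iff)
    finally show "G ((1 - 1 / real (Suc n)) *\<^sub>R z) < 1" .
    have "(\<lambda>n. (1 - 1 / real (Suc n)) *\<^sub>R z) \<longlonglongrightarrow> (1 - 0) *\<^sub>R z"
     by (intro tendsto_intros) (use LIMSEQ_inverse_real_of_nat in \<open>simp add: inverse_eq_divide\<close>)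
    then show "(\<lambda>n. (1 - 1 / real (Suc n)) *\<^sub>R z) \<longlonglongrightarrow> z" by simp
   qed
  qed
 qed
 show "frontier {z. G z < 1} = lev" unfolding frontier_def cl interior_open[OF op] by auto
qed

text \<open>By compactness a Hamiltonian in \<open>FB lev\<close> vanishes on a whole zone of levels
  around 1, and its prescribed form at infinity bounds it by a multiple of
  \<open>1 + G\<close>.\<close>

lemma cEH_level_lower:
 assumes "\<And>B. spec B ==> A \<le> B" "0 < A"
 shows "ereal A \<le> cEH_tau0_bdd lev"
 unfolding cEH_tau0_bdd_def
proof (rule INF_greatest)
 fix H assume "H \<in> FB lev"
 then obtain C z0 a b U where H: "continuous_on UNIV H" "\<And>z. 0 \<le> H z" "compact C" "a > 2 * pi"
  "\<And>z. z \<notin> C ==> H z = a * (norm z)\<^sup>2 + z \<bullet> z0 + b" "open U" "closure lev \<subseteq> U" "\<And>z. z \<in> U ==> H z = 0"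
  unfolding FB_def by blast
 \<comment> \<open>The restriction \<open>G z \<le> 3\<close> makes the part outside
   \<open>U\<close> compact; the zone chosen below stays within it because
   \<open>2 * \<rho> \<le> 1\<close>.\<close>
 have "\<exists>\<mu>>0. \<forall>z. G z \<le> 3 \<longrightarrow> z \<notin> U \<longrightarrow> \<mu> \<le> \<bar>G z - 1\<bar>"
 proof (cases "{z. G z \<le> 3} - U = {}")
  case True then show ?thesis by (intro exI[of _ 1]) auto
 next
  case False
  have "compact ({z. G z \<le> 3} - U)" by (rule compact_diff[OF compact_sublevel H(6)])
  moreover have "continuous_on ({z. G z \<le> 3} - U) (\<lambda>z. \<bar>G z - 1\<bar>)" by (intro continuous_intros H_continuous)
  ultimately obtain w where w: "w \<notin> U" "\<And>z. G z \<le> 3 ==> z \<notin> U ==> \<bar>G w - 1\<bar> \<le> \<bar>G z - 1\<bar>"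
   using continuous_attains_inf[OF _ False] by (metis (mono_tags, lifting) DiffD2 DiffI mem_Collect_eq)
  have "lev \<subseteq> U" by (rule order.trans[OF closure_subset H(7)])
  then have "w \<notin> lev" using w(1) by blast
  then show ?thesis using w(2) by (intro exI[of _ "\<bar>G w - 1\<bar>"]) auto
 qed
 then obtain \<mu> where \<mu>: "0 < \<mu>" "\<And>z. G z \<le> 3 ==> z \<notin> U ==> \<mu> \<le> \<bar>G z - 1\<bar>" by blast
 define \<rho> where "\<rho> = min (1 / 2) (\<mu> / 4)"
 have \<rho>: "0 < \<rho>" "\<rho> \<le> 1 / 2" "2 * \<rho> < \<mu>" using \<mu>(1) by (auto simp: \<rho>_def min_def)
 have zero: "H z = 0" if "\<bar>G z - 1\<bar> \<le> 2 * \<rho>" for z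
 proof (rule H(8), rule ccontr)
  assume "z \<notin> U"
  moreover have "G z \<le> 3" using that \<rho>(2) by linarith
  ultimately show False using \<mu>(2)[of z] that \<rho>(3) by simp
 qed
 have "bounded (H ` C)" using H(1,3) by (intro compact_imp_bounded compact_continuous_image) (auto intro: continuous_on_subset)
 then obtain M where M: "\<And>z. z \<in> C ==> \<bar>H z\<bar> \<le> M" unfolding bounded_iff by auto
 define K where "K = (a + 1) / m + (norm z0)\<^sup>2 + \<bar>b\<bar> + \<bar>M\<bar>"
 have a0: "0 < a" using H(4) pi_gt_zero by linarith
 have am: "0 < (a + 1) / m" using a0 m_pos by simp
 have growth: "H z \<le> K * (1 + G z)" for z
 proof (cases "z \<in> C")
  case True
  have "H z \<le> K * 1" using M[OF True] am unfolding K_def by (smt (verit) zero_le_power2)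
  also have "\<dots> \<le> K * (1 + G z)" using am G_nonneg[of z] by (intro mult_left_mono) (auto simp: K_def)
  finally show ?thesis .
 next
  case False
  have "z \<bullet> z0 \<le> (norm z)\<^sup>2 + (norm z0)\<^sup>2"
  proof -
   have "2 * (norm z * norm z0) \<le> (norm z)\<^sup>2 + (norm z0)\<^sup>2"
    using sum_squares_bound[of "norm z" "norm z0"] by (simp only: mult.assoc)
   moreover have "0 \<le> norm z * norm z0" by simp
   ultimately show ?thesis using norm_cauchy_schwarz[of z z0] by linarith
  qed
  then have "H z \<le> (a + 1) * (norm z)\<^sup>2 + (norm z0)\<^sup>2 + \<bar>b\<bar>" unfolding H(5)[OF False] by (simp add: algebra_simps)
  also have "(a + 1) * (norm z)\<^sup>2 \<le> (a + 1) * (G z / m)"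
   using G_lower[of z] m_pos a0 by (intro mult_left_mono) (auto simp: pos_le_divide_eq mult.commute)
  finally have "H z \<le> (a + 1) / m * G z + ((norm z0)\<^sup>2 + \<bar>b\<bar>)" by simp
  also have "\<dots> \<le> K * G z + K * 1" using am G_nonneg[of z]
   by (intro add_mono mult_right_mono) (auto simp: K_def)
  finally show ?thesis by (simp add: distrib_left)
 qed
 obtain q where q: "G (q, 0) = 1" by (rule unit_level_L0)
 show "ereal A \<le> cEH_fun H"
 proof (rule dense_le)
  \<comment> \<open>\<open>cEH_fun_lower_bound\<close> needs \<open>B\<close> strictly below every
    multiplier, so \<open>A\<close> is approached from below.\<close>
  fix y assume y: "y < ereal A"
  obtain B where B: "max y 0 < ereal B" "ereal B < ereal A"
   using ereal_dense2[of "max y 0" "ereal A"] y assms(2) by auto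
  have "ereal B \<le> cEH_fun H"
  proof (rule cEH_fun_lower_bound[OF \<rho>(1) _ _ _ _ q zero growth])
   show "\<rho> < 1" using \<rho> by simp
   show "0 < B" using B(1) by auto
   show "0 \<le> K" using am by (simp add: K_def)
   show "B < A'" if "spec A'" for A' using assms(1)[OF that] B(2) by simp
  qed
  then show "y \<le> cEH_fun H" using B(1) by (meson less_imp_le max.strict_boundedE order.trans)
 qed
qed

lemma cEH_sublevel_upper:
 assumes "spec A" shows "cEH_tau0_bdd {z. G z < 1} \<le> ereal A"
proof (rule ereal_le_epsilon2)
 fix e :: real assume e: "0 < e"
 have A: "0 < A" using assms by (simp add: spec_def)
 \<comment> \<open>\<open>A * \<delta> = e\<close> is the allowed loss. \<open>a\<close> is the
   growth rate \<open>A * L\<close> of \<open>A * G\<close> plus 8, hence above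
   \<open>2 * pi\<close>, and \<open>b\<close> makes the quadratic branch nonpositive where
   \<open>G z < 1 + \<delta>\<close>.\<close>
 define \<delta> a b where "\<delta> = e / A" and "a = A * L + 8" and "b = (A * L + 8) * ((1 + e / A) / m)"
 have \<delta>: "0 < \<delta>" and a: "8 \<le> a" using e A L_nonneg by (auto simp: \<delta>_def a_def)
 define H where "H z = max 0 (max (A * (G z - 1 - \<delta>)) (a * (norm z)\<^sup>2 - b))" for z
 have zero: "H z = 0" if "G z < 1 + \<delta>" for z
 proof -
  have "(norm z)\<^sup>2 \<le> (1 + \<delta>) / m" using G_lower[of z] that m_pos by (simp add: pos_le_divide_eq mult.commute)
  then have "a * (norm z)\<^sup>2 \<le> a * ((1 + \<delta>) / m)" using a by (intro mult_left_mono) auto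
  moreover have "A * (G z - 1 - \<delta>) \<le> 0" using that A by (simp add: mult_le_0_iff)
  ultimately show ?thesis unfolding H_def b_def a_def \<delta>_def by simp
 qed
 have op: "open {z. G z < 1 + \<delta>}" by (rule open_Collect_less[OF H_continuous continuous_on_const])
 have "H \<in> FB {z. G z < 1}"
  unfolding FB_def mem_Collect_eq
 proof (intro conjI allI)
  show "continuous_on UNIV H" unfolding H_def by (intro continuous_intros H_continuous)
  show "0 \<le> H z" "H (tau0 z) = H z" for z by (simp_all add: H_def G_tau0)
  have "{z. G z < 1 + \<delta>} \<subseteq> interior {z. H z = 0}" by (rule interior_maximal[OF _ op]) (use zero in auto)
  moreover have "0 \<in> {z. G z < 1 + \<delta>}" using \<delta> by simp
  moreover have "0 \<in> L0" by (simp add: L0_def)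
  ultimately show "interior {z. H z = 0} \<inter> L0 \<noteq> {}" by blast
  show "\<exists>U. open U \<and> closure {z. G z < 1} \<subseteq> U \<and> (\<forall>z\<in>U. H z = 0)"
   using op zero \<delta> unfolding closure_sublevel by (intro exI[of _ "{z. G z < 1 + \<delta>}"]) auto
  show "\<exists>C z0 a b. compact C \<and> z0 \<in> L0 \<and> a > 2 * pi \<and> (\<forall>z. z \<notin> C \<longrightarrow> H z = a * (norm z)\<^sup>2 + z \<bullet> z0 + b)"
  \<comment> \<open>Outside this ball \<open>8 * (norm z)\<^sup>2\<close> exceeds \<open>b\<close>,
    so the quadratic branch dominates \<open>A * G z\<close> and attains the maximum.\<close>
  proof (rule exI[of _ "cball 0 (sqrt (b / 8))"], rule exI[of _ 0], rule exI[of _ a], rule exI[of _ "- b"],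
    intro conjI allI impI)
   show "2 * pi < a" using a pi_less_4 by linarith
   fix z :: "'n st" assume "z \<notin> cball 0 (sqrt (b / 8))"
   then have "sqrt (b / 8) < norm z" by simp
   moreover have b: "0 \<le> b / 8" using A L_nonneg m_pos e by (simp add: b_def)
   ultimately have z: "b / 8 < (norm z)\<^sup>2" by (metis real_less_rsqrt not_less real_sqrt_le_iff real_sqrt_abs abs_norm_cancel real_le_lsqrt norm_ge_zero)
   have "A * G z \<le> A * (L * (norm z)\<^sup>2)" using G_upper A by (intro mult_left_mono) auto
   then have 1: "A * G z \<le> a * (norm z)\<^sup>2 - b" using z by (simp add: a_def algebra_simps)
   moreover have "0 \<le> A * G z" "A * (G z - 1 - \<delta>) \<le> A * G z" using A G_nonneg \<delta> by auto
   ultimately show "H z = a * (norm z)\<^sup>2 + z \<bullet> 0 + - b" by (simp add: H_def)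
  qed (auto simp: L0_def)
 qed
 then have "cEH_tau0_bdd {z. G z < 1} \<le> cEH_fun H" unfolding cEH_tau0_bdd_def by (rule INF_lower)
 also have "\<dots> \<le> ereal (A + e)"
 proof (rule cEH_fun_upper_bound[OF assms])
  fix z
  have "A * (G z - 1) - e = A * (G z - 1 - \<delta>)" using A by (simp add: \<delta>_def algebra_simps)
  then show "A * (G z - 1) - e \<le> H z" by (simp add: H_def)
 qed
 finally show "cEH_tau0_bdd {z. G z < 1} \<le> ereal A + ereal e" by simp
qed

theorem minimal_action:
 "\<exists>z. brake_char tau0 lev z 1 \<and> 0 < action z 1 \<and>
  (\<forall>x T. brake_char tau0 lev x T \<and> 0 < action x T \<longrightarrow> action z 1 \<le> action x T) \<and>
  cEH_tau0_bdd {z. G z < 1} = ereal (action z 1) \<and> cEH_tau0_bdd lev = ereal (action z 1)"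
proof -
 obtain A where A: "spec A" "\<And>B. spec B ==> A \<le> B" using spec_minimum by blast
 obtain z where z: "brake_char tau0 lev z 1" "action z 1 = A" using spec_to_brake[OF A] by blast
 have A0: "0 < A" using A(1) by (simp add: spec_def)
 have l: "ereal A \<le> cEH_tau0_bdd lev" by (rule cEH_level_lower[OF _ A0]) (rule A(2))
 have "closure lev \<subseteq> closure {z. G z < 1}"
  unfolding closure_sublevel by (rule closure_minimal) (auto intro: compact_imp_closed[OF compact_sublevel])
 then have "FB {z. G z < 1} \<subseteq> FB lev" unfolding FB_def by blast
 then have "cEH_tau0_bdd lev \<le> cEH_tau0_bdd {z. G z < 1}" unfolding cEH_tau0_bdd_def by (rule INF_superset_mono) simp
 then have "cEH_tau0_bdd {z. G z < 1} = ereal A" "cEH_tau0_bdd lev = ereal A"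
  using l cEH_sublevel_upper[OF A(1)] by order+
 moreover have "A \<le> action x T" if "brake_char tau0 lev x T" "0 < action x T" for x T
  by (rule A(2)[OF brake_to_spec[OF that]])
 ultimately show ?thesis using z A0 by blast
qed

end

section \<open>The gauge of a convex domain with a $C^{1,1}$ boundary\<close>

lemma frechet_gradient_lipschitz:
 fixes g :: "'a::euclidean_space => real"
 assumes g: "\<And>z. g differentiable (at z)"
  and L: "\<And>z w. onorm (\<lambda>h. frechet_derivative g (at z) h - frechet_derivative g (at w) h) \<le> L * norm (z - w)"
 shows "\<exists>\<gamma>. (\<forall>z. (g has_derivative (\<lambda>h. \<gamma> z \<bullet> h)) (at z)) \<and> (\<forall>z w. norm (\<gamma> z - \<gamma> w) \<le> L * norm (z - w))"
proof -
 let ?D = "\<lambda>z. frechet_derivative g (at z)"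
 define \<gamma> where "\<gamma> z = adjoint (?D z) 1" for z
 have d: "(g has_derivative ?D z) (at z)" for z using g frechet_derivative_works by blast
 have bl: "bounded_linear (?D z)" for z by (rule has_derivative_bounded_linear[OF d])
 have eq: "\<gamma> z \<bullet> h = ?D z h" for z h
  using adjoint_works[OF bounded_linear.linear[OF bl], of h z 1] by (simp add: \<gamma>_def inner_commute)
 have "norm (\<gamma> z - \<gamma> w) \<le> L * norm (z - w)" for z w
 proof (cases "\<gamma> z = \<gamma> w")
  case True
  have "0 \<le> onorm (\<lambda>h. ?D z h - ?D w h)" by (rule onorm_pos_le[OF bounded_linear_sub[OF bl bl]])
  then show ?thesis using True L[of z w] by simp
 next
  case False
  let ?v = "\<gamma> z - \<gamma> w"
  have "norm ?v * norm ?v = norm (?D z ?v - ?D w ?v)"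
   unfolding eq[symmetric] by (simp add: inner_diff_left[symmetric] dot_square_norm power2_eq_square)
  also have "\<dots> \<le> onorm (\<lambda>h. ?D z h - ?D w h) * norm ?v" by (rule onorm[OF bounded_linear_sub[OF bl bl]])
  also have "\<dots> \<le> (L * norm (z - w)) * norm ?v" using L by (intro mult_right_mono) auto
  finally show ?thesis using False by simp
 qed
 moreover have "(\<lambda>h. \<gamma> z \<bullet> h) = ?D z" for z by (auto simp: eq)
 ultimately show ?thesis using d by metis
qed

text \<open>Near \<open>p\<close> the domain is where \<open>\<phi>\<close> is positive, and
  \<open>n\<close> is minus the gradient of \<open>\<phi>\<close>. Convexity makes
  \<open>n z\<close> an outer normal of the whole domain, and differentiability leaves no other
  normal direction.\<close>

lemma C11_local_normal:
 fixes D :: "'n::finite st set"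
 assumes "C11_boundary D" "open D" "convex D" and p: "p \<in> frontier D"
 shows "\<exists>r>0. \<exists>n K. (\<forall>z w. norm (n z - n w) \<le> K * norm (z - w)) \<and>
  (\<forall>z\<in>frontier D \<inter> ball p r. 1 \<le> norm (n z) \<and> (\<forall>w\<in>D. n z \<bullet> (w - z) \<le> 0) \<and>
   (\<forall>M. (\<forall>w\<in>D. M \<bullet> (w - z) \<le> 0) \<longrightarrow> (\<exists>c. M = c *\<^sub>R n z)))"
proof -
 obtain e r g L where e: "norm e = 1" and r: "0 < r" and g: "\<And>z. g differentiable (at z)"
  and L: "\<And>z w. onorm (\<lambda>h. frechet_derivative g (at z) h - frechet_derivative g (at w) h) \<le> L * norm (z - w)"
  and D: "D \<inter> ball p r = {z \<in> ball p r. z \<bullet> e < g (z - (z \<bullet> e) *\<^sub>R e)}"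
  using assms(1) p unfolding C11_boundary_def by blast
 obtain \<gamma> where \<gamma>: "\<And>z. (g has_derivative (\<lambda>h. \<gamma> z \<bullet> h)) (at z)" "\<And>z w. norm (\<gamma> z - \<gamma> w) \<le> L * norm (z - w)"
  using frechet_gradient_lipschitz[OF g L] by blast
 define \<pi> where "\<pi> z = z - (z \<bullet> e) *\<^sub>R e" for z :: "'n st"
 define \<phi> where "\<phi> z = g (\<pi> z) - z \<bullet> e" for z
 \<comment> \<open>\<open>g\<close> is evaluated only after the projection \<open>\<pi>\<close>, so
   its gradient enters projected.\<close>
 define n where "n z = e - \<pi> (\<gamma> (\<pi> z))" for z
 have ee: "e \<bullet> e = 1" using e by (simp add: dot_square_norm)
 have \<pi>_adj: "\<pi> a \<bullet> b = a \<bullet> \<pi> b" for a b by (simp add: \<pi>_def inner_diff_left inner_diff_right inner_commute)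
 have \<pi>_diff: "\<pi> a - \<pi> b = \<pi> (a - b)" for a b by (simp add: \<pi>_def inner_diff_left scaleR_diff_left)
 have \<pi>_norm: "norm (\<pi> a) \<le> 2 * norm a" for a
  using norm_triangle_ineq4[of a "(a \<bullet> e) *\<^sub>R e"] Cauchy_Schwarz_ineq2[of a e] e by (simp add: \<pi>_def)
 have \<pi>_lin: "bounded_linear \<pi>"
  unfolding \<pi>_def by (intro bounded_linear_sub bounded_linear_ident bounded_linear_scaleR_const bounded_linear_inner_left)
 have d\<phi>: "(\<phi> has_derivative (\<lambda>h. - (n z \<bullet> h))) (at z)" for z
 proof -
  have "((\<lambda>z. g (\<pi> z)) has_derivative (\<lambda>h. \<gamma> (\<pi> z) \<bullet> \<pi> h)) (at z)"
   by (rule has_derivative_compose[OF bounded_linear_imp_has_derivative[OF \<pi>_lin] \<gamma>(1)])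
  then have "(\<phi> has_derivative (\<lambda>h. \<gamma> (\<pi> z) \<bullet> \<pi> h - h \<bullet> e)) (at z)"
   unfolding \<phi>_def by (intro has_derivative_diff) (auto intro!: derivative_eq_intros)
  moreover have "(\<lambda>h. \<gamma> (\<pi> z) \<bullet> \<pi> h - h \<bullet> e) = (\<lambda>h. - (n z \<bullet> h))"
   by (auto simp: n_def inner_diff_left \<pi>_adj inner_commute[of e])
  ultimately show ?thesis by simp
 qed
 have dir: "((\<lambda>s. \<phi> (z + s *\<^sub>R h)) has_real_derivative - (n z \<bullet> h)) (at 0)" for z h
 proof -
  have "((\<lambda>s. z + s *\<^sub>R h) has_derivative (\<lambda>s. s *\<^sub>R h)) (at 0)" by (auto intro!: derivative_eq_intros)
  moreover have "(\<phi> has_derivative (\<lambda>h. - (n z \<bullet> h))) (at (z + 0 *\<^sub>R h))" using d\<phi> by simp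
  ultimately have "((\<lambda>s. \<phi> (z + s *\<^sub>R h)) has_derivative (\<lambda>s. - (n z \<bullet> (s *\<^sub>R h)))) (at 0)"
   by (rule has_derivative_compose)
  moreover have "(\<lambda>s. - (n z \<bullet> (s *\<^sub>R h))) = (*) (- (n z \<bullet> h))" by auto
  ultimately show ?thesis by (simp only: has_field_derivative_def)
 qed
 have lip: "norm (n z - n w) \<le> 4 * \<bar>L\<bar> * norm (z - w)" for z w
 proof -
  have "norm (n z - n w) = norm (\<pi> (\<gamma> (\<pi> z) - \<gamma> (\<pi> w)))"
   by (simp add: n_def \<pi>_diff[symmetric] norm_minus_commute)
  also have "\<dots> \<le> 2 * (L * norm (\<pi> (z - w)))"
   using \<pi>_norm[of "\<gamma> (\<pi> z) - \<gamma> (\<pi> w)"] \<gamma>(2)[of "\<pi> z" "\<pi> w"] unfolding \<pi>_diff by linarith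
  also have "L * norm (\<pi> (z - w)) \<le> \<bar>L\<bar> * (2 * norm (z - w))"
   using \<pi>_norm[of "z - w"] by (intro mult_mono) auto
  finally show ?thesis by simp
 qed
 have inD: "z \<in> D \<longleftrightarrow> 0 < \<phi> z" if "z \<in> ball p r" for z
 proof -
  have "z \<in> D \<longleftrightarrow> z \<in> D \<inter> ball p r" using that by blast
  then show ?thesis unfolding D using that by (simp add: \<phi>_def \<pi>_def)
 qed
 have near: "\<exists>d>0. \<forall>s. 0 < s \<and> s < d \<longrightarrow> z + s *\<^sub>R h \<in> ball p r" if "z \<in> ball p r" for z h
 proof -
  have "((\<lambda>s. z + s *\<^sub>R h) \<longlongrightarrow> z + 0 *\<^sub>R h) (at_right 0)" by (intro tendsto_intros)
  then have "\<forall>\<^sub>F s in at_right 0. z + s *\<^sub>R h \<in> ball p r"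
   by (rule topological_tendstoD) (use that in auto)
  then show ?thesis unfolding eventually_at_right_field by auto
 qed
 have "1 \<le> norm (n z) \<and> (\<forall>w\<in>D. n z \<bullet> (w - z) \<le> 0) \<and> (\<forall>M. (\<forall>w\<in>D. M \<bullet> (w - z) \<le> 0) \<longrightarrow> (\<exists>c. M = c *\<^sub>R n z))"
  if z: "z \<in> frontier D \<inter> ball p r" for z
 proof (intro conjI ballI allI impI)
  have zD: "z \<notin> D" and zc: "z \<in> closure D" using z assms(2) by (auto simp: frontier_def interior_open)
  have "n z \<bullet> e = 1" using ee by (simp add: n_def inner_diff_left \<pi>_adj) (simp add: \<pi>_def ee)
  then show "1 \<le> norm (n z)" using Cauchy_Schwarz_ineq2[of "n z" e] e by simp
  have \<phi>z: "\<phi> z = 0"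
  proof (rule ccontr)
   assume "\<phi> z \<noteq> 0"
   then have neg: "\<phi> z < 0" using inD[of z] z zD by auto
   have "isCont \<phi> z" using has_derivative_continuous[OF d\<phi>] by blast
   then have "\<forall>\<^sub>F w in nhds z. \<phi> w < 0"
    using neg order_tendstoD(2)[of \<phi> "\<phi> z" "nhds z" 0] by (simp add: isCont_def tendsto_at_iff_tendsto_nhds)
   moreover have "\<forall>\<^sub>F w in nhds z. w \<in> ball p r" using z by (intro eventually_nhds_in_open) auto
   ultimately have "\<forall>\<^sub>F w in nhds z. w \<notin> D" by eventually_elim (use inD in fastforce)
   then obtain S where "open S" "z \<in> S" "S \<inter> D = {}" unfolding eventually_nhds by blast
   then show False using zc open_Int_closure_eq_empty[of S D] by blast
  qed
  show "n z \<bullet> (w - z) \<le> 0" if w: "w \<in> D" for w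
  proof (rule ccontr)
   assume "\<not> n z \<bullet> (w - z) \<le> 0"
   then have "- (n z \<bullet> (w - z)) < 0" by simp
   from DERIV_neg_dec_right[OF dir this] obtain d where d: "0 < d" "\<And>s. 0 < s ==> s < d ==> \<phi> (z + s *\<^sub>R (w - z)) < 0"
    using \<phi>z by auto
   obtain d' where d': "0 < d'" "\<And>s. 0 < s ==> s < d' ==> z + s *\<^sub>R (w - z) \<in> ball p r"
    using near[of z "w - z"] z by blast
   \<comment> \<open>By convexity the segment from \<open>z\<close> to \<open>w\<close> lies in the
     domain except for \<open>z\<close>, yet \<open>\<phi>\<close> would be negative at its
     start.\<close>
   define s where "s = min 1 (min d d' / 2)"
   have s: "0 < s" "s \<le> 1" "s < d" "s < d'" using d(1) d'(1) by (auto simp: s_def min_def)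
   have "z - s *\<^sub>R (z - w) \<in> interior D"
    by (rule mem_interior_closure_convex_shrink[OF assms(3) _ zc s(1,2)]) (use w assms(2) in \<open>simp add: interior_open\<close>)
   moreover have "z - s *\<^sub>R (z - w) = z + s *\<^sub>R (w - z)" by (simp add: scaleR_diff_right)
   ultimately have "z + s *\<^sub>R (w - z) \<in> D" using interior_subset[of D] by auto
   then show False using inD[OF d'(2)[OF s(1,4)]] d(2)[OF s(1,3)] by simp
  qed
  fix M assume M: "\<forall>w\<in>D. M \<bullet> (w - z) \<le> 0"
  \<comment> \<open>Directions with \<open>n z \<bullet> h < 0\<close> lead into the domain, so
    \<open>M\<close> is nonpositive on an open half space and must be a multiple of
    \<open>n z\<close>.\<close>
  have half: "M \<bullet> h \<le> 0" if "n z \<bullet> h < 0" for h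
  proof -
   have "0 < - (n z \<bullet> h)" using that by simp
   from DERIV_pos_inc_right[OF dir this] obtain d where d: "0 < d" "\<And>s. 0 < s ==> s < d ==> 0 < \<phi> (z + s *\<^sub>R h)"
    using \<phi>z by auto
   obtain d' where d': "0 < d'" "\<And>s. 0 < s ==> s < d' ==> z + s *\<^sub>R h \<in> ball p r"
    using near[of z h] z by blast
   define s where "s = min d d' / 2"
   have s: "0 < s" "s < d" "s < d'" using d(1) d'(1) by (auto simp: s_def min_def)
   have "z + s *\<^sub>R h \<in> D" using inD[OF d'(2)[OF s(1,3)]] d(2)[OF s(1,2)] by simp
   then have "M \<bullet> (s *\<^sub>R h) \<le> 0" using M by fastforce
   then show ?thesis using s(1) by (simp add: mult_le_0_iff)
  qed
  define c where "c = (M \<bullet> n z) / (n z \<bullet> n z)"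
  define w where "w = M - c *\<^sub>R n z"
  have nn: "0 < n z \<bullet> n z" using \<open>1 \<le> norm (n z)\<close> by auto
  have nw: "n z \<bullet> w = 0" using nn by (simp add: w_def c_def inner_diff_right inner_commute)
  have "w \<bullet> w \<le> \<epsilon> * \<bar>M \<bullet> n z\<bar>" if "0 < \<epsilon>" for \<epsilon>
  proof -
   have "n z \<bullet> (w - \<epsilon> *\<^sub>R n z) < 0" using nw nn that by (simp add: inner_diff_right)
   then have "M \<bullet> (w - \<epsilon> *\<^sub>R n z) \<le> 0" by (rule half)
   moreover have "M \<bullet> w = w \<bullet> w" using nw by (simp add: w_def inner_diff_left)
   ultimately have "w \<bullet> w \<le> \<epsilon> * (M \<bullet> n z)" by (simp add: inner_diff_right)
   also have "\<dots> \<le> \<epsilon> * \<bar>M \<bullet> n z\<bar>" using that by (intro mult_left_mono) auto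
   finally show ?thesis .
  qed
  then have "\<forall>\<^sub>F \<epsilon> in at_right 0. w \<bullet> w \<le> \<epsilon> * \<bar>M \<bullet> n z\<bar>" by (simp add: eventually_at_right_field) (use zero_less_one in blast)
  moreover have "((\<lambda>\<epsilon>. \<epsilon> * \<bar>M \<bullet> n z\<bar>) \<longlongrightarrow> 0 * \<bar>M \<bullet> n z\<bar>) (at_right 0)" by (intro tendsto_intros)
  ultimately have "w \<bullet> w \<le> 0" using tendsto_lowerbound[of _ _ "at_right (0::real)"] by fastforce
  then have "w = 0" using inner_ge_zero[of w] by (metis inner_eq_zero_iff order.antisym)
  then show "\<exists>c. M = c *\<^sub>R n z" by (auto simp: w_def)
 qed
 then show ?thesis using r lip by blast
qed

text \<open>The scaling \<open>N z \<bullet> (z - p0) = 1\<close> makes the normal unique, so the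
  local fields of \<open>C11_local_normal\<close> fit together, and a locally Lipschitz field on the
  compact frontier is Lipschitz.\<close>

lemma C11_normals:
 fixes D :: "'n::finite st set"
 assumes "C11_boundary D" "open D" "convex D" "bounded D" "p0 \<in> D"
 shows "\<exists>N K. 0 \<le> K \<and> (\<forall>z\<in>frontier D. N z \<bullet> (z - p0) = 1 \<and> (\<forall>w\<in>D. N z \<bullet> (w - z) \<le> 0)) \<and>
  (\<forall>z\<in>frontier D. \<forall>w\<in>frontier D. norm (N z - N w) \<le> K * norm (z - w)) \<and> (\<forall>z\<in>frontier D. norm (N z) \<le> K)"
proof -
 define nor where "nor z M \<longleftrightarrow> M \<bullet> (z - p0) = 1 \<and> (\<forall>w\<in>D. M \<bullet> (w - z) \<le> 0)" for z M
 obtain \<delta> where \<delta>: "0 < \<delta>" "cball p0 \<delta> \<subseteq> D" using assms(2,5) open_contains_cball by blast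
 \<comment> \<open>The point of the ball around \<open>p0\<close> farthest in the direction
   \<open>M\<close> lies in \<open>D\<close>; this keeps the scaling factor away from 0. For
   \<open>M = 0\<close> the quotient is 0 and the point is \<open>p0\<close>.\<close>
 have pos: "\<delta> * norm M \<le> M \<bullet> (z - p0)" if "\<forall>w\<in>D. M \<bullet> (w - z) \<le> 0" for M z
 proof -
  have "p0 + (\<delta> / norm M) *\<^sub>R M \<in> cball p0 \<delta>" using \<delta>(1) by (simp add: dist_norm)
  then have "M \<bullet> (p0 + (\<delta> / norm M) *\<^sub>R M - z) \<le> 0" using that \<delta>(2) by blast
  moreover have "M \<bullet> ((\<delta> / norm M) *\<^sub>R M) = \<delta> * norm M" by (simp add: dot_square_norm power2_eq_square)
  ultimately show ?thesis by (simp add: inner_diff_right inner_add_right)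
 qed
 have bfr: "compact (frontier D)" by (rule compact_frontier_bounded[OF assms(4)])
 then obtain R where R: "\<And>z. z \<in> frontier D ==> norm (z - p0) \<le> R"
  using bounded_iff[of "(\<lambda>z. z - p0) ` frontier D"] compact_imp_bounded bounded_translation_minus by (metis imageI)
 define N where "N z = (THE M. nor z M)" for z
 have chart: "\<exists>r>0. \<exists>C. (\<forall>z\<in>frontier D \<inter> ball p r. nor z (N z)) \<and>
   (\<forall>z\<in>frontier D \<inter> ball p r. \<forall>w\<in>frontier D \<inter> ball p r. norm (N z - N w) \<le> C * norm (z - w))"
  if p: "p \<in> frontier D" for p
 proof -
  obtain r n K where r: "0 < r" and lip: "\<And>z w. norm (n z - n w) \<le> K * norm (z - w)"
   and n: "\<And>z. z \<in> frontier D \<inter> ball p r ==> 1 \<le> norm (n z)"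
    "\<And>z w. z \<in> frontier D \<inter> ball p r ==> w \<in> D ==> n z \<bullet> (w - z) \<le> 0"
    "\<And>z M. z \<in> frontier D \<inter> ball p r ==> \<forall>w\<in>D. M \<bullet> (w - z) \<le> 0 ==> \<exists>c. M = c *\<^sub>R n z"
   using C11_local_normal[OF assms(1-3) p] by blast
  define \<alpha> where "\<alpha> z = n z \<bullet> (z - p0)" for z
  have \<alpha>: "\<delta> * norm (n z) \<le> \<alpha> z" "\<delta> \<le> \<alpha> z" if "z \<in> frontier D \<inter> ball p r" for z
  proof -
   show "\<delta> * norm (n z) \<le> \<alpha> z" unfolding \<alpha>_def by (rule pos) (use n(2)[OF that] in blast)
   moreover have "\<delta> * 1 \<le> \<delta> * norm (n z)" using n(1)[OF that] \<delta>(1) by (intro mult_left_mono) auto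
   ultimately show "\<delta> \<le> \<alpha> z" by simp
  qed
  have nor: "nor z ((1 / \<alpha> z) *\<^sub>R n z)" and Nz: "N z = (1 / \<alpha> z) *\<^sub>R n z" if z: "z \<in> frontier D \<inter> ball p r" for z
  proof -
   have az: "0 < \<alpha> z" using \<alpha>(2)[OF z] \<delta>(1) by simp
   show *: "nor z ((1 / \<alpha> z) *\<^sub>R n z)"
    using az n(2)[OF z] by (auto simp: nor_def \<alpha>_def[symmetric] divide_le_0_iff)
   have "M = (1 / \<alpha> z) *\<^sub>R n z" if "nor z M" for M
   proof -
    have "\<forall>w\<in>D. M \<bullet> (w - z) \<le> 0" using that by (simp add: nor_def)
    from n(3)[OF z this] obtain c where c: "M = c *\<^sub>R n z" ..
    then have "c * \<alpha> z = 1" using that by (simp add: nor_def \<alpha>_def)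
    then have "c = 1 / \<alpha> z" using az by (simp add: field_simps)
    then show ?thesis using c by simp
   qed
   then show "N z = (1 / \<alpha> z) *\<^sub>R n z" unfolding N_def using * by (rule the_equality[rotated])
  qed
  define B where "B = norm (n p) + \<bar>K\<bar> * r"
  have B: "norm (n z) \<le> B" if "z \<in> ball p r" for z
  proof -
   have "norm (n z) \<le> norm (n p) + norm (n z - n p)" using norm_triangle_sub[of "n z" "n p"] by simp
   moreover have "K * norm (z - p) \<le> \<bar>K\<bar> * r" using that by (intro mult_mono) (auto simp: dist_norm norm_minus_commute)
   ultimately show ?thesis using lip[of z p] unfolding B_def by linarith
  qed
  have "norm (N z - N w) \<le> (\<bar>K\<bar> / \<delta> + (\<bar>K\<bar> * R + B) / \<delta> / \<delta>) * norm (z - w)"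
   if z: "z \<in> frontier D \<inter> ball p r" and w: "w \<in> frontier D \<inter> ball p r" for z w
  proof -
   have az: "0 < \<alpha> z" "0 < \<alpha> w" using \<alpha>(2)[OF z] \<alpha>(2)[OF w] \<delta>(1) by auto
   have lip': "norm (n z - n w) \<le> \<bar>K\<bar> * norm (z - w)"
    using lip[of z w] by (meson abs_ge_self mult_right_mono norm_ge_zero order.trans)
   have i: "1 / \<alpha> z \<le> 1 / \<delta>" using \<alpha>(2)[OF z] \<delta>(1) by (simp add: frac_le)
   have j: "norm (n w) / \<alpha> w \<le> 1 / \<delta>" using \<alpha>(1)[OF w] az \<delta>(1) by (simp add: field_simps)
   have "\<alpha> w - \<alpha> z = (n w - n z) \<bullet> (z - p0) + n w \<bullet> (w - z)"
    by (simp add: \<alpha>_def inner_diff_left inner_diff_right)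
   then have "\<bar>\<alpha> w - \<alpha> z\<bar> \<le> norm (n w - n z) * norm (z - p0) + norm (n w) * norm (w - z)"
    using Cauchy_Schwarz_ineq2[of "n w - n z" "z - p0"] Cauchy_Schwarz_ineq2[of "n w" "w - z"] by linarith
   also have "\<dots> \<le> (\<bar>K\<bar> * norm (z - w)) * R + B * norm (z - w)"
    using lip' R[of z] B[of w] order.trans[OF norm_ge_zero B, of w] z w
    by (intro add_mono mult_mono) (auto simp: norm_minus_commute)
   finally have al: "\<bar>\<alpha> w - \<alpha> z\<bar> \<le> (\<bar>K\<bar> * R + B) * norm (z - w)" by (simp add: algebra_simps)
   have KRB: "0 \<le> \<bar>K\<bar> * R + B"
    using order.trans[OF norm_ge_zero R, of z] order.trans[OF norm_ge_zero B, of w] z w by simp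
   have "N z - N w = (1 / \<alpha> z) *\<^sub>R (n z - n w) + ((\<alpha> w - \<alpha> z) / (\<alpha> z * \<alpha> w)) *\<^sub>R n w"
    using az by (simp add: Nz[OF z] Nz[OF w] diff_divide_distrib scaleR_diff_left scaleR_diff_right)
   then have "norm (N z - N w) \<le> 1 / \<alpha> z * norm (n z - n w) + \<bar>\<alpha> w - \<alpha> z\<bar> / (\<alpha> z * \<alpha> w) * norm (n w)"
    using norm_triangle_ineq[of "(1 / \<alpha> z) *\<^sub>R (n z - n w)" "((\<alpha> w - \<alpha> z) / (\<alpha> z * \<alpha> w)) *\<^sub>R n w"] az by simp
   also have "\<bar>\<alpha> w - \<alpha> z\<bar> / (\<alpha> z * \<alpha> w) * norm (n w) = \<bar>\<alpha> w - \<alpha> z\<bar> * (1 / \<alpha> z) * (norm (n w) / \<alpha> w)" by simp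
   also have "1 / \<alpha> z * norm (n z - n w) + \<bar>\<alpha> w - \<alpha> z\<bar> * (1 / \<alpha> z) * (norm (n w) / \<alpha> w)
    \<le> 1 / \<delta> * (\<bar>K\<bar> * norm (z - w)) + ((\<bar>K\<bar> * R + B) * norm (z - w)) * (1 / \<delta>) * (1 / \<delta>)"
    using i j lip' al az \<delta>(1) KRB by (intro add_mono mult_mono mult_nonneg_nonneg) auto
   finally show ?thesis by (simp add: distrib_right)
  qed
  then show ?thesis using r nor Nz by metis
 qed
 have norN: "nor z (N z)" if z: "z \<in> frontier D" for z
 proof -
  obtain r where "0 < r" "\<forall>w\<in>frontier D \<inter> ball z r. nor w (N w)" using chart[OF z] by blast
  then show ?thesis using z by simp
 qed
 have "local_lipschitz {0::real} (frontier D) (\<lambda>_. N)"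
 proof (rule local_lipschitzI)
  fix p assume "p \<in> frontier D"
  then obtain r C where r: "0 < r" "\<And>z w. z \<in> frontier D \<inter> ball p r ==> w \<in> frontier D \<inter> ball p r ==> norm (N z - N w) \<le> C * norm (z - w)"
   using chart by meson
  have "\<bar>C\<bar>-lipschitz_on (cball p (r / 2) \<inter> frontier D) N"
  proof (rule lipschitz_onI)
   fix z w assume "z \<in> cball p (r / 2) \<inter> frontier D" "w \<in> cball p (r / 2) \<inter> frontier D"
   then have "norm (N z - N w) \<le> C * norm (z - w)" using r by auto
   also have "\<dots> \<le> \<bar>C\<bar> * norm (z - w)" by (intro mult_right_mono) auto
   finally show "dist (N z) (N w) \<le> \<bar>C\<bar> * dist z w" by (simp add: dist_norm)
  qed simp
  then show "\<exists>u>0. \<exists>L. \<forall>t\<in>cball t u \<inter> {0}. L-lipschitz_on (cball p u \<inter> frontier D) N" for t :: real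
   using r(1) by (intro exI[of _ "r / 2"]) auto
 qed
 then obtain K where K: "K-lipschitz_on (frontier D) N"
  using local_lipschitz_compact_implies_lipschitz[OF _ bfr, of "{0::real}" "\<lambda>_. N"] by auto
 have "norm (N z) \<le> 1 / \<delta>" if "z \<in> frontier D" for z
  using pos[of "N z" z] norN[OF that] \<delta>(1) by (simp add: nor_def pos_le_divide_eq mult.commute)
 moreover have "norm (N z - N w) \<le> max K (1 / \<delta>) * norm (z - w)" if "z \<in> frontier D" "w \<in> frontier D" for z w
 proof -
  have "norm (N z - N w) \<le> K * norm (z - w)" using lipschitz_onD[OF K that] by (simp add: dist_norm)
  also have "\<dots> \<le> max K (1 / \<delta>) * norm (z - w)" by (intro mult_right_mono) auto
  finally show ?thesis .
 qed
 ultimately show ?thesis using norN \<delta>(1) unfolding nor_def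
  by (intro exI[of _ N] exI[of _ "max K (1 / \<delta>)"]) (auto simp: le_max_iff_disj)
qed

text \<open>\<open>j\<close> is the gauge of \<open>D - p0\<close>, \<open>\<beta>\<close> the
  radial projection to the frontier, and the gradient of \<open>j\<^sup>2\<close> is
  \<open>2 * j z\<close> times the scaled normal at \<open>\<beta> z\<close>. The estimates rest on
  the support inequality \<open>N p \<bullet> z \<le> j z\<close>, with equality at
  \<open>p = \<beta> z\<close>.\<close>

theorem convex_gauge_exists:
 fixes D :: "'n::finite st set"
 assumes "C11_boundary D" "open D" "convex D" "bounded D" "p0 \<in> D"
 shows "\<exists>G F L m. convex_gauge G F L m \<and> D = {z. G (z - p0) < 1}"
proof -
 obtain N K where K: "0 \<le> K" and N: "\<And>z. z \<in> frontier D ==> N z \<bullet> (z - p0) = 1"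
   "\<And>z w. z \<in> frontier D ==> w \<in> D ==> N z \<bullet> (w - z) \<le> 0"
  and lip: "\<And>z w. z \<in> frontier D ==> w \<in> frontier D ==> norm (N z - N w) \<le> K * norm (z - w)"
  and NK: "\<And>z. z \<in> frontier D ==> norm (N z) \<le> K"
  using C11_normals[OF assms] by blast
 have Nc: "N z \<bullet> (w - p0) \<le> 1" if z: "z \<in> frontier D" and w: "w \<in> closure D" for z w
 proof -
  have "D \<subseteq> {w. N z \<bullet> w \<le> N z \<bullet> z}" using N(2)[OF z] by (auto simp: inner_diff_right)
  then have "closure D \<subseteq> {w. N z \<bullet> w \<le> N z \<bullet> z}" by (rule closure_minimal) (rule closed_halfspace_le)
  then have "N z \<bullet> w \<le> N z \<bullet> z" using w by blast
  then show ?thesis using N(1)[OF z] by (simp add: inner_diff_right)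
 qed
 have iD: "interior D = D" by (rule interior_open[OF assms(2)])
 have "\<exists>d>0. p0 + d *\<^sub>R z \<in> frontier D \<and> (\<forall>e. 0 \<le> e \<longrightarrow> e < d \<longrightarrow> p0 + e *\<^sub>R z \<in> D)" if "z \<noteq> 0" for z
  using ray_to_frontier[OF assms(4), of p0 z] that assms(5) unfolding iD by metis
 then obtain t where t: "\<And>z. z \<noteq> 0 ==> 0 < t z" "\<And>z. z \<noteq> 0 ==> p0 + t z *\<^sub>R z \<in> frontier D"
  "\<And>z e. z \<noteq> 0 ==> 0 \<le> e ==> e < t z ==> p0 + e *\<^sub>R z \<in> D" by metis
 define \<beta> where "\<beta> z = p0 + t z *\<^sub>R z" for z
 define j where "j z = (if z = 0 then 0 else 1 / t z)" for z
 define F where "F z = (if z = 0 then 0 else (2 * j z) *\<^sub>R N (\<beta> z))" for z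
 have \<beta>: "\<beta> z \<in> frontier D" if "z \<noteq> 0" for z using t(2)[OF that] by (simp add: \<beta>_def)
 have j0: "0 \<le> j z" and jpos: "z \<noteq> 0 ==> 0 < j z" for z using t(1)[of z] by (auto simp: j_def)
 have Nz: "N (\<beta> z) \<bullet> z = j z" if "z \<noteq> 0" for z
  using N(1)[OF \<beta>[OF that]] t(1)[OF that] that by (simp add: \<beta>_def j_def field_simps)
 have Nle: "N p \<bullet> z \<le> j z" if p: "p \<in> frontier D" for p z
 proof (cases "z = 0")
  case False
  have "\<beta> z \<in> closure D" using \<beta>[OF False] by (simp add: frontier_def)
  from Nc[OF p this] show ?thesis using t(1)[OF False] False by (simp add: \<beta>_def j_def field_simps)
 qed (simp add: j_def)
 have \<beta>': "\<beta> z = p0 + (1 / j z) *\<^sub>R z" for z by (simp add: \<beta>_def j_def)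
 \<comment> \<open>Homogeneity comes from the support inequality used in both directions, rather
   than from uniqueness of the frontier point on a ray.\<close>
 have jscale: "j (s *\<^sub>R z) = s * j z" if s: "0 < s" for s z
 proof (cases "z = 0")
  case False
  then have sz: "s *\<^sub>R z \<noteq> 0" using s by simp
  have "j (s *\<^sub>R z) = s * (N (\<beta> (s *\<^sub>R z)) \<bullet> z)" using Nz[OF sz] by simp
  also have "\<dots> \<le> s * j z" using Nle[OF \<beta>[OF sz]] s by (intro mult_left_mono) auto
  finally have 1: "j (s *\<^sub>R z) \<le> s * j z" .
  have "s * j z = N (\<beta> z) \<bullet> (s *\<^sub>R z)" using Nz[OF False] by simp
  also have "\<dots> \<le> j (s *\<^sub>R z)" by (rule Nle[OF \<beta>[OF False]])
  finally show ?thesis using 1 by simp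
 qed (simp add: j_def)
 have \<beta>scale: "\<beta> (s *\<^sub>R z) = \<beta> z" if "0 < s" for s z
  using that by (simp add: \<beta>' jscale)
 obtain R where R: "0 < R" "\<And>z. z \<in> frontier D ==> norm (z - p0) \<le> R"
 proof -
  have "bounded ((\<lambda>z. z - p0) ` frontier D)"
   by (intro bounded_translation_minus compact_imp_bounded compact_frontier_bounded assms)
  then show ?thesis using that unfolding bounded_pos by blast
 qed
 have jlow: "norm z \<le> R * j z" for z
 proof (cases "z = 0")
  case False
  have "norm (\<beta> z - p0) \<le> R" by (rule R(2)[OF \<beta>[OF False]])
  then have "t z * norm z \<le> R" using t(1)[OF False] by (simp add: \<beta>_def)
  then show ?thesis using t(1)[OF False] False by (simp add: j_def field_simps)
 qed (simp add: j_def)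
 have jlip: "j z - j w \<le> K * norm (z - w)" for z w
 proof (cases "z = 0")
  case False
  have "j z - j w \<le> N (\<beta> z) \<bullet> z - N (\<beta> z) \<bullet> w" using Nz[OF False] Nle[OF \<beta>[OF False], of w] by simp
  also have "\<dots> = N (\<beta> z) \<bullet> (z - w)" by (simp add: inner_diff_right)
  also have "\<dots> \<le> norm (N (\<beta> z)) * norm (z - w)" by (rule norm_cauchy_schwarz)
  also have "\<dots> \<le> K * norm (z - w)" using NK[OF \<beta>[OF False]] by (intro mult_right_mono) auto
  finally show ?thesis .
 next
  case True
  then show ?thesis using j0[of w] K by (simp add: j_def) (smt (verit) mult_nonneg_nonneg norm_ge_zero)
 qed
 have jlip': "\<bar>j z - j w\<bar> \<le> K * norm (z - w)" for z w using jlip[of z w] jlip[of w z] by (simp add: norm_minus_commute abs_le_iff)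
 define L where "L = 2 * (K * (1 + R * K) + K * K)"
 have L0: "0 \<le> L" using K R(1) by (simp add: L_def)
 have F0: "norm (F z) \<le> L * norm z" for z
 proof (cases "z = 0")
  case False
  have "norm (F z) = 2 * (j z * norm (N (\<beta> z)))" using False j0[of z] by (simp add: F_def)
  also have "j z * norm (N (\<beta> z)) \<le> (K * norm z) * K"
   using jlip[of z 0] NK[OF \<beta>[OF False]] j0[of z] by (intro mult_mono) (auto simp: j_def)
  finally have "norm (F z) \<le> (2 * (K * K)) * norm z" by (simp add: mult_ac)
  also have "\<dots> \<le> L * norm z" using K R(1) by (intro mult_right_mono) (auto simp: L_def)
  finally show ?thesis .
 qed (simp add: F_def)
 have Flip: "norm (F z - F w) \<le> L * norm (z - w)" for z w
 proof (cases "z = 0 \<or> w = 0")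
  case True
  then show ?thesis using F0[of z] F0[of w] by (auto simp: F_def)
 next
  case False
  then have z: "z \<noteq> 0" and w: "w \<noteq> 0" by auto
  \<comment> \<open>Radial projection is Lipschitz only away from 0; the factor \<open>j z\<close>,
    present in \<open>F\<close>, compensates for this.\<close>
  have "j z *\<^sub>R (\<beta> z - \<beta> w) = (z - w) + ((j w - j z) / j w) *\<^sub>R w"
   using jpos[OF z] jpos[OF w] by (simp add: \<beta>' algebra_simps diff_divide_distrib)
  then have "norm (j z *\<^sub>R (\<beta> z - \<beta> w)) \<le> norm (z - w) + norm (((j w - j z) / j w) *\<^sub>R w)"
   by (simp only: norm_triangle_ineq)
  then have "j z * norm (\<beta> z - \<beta> w) \<le> norm (z - w) + \<bar>j w - j z\<bar> * (norm w / j w)"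
   using jpos[OF z] jpos[OF w] by simp
  also have "\<bar>j w - j z\<bar> * (norm w / j w) \<le> (K * norm (z - w)) * R"
   using jlip'[of w z] jlow[of w] jpos[OF w] K by (intro mult_mono) (auto simp: norm_minus_commute pos_divide_le_eq)
  finally have b: "j z * norm (\<beta> z - \<beta> w) \<le> (1 + R * K) * norm (z - w)" by (simp add: algebra_simps)
  have "j z * norm (N (\<beta> z) - N (\<beta> w)) \<le> j z * (K * norm (\<beta> z - \<beta> w))"
   using j0 lip[OF \<beta>[OF z] \<beta>[OF w]] by (intro mult_left_mono) auto
  also have "\<dots> = K * (j z * norm (\<beta> z - \<beta> w))" by simp
  also have "\<dots> \<le> K * ((1 + R * K) * norm (z - w))" using b K by (intro mult_left_mono) auto
  finally have 1: "j z * norm (N (\<beta> z) - N (\<beta> w)) \<le> K * (1 + R * K) * norm (z - w)" by (simp add: mult.assoc)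
  have 2: "\<bar>j z - j w\<bar> * norm (N (\<beta> w)) \<le> (K * norm (z - w)) * K"
   using jlip' NK[OF \<beta>[OF w]] K by (intro mult_mono) auto
  have "F z - F w = 2 *\<^sub>R (j z *\<^sub>R (N (\<beta> z) - N (\<beta> w)) + (j z - j w) *\<^sub>R N (\<beta> w))"
   using z w by (simp add: F_def algebra_simps)
  then have "norm (F z - F w) \<le> 2 * (j z * norm (N (\<beta> z) - N (\<beta> w)) + \<bar>j z - j w\<bar> * norm (N (\<beta> w)))"
   using norm_triangle_ineq[of "j z *\<^sub>R (N (\<beta> z) - N (\<beta> w))" "(j z - j w) *\<^sub>R N (\<beta> w)"] j0[of z] by simp
  also have "\<dots> \<le> 2 * (K * (1 + R * K) * norm (z - w) + (K * norm (z - w)) * K)" using 1 2 by simp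
  finally show ?thesis by (simp add: L_def algebra_simps)
 qed
 have "convex_gauge (\<lambda>z. (j z)\<^sup>2) F L (1 / R\<^sup>2)"
 proof
  fix z w :: "'n st" and s :: real
  have Fin: "F z \<bullet> w \<le> 2 * j z * j w" for w
   using Nle[OF \<beta>, of z w] j0[of z] j0[of w] by (cases "z = 0") (auto simp: F_def intro: mult_left_mono)
  show Fzz: "F z \<bullet> z = 2 * (j z)\<^sup>2" using Nz[of z] by (simp add: F_def j_def power2_eq_square)
  have "(j z)\<^sup>2 + F z \<bullet> (w - z) \<le> (j z)\<^sup>2 + 2 * j z * j w - 2 * (j z)\<^sup>2"
   using Fin[of w] Fzz by (simp add: inner_diff_right)
  also have "\<dots> \<le> (j w)\<^sup>2" using zero_le_power2[of "j z - j w"] by (simp add: power2_eq_square algebra_simps)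
  finally show "(j z)\<^sup>2 + F z \<bullet> (w - z) \<le> (j w)\<^sup>2" .
  show "(j (s *\<^sub>R z))\<^sup>2 = s\<^sup>2 * (j z)\<^sup>2" if "0 \<le> s"
   using jscale[of s z] that by (cases "s = 0") (auto simp: power_mult_distrib j_def)
  show "F (s *\<^sub>R z) = s *\<^sub>R F z" if "0 \<le> s"
   using jscale[of s z] \<beta>scale[of s z] that by (cases "s = 0") (auto simp: F_def)
  have "(norm z)\<^sup>2 \<le> (R * j z)\<^sup>2" using jlow by (intro power_mono) auto
  then show "1 / R\<^sup>2 * (norm z)\<^sup>2 \<le> (j z)\<^sup>2" using R(1) by (simp add: power_mult_distrib pos_divide_le_eq mult.commute)
 qed (use L0 Flip R(1) in auto)
 moreover have "D = {z. (j (z - p0))\<^sup>2 < 1}"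
 proof -
  have "z \<in> D \<longleftrightarrow> j (z - p0) < 1" for z
  proof (cases "z = p0")
   case True then show ?thesis using assms(5) by (simp add: j_def)
  next
   case False
   then have nz: "z - p0 \<noteq> 0" by simp
   show ?thesis
   proof
    assume "j (z - p0) < 1"
    then have "1 < t (z - p0)" using t(1)[OF nz] nz by (simp add: j_def split: if_splits)
    from t(3)[OF nz _ this] show "z \<in> D" by simp
   next
    assume z: "z \<in> D"
    have "j (z - p0) = N (\<beta> (z - p0)) \<bullet> (z - p0)" using Nz[OF nz] by simp
    also have "\<dots> \<le> 1" using Nc[OF \<beta>[OF nz], of z] z closure_subset by blast
    finally have le: "j (z - p0) \<le> 1" .
    moreover have "j (z - p0) \<noteq> 1"
    proof
     assume "j (z - p0) = 1"
     then have "\<beta> (z - p0) = z" by (simp add: \<beta>')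
     then show False using \<beta>[OF nz] z iD by (simp add: frontier_def)
    qed
    ultimately show "j (z - p0) < 1" by simp
   qed
  qed
  moreover have "(j z)\<^sup>2 < 1 \<longleftrightarrow> j z < 1" for z using j0[of z] by (simp add: power_less_one_iff)
  ultimately show ?thesis by blast
 qed
 ultimately show ?thesis by blast
qed

section \<open>Reduction to the standard involution\<close>

lemma omega0_J0: "omega0 u v = J0 u \<bullet> v"
 by (simp add: omega0_def J0_def inner_prod_def)

text \<open>\<open>J0\<close> maps an isotropic subspace into its orthogonal complement, so two
  copies of it fit into dimension \<open>2 * CARD('n)\<close>.\<close>

lemma isotropic_dim_le:
 fixes V :: "'n::finite st set"
 assumes V: "subspace V" "\<And>u v. u \<in> V ==> v \<in> V ==> omega0 u v = 0"
 shows "dim V \<le> CARD('n)"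
proof -
 have inj: "inj J0" by (rule injI) (metis J0_J0 minus_minus)
 have JV: "subspace (J0 ` V)" by (rule linear_subspace_image[OF linear_J0 V(1)])
 have "J0 ` V \<inter> V \<subseteq> {0}"
 proof
  fix x assume "x \<in> J0 ` V \<inter> V"
  then obtain v where "v \<in> V" "x = J0 v" "x \<in> V" by blast
  then have "x \<bullet> x = 0" using V(2)[of v x] by (simp add: omega0_J0)
  then show "x \<in> {0}" by simp
 qed
 then have "dim (J0 ` V \<inter> V) = 0" by (simp add: dim_eq_0)
 moreover have "dim (J0 ` V) = dim V" by (rule dim_image_eq[OF linear_J0]) (use inj in \<open>auto intro: inj_on_subset\<close>)
 ultimately have "dim V + dim V = dim {x + y |x y. x \<in> J0 ` V \<and> y \<in> V}" using dim_sums_Int[OF JV V(1)] by linarith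
 also have "\<dots> \<le> DIM('n st)" by (rule dim_subset_UNIV)
 finally show ?thesis by simp
qed

text \<open>The fixed space \<open>P\<close> and the space \<open>M\<close> where
  \<open>\<tau>\<close> is minus the identity are isotropic and together span everything, so
  \<open>P\<close> has half the dimension. A linear identification of \<open>P\<close> with the
  first factor then extends to a symplectic map.\<close>

theorem symplectic_conjugation_exists:
 fixes \<tau> :: "'n::finite st => 'n st"
 assumes "lin_anti_symplectic_involution \<tau>"
 shows "\<exists>\<Psi>. lin_symplectic \<Psi> \<and> \<Psi> \<circ> \<tau> = tau0 \<circ> \<Psi>"
proof -
 have lin: "linear \<tau>" and anti: "\<And>u v. omega0 (\<tau> u) (\<tau> v) = - omega0 u v" and inv: "\<And>z. \<tau> (\<tau> z) = z"
  using assms by (auto simp: lin_anti_symplectic_involution_def)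
 define P M where "P = {z. \<tau> z = z}" and "M = {z. \<tau> z = - z}"
 have sub: "subspace P" "subspace M"
  by (auto simp: P_def M_def subspace_def linear_0[OF lin] linear_add[OF lin] linear_cmul[OF lin])
 have iso: "omega0 u v = 0" if "u \<in> P \<and> v \<in> P \<or> u \<in> M \<and> v \<in> M" for u v
  using anti[of u v] that by (auto simp: P_def M_def omega0_def)
 define \<pi> where "\<pi> z = (1 / 2) *\<^sub>R (z + \<tau> z)" for z
 have \<pi>P: "\<pi> z \<in> P" and \<pi>M: "z - \<pi> z \<in> M" for z
  by (simp_all add: \<pi>_def P_def M_def linear_add[OF lin] linear_diff[OF lin] linear_cmul[OF lin] inv add.commute
    scaleR_add_right) (simp add: algebra_simps scaleR_half_double flip: scaleR_add_left)
 have "dim P = CARD('n)"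
 proof -
  have "z \<in> {x + y |x y. x \<in> P \<and> y \<in> M}" for z
  proof -
   have "z = \<pi> z + (z - \<pi> z)" by simp
   then show ?thesis using \<pi>P \<pi>M by blast
  qed
  then have "{x + y |x y. x \<in> P \<and> y \<in> M} = UNIV" by blast
  then have "DIM('n st) \<le> dim P + dim M" using dim_sums_Int[OF sub] by (simp add: dim_UNIV)
  moreover have "dim P \<le> CARD('n)" "dim M \<le> CARD('n)" using sub iso by (auto intro!: isotropic_dim_le)
  ultimately show ?thesis by simp
 qed
 then have "dim (UNIV :: (real^'n) set) = dim P" by (simp add: dim_UNIV)
 from isometries_subspaces[OF subspace_UNIV sub(1) this]
 obtain f :: "real^'n => 'n st" and g where f: "linear f" "linear g" "f ` UNIV = P" "\<And>x. x \<in> P ==> f (g x) = x" by metis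
 \<comment> \<open>The second component represents the functional sending \<open>q\<close> to
   \<open>omega0 (f q) z\<close>, which is what the first component has to be paired with.\<close>
 define \<Psi> where "\<Psi> z = (g (\<pi> z), - adjoint f (J0 z))" for z
 have B: "q \<bullet> (- adjoint f (J0 z)) = omega0 (f q) z" for q z
  by (simp add: adjoint_works[OF f(1)] omega0_J0 inner_J0_left)
 have "linear \<Psi>"
  unfolding \<Psi>_def \<pi>_def
  by (rule linearI) (simp_all add: linear_add[OF f(2)] linear_add[OF lin] linear_cmul[OF f(2)] linear_cmul[OF lin]
    linear_add[OF adjoint_linear[OF f(1)]] linear_cmul[OF adjoint_linear[OF f(1)]] J0_add J0_scaleR scaleR_add_right)
 moreover have "omega0 (\<Psi> u) (\<Psi> v) = omega0 u v" for u v
 proof -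
  have "omega0 (\<Psi> u) (\<Psi> v) = g (\<pi> u) \<bullet> (- adjoint f (J0 v)) - g (\<pi> v) \<bullet> (- adjoint f (J0 u))"
   by (simp only: omega0_def \<Psi>_def fst_conv snd_conv inner_commute[of "- adjoint f (J0 u)"])
  also have "\<dots> = omega0 (f (g (\<pi> u))) v - omega0 (f (g (\<pi> v))) u" by (simp only: B)
  also have "\<dots> = omega0 (\<pi> u) v - omega0 (\<pi> v) u" by (simp add: f(4)[OF \<pi>P])
  also have "\<dots> = omega0 u v"
  proof -
   have "omega0 (\<pi> u) (\<pi> v) = 0" "omega0 (u - \<pi> u) (v - \<pi> v) = 0" by (rule iso; use \<pi>P \<pi>M in blast)+
   then show ?thesis by (simp add: omega0_def inner_diff_left inner_diff_right inner_commute)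
  qed
  finally show ?thesis .
 qed
 moreover have "\<Psi> (\<tau> z) = tau0 (\<Psi> z)" for z
 proof -
  have "\<pi> (\<tau> z) = \<pi> z" by (simp add: \<pi>_def inv add.commute)
  moreover have "- adjoint f (J0 (\<tau> z)) = adjoint f (J0 z)"
  proof (rule vector_eq_ldot[THEN iffD1], rule allI)
   fix q
   have "\<tau> (f q) = f q" using f(3) by (auto simp: P_def)
   then have "omega0 (f q) (\<tau> z) = - omega0 (f q) z" using anti[of "f q" z] by simp
   then show "q \<bullet> (- adjoint f (J0 (\<tau> z))) = q \<bullet> adjoint f (J0 z)" unfolding B using B[of q z] by simp
  qed
  ultimately show ?thesis by (simp add: \<Psi>_def tau0_def)
 qed
 ultimately show ?thesis unfolding lin_symplectic_def by (intro exI[of _ \<Psi>]) (auto simp: fun_eq_iff)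
qed

lemma lin_symplectic_inverse:
 assumes "lin_symplectic \<Psi>"
 obtains \<Theta> where "linear \<Theta>" "\<And>z. \<Theta> (\<Psi> z) = z" "\<And>z. \<Psi> (\<Theta> z) = z" "\<And>u v. omega0 (\<Theta> u) (\<Theta> v) = omega0 u v"
proof -
 have lin: "linear \<Psi>" and sym: "\<And>u v. omega0 (\<Psi> u) (\<Psi> v) = omega0 u v" using assms by (auto simp: lin_symplectic_def)
 have "inj \<Psi>"
  unfolding linear_injective_0[OF lin]
 proof (intro allI impI)
  fix u assume "\<Psi> u = 0"
  then have "omega0 u (J0 u) = 0" using sym[of u "J0 u"] by (simp add: omega0_def)
  then show "u = 0" by (simp add: omega0_J0)
 qed
 from linear_injective_isomorphism[OF lin this] obtain \<Theta> where "linear \<Theta>" "\<And>z. \<Theta> (\<Psi> z) = z" "\<And>z. \<Psi> (\<Theta> z) = z" by blast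
 then show ?thesis using that sym by metis
qed

lemma tangent_space_affine:
 assumes "linear \<Psi>" "v \<in> tangent_space S p"
 shows "\<Psi> v \<in> tangent_space ((\<lambda>z. \<Psi> z + c) ` S) (\<Psi> p + c)"
proof -
 have "\<exists>\<gamma>. (\<forall>t. \<gamma> t \<in> S) \<and> \<gamma> 0 = p \<and> (\<gamma> has_vector_derivative v) (at 0)" using assms(2) by (simp add: tangent_space_def)
 then obtain \<gamma> where g: "\<And>t. \<gamma> t \<in> S" "\<gamma> 0 = p" "(\<gamma> has_vector_derivative v) (at 0)" by blast
 have "((\<lambda>t. \<Psi> (\<gamma> t) + c) has_vector_derivative \<Psi> v + 0) (at 0)"
  by (intro has_vector_derivative_add has_vector_derivative_const
    bounded_linear.has_vector_derivative[OF linear_conv_bounded_linear[THEN iffD1, OF assms(1)]] g(3))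
 then have "(\<forall>t. \<Psi> (\<gamma> t) + c \<in> (\<lambda>z. \<Psi> z + c) ` S) \<and> \<Psi> (\<gamma> 0) + c = \<Psi> p + c \<and> ((\<lambda>t. \<Psi> (\<gamma> t) + c) has_vector_derivative \<Psi> v) (at 0)"
  using g by simp
 then show ?thesis unfolding tangent_space_def mem_Collect_eq by (rule exI[of _ "\<lambda>t. \<Psi> (\<gamma> t) + c"])
qed

text \<open>This covers the symplectic change of coordinates and the translation of the centre to 0
  at once, in either direction.\<close>

lemma brake_char_affine:
 fixes \<Psi> \<Theta> :: "'n::finite st => 'n st"
 assumes lin: "linear \<Psi>" "linear \<Theta>" and inv: "\<And>z. \<Theta> (\<Psi> z) = z" "\<And>z. \<Psi> (\<Theta> z) = z"
  and sym: "\<And>u v. omega0 (\<Psi> u) (\<Psi> v) = omega0 u v"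
  and eqv: "\<And>z. \<tau>' (\<Psi> z + c) = \<Psi> (\<tau> z) + c"
  and br: "brake_char \<tau> S x T"
 shows "brake_char \<tau>' ((\<lambda>z. \<Psi> z + c) ` S) (\<lambda>t. \<Psi> (x t) + c) T" "action (\<lambda>t. \<Psi> (x t) + c) T = action x T"
proof -
 let ?\<phi> = "\<lambda>z. \<Psi> z + c" and ?y = "\<lambda>t. \<Psi> (x t) + c"
 have T: "0 < T" and per: "\<And>t. x (t + T) = x t" and C1: "x C1_differentiable_on UNIV"
  and nz: "\<And>t. vector_derivative x (at t) \<noteq> 0" and inj: "inj_on x {0..<T}" and xS: "\<And>t. x t \<in> S"
  and ker: "\<And>t. vector_derivative x (at t) \<in> char_kernel S (x t)" and refl: "\<And>t. x (T - t) = \<tau> (x t)"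
  using br unfolding brake_char_def by auto
 have bl: "bounded_linear \<Psi>" using lin(1) by (simp add: linear_conv_bounded_linear)
 obtain x' where x': "\<And>t. (x has_vector_derivative x' t) (at t)" "continuous_on UNIV x'"
  using C1 unfolding C1_differentiable_on_def by auto
 have vx: "vector_derivative x (at t) = x' t" for t using x'(1) by (rule vector_derivative_at)
 have dy: "(?y has_vector_derivative \<Psi> (x' t)) (at t)" for t
  using has_vector_derivative_add[OF bounded_linear.has_vector_derivative[OF bl x'(1)] has_vector_derivative_const[of c]] by simp
 have vy: "vector_derivative ?y (at t) = \<Psi> (x' t)" for t using dy by (rule vector_derivative_at)
 have cx': "continuous_on A x'" for A using x'(2) by (rule continuous_on_subset) simp
 have cx: "continuous_on A x" for A
  by (intro continuous_at_imp_continuous_on ballI has_vector_derivative_continuous[OF x'(1)])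
 have \<Psi>inj: "\<Psi> a = \<Psi> b \<longleftrightarrow> a = b" for a b using inv(1) by metis
 show "brake_char \<tau>' (?\<phi> ` S) ?y T"
  unfolding brake_char_def
 proof (intro conjI allI)
  show "?y C1_differentiable_on UNIV" unfolding C1_differentiable_on_def
   by (intro exI[of _ "\<lambda>t. \<Psi> (x' t)"] conjI ballI dy bounded_linear.continuous_on[OF bl] cx')
  show "vector_derivative ?y (at t) \<noteq> 0" for t
   using nz[of t] inv(1)[of "x' t"] linear_0[OF lin(2)] unfolding vy vx by metis
  show "inj_on ?y {0..<T}" using inj by (simp add: inj_on_def \<Psi>inj)
  show "vector_derivative ?y (at t) \<in> char_kernel (?\<phi> ` S) (\<Psi> (x t) + c)" for t
   unfolding char_kernel_def vy mem_Collect_eq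
  proof (intro conjI ballI)
   show "\<Psi> (x' t) \<in> tangent_space (?\<phi> ` S) (\<Psi> (x t) + c)"
    using ker[of t] by (intro tangent_space_affine lin) (simp add: char_kernel_def vx)
   fix w assume "w \<in> tangent_space (?\<phi> ` S) (\<Psi> (x t) + c)"
   from tangent_space_affine[OF lin(2) this, of "- \<Theta> c"]
   have "\<Theta> w \<in> tangent_space S (x t)" by (simp add: image_comp o_def linear_add[OF lin(2)] inv)
   then have "omega0 (x' t) (\<Theta> w) = 0" using ker[of t] by (auto simp: char_kernel_def vx)
   then show "omega0 (\<Psi> (x' t)) w = 0" using sym[of "x' t" "\<Theta> w"] by (simp add: inv)
  qed
  show "\<Psi> (x (T - t)) + c = \<tau>' (\<Psi> (x t) + c)" for t by (simp add: refl eqv)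
 qed (use T per xS in auto)
 have "(\<lambda>t. (- J0 (x' t)) \<bullet> x t) integrable_on {0..T}"
  by (intro integrable_continuous_interval continuous_intros bounded_linear.continuous_on[OF bounded_linear_J0] cx cx')
 then have 1: "((\<lambda>t. (- J0 (x' t)) \<bullet> x t) has_integral integral {0..T} (\<lambda>t. (- J0 (x' t)) \<bullet> x t)) {0..T}"
  by (rule integrable_integral)
 \<comment> \<open>The translation contributes the integral of a derivative over a full period,
   which is 0.\<close>
 have "((\<lambda>t. (- J0 (\<Psi> (x' t))) \<bullet> c) has_integral (- J0 (\<Psi> (x T))) \<bullet> c - (- J0 (\<Psi> (x 0))) \<bullet> c) {0..T}"
 proof (rule fundamental_theorem_of_calculus)
  have bl': "bounded_linear (\<lambda>z. (- J0 (\<Psi> z)) \<bullet> c)"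
   by (intro bounded_linear_inner_left_comp bounded_linear_minus bounded_linear_compose[OF bounded_linear_J0] bl)
  show "((\<lambda>t. (- J0 (\<Psi> (x t))) \<bullet> c) has_vector_derivative (- J0 (\<Psi> (x' t))) \<bullet> c) (at t within {0..T})" for t
   by (rule bounded_linear.has_vector_derivative[OF bl' has_vector_derivative_at_within[OF x'(1)]])
 qed (use T in simp)
 then have 2: "((\<lambda>t. (- J0 (\<Psi> (x' t))) \<bullet> c) has_integral 0) {0..T}" using per[of 0] by simp
 have "(- J0 (\<Psi> (x' t))) \<bullet> (\<Psi> (x t) + c) = (- J0 (x' t)) \<bullet> x t + (- J0 (\<Psi> (x' t))) \<bullet> c" for t
  using sym[of "x' t" "x t"] by (simp add: omega0_J0 inner_add_right)
 then show "action ?y T = action x T"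
  unfolding action_def vy vx using integral_unique[OF has_integral_add[OF 1 2]] by simp
qed

context convex_gauge
begin

text \<open>By the chain rule the gradient of the transformed gauge is pulled back by the adjoint;
  the new constants collect operator bounds.\<close>

lemma gauge_linear_image:
 fixes \<Psi> \<Theta> :: "'n st => 'n st"
 assumes lin: "linear \<Psi>" "linear \<Theta>" and inv: "\<And>z. \<Theta> (\<Psi> z) = z" "\<And>z. \<Psi> (\<Theta> z) = z"
 shows "\<exists>L' m'. convex_gauge (\<lambda>z. G (\<Theta> z)) (\<lambda>z. adjoint \<Theta> (F (\<Theta> z))) L' m'"
proof -
 have la: "linear (adjoint \<Theta>)" by (rule adjoint_linear[OF lin(2)])
 obtain A where A: "0 < A" "\<And>z. norm (\<Theta> z) \<le> A * norm z" using linear_bounded_pos[OF lin(2)] by blast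
 obtain B where B: "0 < B" "\<And>z. norm (adjoint \<Theta> z) \<le> B * norm z" using linear_bounded_pos[OF la] by blast
 obtain C where C: "0 < C" "\<And>z. norm (\<Psi> z) \<le> C * norm z" using linear_bounded_pos[OF lin(1)] by blast
 have "convex_gauge (\<lambda>z. G (\<Theta> z)) (\<lambda>z. adjoint \<Theta> (F (\<Theta> z))) (B * (L * A)) (m / C\<^sup>2)"
 proof
  fix z w :: "'n st" and s :: real
  have "norm (adjoint \<Theta> (F (\<Theta> z) - F (\<Theta> w))) \<le> B * norm (F (\<Theta> z) - F (\<Theta> w))" by (rule B(2))
  also have "\<dots> \<le> B * (L * norm (\<Theta> z - \<Theta> w))" using B(1) F_lipschitz by (intro mult_left_mono) auto
  also have "\<dots> \<le> B * (L * (A * norm (z - w)))"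
   using B(1) L_nonneg A(2)[of "z - w"] by (intro mult_left_mono) (auto simp: linear_diff[OF lin(2)])
  finally show "norm (adjoint \<Theta> (F (\<Theta> z)) - adjoint \<Theta> (F (\<Theta> w))) \<le> B * (L * A) * norm (z - w)"
   by (simp add: linear_diff[OF la] mult.assoc)
  have ad: "adjoint \<Theta> a \<bullet> b = a \<bullet> \<Theta> b" for a b using adjoint_works[OF lin(2), of b a] by (simp add: inner_commute)
  show "G (\<Theta> z) + adjoint \<Theta> (F (\<Theta> z)) \<bullet> (w - z) \<le> G (\<Theta> w)"
   using G_sub[of "\<Theta> z" "\<Theta> w"] by (simp add: ad linear_diff[OF lin(2)])
  show "adjoint \<Theta> (F (\<Theta> z)) \<bullet> z = 2 * G (\<Theta> z)" by (simp add: ad F_inner)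
  show "G (\<Theta> (s *\<^sub>R z)) = s\<^sup>2 * G (\<Theta> z)" if "0 \<le> s" using G_scale[OF that] by (simp add: linear_cmul[OF lin(2)])
  show "adjoint \<Theta> (F (\<Theta> (s *\<^sub>R z))) = s *\<^sub>R adjoint \<Theta> (F (\<Theta> z))" if "0 \<le> s"
   using F_scale[OF that] by (simp add: linear_cmul[OF lin(2)] linear_cmul[OF la])
  have "(norm z)\<^sup>2 \<le> (C * norm (\<Theta> z))\<^sup>2" using C(2)[of "\<Theta> z"] by (intro power_mono) (auto simp: inv)
  then have "m / C\<^sup>2 * (norm z)\<^sup>2 \<le> m / C\<^sup>2 * (C * norm (\<Theta> z))\<^sup>2" using m_pos C(1) by (intro mult_left_mono) auto
  also have "\<dots> = m * (norm (\<Theta> z))\<^sup>2" using C(1) by (simp add: power_mult_distrib)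
  finally show "m / C\<^sup>2 * (norm z)\<^sup>2 \<le> G (\<Theta> z)" using G_lower[of "\<Theta> z"] by linarith
 qed (use A(1) B(1) C(1) L_nonneg m_pos in auto)
 then show ?thesis by blast
qed

text \<open>A subgradient of the differentiable function \<^term>\<open>G\<close> is its gradient, so \<^term>\<open>F\<close> inherits the
 symmetries of \<^term>\<open>G\<close>.\<close>

lemma gauge_symmetric:
 assumes sym: "\<And>z. G (tau0 z) < 1 \<longleftrightarrow> G z < 1" shows "gauge G F L m"
proof -
 have le: "G (tau0 z) \<le> G z" for z
 proof (rule ccontr)
  assume "\<not> G (tau0 z) \<le> G z"
  then have lt: "G z < G (tau0 z)" by simp
  \<comment> \<open>The level \<open>s\<^sup>2\<close> lies strictly between the two values;
    homogeneity transfers the hypothesis from level 1 to it.\<close>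
  define s where "s = sqrt ((G z + G (tau0 z)) / 2)"
  have "0 \<le> G z" using G_lower[of z] m_pos by (smt (verit) mult_nonneg_nonneg zero_le_power2)
  then have s: "0 < s" "G z < s\<^sup>2" "s\<^sup>2 < G (tau0 z)" using lt by (auto simp: s_def)
  have sc: "G ((1 / s) *\<^sub>R w) < 1 \<longleftrightarrow> G w < s\<^sup>2" for w
   using G_scale[of "1 / s" w] s(1) by (simp add: power_divide divide_less_eq)
  have "G (tau0 ((1 / s) *\<^sub>R z)) < 1" unfolding sym sc by (rule s(2))
  then show False using s(3) unfolding tau0_scaleR sc by simp
 qed
 have Gt: "G (tau0 z) = G z" for z using le[of z] le[of "tau0 z"] by simp
 have grad: "u = F z" if u: "\<And>w. G z + u \<bullet> (w - z) \<le> G w" for u z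
 proof (rule ccontr)
  assume "u \<noteq> F z"
  define d where "d = u - F z"
  have dd: "0 < d \<bullet> d" using \<open>u \<noteq> F z\<close> by (simp add: d_def)
  \<comment> \<open>The step is so short that the change of \<open>F\<close> along it stays below
    \<open>norm d\<close>.\<close>
  define s where "s = 1 / (L + 1)"
  have s: "0 < s" "L * s < 1" using L_nonneg by (auto simp: s_def)
  let ?w = "z + s *\<^sub>R d"
  have "G ?w + F ?w \<bullet> (z - ?w) \<le> G z" by (rule G_sub)
  then have "u \<bullet> (s *\<^sub>R d) \<le> F ?w \<bullet> (s *\<^sub>R d)" using u[of ?w] by simp
  then have "d \<bullet> d \<le> (F ?w - F z) \<bullet> d" using s(1) by (simp add: d_def inner_diff_left)
  also have "\<dots> \<le> norm (F ?w - F z) * norm d" by (rule norm_cauchy_schwarz)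
  also have "\<dots> \<le> (L * norm (s *\<^sub>R d)) * norm d" using F_lipschitz[of ?w z] by (intro mult_right_mono) auto
  also have "\<dots> = (L * s) * (d \<bullet> d)" using s(1) by (simp add: dot_square_norm power2_eq_square)
  also have "\<dots> < 1 * (d \<bullet> d)" using s(2) dd by (rule mult_strict_right_mono)
  finally show False by simp
 qed
 have "F (tau0 z) = tau0 (F z)" for z
 proof (rule grad[symmetric])
  fix w
  have "tau0 (F z) \<bullet> (w - tau0 z) = F z \<bullet> (tau0 w - z)"
   using inner_tau0[of "F z" "tau0 w - z"] by (simp add: linear_diff[OF linear_tau0])
  then show "G (tau0 z) + tau0 (F z) \<bullet> (w - tau0 z) \<le> G w" using G_sub[of z "tau0 w"] Gt[of z] Gt[of w] by simp
 qed
 then show ?thesis by unfold_locales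
qed

end

theorem theorem1p10:
 fixes \<tau> :: "'n::finite st \<Rightarrow> 'n st" and D :: "'n st set"
 assumes "lin_anti_symplectic_involution \<tau>"
  and "open D" and "connected D" and "D \<noteq> {}" and "convex D" and "bounded D"
  and "\<tau> ` D = D"
  and "C11_boundary D"
 shows "\<exists>xs Ts. brake_char \<tau> (frontier D) xs Ts \<and> action xs Ts > 0 \<and>
   (\<forall>x T. brake_char \<tau> (frontier D) x T \<and> action x T > 0 \<longrightarrow> action xs Ts \<le> action x T) \<and>
   ereal (action xs Ts) = cEH_tau \<tau> D \<and>
   ereal (action xs Ts) = cEH_tau \<tau> (frontier D)"
proof -
 have lin\<tau>: "linear \<tau>" and inv\<tau>: "\<And>z. \<tau> (\<tau> z) = z"
  using assms(1) by (auto simp: lin_anti_symplectic_involution_def)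
 \<comment> \<open>This is the same choice as inside \<open>cEH_tau\<close>, so its value can be
   read off without comparing different conjugations.\<close>
 define \<Psi> :: "'n st \<Rightarrow> 'n st" where "\<Psi> = (SOME \<Psi>. lin_symplectic \<Psi> \<and> \<Psi> \<circ> \<tau> = tau0 \<circ> \<Psi>)"
 have \<Psi>: "lin_symplectic \<Psi> \<and> \<Psi> \<circ> \<tau> = tau0 \<circ> \<Psi>"
  unfolding \<Psi>_def by (rule someI_ex[OF symplectic_conjugation_exists[OF assms(1)]])
 then have lin: "linear \<Psi>" and sym: "\<And>u v. omega0 (\<Psi> u) (\<Psi> v) = omega0 u v" and eqv: "\<And>z. \<Psi> (\<tau> z) = tau0 (\<Psi> z)"
  by (auto simp: lin_symplectic_def fun_eq_iff)
 obtain \<Theta> where lin': "linear \<Theta>" and inv: "\<And>z. \<Theta> (\<Psi> z) = z" "\<And>z. \<Psi> (\<Theta> z) = z"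
  and sym': "\<And>u v. omega0 (\<Theta> u) (\<Theta> v) = omega0 u v" using lin_symplectic_inverse[of \<Psi>] \<Psi> by blast
 have inj: "inj \<Psi>" using inv(1) by (rule inj_on_inverseI)
 have surj: "surj \<Psi>" using inv(2) by (metis surjI)
 have eqv': "\<Theta> (tau0 z) = \<tau> (\<Theta> z)" for z using eqv[of "\<Theta> z"] inv by metis
 obtain p where p: "p \<in> D" using assms(4) by blast
 \<comment> \<open>The midpoint of a point and its image is fixed by \<open>\<tau>\<close>, and
   convexity keeps it in \<open>D\<close>; it becomes the centre of the gauge.\<close>
 define p0 where "p0 = (1 / 2) *\<^sub>R p + (1 / 2) *\<^sub>R \<tau> p"
 have "\<tau> p \<in> D" using p assms(7) by blast
 then have p0: "p0 \<in> D" unfolding p0_def using p by (intro convexD[OF assms(5)]) auto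
 have \<tau>p0: "\<tau> p0 = p0" by (simp add: p0_def linear_add[OF lin\<tau>] linear_cmul[OF lin\<tau>] inv\<tau> add.commute)
 define q where "q = \<Psi> p0"
 have tq: "tau0 q = q" using eqv[of p0] by (simp add: q_def \<tau>p0)
 then have qL: "q \<in> L0" by (simp add: L0_def tau0_fixed_iff)
 obtain G F L m where G: "convex_gauge G F L m" and D: "D = {z. G (z - p0) < 1}"
  using convex_gauge_exists[OF assms(8,2,5,6) p0] by blast
 define G' where "G' z = G (\<Theta> z)" for z
 obtain F' L' m' where G': "convex_gauge G' F' L' m'"
  using convex_gauge.gauge_linear_image[OF G lin lin' inv] unfolding G'_def by blast
 have inD: "z \<in> D \<longleftrightarrow> G' (\<Psi> z - q) < 1" for z
  by (simp add: D G'_def q_def linear_diff[OF lin', symmetric] linear_diff[OF lin] linear_diff[OF lin'] inv)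
 have D\<tau>: "\<tau> z \<in> D \<longleftrightarrow> z \<in> D" for z using assms(7) inv\<tau> by (metis imageE imageI)
 have "gauge G' F' L' m'"
 proof (rule convex_gauge.gauge_symmetric[OF G'])
  fix z
  have "G' (tau0 z) < 1 \<longleftrightarrow> \<tau> (\<Theta> (z + q)) \<in> D"
   unfolding inD eqv inv by (simp add: tau0_add tq)
  also have "\<dots> \<longleftrightarrow> G' z < 1" by (simp only: D\<tau>) (simp add: inD inv)
  finally show "G' (tau0 z) < 1 \<longleftrightarrow> G' z < 1" .
 qed
 then interpret gauge G' F' L' m' .
 have \<Psi>D: "\<Psi> ` D = (+) q ` {z. G' z < 1}"
 proof (intro Set.set_eqI iffI)
  fix w assume "w \<in> \<Psi> ` D"
  then have "w = q + (w - q)" "G' (w - q) < 1" using inD by auto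
  then show "w \<in> (+) q ` {z. G' z < 1}" by blast
 next
  fix w assume "w \<in> (+) q ` {z. G' z < 1}"
  then have "w = \<Psi> (\<Theta> w)" "\<Theta> w \<in> D" by (auto simp: inD inv)
  then show "w \<in> \<Psi> ` D" by blast
 qed
 have "\<Psi> ` frontier D = frontier (\<Psi> ` D)"
  unfolding frontier_def image_set_diff[OF inj] closure_injective_linear_image[OF lin inj]
   interior_injective_linear_image[OF lin inj] ..
 then have \<Psi>fr: "\<Psi> ` frontier D = (+) q ` lev"
  unfolding \<Psi>D frontier_translation frontier_sublevel .
 have "(\<lambda>z. \<Psi> z + - q) ` frontier D = (\<lambda>w. w + - q) ` (\<Psi> ` frontier D)" by (simp add: image_comp o_def)
 then have lev: "lev = (\<lambda>z. \<Psi> z + - q) ` frontier D" unfolding \<Psi>fr by (simp add: image_comp o_def)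
 have fr: "frontier D = (\<lambda>z. \<Theta> z + p0) ` lev"
  unfolding lev by (simp add: image_comp o_def linear_diff[OF lin'] inv q_def)
 \<comment> \<open>The image of \<open>D\<close> is bounded, so the bounded case of the definition
   applies, and translation by \<open>q\<close> in \<open>L0\<close> leaves the value
   unchanged.\<close>
 have cD: "cEH_tau \<tau> D = cEH_tau0_bdd {z. G' z < 1}"
  using bounded_linear_image[OF assms(6) linear_conv_bounded_linear[THEN iffD1, OF lin]]
  unfolding cEH_tau_def \<Psi>_def[symmetric] cEH_tau0_def by (simp add: \<Psi>D cEH_tau0_bdd_translate[OF qL])
 have cfr: "cEH_tau \<tau> (frontier D) = cEH_tau0_bdd lev"
  using bounded_linear_image[OF compact_imp_bounded[OF compact_frontier_bounded[OF assms(6)]] linear_conv_bounded_linear[THEN iffD1, OF lin]]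
  unfolding cEH_tau_def \<Psi>_def[symmetric] cEH_tau0_def by (simp add: \<Psi>fr cEH_tau0_bdd_translate[OF qL])
 obtain z where z: "brake_char tau0 lev z 1" "0 < action z 1"
  "\<And>x T. brake_char tau0 lev x T \<Longrightarrow> 0 < action x T \<Longrightarrow> action z 1 \<le> action x T"
  "cEH_tau0_bdd {z. G' z < 1} = ereal (action z 1)" "cEH_tau0_bdd lev = ereal (action z 1)"
  using minimal_action by blast
 have e1: "\<tau> (\<Theta> w + p0) = \<Theta> (tau0 w) + p0" for w by (simp add: linear_add[OF lin\<tau>] \<tau>p0 eqv')
 have e2: "tau0 (\<Psi> w + - q) = \<Psi> (\<tau> w) + - q" for w
  using tau0_add[of "\<Psi> w" "- q"] linear_neg[OF linear_tau0, of q] by (simp add: eqv tq)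
 \<comment> \<open>The minimal loop is carried back to the frontier of \<open>D\<close> here; below,
   competitors are carried in the opposite direction.\<close>
 note b = brake_char_affine[OF lin' lin inv(2,1) sym' e1 z(1), folded fr]
 show ?thesis
 proof (intro exI conjI allI impI)
  show "brake_char \<tau> (frontier D) (\<lambda>t. \<Theta> (z t) + p0) 1" by (rule b(1))
  show "0 < action (\<lambda>t. \<Theta> (z t) + p0) 1" unfolding b(2) by (rule z(2))
  fix x T assume x: "brake_char \<tau> (frontier D) x T \<and> 0 < action x T"
  note c = brake_char_affine[OF lin lin' inv sym e2 conjunct1[OF x], folded lev]
  show "action (\<lambda>t. \<Theta> (z t) + p0) 1 \<le> action x T"
   using z(3)[OF c(1)] x unfolding b(2) c(2) by blast
 next
  show "ereal (action (\<lambda>t. \<Theta> (z t) + p0) 1) = cEH_tau \<tau> D"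
   "ereal (action (\<lambda>t. \<Theta> (z t) + p0) 1) = cEH_tau \<tau> (frontier D)"
   unfolding b(2) cD cfr by (simp_all add: z(4,5))
 qed
qed

end
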